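(* Let $X=\{X(h):h\in\mathfrak{H}\}$ be an isonormal Gaussian process over a real separable Hilbert space $\mathfrak{H}$, and let $F_n$, $n\ge 1$, be a sequence of centered, square-integrable functionals of $X$ (i.e. $F_n\in L^2(\Omega,\sigma(X),P)$, $E(F_n)=0$) such that $E(F_n^2)\to 1$ as $n\to\infty$. Suppose that: (i) for every $n$, $F_n\in\mathbb{D}^{1,2}$ and the law of $F_n$ is absolutely continuous with respect to Lebesgue measure; (ii) the quantity $$\varphi(n)=\sqrt{E\big[(1-\langle DF_n,-DL^{-1}F_n\rangle_{\mathfrak{H}})^2\big]}$$ is finite for every $n$, converges to $0$ as $n\to\infty$, and there exists $m\ge 1$ such that $\varphi(n)>0$ for all $n\ge m$; (iii) as $n\to\infty$, the two-dimensional random vector $\Big(F_n,\ \dfrac{1-\langle DF_n,-DL^{-1}F_n\rangle_{\mathfrak{H}}}{\varphi(n)}\Big)$ converges in distribution to a centered two-dimensional Gaussian vector $(N_1,N_2)$ with $E(N_1^2)=E(N_2^2)=1$ and $E(N_1N_2)=\rho$. Let $N\sim\mathcal{N}(0,1)$ and $\Phi(z)=P(N\le z)$. Then $d_{\mathrm{Kol}}(F_n,N)\le\varphi(n)$. Moreover, for every $z\in\mathbb{R}$, $$\varphi(n)^{-1}\big[P(F_n\le z)-\Phi(z)\big]\ \xrightarrow[n\to\infty]{}\ \frac{\rho}{3}(z^2-1)\frac{e^{-z^2/2}}{\sqrt{2\pi}}=\frac{\rho}{3}\Phi^{(3)}(z).$$ As a consequence, if $\rho\ne 0$, then there exist a constant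 $c\in(0,1)$ and an integer $n_0\ge 1$ such that, for every $n\ge n_0$, $$c<\frac{d_{\mathrm{Kol}}(F_n,N)}{\varphi(n)}\le 1 .$$
   Context: Isonormal Gaussian process: $X=\{X(h):h\in\mathfrak{H}\}$ is a centered Gaussian family with $E[X(h)X(g)]=\langle h,g\rangle_{\mathfrak{H}}$. Every $F\in L^2(\Omega,\sigma(X),P)$ has a unique chaotic expansion $F=\sum_{q\ge0}I_q(f_q)$, with $I_0(f_0)=E[F]$, $f_q\in\mathfrak{H}^{\odot q}$ (symmetric tensor power), where $I_q$ is the multiple Wiener–Itô integral of order $q$, mapping $\mathfrak{H}^{\odot q}$ onto the $q$th Wiener chaos with $E[I_q(f)^2]=q!\|f\|^2_{\mathfrak{H}^{\otimes q}}$; $J_qF=I_q(f_q)$ denotes the projection on the $q$th chaos. Malliavin derivative: for $F=g(X(\phi_1),\dots,X(\phi_n))$ with $g$ smooth with compact support and $\phi_i\in\mathfrak{H}$, $DF=\sum_i\partial_ig(X(\phi_1),\dots,X(\phi_n))\phi_i\in L^2(\Omega,\mathfrak{H})$; $\mathbb{D}^{1,2}$ is the closure of such variables under $\|F\|_{1,2}^2=E[F^2]+E[\|DF\|_{\mathfrak{H}}^2]$, and $D$ is extended to $\mathbb{D}^{1,2}$ by closure. Pseudo-inverse of the Ornstein–Uhlenbeck generator $L=\sum_{q\ge0}-qJ_q$: $L^{-1}F=-\sum_{q\ge1}\frac1qJ_qF$, so that $LL^{-1}F=F-E(F)$; $L^{-1}F$ is Malliavin differentiable for every $F\in L^2(\Omega,\sigma(X),P)$.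 Kolmogorov distance: $d_{\mathrm{Kol}}(X,Y)=\sup_{z\in\mathbb{R}}|P(X\le z)-P(Y\le z)|$. $\Phi^{(3)}$ is the third derivative of $\Phi$. *)

theory Defs
  imports "HOL-Probability.Probability"
begin

text \<open>Degenerate (variance zero) laws count as Gaussian.\<close>

definition centered_gaussian :: "'a measure \<Rightarrow> ('a \<Rightarrow> real) \<Rightarrow> bool" where
  "centered_gaussian M Y \<longleftrightarrow>
     Y \<in> borel_measurable M \<and>
     (distr M borel Y = return borel 0 \<or>
      (\<exists>\<sigma>>0. distr M borel Y = density lborel (normal_density 0 \<sigma>)))"

definition centered_gaussian_vector ::
    "'a measure \<Rightarrow> ('a \<Rightarrow> 'e::euclidean_space) \<Rightarrow> bool" where
  "centered_gaussian_vector M V \<longleftrightarrow>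
     V \<in> borel_measurable M \<and> (\<forall>u. centered_gaussian M (\<lambda>\<omega>. u \<bullet> V \<omega>))"

definition centered_gaussian_family :: "'a measure \<Rightarrow> ('i \<Rightarrow> 'a \<Rightarrow> real) \<Rightarrow> bool" where
  "centered_gaussian_family M Y \<longleftrightarrow>
     (\<forall>S c. finite S \<longrightarrow> centered_gaussian M (\<lambda>\<omega>. \<Sum>i\<in>S. c i * Y i \<omega>))"

definition isonormal ::
    "'a measure \<Rightarrow> ('h::{real_inner,banach,second_countable_topology} \<Rightarrow> 'a \<Rightarrow> real) \<Rightarrow> bool" where
  "isonormal M X \<longleftrightarrow>
     prob_space M \<and> centered_gaussian_family M X \<and>
     (\<forall>h g. (\<integral>\<omega>. X h \<omega> * X g \<omega> \<partial>M) = h \<bullet> g)"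

definition generated_sigma :: "'a measure \<Rightarrow> ('i \<Rightarrow> 'a \<Rightarrow> real) \<Rightarrow> 'a measure" where
  "generated_sigma M X =
     sigma (space M) {X h -` B \<inter> space M | h B. B \<in> sets borel}"

text \<open>The library's weak convergence is formulated with distribution functions on the real
  line; the plane needs the formulation with bounded continuous test functions.\<close>

definition conv_in_distribution ::
    "'a measure \<Rightarrow> (nat \<Rightarrow> 'a \<Rightarrow> 'e::topological_space) \<Rightarrow> 'b measure \<Rightarrow> ('b \<Rightarrow> 'e) \<Rightarrow> bool" where
  "conv_in_distribution M V M' W \<longleftrightarrow>
     (\<forall>f :: 'e \<Rightarrow> real. continuous_on UNIV f \<and> bounded (range f) \<longrightarrow>
        (\<lambda>n. \<integral>\<omega>. f (V n \<omega>) \<partial>M) \<longlonglongrightarrow> (\<integral>\<omega>. f (W \<omega>) \<partial>M'))"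

definition kolmogorov_dist :: "real measure \<Rightarrow> real measure \<Rightarrow> real" where
  "kolmogorov_dist \<mu> \<nu> = (SUP z. \<bar>cdf \<mu> z - cdf \<nu> z\<bar>)"

definition square_integrable ::
    "'a measure \<Rightarrow> ('a \<Rightarrow> 'e::{real_normed_vector,second_countable_topology}) \<Rightarrow> bool" where
  "square_integrable M f \<longleftrightarrow>
     f \<in> borel_measurable M \<and> integrable M (\<lambda>\<omega>. (norm (f \<omega>))\<^sup>2)"

definition L2_tendsto ::
    "'a measure \<Rightarrow> (nat \<Rightarrow> 'a \<Rightarrow> 'e::{real_normed_vector,second_countable_topology}) \<Rightarrow>
     ('a \<Rightarrow> 'e) \<Rightarrow> bool" where
  "L2_tendsto M f g \<longleftrightarrow>
     (\<forall>k. square_integrable M (f k)) \<and> square_integrable M g \<and>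
     (\<lambda>k. \<integral>\<omega>. (norm (f k \<omega> - g \<omega>))\<^sup>2 \<partial>M) \<longlonglongrightarrow> 0"

text \<open>Probabilists' (monic) Hermite polynomials. The normalisation by the factorial of the
  degree, which some authors use, does not affect the chaoses.\<close>

fun hermite :: "nat \<Rightarrow> real \<Rightarrow> real" where
  "hermite 0 x = 1"
| "hermite (Suc 0) x = x"
| "hermite (Suc (Suc n)) x = x * hermite (Suc n) x - real (Suc n) * hermite n x"

text \<open>The chaos of order zero consists of the constants; the chaos of order \<open>q \<ge> 1\<close> is the
  closed linear span in L2 of the variables \<open>hermite q (X h)\<close> with \<open>h\<close> a unit vector, i.e. the
  image of the multiple integral of order \<open>q\<close>, which maps the tensor power
  of order \<open>q\<close> of a unit vector \<open>h\<close> to \<open>hermite q (X h)\<close>. Elements of L2 are represented by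
  functions, so the chaoses are closed under almost sure modification, and the operators below
  pick one representative.\<close>

definition wiener_chaos ::
    "'a measure \<Rightarrow> ('h::{real_inner,banach,second_countable_topology} \<Rightarrow> 'a \<Rightarrow> real) \<Rightarrow> nat \<Rightarrow>
     ('a \<Rightarrow> real) set" where
  "wiener_chaos M X q =
     (if q = 0 then {G. G \<in> borel_measurable M \<and> (\<exists>c. AE \<omega> in M. G \<omega> = c)}
      else {G. \<exists>S c. (\<forall>k. finite (S k) \<and> (\<forall>h\<in>S k. norm h = 1)) \<and>
               L2_tendsto M (\<lambda>k \<omega>. \<Sum>h\<in>S k. c k h * hermite q (X h \<omega>)) G})"

definition chaos_projection ::
    "'a measure \<Rightarrow> ('h::{real_inner,banach,second_countable_topology} \<Rightarrow> 'a \<Rightarrow> real) \<Rightarrow> nat \<Rightarrow>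
     ('a \<Rightarrow> real) \<Rightarrow> 'a \<Rightarrow> real" where
  "chaos_projection M X q F =
     (SOME G. G \<in> wiener_chaos M X q \<and>
              (\<forall>H\<in>wiener_chaos M X q. (\<integral>\<omega>. (F \<omega> - G \<omega>) * H \<omega> \<partial>M) = 0))"

definition OU_pseudo_inverse ::
    "'a measure \<Rightarrow> ('h::{real_inner,banach,second_countable_topology} \<Rightarrow> 'a \<Rightarrow> real) \<Rightarrow>
     ('a \<Rightarrow> real) \<Rightarrow> 'a \<Rightarrow> real" where
  "OU_pseudo_inverse M X F =
     (SOME G. L2_tendsto M
        (\<lambda>k \<omega>. - (\<Sum>q=1..k. (1 / real q) * chaos_projection M X q F \<omega>)) G)"

text \<open>A function on n-dimensional space, with n varying, is a function on sequences depending
  only on the first n coordinates; continuity for the product topology is then ordinary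
  continuity in these coordinates.\<close>

definition partial_deriv :: "nat \<Rightarrow> ((nat \<Rightarrow> real) \<Rightarrow> real) \<Rightarrow> (nat \<Rightarrow> real) \<Rightarrow> real" where
  "partial_deriv i g x = deriv (\<lambda>t. g (x(i := t))) (x i)"

definition smooth_compact_support :: "nat \<Rightarrow> ((nat \<Rightarrow> real) \<Rightarrow> real) \<Rightarrow> bool" where
  "smooth_compact_support n g \<longleftrightarrow>
     (\<forall>x y. (\<forall>i<n. x i = y i) \<longrightarrow> g x = g y) \<and>
     (\<forall>is. set is \<subseteq> {..<n} \<longrightarrow>
        continuous_on UNIV (foldr partial_deriv is g) \<and>
        (\<forall>i<n. \<forall>x. (\<lambda>t. foldr partial_deriv is g (x(i := t))) differentiable (at (x i)))) \<and>
     (\<exists>K. \<forall>x. g x \<noteq> 0 \<longrightarrow> (\<forall>i<n. \<bar>x i\<bar> \<le> K))"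

text \<open>The derivative is attached to a representation of the functional, hence a relation.\<close>

definition smooth_functional_deriv ::
    "('h::{real_inner,banach,second_countable_topology} \<Rightarrow> 'a \<Rightarrow> real) \<Rightarrow>
     ('a \<Rightarrow> real) \<Rightarrow> ('a \<Rightarrow> 'h) \<Rightarrow> bool" where
  "smooth_functional_deriv X F U \<longleftrightarrow>
     (\<exists>n g \<phi>. n \<ge> 1 \<and> smooth_compact_support n g \<and>
        F = (\<lambda>\<omega>. g (\<lambda>i. X (\<phi> i) \<omega>)) \<and>
        U = (\<lambda>\<omega>. \<Sum>i<n. partial_deriv i g (\<lambda>j. X (\<phi> j) \<omega>) *\<^sub>R \<phi> i))"

definition is_malliavin_deriv ::
    "'a measure \<Rightarrow> ('h::{real_inner,banach,second_countable_topology} \<Rightarrow> 'a \<Rightarrow> real) \<Rightarrow>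
     ('a \<Rightarrow> real) \<Rightarrow> ('a \<Rightarrow> 'h) \<Rightarrow> bool" where
  "is_malliavin_deriv M X F U \<longleftrightarrow>
     (\<exists>F' U'. (\<forall>k. smooth_functional_deriv X (F' k) (U' k)) \<and>
        L2_tendsto M F' F \<and> L2_tendsto M U' U)"

definition D12 ::
    "'a measure \<Rightarrow> ('h::{real_inner,banach,second_countable_topology} \<Rightarrow> 'a \<Rightarrow> real) \<Rightarrow>
     ('a \<Rightarrow> real) set" where
  "D12 M X = {F. \<exists>U. is_malliavin_deriv M X F U}"

definition malliavin_deriv ::
    "'a measure \<Rightarrow> ('h::{real_inner,banach,second_countable_topology} \<Rightarrow> 'a \<Rightarrow> real) \<Rightarrow>
     ('a \<Rightarrow> real) \<Rightarrow> 'a \<Rightarrow> 'h" where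
  "malliavin_deriv M X F = (SOME U. is_malliavin_deriv M X F U)"

definition stein_factor ::
    "'a measure \<Rightarrow> ('h::{real_inner,banach,second_countable_topology} \<Rightarrow> 'a \<Rightarrow> real) \<Rightarrow>
     ('a \<Rightarrow> real) \<Rightarrow> 'a \<Rightarrow> real" where
  "stein_factor M X F \<omega> =
     1 - malliavin_deriv M X F \<omega> \<bullet> (- malliavin_deriv M X (OU_pseudo_inverse M X F) \<omega>)"

end

theory Submission
  imports Defs
begin

text \<open>
  Since \<open>- D L\<^sup>-\<^sup>1 F\<close> represents \<open>F\<close> through Gaussian integration by parts,
  \<open>E (F f(F)) = E (f'(F) (1 - S))\<close> with \<open>S\<close> the Stein factor. For the solution \<open>f\<close> of
  Stein's equation \<open>f' x - x f x = 1 (x \<le> z) - \<Phi> z\<close> this reads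
  \<open>P (F \<le> z) - \<Phi> z = E (f'(F) S)\<close>, and \<open>\<bar>f'\<bar> \<le> 1\<close> gives the bound. Dividing by \<open>\<phi> n\<close>, the right-hand side
  converges to \<open>E (f'(N1) N2) = \<rho> E (f'(N1) N1)\<close>, which is computed explicitly.

  The integration by parts formula needs no Fock space. Functionals of the field are differentiated
  along Cameron--Martin directions, the formula for cylindrical functionals follows from the
  independence of \<open>X h\<close> and \<open>X - \<langle>\<cdot>, h\<rangle> X h\<close>, and it is extended to \<open>F\<close> by
  approximating \<open>L\<^sup>-\<^sup>1 F\<close> by finite Hermite sums \<open>P\<close>, for which
  \<open>E \<parallel>D P\<parallel>\<^sup>2 = - E (P L P)\<close> makes the gradients converge. Malliavin derivatives picked by a
  choice operator are harmless, because integration by parts against \<open>exp (i X \<psi>)\<close>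
  determines them weakly and characteristic functions separate laws.
\<close>

section \<open>Square-integrable functions\<close>

text \<open>Three obstacles shape the proof. The function \<open>f'\<close> jumps at
  \<open>z\<close>, while the chain rule for Malliavin derivatives asks for continuous derivatives;
  the solution is therefore smoothed at its kink, with derivatives bounded by 1 uniformly and
  converging at every point. Convergence in distribution controls only bounded continuous functions,
  whereas the integrand has a jump in one factor and no bound on the other; the jump is paid for by
  an integral that is small because \<open>N1\<close> has no atom at \<open>z\<close>, the missing
  bound by the unit second moment. Finally, elements of L2 are functions, not classes, and the
  operators choose representatives: two Malliavin derivatives of one variable are never compared
  almost everywhere, only through their pairings with
  \<open>K (field \<omega>) *\<^sub>R \<phi>\<close> for bounded \<open>K\<close>. This is enough,
  since gradients of smooth functionals are finite sums of such terms and \<open>D F\<close> is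
  reached from them by an L2 limit. The factor 1/3 in the limit comes from the antiderivative x^3 /
  3 of x^2.\<close>

definition L2norm ::
    "'a measure \<Rightarrow> ('a \<Rightarrow> 'e::{real_normed_vector,second_countable_topology}) \<Rightarrow> real" where
  "L2norm M f = sqrt (\<integral>\<omega>. (norm (f \<omega>))\<^sup>2 \<partial>M)"

lemma L2norm_nonneg[simp]: "0 \<le> L2norm M f"
  by (simp add: L2norm_def)

lemma L2norm_square: "(L2norm M f)\<^sup>2 = (\<integral>\<omega>. (norm (f \<omega>))\<^sup>2 \<partial>M)"
  by (simp add: L2norm_def)

lemma square_integrable_measurable[dest]: "square_integrable M f \<Longrightarrow> f \<in> borel_measurable M"
  by (simp add: square_integrable_def)

lemma square_integrable_norm: "square_integrable M f \<Longrightarrow> square_integrable M (\<lambda>x. norm (f x))"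
  by (auto simp: square_integrable_def)

lemma square_integrable_bound:
  assumes "square_integrable M f" "g \<in> borel_measurable M" "AE x in M. norm (g x) \<le> norm (f x)"
  shows "square_integrable M g"
proof -
  have "integrable M (\<lambda>x. (norm (g x))\<^sup>2)"
    by (rule Bochner_Integration.integrable_bound[of M "\<lambda>x. (norm (f x))\<^sup>2"])
       (use assms in \<open>auto simp: square_integrable_def intro: power_mono elim!: eventually_mono\<close>)
  then show ?thesis using assms by (simp add: square_integrable_def)
qed

lemma integrable_mult_square_integrable:
  fixes f g :: "'a \<Rightarrow> real"
  assumes "square_integrable M f" "square_integrable M g"
  shows "integrable M (\<lambda>x. f x * g x)"
proof (rule Bochner_Integration.integrable_bound[of M "\<lambda>x. (f x)\<^sup>2 + (g x)\<^sup>2"])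
  show "integrable M (\<lambda>x. (f x)\<^sup>2 + (g x)\<^sup>2)"
    using assms by (auto simp: square_integrable_def)
  show "(\<lambda>x. f x * g x) \<in> borel_measurable M"
    using assms by (auto simp: square_integrable_def)
  have "\<bar>f x * g x\<bar> \<le> (f x)\<^sup>2 + (g x)\<^sup>2" for x
  proof -
    have "0 \<le> (\<bar>f x\<bar> - \<bar>g x\<bar>)\<^sup>2" by simp
    then have "2 * (\<bar>f x\<bar> * \<bar>g x\<bar>) \<le> (f x)\<^sup>2 + (g x)\<^sup>2"
      by (simp add: power2_eq_square algebra_simps)
    moreover have "0 \<le> \<bar>f x\<bar> * \<bar>g x\<bar>" by simp
    ultimately show ?thesis unfolding abs_mult by linarith
  qed
  then show "AE x in M. norm (f x * g x) \<le> norm ((f x)\<^sup>2 + (g x)\<^sup>2)" by simp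
qed

lemma square_integrable_add:
  assumes "square_integrable M f" "square_integrable M g"
  shows "square_integrable M (\<lambda>x. f x + g x)"
proof -
  have [measurable]: "f \<in> borel_measurable M" "g \<in> borel_measurable M" using assms by auto
  have i: "integrable M (\<lambda>x. (norm (f x))\<^sup>2 + 2 * (norm (f x) * norm (g x)) + (norm (g x))\<^sup>2)"
    using assms integrable_mult_square_integrable[OF square_integrable_norm square_integrable_norm, OF assms]
    by (auto simp: square_integrable_def)
  have "integrable M (\<lambda>x. (norm (f x + g x))\<^sup>2)"
  proof (rule Bochner_Integration.integrable_bound[OF i])
    have "(norm (f x + g x))\<^sup>2 \<le> (norm (f x))\<^sup>2 + 2 * (norm (f x) * norm (g x)) + (norm (g x))\<^sup>2" for x
      using power_mono[OF norm_triangle_ineq[of "f x" "g x"] norm_ge_zero, of 2]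
      by (simp add: power2_sum algebra_simps)
    then show "AE x in M. norm ((norm (f x + g x))\<^sup>2)
        \<le> norm ((norm (f x))\<^sup>2 + 2 * (norm (f x) * norm (g x)) + (norm (g x))\<^sup>2)" by simp
  qed measurable
  then show ?thesis by (simp add: square_integrable_def)
qed

lemma square_integrable_scaleR:
  "square_integrable M f \<Longrightarrow> square_integrable M (\<lambda>x. c *\<^sub>R f x)"
  by (auto simp: square_integrable_def power_mult_distrib)

lemma square_integrable_cmult:
  fixes f :: "'a \<Rightarrow> real"
  shows "square_integrable M f \<Longrightarrow> square_integrable M (\<lambda>x. c * f x)"
  using square_integrable_scaleR[of M f c] by simp

lemma square_integrable_uminus:
  "square_integrable M f \<Longrightarrow> square_integrable M (\<lambda>x. - f x)"
  using square_integrable_scaleR[of M f "-1"] by simp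

lemma square_integrable_diff:
  "square_integrable M f \<Longrightarrow> square_integrable M g \<Longrightarrow> square_integrable M (\<lambda>x. f x - g x)"
  using square_integrable_add[of M f "\<lambda>x. - g x"] square_integrable_uminus[of M g] by simp

lemma square_integrable_zero: "square_integrable M (\<lambda>x. 0)"
  by (simp add: square_integrable_def)

lemma square_integrable_sum:
  "(\<And>i. i \<in> I \<Longrightarrow> square_integrable M (f i)) \<Longrightarrow> square_integrable M (\<lambda>x. \<Sum>i\<in>I. f i x)"
  by (induction I rule: infinite_finite_induct) (auto simp: square_integrable_zero square_integrable_add)

text \<open>The integral of (t |f| - |g|)^2 is a quadratic in t that is never negative. Norms are
  used so that one lemma serves real functions as well as gradients with values in the Hilbert
  space.\<close>

lemma norm_Cauchy_Schwarz:
  assumes "square_integrable M f" "square_integrable M g"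
  shows "integrable M (\<lambda>x. norm (f x) * norm (g x))"
    "(\<integral>x. norm (f x) * norm (g x) \<partial>M) \<le> L2norm M f * L2norm M g"
proof -
  let ?A = "\<integral>x. (norm (f x))\<^sup>2 \<partial>M" and ?B = "\<integral>x. (norm (g x))\<^sup>2 \<partial>M"
    and ?P = "\<integral>x. norm (f x) * norm (g x) \<partial>M"
  show int: "integrable M (\<lambda>x. norm (f x) * norm (g x))"
    using integrable_mult_square_integrable[OF square_integrable_norm square_integrable_norm, OF assms] .
  have A: "integrable M (\<lambda>x. (norm (f x))\<^sup>2)" and B: "integrable M (\<lambda>x. (norm (g x))\<^sup>2)"
    using assms by (auto simp: square_integrable_def)
  have q: "0 \<le> t\<^sup>2 * ?A - 2 * t * ?P + ?B" for t
  proof -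
    have "0 \<le> (\<integral>x. (t * norm (f x) - norm (g x))\<^sup>2 \<partial>M)" by simp
    also have "\<dots> = (\<integral>x. t\<^sup>2 * (norm (f x))\<^sup>2 - 2 * t * (norm (f x) * norm (g x)) + (norm (g x))\<^sup>2 \<partial>M)"
      by (simp add: power2_diff algebra_simps power_mult_distrib)
    also have "\<dots> = t\<^sup>2 * ?A - 2 * t * ?P + ?B" using A B int by simp
    finally show ?thesis .
  qed
  have P: "?P\<^sup>2 \<le> ?A * ?B"
  proof (cases "?A = 0")
    case True
    have "?P = 0"
    proof (rule ccontr)
      assume "?P \<noteq> 0"
      \<comment> \<open>With A = 0 the quadratic is affine in t, and this t gives it the value
        -1.\<close>
      then show False using q[of "(?B + 1) / (2 * ?P)"] True by simp
    qed
    then show ?thesis using True by simp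
  next
    case False
    moreover have "?A \<ge> 0" by simp
    ultimately have "?A > 0" by linarith
    \<comment> \<open>The quadratic takes its minimum at t = P / A.\<close>
    with q[of "?P / ?A"] have "0 \<le> ?A * ((?P / ?A)\<^sup>2 * ?A - 2 * (?P / ?A) * ?P + ?B)" by simp
    also have "\<dots> = ?A * ?B - ?P\<^sup>2" using \<open>?A > 0\<close> by (simp add: field_simps power2_eq_square)
    finally show ?thesis by simp
  qed
  show "?P \<le> L2norm M f * L2norm M g"
    unfolding L2norm_def real_sqrt_mult[symmetric] using P by (rule real_le_rsqrt)
qed

lemma inner_Cauchy_Schwarz:
  fixes f g :: "'a \<Rightarrow> 'e::{real_inner,second_countable_topology}"
  assumes "square_integrable M f" "square_integrable M g"
  shows "integrable M (\<lambda>x. f x \<bullet> g x)" "\<bar>\<integral>x. f x \<bullet> g x \<partial>M\<bar> \<le> L2norm M f * L2norm M g"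
proof -
  have [measurable]: "f \<in> borel_measurable M" "g \<in> borel_measurable M" using assms by auto
  show i: "integrable M (\<lambda>x. f x \<bullet> g x)"
    by (rule Bochner_Integration.integrable_bound[OF norm_Cauchy_Schwarz(1)[OF assms]])
       (auto simp: Cauchy_Schwarz_ineq2)
  have "\<bar>\<integral>x. f x \<bullet> g x \<partial>M\<bar> \<le> (\<integral>x. norm (f x \<bullet> g x) \<partial>M)"
    using integral_norm_bound[of M "\<lambda>x. f x \<bullet> g x"] by simp
  also have "\<dots> \<le> (\<integral>x. norm (f x) * norm (g x) \<partial>M)"
    by (rule integral_mono) (use i norm_Cauchy_Schwarz(1)[OF assms] in \<open>auto simp: Cauchy_Schwarz_ineq2\<close>)
  also have "\<dots> \<le> L2norm M f * L2norm M g" by (rule norm_Cauchy_Schwarz(2)[OF assms])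
  finally show "\<bar>\<integral>x. f x \<bullet> g x \<partial>M\<bar> \<le> L2norm M f * L2norm M g" .
qed

lemma L2norm_triangle:
  assumes "square_integrable M f" "square_integrable M g"
  shows "L2norm M (\<lambda>x. f x + g x) \<le> L2norm M f + L2norm M g"
proof -
  have A: "integrable M (\<lambda>x. (norm (f x))\<^sup>2)" and B: "integrable M (\<lambda>x. (norm (g x))\<^sup>2)"
    using assms by (auto simp: square_integrable_def)
  note int = norm_Cauchy_Schwarz[OF assms]
  have "(L2norm M (\<lambda>x. f x + g x))\<^sup>2
      \<le> (\<integral>x. (norm (f x))\<^sup>2 + 2 * (norm (f x) * norm (g x)) + (norm (g x))\<^sup>2 \<partial>M)"
    unfolding L2norm_square
  proof (rule integral_mono)
    show "integrable M (\<lambda>x. (norm (f x + g x))\<^sup>2)"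
      using square_integrable_add[OF assms] by (simp add: square_integrable_def)
    show "(norm (f x + g x))\<^sup>2 \<le> (norm (f x))\<^sup>2 + 2 * (norm (f x) * norm (g x)) + (norm (g x))\<^sup>2" for x
      using power_mono[OF norm_triangle_ineq[of "f x" "g x"] norm_ge_zero, of 2]
      by (simp add: power2_sum algebra_simps)
  qed (use A B int in auto)
  also have "\<dots> = (L2norm M f)\<^sup>2 + 2 * (\<integral>x. norm (f x) * norm (g x) \<partial>M) + (L2norm M g)\<^sup>2"
    using A B int by (simp add: L2norm_square)
  also have "\<dots> \<le> (L2norm M f + L2norm M g)\<^sup>2"
    using int(2) by (simp add: power2_sum)
  finally show ?thesis by (rule power2_le_imp_le) simp
qed

lemma L2norm_scaleR: "L2norm M (\<lambda>x. c *\<^sub>R f x) = \<bar>c\<bar> * L2norm M f"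
  by (simp add: L2norm_def power_mult_distrib real_sqrt_mult)

lemma L2norm_cmult: fixes f :: "'a \<Rightarrow> real" shows "L2norm M (\<lambda>x. c * f x) = \<bar>c\<bar> * L2norm M f"
  using L2norm_scaleR[of M c f] by simp

lemma L2norm_minus: "L2norm M (\<lambda>x. - f x) = L2norm M f"
  by (simp add: L2norm_def)

lemma L2norm_minus_commute: "L2norm M (\<lambda>x. f x - g x) = L2norm M (\<lambda>x. g x - f x)"
  by (simp add: L2norm_def norm_minus_commute)

lemma L2norm_triangle_diff:
  assumes "square_integrable M f" "square_integrable M g" "square_integrable M h"
  shows "L2norm M (\<lambda>x. f x - h x) \<le> L2norm M (\<lambda>x. f x - g x) + L2norm M (\<lambda>x. g x - h x)"
  using L2norm_triangle[OF square_integrable_diff square_integrable_diff, OF assms(1,2,2,3)] by simp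

lemma L2norm_sum:
  "(\<And>i. i \<in> I \<Longrightarrow> square_integrable M (f i)) \<Longrightarrow>
     L2norm M (\<lambda>x. \<Sum>i\<in>I. f i x) \<le> (\<Sum>i\<in>I. L2norm M (f i))"
proof (induction I rule: infinite_finite_induct)
  case (insert i I)
  have "L2norm M (\<lambda>x. f i x + (\<Sum>i\<in>I. f i x)) \<le> L2norm M (f i) + L2norm M (\<lambda>x. \<Sum>i\<in>I. f i x)"
    using insert by (intro L2norm_triangle square_integrable_sum) auto
  then show ?case using insert by fastforce
qed (auto simp: L2norm_def)

section \<open>Convergence in L2, completeness and orthogonal projection\<close>

lemma L2_tendsto_iff:
  "L2_tendsto M f g \<longleftrightarrow> (\<forall>k. square_integrable M (f k)) \<and> square_integrable M g \<and>
     (\<lambda>k. L2norm M (\<lambda>x. f k x - g x)) \<longlonglongrightarrow> 0"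
proof -
  have "(\<lambda>k. L2norm M (\<lambda>x. f k x - g x)) \<longlonglongrightarrow> 0 \<longleftrightarrow> (\<lambda>k. (\<integral>\<omega>. (norm (f k \<omega> - g \<omega>))\<^sup>2 \<partial>M)) \<longlonglongrightarrow> 0"
    using tendsto_real_sqrt[of "\<lambda>k. (\<integral>\<omega>. (norm (f k \<omega> - g \<omega>))\<^sup>2 \<partial>M)" 0 sequentially]
      tendsto_power[of "\<lambda>k. L2norm M (\<lambda>x. f k x - g x)" 0 sequentially 2]
    by (auto simp: L2norm_def)
  then show ?thesis by (simp add: L2_tendsto_def)
qed

lemma L2_tendstoD:
  assumes "L2_tendsto M f g"
  shows "square_integrable M (f k)" "square_integrable M g"
    "(\<lambda>k. L2norm M (\<lambda>x. f k x - g x)) \<longlonglongrightarrow> 0"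
  using assms by (auto simp: L2_tendsto_iff)

lemma L2_tendstoI:
  assumes "\<And>k. square_integrable M (f k)" "square_integrable M g"
    "\<And>k. L2norm M (\<lambda>x. f k x - g x) \<le> e k" "e \<longlonglongrightarrow> 0"
  shows "L2_tendsto M f g"
  unfolding L2_tendsto_iff
  using assms tendsto_sandwich[of "\<lambda>_. 0" "\<lambda>k. L2norm M (\<lambda>x. f k x - g x)" sequentially e 0]
  by auto

lemma L2_tendsto_const: "square_integrable M f \<Longrightarrow> L2_tendsto M (\<lambda>_. f) f"
  by (rule L2_tendstoI[of _ _ _ "\<lambda>_. 0"]) (auto simp: L2norm_def)

lemma L2_tendsto_subseq:
  "L2_tendsto M f g \<Longrightarrow> strict_mono r \<Longrightarrow> L2_tendsto M (\<lambda>k. f (r k)) g"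
  unfolding L2_tendsto_iff using LIMSEQ_subseq_LIMSEQ[of "\<lambda>k. L2norm M (\<lambda>x. f k x - g x)" 0 r]
  by (auto simp: o_def)

lemma L2_tendsto_scaleR:
  assumes "L2_tendsto M f g"
  shows "L2_tendsto M (\<lambda>k x. c *\<^sub>R f k x) (\<lambda>x. c *\<^sub>R g x)"
proof (rule L2_tendstoI)
  note a = L2_tendstoD[OF assms(1)]
  show "L2norm M (\<lambda>x. c *\<^sub>R f k x - c *\<^sub>R g x) \<le> \<bar>c\<bar> * L2norm M (\<lambda>x. f k x - g x)" for k
    using L2norm_scaleR[of M c "\<lambda>x. f k x - g x"] by (simp add: algebra_simps)
  show "(\<lambda>k. \<bar>c\<bar> * L2norm M (\<lambda>x. f k x - g x)) \<longlonglongrightarrow> 0"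
    using tendsto_mult_left[OF a(3)] by simp
qed (use L2_tendstoD(1,2)[OF assms] in \<open>auto intro!: square_integrable_scaleR\<close>)

lemma L2_tendsto_uminus: "L2_tendsto M f g \<Longrightarrow> L2_tendsto M (\<lambda>k x. - f k x) (\<lambda>x. - g x)"
  using L2_tendsto_scaleR[of M f g "-1"] by simp

text \<open>Expanding around the limits leaves three pairings, each with at least one small factor,
  which Cauchy-Schwarz bounds. With one of the sequences constant this is the continuity of a
  pairing, the form in which identities are passed to the limit below.\<close>

lemma L2_tendsto_inner:
  fixes f f' :: "nat \<Rightarrow> 'a \<Rightarrow> 'e::{real_inner,second_countable_topology}"
  assumes "L2_tendsto M f g" "L2_tendsto M f' g'"
  shows "(\<lambda>k. \<integral>x. f k x \<bullet> f' k x \<partial>M) \<longlonglongrightarrow> (\<integral>x. g x \<bullet> g' x \<partial>M)"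
proof -
  note a = L2_tendstoD[OF assms(1)] and b = L2_tendstoD[OF assms(2)]
  let ?u = "\<lambda>k. L2norm M (\<lambda>x. f k x - g x)" and ?v = "\<lambda>k. L2norm M (\<lambda>x. f' k x - g' x)"
  have bd: "norm ((\<integral>x. f k x \<bullet> f' k x \<partial>M) - (\<integral>x. g x \<bullet> g' x \<partial>M))
      \<le> ?u k * ?v k + ?u k * L2norm M g' + L2norm M g * ?v k" for k
  proof -
    have "(\<integral>x. f k x \<bullet> f' k x \<partial>M) - (\<integral>x. g x \<bullet> g' x \<partial>M)
       = (\<integral>x. f k x \<bullet> f' k x - g x \<bullet> g' x \<partial>M)"
      using a b by (intro Bochner_Integration.integral_diff[symmetric] inner_Cauchy_Schwarz) auto
    also have "\<dots> = (\<integral>x. (f k x - g x) \<bullet> (f' k x - g' x) + (f k x - g x) \<bullet> g' x + g x \<bullet> (f' k x - g' x) \<partial>M)"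
      by (simp add: algebra_simps)
    also have "\<dots> = (\<integral>x. (f k x - g x) \<bullet> (f' k x - g' x) \<partial>M) + (\<integral>x. (f k x - g x) \<bullet> g' x \<partial>M)
        + (\<integral>x. g x \<bullet> (f' k x - g' x) \<partial>M)"
      using a b by (simp add: inner_Cauchy_Schwarz square_integrable_diff)
    finally show ?thesis
      using inner_Cauchy_Schwarz(2)[OF square_integrable_diff square_integrable_diff, OF a(1,2) b(1,2), of k k]
        inner_Cauchy_Schwarz(2)[OF square_integrable_diff, OF a(1,2) b(2), of k]
        inner_Cauchy_Schwarz(2)[OF _ square_integrable_diff, OF a(2) b(1,2), of k] by simp
  qed
  have "(\<lambda>k. ?u k * ?v k + ?u k * L2norm M g' + L2norm M g * ?v k) \<longlonglongrightarrow> 0 * 0 + 0 * L2norm M g' + L2norm M g * 0"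
    by (rule tendsto_add tendsto_mult tendsto_const a(3) b(3))+
  then have lim: "(\<lambda>k. ?u k * ?v k + ?u k * L2norm M g' + L2norm M g * ?v k) \<longlonglongrightarrow> 0" by simp
  have "(\<lambda>k. (\<integral>x. f k x \<bullet> f' k x \<partial>M) - (\<integral>x. g x \<bullet> g' x \<partial>M)) \<longlonglongrightarrow> 0"
    by (rule Lim_null_comparison[OF always_eventually[OF allI, OF bd] lim])
  then show ?thesis using Lim_null by blast
qed

text \<open>The squared distances converge to 0 in L1, hence almost surely along a
  subsequence.\<close>

lemma L2_tendsto_AE_subseq:
  fixes f :: "nat \<Rightarrow> 'a \<Rightarrow> 'e::{banach,second_countable_topology}"
  assumes "L2_tendsto M f g"
  obtains r where "strict_mono r" "AE x in M. (\<lambda>k. f (r k) x) \<longlonglongrightarrow> g x"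
proof -
  note a = L2_tendstoD[OF assms(1)]
  let ?u = "\<lambda>k x. (norm (f k x - g x))\<^sup>2"
  have i: "integrable M (?u k)" for k
    using square_integrable_diff[OF a(1,2)] by (simp add: square_integrable_def)
  have "(\<lambda>k. \<integral>x. norm (?u k x) \<partial>M) \<longlonglongrightarrow> 0"
    using assms by (simp add: L2_tendsto_def)
  from tendsto_L1_AE_subseq[OF i this] obtain r where r: "strict_mono r"
    "AE x in M. (\<lambda>k. ?u (r k) x) \<longlonglongrightarrow> 0" by auto
  from r(2) have "AE x in M. (\<lambda>k. f (r k) x) \<longlonglongrightarrow> g x"
  proof eventually_elim
    case (elim x)
    from tendsto_real_sqrt[OF this] show ?case by (simp add: tendsto_norm_zero_iff Lim_null[symmetric])
  qed
  with r(1) that show ?thesis by blast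
qed

context prob_space
begin

lemma square_integrable_integrable:
  fixes f :: "'a \<Rightarrow> 'e::{banach,second_countable_topology}"
  assumes "square_integrable M f"
  shows "integrable M f" "(\<integral>x. norm (f x) \<partial>M) \<le> L2norm M f"
proof -
  have c: "square_integrable M (\<lambda>x. 1::real)" by (simp add: square_integrable_def)
  note norm_Cauchy_Schwarz[OF assms c]
  then show "(\<integral>x. norm (f x) \<partial>M) \<le> L2norm M f" "integrable M f"
    using assms by (auto simp: L2norm_def prob_space square_integrable_def integrable_norm_iff)
qed

lemma square_integrable_bounded:
  assumes "f \<in> borel_measurable M" "\<And>x. norm (f x) \<le> B"
  shows "square_integrable M f"
  unfolding square_integrable_def
proof
  show "integrable M (\<lambda>x. (norm (f x))\<^sup>2)"
    by (rule integrable_const_bound[of _ "B\<^sup>2"]) (use assms in \<open>auto intro!: power_mono\<close>)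
qed fact

text \<open>The Riesz-Fischer argument, for values in a Banach space because it is applied to
  gradients too. Along a fast subsequence the increments are summable in L1 (the total mass is 1, so
  L1 norms are below L2 norms), hence almost surely; Fatou's lemma then bounds the distance of the
  whole sequence from the limit.\<close>

lemma L2_complete:
  fixes f :: "nat \<Rightarrow> 'a \<Rightarrow> 'e::{banach,second_countable_topology}"
  assumes sq: "\<And>k. square_integrable M (f k)"
    and cauchy: "\<And>e. e > 0 \<Longrightarrow> \<exists>K. \<forall>j\<ge>K. \<forall>k\<ge>K. L2norm M (\<lambda>x. f j x - f k x) < e"
  obtains g where "L2_tendsto M f g"
proof -
  have [measurable]: "f k \<in> borel_measurable M" for k using sq by auto
  obtain K where K: "\<And>n j k. j \<ge> K n \<Longrightarrow> k \<ge> K n \<Longrightarrow> L2norm M (\<lambda>x. f j x - f k x) < (1/2)^n"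
    using cauchy[of "(1/2)^n" for n] by (metis zero_less_divide_1_iff zero_less_numeral zero_less_power)
  \<comment> \<open>A sum dominates each of its terms, so \<open>r i\<close> lies beyond every
    \<open>K n\<close> with n \<le> i.\<close>
  define r where "r n = (\<Sum>i\<le>n. K i)" for n
  have rK: "r n \<ge> K n" "r (Suc n) \<ge> K n" for n
    unfolding r_def using member_le_sum[of n "{..n}" K] by auto
  have rmono: "r i \<ge> K n" if "i \<ge> n" for i n
    unfolding r_def using that member_le_sum[of n "{..i}" K] by auto
  define d where "d n x = norm (f (r (Suc n)) x - f (r n) x)" for n x
  have [measurable]: "d n \<in> borel_measurable M" for n unfolding d_def by measurable
  have d1: "(\<integral>\<^sup>+x. ennreal (d n x) \<partial>M) \<le> ennreal ((1/2)^n)" for n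
  proof -
    have s: "square_integrable M (\<lambda>x. f (r (Suc n)) x - f (r n) x)" by (intro square_integrable_diff sq)
    have "(\<integral>\<^sup>+x. ennreal (d n x) \<partial>M) = ennreal (\<integral>x. d n x \<partial>M)"
      unfolding d_def using square_integrable_integrable[OF s] by (intro nn_integral_eq_integral) auto
    also have "(\<integral>x. d n x \<partial>M) \<le> (1/2)^n"
      unfolding d_def using square_integrable_integrable(2)[OF s] K[OF rK(2,1), of n] by linarith
    finally show ?thesis by (simp add: ennreal_leI)
  qed
  have "(\<integral>\<^sup>+x. (\<Sum>n. ennreal (d n x)) \<partial>M) = (\<Sum>n. (\<integral>\<^sup>+x. ennreal (d n x) \<partial>M))"
    by (rule nn_integral_suminf) measurable
  also have "\<dots> \<le> (\<Sum>n. ennreal ((1/2)^n))" by (intro suminf_le d1) auto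
  also have "\<dots> = ennreal 2"
    using suminf_geometric[of "1/2::real"] by (subst suminf_ennreal2) (auto simp: suminf_geometric)
  finally have "(\<integral>\<^sup>+x. (\<Sum>n. ennreal (d n x)) \<partial>M) \<noteq> \<infinity>"
    by (metis ennreal_less_top infinity_ennreal_def leD)
  then have "AE x in M. (\<Sum>n. ennreal (d n x)) \<noteq> \<infinity>"
    by (intro nn_integral_PInf_AE) auto
  then have conv: "AE x in M. convergent (\<lambda>n. f (r n) x)"
  proof eventually_elim
    case (elim x)
    then have "summable (\<lambda>n. d n x)"
      by (intro summable_suminf_not_top) (auto simp: d_def)
    then have "summable (\<lambda>n. f (r (Suc n)) x - f (r n) x)"
      unfolding d_def by (rule summable_norm_cancel)
    then have "convergent (\<lambda>n. \<Sum>i<n. f (r (Suc i)) x - f (r i) x)"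
      by (simp add: summable_iff_convergent)
    then have "convergent (\<lambda>n. f (r n) x - f (r 0) x)"
      using sum_lessThan_telescope[of "\<lambda>n. f (r n) x"] by simp
    then show ?case by (simp add: convergent_diff_const_right_iff)
  qed
  define g where "g x = lim (\<lambda>n. f (r n) x)" for x
  have [measurable]: "g \<in> borel_measurable M" unfolding g_def by measurable
  have bd: "(\<integral>\<^sup>+x. ennreal ((norm (f k x - g x))\<^sup>2) \<partial>M) \<le> ennreal (((1/2)^n)\<^sup>2)" if "k \<ge> K n" for k n
  proof -
    have "(\<integral>\<^sup>+x. ennreal ((norm (f k x - g x))\<^sup>2) \<partial>M)
      = (\<integral>\<^sup>+x. liminf (\<lambda>i. ennreal ((norm (f k x - f (r i) x))\<^sup>2)) \<partial>M)"
    proof (rule nn_integral_cong_AE, use conv in eventually_elim)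
      case (elim x)
      then have "(\<lambda>n. f (r n) x) \<longlonglongrightarrow> g x" by (simp add: g_def convergent_LIMSEQ_iff)
      then have "(\<lambda>i. ennreal ((norm (f k x - f (r i) x))\<^sup>2)) \<longlonglongrightarrow> ennreal ((norm (f k x - g x))\<^sup>2)"
        by (intro tendsto_intros)
      from lim_imp_Liminf[OF _ this] show ?case by simp
    qed
    also have "\<dots> \<le> liminf (\<lambda>i. \<integral>\<^sup>+x. ennreal ((norm (f k x - f (r i) x))\<^sup>2) \<partial>M)"
      by (rule nn_integral_liminf) measurable
    also have "\<dots> \<le> liminf (\<lambda>i. ennreal (((1/2)^n)\<^sup>2))"
    proof (rule Liminf_mono, rule eventually_sequentiallyI[of n])
      fix i assume "i \<ge> n"
      have s: "square_integrable M (\<lambda>x. f k x - f (r i) x)" by (intro square_integrable_diff sq)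
      then have "(\<integral>\<^sup>+x. ennreal ((norm (f k x - f (r i) x))\<^sup>2) \<partial>M) = ennreal ((L2norm M (\<lambda>x. f k x - f (r i) x))\<^sup>2)"
        unfolding L2norm_square by (intro nn_integral_eq_integral) (auto simp: square_integrable_def)
      also have "\<dots> \<le> ennreal (((1/2)^n)\<^sup>2)"
        using K[OF \<open>k \<ge> K n\<close> rmono[OF \<open>i \<ge> n\<close>]] by (intro ennreal_leI power_mono) auto
      finally show "(\<integral>\<^sup>+x. ennreal ((norm (f k x - f (r i) x))\<^sup>2) \<partial>M) \<le> ennreal (((1/2)^n)\<^sup>2)" .
    qed
    finally show ?thesis by (simp add: Liminf_const)
  qed
  have sqd: "square_integrable M (\<lambda>x. f k x - g x)" "L2norm M (\<lambda>x. f k x - g x) \<le> (1/2)^n" if "k \<ge> K n" for k n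
  proof -
    have i: "integrable M (\<lambda>x. (norm (f k x - g x))\<^sup>2)"
      using le_less_trans[OF bd[OF that] ennreal_less_top] by (intro integrableI_nonneg) (auto simp: infinity_ennreal_def)
    then show "square_integrable M (\<lambda>x. f k x - g x)" by (simp add: square_integrable_def)
    have "ennreal ((L2norm M (\<lambda>x. f k x - g x))\<^sup>2) \<le> ennreal (((1/2)^n)\<^sup>2)"
      using bd[OF that] nn_integral_eq_integral[OF i] by (simp add: L2norm_square)
    then have "(L2norm M (\<lambda>x. f k x - g x))\<^sup>2 \<le> ((1/2)^n)\<^sup>2" by (subst (asm) ennreal_le_iff) auto
    then show "L2norm M (\<lambda>x. f k x - g x) \<le> (1/2)^n" by (rule power2_le_imp_le) simp
  qed
  have "square_integrable M g"
    using square_integrable_diff[OF sq sqd(1)[of 0 "K 0"], of "K 0"] by simp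
  moreover have "(\<lambda>k. L2norm M (\<lambda>x. f k x - g x)) \<longlonglongrightarrow> 0"
  proof (rule LIMSEQ_I)
    fix e :: real assume "e > 0"
    then obtain n where n: "(1/2)^n < e" using real_arch_pow_inv[of e "1/2"] by auto
    show "\<exists>N. \<forall>k\<ge>N. norm (L2norm M (\<lambda>x. f k x - g x) - 0) < e"
      using sqd(2)[of n] n by (intro exI[of _ "K n"]) fastforce
  qed
  ultimately show ?thesis using that[of g] sq by (simp add: L2_tendsto_iff)
qed

end

text \<open>The subspace \<open>V\<close> need not be closed, so the projection \<open>G\<close> is
  a limit of elements of \<open>V\<close>. The approximating sequence is part of the conclusion
  because a Wiener chaos is defined through such sequences.\<close>

lemma (in prob_space) L2_projection:
  fixes F :: "'a \<Rightarrow> real" and V :: "('a \<Rightarrow> real) set"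
  assumes F: "square_integrable M F"
    and V: "\<And>v. v \<in> V \<Longrightarrow> square_integrable M v" "(\<lambda>_. 0) \<in> V"
      "\<And>v w. v \<in> V \<Longrightarrow> w \<in> V \<Longrightarrow> (\<lambda>x. v x + w x) \<in> V"
      "\<And>v c. v \<in> V \<Longrightarrow> (\<lambda>x. c * v x) \<in> V"
  obtains P G where "\<And>k. P k \<in> V" "L2_tendsto M P G" "\<And>v. v \<in> V \<Longrightarrow> (\<integral>x. (F x - G x) * v x \<partial>M) = 0"
proof -
  define N where "N f = (\<integral>x. (f x)\<^sup>2 \<partial>M)" for f :: "'a \<Rightarrow> real"
  have N0: "0 \<le> N f" for f unfolding N_def by simp
  have N_L2: "N f = (L2norm M f)\<^sup>2" for f unfolding N_def L2norm_square by simp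
  have sqi: "integrable M (\<lambda>x. (f x)\<^sup>2)" if "square_integrable M f" for f :: "'a \<Rightarrow> real"
    using that by (simp add: square_integrable_def)
  define d where "d = (INF v\<in>V. N (\<lambda>x. F x - v x))"
  have bdd: "bdd_below ((\<lambda>v. N (\<lambda>x. F x - v x)) ` V)" using N0 by (intro bdd_belowI2[of _ 0]) auto
  have dle: "d \<le> N (\<lambda>x. F x - v x)" if "v \<in> V" for v
    unfolding d_def using bdd that by (rule cINF_lower)
  have "\<exists>v\<in>V. N (\<lambda>x. F x - v x) < d + 1 / (real k + 1)" for k
  proof -
    have "(INF v\<in>V. N (\<lambda>x. F x - v x)) < d + 1 / (real k + 1)" unfolding d_def by simp
    then show ?thesis using cINF_less_iff[of V "\<lambda>v. N (\<lambda>x. F x - v x)"] bdd V(2) by auto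
  qed
  then obtain P where P: "P k \<in> V" "N (\<lambda>x. F x - P k x) < d + 1 / (real k + 1)" for k by metis
  \<comment> \<open>Parallelogram identity: the midpoint lies in \<open>V\<close>, so its distance
    from \<open>F\<close> is at least the infimum, and a minimising sequence is Cauchy.\<close>
  have par: "N (\<lambda>x. P j x - P k x) \<le> 2 / (real j + 1) + 2 / (real k + 1)" for j k
  proof -
    have a: "square_integrable M (\<lambda>x. F x - P j x)" "square_integrable M (\<lambda>x. F x - P k x)"
      using F V(1) P(1) by (auto intro!: square_integrable_diff)
    have mid: "(\<lambda>x. (1/2) * (P j x + P k x)) \<in> V" by (intro V(3,4) P(1))
    then have b: "square_integrable M (\<lambda>x. F x - (1/2) * (P j x + P k x))"
      by (intro square_integrable_diff F V(1))
    have "N (\<lambda>x. P j x - P k x) = (\<integral>x. 2 * (F x - P j x)\<^sup>2 + 2 * (F x - P k x)\<^sup>2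
        - 4 * (F x - (1/2) * (P j x + P k x))\<^sup>2 \<partial>M)"
      unfolding N_def by (rule Bochner_Integration.integral_cong) (auto simp: power2_eq_square algebra_simps)
    also have "\<dots> = 2 * N (\<lambda>x. F x - P j x) + 2 * N (\<lambda>x. F x - P k x)
        - 4 * N (\<lambda>x. F x - (1/2) * (P j x + P k x))"
      unfolding N_def using sqi[OF a(1)] sqi[OF a(2)] sqi[OF b] by simp
    also have "\<dots> \<le> 2 / (real j + 1) + 2 / (real k + 1)"
      using P(2)[of j] P(2)[of k] dle[OF mid] by simp
    finally show ?thesis .
  qed
  obtain G where G: "L2_tendsto M P G"
  proof (rule L2_complete[of P])
    show "square_integrable M (P k)" for k using P V by auto
    fix e :: real assume "e > 0"
    obtain K :: nat where K: "4 / e\<^sup>2 < real K" using reals_Archimedean2 by blast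
    show "\<exists>K. \<forall>j\<ge>K. \<forall>k\<ge>K. L2norm M (\<lambda>x. P j x - P k x) < e"
    proof (intro exI allI impI)
      fix j k assume jk: "K \<le> j" "K \<le> k"
      have i: "2 / (real i + 1) < e\<^sup>2 / 2" if "K \<le> i" for i
      proof -
        have "4 / e\<^sup>2 < real i + 1" using K that by linarith
        then show ?thesis using \<open>e > 0\<close> by (simp add: field_simps)
      qed
      then have "(L2norm M (\<lambda>x. P j x - P k x))\<^sup>2 < e\<^sup>2"
        using par[of j k] i[OF jk(1)] i[OF jk(2)] unfolding N_L2 by linarith
      then show "L2norm M (\<lambda>x. P j x - P k x) < e" using \<open>e > 0\<close> by (simp add: power_less_imp_less_base)
    qed
  qed
  note PG = L2_tendstoD[OF G]
  have lim: "(\<lambda>k. L2norm M (\<lambda>x. F x - P k x - w x)) \<longlonglongrightarrow> L2norm M (\<lambda>x. F x - G x - w x)" if w: "square_integrable M w" for w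
  proof -
    have s: "square_integrable M (\<lambda>x. F x - P k x - w x)" "square_integrable M (\<lambda>x. F x - G x - w x)"
      "square_integrable M (\<lambda>x. P k x - G x)" for k
      using F PG w by (auto intro!: square_integrable_diff)
    have "\<bar>L2norm M (\<lambda>x. F x - P k x - w x) - L2norm M (\<lambda>x. F x - G x - w x)\<bar> \<le> L2norm M (\<lambda>x. P k x - G x)" for k
      using L2norm_triangle[OF s(2) square_integrable_uminus[OF s(3)], of k]
        L2norm_triangle[OF s(1,3), of k k] L2norm_minus_commute[of M "P k" G] by (simp add: L2norm_minus algebra_simps)
    then have "(\<lambda>k. L2norm M (\<lambda>x. F x - P k x - w x) - L2norm M (\<lambda>x. F x - G x - w x)) \<longlonglongrightarrow> 0"
      by (intro Lim_null_comparison[OF always_eventually PG(3)]) auto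
    then show ?thesis by (rule LIM_zero_cancel)
  qed
  have limN: "(\<lambda>k. N (\<lambda>x. F x - P k x - w x)) \<longlonglongrightarrow> N (\<lambda>x. F x - G x - w x)" if "square_integrable M w" for w
    unfolding N_L2 by (intro tendsto_power lim that)
  have NG: "N (\<lambda>x. F x - G x) \<le> d"
  proof -
    have "(\<lambda>k. d + inverse (real (Suc k))) \<longlonglongrightarrow> d" using LIMSEQ_inverse_real_of_nat_add .
    from LIMSEQ_le[OF limN[of "\<lambda>_. 0", OF square_integrable_zero] this] P(2) show ?thesis
      by (fastforce simp: inverse_eq_divide add.commute less_imp_le)
  qed
  show ?thesis
  proof (rule that[OF P(1) G])
    fix v assume v: "v \<in> V"
    have sv: "square_integrable M v" using V(1) v .
    have sFG: "square_integrable M (\<lambda>x. F x - G x)" using F PG by (auto intro: square_integrable_diff)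
    let ?I = "\<integral>x. (F x - G x) * v x \<partial>M"
    have iFG: "integrable M (\<lambda>x. (F x - G x) * v x)"
      using sFG sv by (rule integrable_mult_square_integrable)
    \<comment> \<open>First variation: moving from \<open>G\<close> by \<open>t * v\<close> cannot
      bring the distance below \<open>d\<close>. The inequality is proved for \<open>P k\<close> and
      passed to the limit, as \<open>G\<close> itself may lie outside \<open>V\<close>.\<close>
    have q: "0 \<le> t\<^sup>2 * N v - 2 * t * ?I" for t
    proof -
      have "d \<le> N (\<lambda>x. F x - P k x - t * v x)" for k
        using dle[of "\<lambda>x. P k x + t * v x"] V(3,4) P(1) v by (simp add: algebra_simps)
      then have "d \<le> N (\<lambda>x. F x - G x - t * v x)"
        by (intro LIMSEQ_le_const[OF limN[OF square_integrable_cmult[OF sv]]]) auto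
      also have "\<dots> = (\<integral>x. (F x - G x)\<^sup>2 - 2 * t * ((F x - G x) * v x) + t\<^sup>2 * (v x)\<^sup>2 \<partial>M)"
        unfolding N_def by (rule Bochner_Integration.integral_cong) (auto simp: power2_eq_square algebra_simps)
      also have "\<dots> = N (\<lambda>x. F x - G x) - 2 * t * ?I + t\<^sup>2 * N v"
        unfolding N_def using sqi[OF sFG] sqi[OF sv] iFG by simp
      finally show ?thesis using NG by linarith
    qed
    show "?I = 0"
    proof (rule ccontr)
      assume I: "?I \<noteq> 0"
      have "N v + 1 > 0" using N0[of v] by linarith
      \<comment> \<open>The minimiser would be \<open>?I / N v\<close>; the added 1 avoids the case
        \<open>N v = 0\<close> and still makes the quadratic negative.\<close>
      define s where "s = ?I / (N v + 1)"
      have Is: "?I = s * (N v + 1)" using \<open>N v + 1 > 0\<close> by (simp add: s_def)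
      have "s \<noteq> 0" using I Is by auto
      have "0 \<le> s\<^sup>2 * N v - 2 * s * ?I" by (rule q)
      also have "\<dots> = s\<^sup>2 * (N v - 2 * (N v + 1))"
        unfolding Is by (simp add: power2_eq_square algebra_simps)
      also have "\<dots> < 0"
        using \<open>s \<noteq> 0\<close> N0[of v] by (intro mult_pos_neg) auto
      finally show False by simp
    qed
  qed
qed

section \<open>Characteristic functions and independence\<close>

text \<open>The hypothesis says that E (Z | Y) = 0. Weighting \<open>M\<close> by the positive and
  by the negative part of \<open>Z\<close> gives two finite measures in place of one signed measure,
  and their images under \<open>Y\<close> agree.\<close>

lemma (in prob_space) integral_zero_distr_eq:
  fixes Z :: "'a \<Rightarrow> real"
  assumes Z: "integrable M Z" and Y[measurable]: "Y \<in> measurable M S"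
    and 0: "\<And>B. B \<in> sets S \<Longrightarrow> (\<integral>\<omega>. indicator B (Y \<omega>) * Z \<omega> \<partial>M) = 0"
  shows "distr (density M (\<lambda>x. ennreal (max 0 (Z x)))) S Y = distr (density M (\<lambda>x. ennreal (max 0 (- Z x)))) S Y"
proof (rule measure_eqI)
  have [measurable]: "Z \<in> borel_measurable M" using Z by auto
  fix B assume "B \<in> sets (distr (density M (\<lambda>x. ennreal (max 0 (Z x)))) S Y)"
  then have B[measurable]: "B \<in> sets S" by simp
  have eq: "emeasure (distr (density M (\<lambda>x. ennreal (max 0 (W x)))) S Y) B
      = ennreal (\<integral>\<omega>. indicator B (Y \<omega>) * max 0 (W \<omega>) \<partial>M)" if W: "integrable M W" for W
  proof -
    have [measurable]: "W \<in> borel_measurable M" using W by auto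
    have "emeasure (distr (density M (\<lambda>x. ennreal (max 0 (W x)))) S Y) B
      = (\<integral>\<^sup>+\<omega>. ennreal (indicator B (Y \<omega>) * max 0 (W \<omega>)) \<partial>M)"
      by (subst emeasure_distr)
         (auto simp: emeasure_density indicator_def ennreal_mult' ac_simps intro!: nn_integral_cong)
    also have "\<dots> = ennreal (\<integral>\<omega>. indicator B (Y \<omega>) * max 0 (W \<omega>) \<partial>M)"
    proof (rule nn_integral_eq_integral)
      show "integrable M (\<lambda>\<omega>. indicator B (Y \<omega>) * max 0 (W \<omega>))"
        by (rule Bochner_Integration.integrable_bound[OF W]) (auto simp: indicator_def)
    qed (auto simp: indicator_def)
    finally show ?thesis .
  qed
  have i: "integrable M (\<lambda>\<omega>. indicator B (Y \<omega>) * max 0 (W \<omega>))" if W: "integrable M W" for W :: "'a \<Rightarrow> real"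
  proof -
    have [measurable]: "W \<in> borel_measurable M" using W by auto
    show ?thesis by (rule Bochner_Integration.integrable_bound[OF W]) (auto simp: indicator_def)
  qed
  have nZ: "integrable M (\<lambda>x. - Z x)" using Z by simp
  have "0 = (\<integral>\<omega>. indicator B (Y \<omega>) * max 0 (Z \<omega>) - indicator B (Y \<omega>) * max 0 (- Z \<omega>) \<partial>M)"
    using 0[OF B] by (intro trans[OF 0[OF B, symmetric]] Bochner_Integration.integral_cong) (auto simp: max_def)
  also have "\<dots> = (\<integral>\<omega>. indicator B (Y \<omega>) * max 0 (Z \<omega>) \<partial>M) - (\<integral>\<omega>. indicator B (Y \<omega>) * max 0 (- Z \<omega>) \<partial>M)"
    by (rule Bochner_Integration.integral_diff[OF i[OF Z] i[OF nZ]])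
  finally show "emeasure (distr (density M (\<lambda>x. ennreal (max 0 (Z x)))) S Y) B =
     emeasure (distr (density M (\<lambda>x. ennreal (max 0 (- Z x)))) S Y) B"
    unfolding eq[OF Z] eq[OF nZ] by simp
qed simp

text \<open>The integral is the difference of the integrals of \<open>K\<close> against two equal
  image measures, so indicators are replaced by arbitrary, possibly unbounded \<open>K\<close> in
  one step.\<close>

lemma (in prob_space) integral_zero_fun:
  fixes Z :: "'a \<Rightarrow> real" and K :: "'b \<Rightarrow> real"
  assumes Z: "integrable M Z" and Y[measurable]: "Y \<in> measurable M S"
    and 0: "\<And>B. B \<in> sets S \<Longrightarrow> (\<integral>\<omega>. indicator B (Y \<omega>) * Z \<omega> \<partial>M) = 0"
    and K[measurable]: "K \<in> borel_measurable S"
    and int: "integrable M (\<lambda>\<omega>. K (Y \<omega>) * Z \<omega>)"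
  shows "(\<integral>\<omega>. K (Y \<omega>) * Z \<omega> \<partial>M) = 0"
proof -
  have [measurable]: "Z \<in> borel_measurable M" using Z by auto
  have e: "(\<integral>y. K y \<partial>distr (density M (\<lambda>x. ennreal (max 0 (W x)))) S Y) = (\<integral>\<omega>. max 0 (W \<omega>) * K (Y \<omega>) \<partial>M)"
    if [measurable]: "W \<in> borel_measurable M" for W
    by (subst integral_distr, simp, simp) (subst integral_density, simp_all)
  have i: "integrable M (\<lambda>\<omega>. max 0 (Z \<omega>) * K (Y \<omega>))" "integrable M (\<lambda>\<omega>. max 0 (- Z \<omega>) * K (Y \<omega>))"
    by (rule Bochner_Integration.integrable_bound[OF int];
        auto simp: abs_mult max_def intro!: AE_I2 mult_nonneg_nonpos)+
  have "(\<integral>\<omega>. K (Y \<omega>) * Z \<omega> \<partial>M) = (\<integral>\<omega>. max 0 (Z \<omega>) * K (Y \<omega>) - max 0 (- Z \<omega>) * K (Y \<omega>) \<partial>M)"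
    by (rule Bochner_Integration.integral_cong) (auto simp: max_def)
  also have "\<dots> = 0"
    using e[of Z] e[of "\<lambda>x. - Z x"] integral_zero_distr_eq[OF Z Y 0] i by simp
  finally show ?thesis .
qed

lemma (in prob_space) iexp_integrable:
  fixes Z :: "'a \<Rightarrow> complex"
  assumes "integrable M Z" "X \<in> borel_measurable M"
  shows "integrable M (\<lambda>\<omega>. Z \<omega> * iexp (X \<omega>))"
proof (rule Bochner_Integration.integrable_bound[OF assms(1)])
  show "(\<lambda>\<omega>. Z \<omega> * iexp (X \<omega>)) \<in> borel_measurable M" using assms by auto
qed (auto simp: norm_mult)

text \<open>After division by their common mass, the laws of \<open>X\<close> weighted by the
  positive and the negative part of \<open>Z\<close> are probability measures with equal
  characteristic functions, and Levy's uniqueness theorem applies.\<close>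

lemma (in prob_space) char_zero_imp_zero_real:
  fixes Z :: "'a \<Rightarrow> real"
  assumes Z: "integrable M Z" and X[measurable]: "X \<in> borel_measurable M"
    and 0: "\<And>t. (\<integral>\<omega>. complex_of_real (Z \<omega>) * iexp (t * X \<omega>) \<partial>M) = 0"
    and B: "B \<in> sets borel"
  shows "(\<integral>\<omega>. indicator B (X \<omega>) * Z \<omega> \<partial>M) = 0"
proof -
  have [measurable]: "Z \<in> borel_measurable M" "B \<in> sets borel" using Z B by auto
  define P where "P \<omega> = max 0 (Z \<omega>)" for \<omega>
  define Q where "Q \<omega> = max 0 (- Z \<omega>)" for \<omega>
  have [measurable]: "P \<in> borel_measurable M" "Q \<in> borel_measurable M" unfolding P_def Q_def by auto
  have PQ: "integrable M P" "integrable M Q" "\<And>\<omega>. 0 \<le> P \<omega>" "\<And>\<omega>. 0 \<le> Q \<omega>" "\<And>\<omega>. Z \<omega> = P \<omega> - Q \<omega>"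
    using Z unfolding P_def Q_def by auto
  have eqt: "(\<integral>\<omega>. complex_of_real (P \<omega>) * iexp (t * X \<omega>) \<partial>M) = (\<integral>\<omega>. complex_of_real (Q \<omega>) * iexp (t * X \<omega>) \<partial>M)" for t
  proof -
    have "0 = (\<integral>\<omega>. complex_of_real (P \<omega>) * iexp (t * X \<omega>) - complex_of_real (Q \<omega>) * iexp (t * X \<omega>) \<partial>M)"
      using 0[of t] PQ(5) by (simp add: algebra_simps)
    also have "\<dots> = (\<integral>\<omega>. complex_of_real (P \<omega>) * iexp (t * X \<omega>) \<partial>M) - (\<integral>\<omega>. complex_of_real (Q \<omega>) * iexp (t * X \<omega>) \<partial>M)"
      by (rule Bochner_Integration.integral_diff; rule iexp_integrable) (use PQ in auto)
    finally show ?thesis by simp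
  qed
  define m where "m = (\<integral>\<omega>. P \<omega> \<partial>M)"
  have mQ: "m = (\<integral>\<omega>. Q \<omega> \<partial>M)"
  proof -
    have "complex_of_real m = complex_of_real (\<integral>\<omega>. Q \<omega> \<partial>M)"
      using eqt[of 0] unfolding m_def integral_complex_of_real[symmetric] by simp
    then show ?thesis by (simp only: of_real_eq_iff)
  qed
  show ?thesis
  \<comment> \<open>Mass zero cannot be normalised, but then \<open>Z\<close> vanishes almost
    surely.\<close>
  proof (cases "m = 0")
    case True
    then have "AE \<omega> in M. P \<omega> = 0" "AE \<omega> in M. Q \<omega> = 0"
      using integral_nonneg_eq_0_iff_AE[OF PQ(1)] integral_nonneg_eq_0_iff_AE[OF PQ(2)] PQ(3,4) mQ
      by (simp_all add: m_def)
    then have "AE \<omega> in M. indicator B (X \<omega>) * Z \<omega> = 0" by eventually_elim (simp add: PQ)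
    then show ?thesis by (simp add: integral_eq_zero_AE)
  next
    case False
    have "m \<ge> 0" unfolding m_def using PQ(3) by simp
    with False have m: "m > 0" by simp
    define D where "D W = distr (density M (\<lambda>\<omega>. ennreal (W \<omega> / m))) borel X" for W :: "'a \<Rightarrow> real"
    have D: "real_distribution (D W)" "char (D W) t = (\<integral>\<omega>. complex_of_real (W \<omega>) * iexp (t * X \<omega>) \<partial>M) / m"
        "measure (D W) B = (\<integral>\<omega>. indicator B (X \<omega>) * W \<omega> \<partial>M) / m"
      if W: "integrable M W" "\<And>\<omega>. 0 \<le> W \<omega>" "m = (\<integral>\<omega>. W \<omega> \<partial>M)" for W t
    proof -
      have [measurable]: "W \<in> borel_measurable M" using W by auto
      have "(\<integral>\<^sup>+\<omega>. ennreal (W \<omega> / m) \<partial>M) = ennreal (\<integral>\<omega>. W \<omega> / m \<partial>M)"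
        using W m by (intro nn_integral_eq_integral) auto
      also have "(\<integral>\<omega>. W \<omega> / m \<partial>M) = 1" using W(3) m by simp
      finally have pd: "prob_space (density M (\<lambda>\<omega>. ennreal (W \<omega> / m)))"
        by (intro prob_spaceI) (simp add: emeasure_density cong: nn_integral_cong)
      then have pD: "prob_space (D W)" unfolding D_def by (rule prob_space.prob_space_distr) simp
      then show "real_distribution (D W)"
        unfolding real_distribution_def real_distribution_axioms_def by (simp add: D_def)
      have "char (D W) t = (\<integral>\<omega>. (W \<omega> / m) *\<^sub>R iexp (t * X \<omega>) \<partial>M)"
        unfolding char_def D_def using W m by (subst integral_distr) (auto simp: integral_density)
      also have "\<dots> = (\<integral>\<omega>. complex_of_real (W \<omega>) * iexp (t * X \<omega>) / m \<partial>M)"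
        by (simp add: scaleR_conv_of_real)
      finally show "char (D W) t = (\<integral>\<omega>. complex_of_real (W \<omega>) * iexp (t * X \<omega>) \<partial>M) / m"
        by simp
      have "measure (D W) B = (\<integral>x. indicator B x \<partial>D W)" by (simp add: D_def)
      also have "\<dots> = (\<integral>\<omega>. (W \<omega> / m) *\<^sub>R indicator B (X \<omega>) \<partial>M)"
        unfolding D_def using W m by (subst integral_distr) (auto simp: integral_density)
      also have "\<dots> = (\<integral>\<omega>. indicator B (X \<omega>) * W \<omega> / m \<partial>M)" by (simp add: ac_simps)
      finally show "measure (D W) B = (\<integral>\<omega>. indicator B (X \<omega>) * W \<omega> \<partial>M) / m" by simp
    qed
    note DP = D[OF PQ(1,3) m_def] and DQ = D[OF PQ(2,4) mQ]
    have "D P = D Q"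
      by (rule Levy_uniqueness[OF DP(1) DQ(1)]) (rule ext, simp only: DP(2) DQ(2) eqt)
    then have e: "(\<integral>\<omega>. indicator B (X \<omega>) * P \<omega> \<partial>M) = (\<integral>\<omega>. indicator B (X \<omega>) * Q \<omega> \<partial>M)"
      using DP(3) DQ(3) m by simp
    have i: "integrable M (\<lambda>\<omega>. indicator B (X \<omega>) * P \<omega>)" "integrable M (\<lambda>\<omega>. indicator B (X \<omega>) * Q \<omega>)"
      by (rule Bochner_Integration.integrable_bound[OF PQ(1)]
               Bochner_Integration.integrable_bound[OF PQ(2)]; auto simp: indicator_def PQ)+
    have "(\<integral>\<omega>. indicator B (X \<omega>) * Z \<omega> \<partial>M) = (\<integral>\<omega>. indicator B (X \<omega>) * P \<omega> - indicator B (X \<omega>) * Q \<omega> \<partial>M)"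
      by (simp add: PQ(5) algebra_simps)
    also have "\<dots> = 0" using e i by simp
    finally show ?thesis .
  qed
qed

text \<open>Complex weights occur because the induction over coordinates below puts exponentials
  into the weight. The conjugate of the hypothesis at -t separates real and imaginary parts.\<close>

lemma (in prob_space) char_zero_imp_zero:
  fixes Z :: "'a \<Rightarrow> complex"
  assumes Z: "integrable M Z" and X[measurable]: "X \<in> borel_measurable M"
    and 0: "\<And>t. (\<integral>\<omega>. Z \<omega> * iexp (t * X \<omega>) \<partial>M) = 0"
    and B: "B \<in> sets borel"
  shows "(\<integral>\<omega>. indicator B (X \<omega>) *\<^sub>R Z \<omega> \<partial>M) = 0"
proof -
  have [measurable]: "Z \<in> borel_measurable M" "B \<in> sets borel" using Z B by auto
  have c0: "(\<integral>\<omega>. cnj (Z \<omega>) * iexp (t * X \<omega>) \<partial>M) = 0" for t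
  proof -
    have "(\<integral>\<omega>. cnj (Z \<omega>) * iexp (t * X \<omega>) \<partial>M) = (\<integral>\<omega>. cnj (Z \<omega> * iexp (- t * X \<omega>)) \<partial>M)"
      by (simp add: exp_cnj)
    also have "\<dots> = cnj (\<integral>\<omega>. Z \<omega> * iexp (- t * X \<omega>) \<partial>M)" by (rule Bochner_Integration.integral_cnj)
    finally show ?thesis using 0[of "-t"] by simp
  qed
  have iZ: "integrable M (\<lambda>\<omega>. Z \<omega> * iexp (t * X \<omega>))" "integrable M (\<lambda>\<omega>. cnj (Z \<omega>) * iexp (t * X \<omega>))" for t
    by (rule iexp_integrable; use Z in auto)+
  have re: "(\<integral>\<omega>. complex_of_real (Re (Z \<omega>)) * iexp (t * X \<omega>) \<partial>M) = 0" for t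
  proof -
    have "(\<integral>\<omega>. complex_of_real (Re (Z \<omega>)) * iexp (t * X \<omega>) \<partial>M)
        = (\<integral>\<omega>. (Z \<omega> * iexp (t * X \<omega>) + cnj (Z \<omega>) * iexp (t * X \<omega>)) / 2 \<partial>M)"
    proof (rule Bochner_Integration.integral_cong)
      have "complex_of_real (Re z) = (z + cnj z) / 2" for z by (simp add: complex_eq_iff)
      then show "complex_of_real (Re (Z \<omega>)) * iexp (t * X \<omega>)
          = (Z \<omega> * iexp (t * X \<omega>) + cnj (Z \<omega>) * iexp (t * X \<omega>)) / 2" for \<omega>
        by (simp only: distrib_right[symmetric] times_divide_eq_left)
    qed simp
    also have "\<dots> = 0" using 0[of t] c0[of t] iZ[of t] by simp
    finally show ?thesis .
  qed
  have im: "(\<integral>\<omega>. complex_of_real (Im (Z \<omega>)) * iexp (t * X \<omega>) \<partial>M) = 0" for t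
  proof -
    have "(\<integral>\<omega>. complex_of_real (Im (Z \<omega>)) * iexp (t * X \<omega>) \<partial>M)
        = (\<integral>\<omega>. (Z \<omega> * iexp (t * X \<omega>) - cnj (Z \<omega>) * iexp (t * X \<omega>)) * (- \<i> / 2) \<partial>M)"
    proof (rule Bochner_Integration.integral_cong)
      have "complex_of_real (Im z) = (z - cnj z) * (- \<i> / 2)" for z by (simp add: complex_eq_iff)
      then show "complex_of_real (Im (Z \<omega>)) * iexp (t * X \<omega>)
          = (Z \<omega> * iexp (t * X \<omega>) - cnj (Z \<omega>) * iexp (t * X \<omega>)) * (- \<i> / 2)" for \<omega>
        by (simp only: left_diff_distrib[symmetric] mult_ac)
    qed simp
    also have "\<dots> = 0" using 0[of t] c0[of t] iZ[of t] by simp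
    finally show ?thesis .
  qed
  have i: "integrable M (\<lambda>\<omega>. indicator B (X \<omega>) *\<^sub>R Z \<omega>)"
    by (rule Bochner_Integration.integrable_bound[OF Z]) (auto simp: indicator_def)
  have "Re (\<integral>\<omega>. indicator B (X \<omega>) *\<^sub>R Z \<omega> \<partial>M) = (\<integral>\<omega>. indicator B (X \<omega>) * Re (Z \<omega>) \<partial>M)"
    using integral_Re[OF i] by simp
  also have "\<dots> = 0" by (rule char_zero_imp_zero_real[OF _ X re B]) (use Z in auto)
  finally have 1: "Re (\<integral>\<omega>. indicator B (X \<omega>) *\<^sub>R Z \<omega> \<partial>M) = 0" .
  have "Im (\<integral>\<omega>. indicator B (X \<omega>) *\<^sub>R Z \<omega> \<partial>M) = (\<integral>\<omega>. indicator B (X \<omega>) * Im (Z \<omega>) \<partial>M)"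
    using integral_Im[OF i] by simp
  also have "\<dots> = 0" by (rule char_zero_imp_zero_real[OF _ X im B]) (use Z in auto)
  finally show ?thesis using 1 by (simp add: complex_eq_iff)
qed

text \<open>Uniqueness of characteristic functions for a field with arbitrarily many coordinates.
  Linearity merges the exponentials of \<open>Y h\<close> and \<open>t * Y j\<close> into one, so
  the one-dimensional result can impose conditions on one coordinate after another; a Dynkin
  argument leads from cylinders to the product sigma-algebra.\<close>

lemma (in prob_space) linear_family_char_zero:
  fixes Z :: "'a \<Rightarrow> complex" and Y :: "'h::real_vector \<Rightarrow> 'a \<Rightarrow> real"
  assumes Z: "integrable M Z" and Y[measurable]: "\<And>h. Y h \<in> borel_measurable M"
    and lin: "\<And>h k t. AE \<omega> in M. Y (h + t *\<^sub>R k) \<omega> = Y h \<omega> + t * Y k \<omega>"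
    and 0: "\<And>h. (\<integral>\<omega>. Z \<omega> * iexp (Y h \<omega>) \<partial>M) = 0"
    and B: "B \<in> sets (PiM UNIV (\<lambda>_::'h. borel))"
  shows "(\<integral>\<omega>. indicator B (\<lambda>h. Y h \<omega>) *\<^sub>R Z \<omega> \<partial>M) = 0"
proof -
  have [measurable]: "Z \<in> borel_measurable M" using Z by auto
  let ?S = "PiM UNIV (\<lambda>_::'h. borel :: real measure)"
  have Ym[measurable]: "(\<lambda>\<omega> h. Y h \<omega>) \<in> measurable M ?S"
    by (rule measurable_PiM_single') auto
  \<comment> \<open>The free exponential in \<open>h\<close> is the strengthening that carries the
    induction: a new coordinate merely changes \<open>h\<close> into
    \<open>h + t *\<^sub>R j\<close>.\<close>
  have fin: "(\<integral>\<omega>. ((\<Prod>j\<in>J. indicator (A j) (Y j \<omega>)) *\<^sub>R Z \<omega>) * iexp (Y h \<omega>) \<partial>M) = 0"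
    if "finite J" and A: "\<And>j. A j \<in> sets borel" for J A h
    using that(1)
  proof (induction J arbitrary: h)
    case empty
    then show ?case using 0 by simp
  next
    case (insert j J)
    note A[measurable]
    let ?P = "\<lambda>\<omega>. (\<Prod>j\<in>J. indicator (A j) (Y j \<omega>)) :: real"
    have P: "\<bar>?P \<omega>\<bar> \<le> 1" for \<omega>
      unfolding abs_prod by (rule prod_le_1) (auto simp: indicator_def)
    let ?Z = "\<lambda>\<omega>. (?P \<omega> *\<^sub>R Z \<omega>) * iexp (Y h \<omega>)"
    have iPZ: "integrable M (\<lambda>\<omega>. ?P \<omega> *\<^sub>R Z \<omega>)"
      by (rule Bochner_Integration.integrable_bound[OF Z])
         (use P in \<open>auto intro!: mult_left_le_one_le\<close>)
    have iZ: "integrable M ?Z" by (rule iexp_integrable[OF iPZ]) simp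
    have "(\<integral>\<omega>. ?Z \<omega> * iexp (t * Y j \<omega>) \<partial>M) = 0" for t
    proof -
      have "(\<integral>\<omega>. ?Z \<omega> * iexp (t * Y j \<omega>) \<partial>M) = (\<integral>\<omega>. (?P \<omega> *\<^sub>R Z \<omega>) * iexp (Y (h + t *\<^sub>R j) \<omega>) \<partial>M)"
      proof (rule integral_cong_AE)
        show "AE \<omega> in M. ?Z \<omega> * iexp (t * Y j \<omega>) = (?P \<omega> *\<^sub>R Z \<omega>) * iexp (Y (h + t *\<^sub>R j) \<omega>)"
          using lin[of h t j] by eventually_elim (simp add: exp_add algebra_simps)
      qed measurable
      then show ?thesis using insert.IH by simp
    qed
    from char_zero_imp_zero[OF iZ Y this A[of j]]
    have "(\<integral>\<omega>. indicator (A j) (Y j \<omega>) *\<^sub>R ?Z \<omega> \<partial>M) = 0" .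
    then show ?case using insert(1,2) by (simp add: scaleR_conv_of_real mult.assoc)
  qed
  \<comment> \<open>Linearity is known only almost surely, so the value at 0 is too; it removes the
    exponential left over from \<open>fin\<close>.\<close>
  have Y0: "AE \<omega> in M. Y 0 \<omega> = 0" using lin[of 0 1 0] by simp
  have fin0: "(\<integral>\<omega>. (\<Prod>j\<in>J. indicator (A j) (Y j \<omega>)) *\<^sub>R Z \<omega> \<partial>M) = 0"
    if J: "finite J" and A: "\<And>j. A j \<in> sets borel" for J and A :: "'h \<Rightarrow> real set"
  proof -
    note A[measurable]
    have "(\<integral>\<omega>. (\<Prod>j\<in>J. indicator (A j) (Y j \<omega>)) *\<^sub>R Z \<omega> \<partial>M)
      = (\<integral>\<omega>. ((\<Prod>j\<in>J. indicator (A j) (Y j \<omega>)) *\<^sub>R Z \<omega>) * iexp (Y 0 \<omega>) \<partial>M)"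
    proof (rule integral_cong_AE)
      show "AE \<omega> in M. (\<Prod>j\<in>J. indicator (A j) (Y j \<omega>)) *\<^sub>R Z \<omega>
         = ((\<Prod>j\<in>J. indicator (A j) (Y j \<omega>)) *\<^sub>R Z \<omega>) * iexp (Y 0 \<omega>)"
        using Y0 by eventually_elim simp
    qed measurable
    then show ?thesis using fin[OF J A] by simp
  qed
  have total: "(\<integral>\<omega>. Z \<omega> \<partial>M) = 0" using fin0[of "{}" "\<lambda>_. {}"] by simp
  have ii: "integrable M (\<lambda>\<omega>. indicator D (\<lambda>h. Y h \<omega>) *\<^sub>R Z \<omega>)" if [measurable]: "D \<in> sets ?S" for D
    by (rule Bochner_Integration.integrable_bound[OF Z]) (auto simp: indicator_def)
  have S: "sets ?S = sigma_sets (\<Pi>\<^sub>E i\<in>UNIV. space borel) (prod_algebra UNIV (\<lambda>_::'h. borel))"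
    by (rule sets_PiM)
  have B': "B \<in> sigma_sets (\<Pi>\<^sub>E i\<in>UNIV. space borel) (prod_algebra UNIV (\<lambda>_::'h. borel))"
    using B unfolding S .
  show ?thesis
  proof (rule sigma_sets_induct_disjoint[OF Int_stable_prod_algebra prod_algebra_sets_into_space B'])
    fix D assume "D \<in> prod_algebra UNIV (\<lambda>_::'h. borel :: real measure)"
    then obtain J E where D: "D = prod_emb UNIV (\<lambda>_. borel) J (Pi\<^sub>E J E)" "finite J"
      "\<And>j. j \<in> J \<Longrightarrow> E j \<in> sets borel"
      by (elim prod_algebraE) auto
    define A where "A j = (if j \<in> J then E j else {})" for j
    have "indicator D (\<lambda>h. Y h \<omega>) = (\<Prod>j\<in>J. indicator (A j) (Y j \<omega>) :: real)" for \<omega>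
    proof -
      have "(\<lambda>h. Y h \<omega>) \<in> D \<longleftrightarrow> (\<forall>j\<in>J. Y j \<omega> \<in> A j)"
        unfolding D A_def by (auto simp: prod_emb_def PiE_def Pi_def)
      then show ?thesis using \<open>finite J\<close> by (auto simp: indicator_def prod_zero_iff)
    qed
    then show "(\<integral>\<omega>. indicator D (\<lambda>h. Y h \<omega>) *\<^sub>R Z \<omega> \<partial>M) = 0"
      using fin0[OF D(2), of A] D(3) by (simp add: A_def)
  next
    show "(\<integral>\<omega>. indicator {} (\<lambda>h. Y h \<omega>) *\<^sub>R Z \<omega> \<partial>M) = 0" by simp
  next
    fix D assume D: "D \<in> sigma_sets (\<Pi>\<^sub>E i\<in>UNIV. space borel) (prod_algebra UNIV (\<lambda>_::'h. borel :: real measure))"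
      and eq: "(\<integral>\<omega>. indicator D (\<lambda>h. Y h \<omega>) *\<^sub>R Z \<omega> \<partial>M) = 0"
    have "(\<integral>\<omega>. indicator ((\<Pi>\<^sub>E i\<in>UNIV. space borel) - D) (\<lambda>h. Y h \<omega>) *\<^sub>R Z \<omega> \<partial>M)
      = (\<integral>\<omega>. Z \<omega> - indicator D (\<lambda>h. Y h \<omega>) *\<^sub>R Z \<omega> \<partial>M)"
      by (rule Bochner_Integration.integral_cong) (auto simp: indicator_def)
    also have "\<dots> = 0" using total eq ii[of D] D Z unfolding S by simp
    finally show "(\<integral>\<omega>. indicator ((\<Pi>\<^sub>E i\<in>UNIV. space borel) - D) (\<lambda>h. Y h \<omega>) *\<^sub>R Z \<omega> \<partial>M) = 0" .
  next
    fix D :: "nat \<Rightarrow> ('h \<Rightarrow> real) set"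
    assume disj: "disjoint_family D"
      and D: "range D \<subseteq> sigma_sets (\<Pi>\<^sub>E i\<in>UNIV. space borel) (prod_algebra UNIV (\<lambda>_::'h. borel :: real measure))"
      and eq: "\<And>i. (\<integral>\<omega>. indicator (D i) (\<lambda>h. Y h \<omega>) *\<^sub>R Z \<omega> \<partial>M) = 0"
    have Dm[measurable]: "D i \<in> sets ?S" for i using D unfolding S by auto
    let ?V = "\<lambda>i. (\<lambda>\<omega> h. Y h \<omega>) -` D i \<inter> space M"
    have e: "(\<integral>\<omega>. indicator E (\<lambda>h. Y h \<omega>) *\<^sub>R Z \<omega> \<partial>M)
       = (LINT \<omega>:(\<lambda>\<omega> h. Y h \<omega>) -` E \<inter> space M|M. Z \<omega>)" for E
      unfolding set_lebesgue_integral_def by (rule Bochner_Integration.integral_cong) (auto simp: indicator_def)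
    have "(LINT \<omega>:(\<Union>i. ?V i)|M. Z \<omega>) = (\<Sum>i. LINT \<omega>:?V i|M. Z \<omega>)"
    proof (rule lebesgue_integral_countable_add)
      show "?V i \<in> sets M" for i by measurable
      show "?V i \<inter> ?V j = {}" if "i \<noteq> j" for i j using disj that by (auto simp: disjoint_family_on_def)
      show "set_integrable M (\<Union>i. ?V i) Z" unfolding set_integrable_def
        by (rule integrable_mult_indicator[OF _ Z]) measurable
    qed
    also have "\<dots> = 0" using eq unfolding e by simp
    finally have sum0: "(LINT \<omega>:(\<Union>i. ?V i)|M. Z \<omega>) = 0" .
    have "(\<lambda>\<omega> h. Y h \<omega>) -` \<Union>(range D) \<inter> space M = (\<Union>i. ?V i)" by auto
    with sum0 show "(\<integral>\<omega>. indicator (\<Union>(range D)) (\<lambda>h. Y h \<omega>) *\<^sub>R Z \<omega> \<partial>M) = 0"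
      unfolding e by simp

  qed
qed

section \<open>Random variables with moments of all orders\<close>

definition has_moments :: "'a measure \<Rightarrow> ('a \<Rightarrow> real) \<Rightarrow> bool" where
  "has_moments M Y \<longleftrightarrow> Y \<in> borel_measurable M \<and> (\<forall>k::nat. integrable M (\<lambda>\<omega>. \<bar>Y \<omega>\<bar> ^ k))"

lemma has_moments_measurable[dest]: "has_moments M Y \<Longrightarrow> Y \<in> borel_measurable M"
  by (simp add: has_moments_def)

lemma has_moments_mono:
  assumes "has_moments M Y" "Z \<in> borel_measurable M" "\<And>\<omega>. \<bar>Z \<omega>\<bar> \<le> \<bar>Y \<omega>\<bar>"
  shows "has_moments M Z"
  unfolding has_moments_def
proof (intro conjI allI)
  fix k
  show "integrable M (\<lambda>\<omega>. \<bar>Z \<omega>\<bar> ^ k)"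
    by (rule Bochner_Integration.integrable_bound[of _ "\<lambda>\<omega>. \<bar>Y \<omega>\<bar> ^ k"])
       (use assms in \<open>auto simp: has_moments_def intro!: power_mono\<close>)
qed fact

text \<open>Cauchy-Schwarz with moments of order 2k. Unlike square integrability, this property is
  stable under products, which settles the integrability obligations for polynomials in Gaussian
  variables.\<close>

lemma has_moments_mult:
  assumes "has_moments M Y" "has_moments M Z"
  shows "has_moments M (\<lambda>\<omega>. Y \<omega> * Z \<omega>)"
  unfolding has_moments_def
proof (intro conjI allI)
  have [measurable]: "Y \<in> borel_measurable M" "Z \<in> borel_measurable M" using assms by auto
  show "(\<lambda>\<omega>. Y \<omega> * Z \<omega>) \<in> borel_measurable M" by measurable
  fix k
  have "square_integrable M (\<lambda>\<omega>. \<bar>W \<omega>\<bar> ^ k)" if "has_moments M W" for W :: "'a \<Rightarrow> real"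
  proof -
    have "integrable M (\<lambda>\<omega>. \<bar>W \<omega>\<bar> ^ (k * 2))" "W \<in> borel_measurable M"
      using that unfolding has_moments_def by blast+
    then show ?thesis by (simp add: square_integrable_def power_mult)
  qed
  from integrable_mult_square_integrable[OF this this, OF assms]
  show "integrable M (\<lambda>\<omega>. \<bar>Y \<omega> * Z \<omega>\<bar> ^ k)" by (simp add: abs_mult power_mult_distrib)
qed

lemma has_moments_add:
  assumes "has_moments M Y" "has_moments M Z"
  shows "has_moments M (\<lambda>\<omega>. Y \<omega> + Z \<omega>)"
  unfolding has_moments_def
proof (intro conjI allI)
  have [measurable]: "Y \<in> borel_measurable M" "Z \<in> borel_measurable M" using assms by auto
  show "(\<lambda>\<omega>. Y \<omega> + Z \<omega>) \<in> borel_measurable M" by measurable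
  fix k
  show "integrable M (\<lambda>\<omega>. \<bar>Y \<omega> + Z \<omega>\<bar> ^ k)"
  proof (rule Bochner_Integration.integrable_bound)
    show "integrable M (\<lambda>\<omega>. 2 ^ k * (\<bar>Y \<omega>\<bar> ^ k + \<bar>Z \<omega>\<bar> ^ k))"
      using assms by (auto simp: has_moments_def)
    have "\<bar>Y \<omega> + Z \<omega>\<bar> ^ k \<le> 2 ^ k * (\<bar>Y \<omega>\<bar> ^ k + \<bar>Z \<omega>\<bar> ^ k)" for \<omega>
    proof -
      have "\<bar>Y \<omega> + Z \<omega>\<bar> ^ k \<le> (2 * max \<bar>Y \<omega>\<bar> \<bar>Z \<omega>\<bar>) ^ k" by (rule power_mono) auto
      also have "\<dots> \<le> 2 ^ k * (\<bar>Y \<omega>\<bar> ^ k + \<bar>Z \<omega>\<bar> ^ k)"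
        unfolding power_mult_distrib by (rule mult_left_mono) (auto simp: max_def)
      finally show ?thesis .
    qed
    then show "AE \<omega> in M. norm (\<bar>Y \<omega> + Z \<omega>\<bar> ^ k) \<le> norm (2 ^ k * (\<bar>Y \<omega>\<bar> ^ k + \<bar>Z \<omega>\<bar> ^ k))"
      by (auto simp: abs_mult)
  qed measurable
qed

lemma has_moments_square_integrable:
  assumes "has_moments M Y" shows "square_integrable M Y"
proof -
  have "integrable M (\<lambda>\<omega>. \<bar>Y \<omega>\<bar> ^ 2)" using assms unfolding has_moments_def by blast
  then show ?thesis using assms by (simp add: square_integrable_def has_moments_def)
qed

lemma has_moments_integrable:
  assumes "has_moments M Y" shows "integrable M Y"
proof -
  have "integrable M (\<lambda>\<omega>. \<bar>Y \<omega>\<bar> ^ 1)" using assms unfolding has_moments_def by blast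
  then show ?thesis using assms by (auto simp: integrable_abs_iff)
qed

lemma (in prob_space) has_moments_bounded:
  assumes "Y \<in> borel_measurable M" "\<And>\<omega>. \<bar>Y \<omega>\<bar> \<le> B"
  shows "has_moments M Y"
  unfolding has_moments_def
proof (intro conjI allI)
  fix k show "integrable M (\<lambda>\<omega>. \<bar>Y \<omega>\<bar> ^ k)"
    by (rule integrable_const_bound[of _ "B ^ k"]) (use assms in \<open>auto intro!: power_mono\<close>)
qed fact

lemma (in prob_space) has_moments_const: "has_moments M (\<lambda>_. c)"
  by (rule has_moments_bounded[of _ "\<bar>c\<bar>"]) auto

lemma has_moments_norm: "has_moments M Y \<Longrightarrow> has_moments M (\<lambda>\<omega>. \<bar>Y \<omega>\<bar>)"
  unfolding has_moments_def by auto

lemma (in prob_space) has_moments_sum: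
  "(\<And>i. i \<in> I \<Longrightarrow> has_moments M (Y i)) \<Longrightarrow> has_moments M (\<lambda>\<omega>. \<Sum>i\<in>I. Y i \<omega>)"
  by (induction I rule: infinite_finite_induct) (auto simp: has_moments_const has_moments_add)

section \<open>Gaussian variables\<close>

lemma normal_distribution_scale:
  assumes "\<sigma> > 0"
  shows "density lborel (normal_density 0 \<sigma>) = distr std_normal_distribution borel (\<lambda>x. \<sigma> * x)"
proof -
  interpret N: real_distribution std_normal_distribution by (rule real_dist_normal_dist)
  have "distributed std_normal_distribution lborel (\<lambda>x. x) std_normal_density"
    unfolding distributed_def by (auto simp: distr_id2 sets_eq_imp_space_eq)
  moreover have "(\<lambda>x. x) = (\<lambda>x. (\<sigma> * x - 0) / \<sigma>)" using assms by auto
  ultimately have "distributed std_normal_distribution lborel (\<lambda>x. \<sigma> * x) (normal_density 0 \<sigma>)"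
    using N.normal_standard_normal_convert[OF assms, of "\<lambda>x. \<sigma> * x" 0] by simp
  then have "distr std_normal_distribution lborel (\<lambda>x. \<sigma> * x) = density lborel (normal_density 0 \<sigma>)"
    by (rule distributed_distr_eq_density)
  moreover have "distr std_normal_distribution lborel (\<lambda>x. \<sigma> * x) = distr std_normal_distribution borel (\<lambda>x. \<sigma> * x)"
    by (rule distr_cong) auto
  ultimately show ?thesis by simp
qed

text \<open>Writing the law as an image of the standard normal under a scaling turns the degenerate
  case into the scaling by 0, so the computations that follow need no case distinction.\<close>

lemma (in prob_space) centered_gaussian_distr:
  assumes "centered_gaussian M Y"
  shows "distr M borel Y = distr std_normal_distribution borel (\<lambda>x. sqrt (\<integral>\<omega>. (Y \<omega>)\<^sup>2 \<partial>M) * x)"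
proof -
  interpret N: real_distribution std_normal_distribution by (rule real_dist_normal_dist)
  have Y[measurable]: "Y \<in> borel_measurable M" using assms by (simp add: centered_gaussian_def)
  obtain \<sigma> where \<sigma>: "\<sigma> \<ge> 0" "distr M borel Y = distr std_normal_distribution borel (\<lambda>x. \<sigma> * x)"
  proof (cases "distr M borel Y = return borel 0")
    case True
    moreover have "distr std_normal_distribution borel (\<lambda>x. 0 * x) = return borel (0::real)"
      using N.distr_const[of 0 borel] by simp
    ultimately show ?thesis using that[of 0] by simp
  next
    case False
    then show ?thesis using assms that normal_distribution_scale
      unfolding centered_gaussian_def by (metis less_imp_le)
  qed
  have "(\<integral>\<omega>. (Y \<omega>)\<^sup>2 \<partial>M) = (\<integral>x. x\<^sup>2 \<partial>distr M borel Y)" by (subst integral_distr) auto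
  also have "\<dots> = (\<integral>x. (\<sigma> * x)\<^sup>2 \<partial>std_normal_distribution)" unfolding \<sigma>(2) by (subst integral_distr) auto
  also have "\<dots> = \<sigma>\<^sup>2 * (\<integral>x. x^(2 * 1) \<partial>std_normal_distribution)" by (simp add: power_mult_distrib)
  also have "\<dots> = \<sigma>\<^sup>2" unfolding std_normal_distribution_even_moments by simp
  finally show ?thesis using \<sigma> by simp
qed

text \<open>Completing the square turns the integrand into a multiple of the normal density with
  mean \<open>t\<close>.\<close>

lemma integrable_std_normal_exp: "integrable std_normal_distribution (\<lambda>x. exp (t * x))"
proof -
  have "std_normal_density x * exp (t * x) = exp (t\<^sup>2 / 2) * normal_density t 1 x" for x
  proof -
    have "- x\<^sup>2 / 2 + t * x = t\<^sup>2 / 2 + - (x - t)\<^sup>2 / 2" by (simp add: power2_eq_square field_simps)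
    then show ?thesis by (simp add: normal_density_def exp_add[symmetric])
  qed
  then show ?thesis by (subst integrable_density) (auto simp: normal_density_nonneg)
qed

lemma (in prob_space) centered_gaussian_iexp:
  assumes "centered_gaussian M Y"
  shows "(\<integral>\<omega>. iexp (t * Y \<omega>) \<partial>M) = complex_of_real (exp (- t\<^sup>2 * (\<integral>\<omega>. (Y \<omega>)\<^sup>2 \<partial>M) / 2))"
proof -
  have Y[measurable]: "Y \<in> borel_measurable M" using assms by (simp add: centered_gaussian_def)
  let ?s = "sqrt (\<integral>\<omega>. (Y \<omega>)\<^sup>2 \<partial>M)"
  have "(\<integral>\<omega>. iexp (t * Y \<omega>) \<partial>M) = (\<integral>x. iexp (t * x) \<partial>distr M borel Y)" by (subst integral_distr) auto
  also have "\<dots> = (\<integral>x. iexp ((t * ?s) * x) \<partial>std_normal_distribution)"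
    unfolding centered_gaussian_distr[OF assms] by (subst integral_distr) (auto simp: mult.assoc)
  also have "\<dots> = char std_normal_distribution (t * ?s)" by (simp add: char_def)
  also have "\<dots> = complex_of_real (exp (- t\<^sup>2 * (\<integral>\<omega>. (Y \<omega>)\<^sup>2 \<partial>M) / 2))"
    unfolding char_std_normal_distribution by (simp add: power_mult_distrib)
  finally show ?thesis .
qed

lemma (in prob_space) centered_gaussian_moments:
  assumes "centered_gaussian M Y"
  shows "has_moments M Y" "integrable M (\<lambda>\<omega>. exp (t * Y \<omega>))"
proof -
  have Y[measurable]: "Y \<in> borel_measurable M" using assms by (simp add: centered_gaussian_def)
  let ?s = "sqrt (\<integral>\<omega>. (Y \<omega>)\<^sup>2 \<partial>M)"
  have i: "integrable M (\<lambda>\<omega>. f (Y \<omega>)) \<longleftrightarrow> integrable std_normal_distribution (\<lambda>x. f (?s * x))"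
    if [measurable]: "f \<in> borel_measurable borel" for f :: "real \<Rightarrow> real"
  proof -
    have "integrable M (\<lambda>\<omega>. f (Y \<omega>)) \<longleftrightarrow> integrable (distr M borel Y) f"
      by (subst integrable_distr_eq) auto
    also have "\<dots> \<longleftrightarrow> integrable std_normal_distribution (\<lambda>x. f (?s * x))"
      unfolding centered_gaussian_distr[OF assms] by (subst integrable_distr_eq) auto
    finally show ?thesis .
  qed
  have "integrable std_normal_distribution (\<lambda>x. \<bar>x ^ k\<bar>)" for k
    using integrable_std_normal_distribution_moment by (rule integrable_abs)
  then show "has_moments M Y"
    unfolding has_moments_def using i[of "\<lambda>y. \<bar>y\<bar> ^ k" for k] by (auto simp: abs_mult power_mult_distrib power_abs)
  show "integrable M (\<lambda>\<omega>. exp (t * Y \<omega>))"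
    using i[of "\<lambda>y. exp (t * y)"] integrable_std_normal_exp[of "t * ?s"] by (simp add: mult.assoc)
qed

section \<open>The isonormal process and its regression residuals\<close>

locale isonormal_process =
  fixes M :: "'a measure" and X :: "'h::{real_inner,banach,second_countable_topology} \<Rightarrow> 'a \<Rightarrow> real"
  assumes isonormal: "isonormal M X"

sublocale isonormal_process \<subseteq> prob_space M
  using isonormal unfolding isonormal_def by blast

abbreviation field_space :: "('h \<Rightarrow> real) measure" where
  "field_space \<equiv> PiM UNIV (\<lambda>_. borel)"

context isonormal_process
begin

lemma gaussian: "centered_gaussian M (X h)"
proof -
  have "\<forall>S c. finite S \<longrightarrow> centered_gaussian M (\<lambda>\<omega>. \<Sum>i\<in>S. c i * X i \<omega>)"
    using isonormal by (simp add: isonormal_def centered_gaussian_family_def)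
  from this[rule_format, of "{h}" "\<lambda>_. 1"] show ?thesis by simp
qed

lemma X_measurable[measurable]: "X h \<in> borel_measurable M"
  using gaussian[of h] by (simp add: centered_gaussian_def)

lemma X_moments: "has_moments M (X h)"
  by (rule centered_gaussian_moments[OF gaussian])

lemma X_exp_integrable: "integrable M (\<lambda>\<omega>. exp (t * X h \<omega>))"
  by (rule centered_gaussian_moments[OF gaussian])

lemma X_inner: "(\<integral>\<omega>. X h \<omega> * X g \<omega> \<partial>M) = h \<bullet> g"
  using isonormal unfolding isonormal_def by blast

lemma X_XX_integrable: "integrable M (\<lambda>\<omega>. X h \<omega> * X g \<omega>)"
  by (intro has_moments_integrable has_moments_mult X_moments)

lemma X_square: "(\<integral>\<omega>. (X h \<omega>)\<^sup>2 \<partial>M) = (norm h)\<^sup>2"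
  using X_inner[of h h] by (simp add: power2_eq_square[symmetric] dot_square_norm)

lemma X_iexp: "(\<integral>\<omega>. iexp (t * X h \<omega>) \<partial>M) = complex_of_real (exp (- t\<^sup>2 * (norm h)\<^sup>2 / 2))"
  using centered_gaussian_iexp[OF gaussian, of t h] by (simp add: X_square)

text \<open>The definition prescribes only covariances. The second moment of the difference of both
  sides expands into inner products that cancel.\<close>

lemma X_linear: "AE \<omega> in M. X (h + t *\<^sub>R k) \<omega> = X h \<omega> + t * X k \<omega>"
proof -
  let ?g = "h + t *\<^sub>R k"
  have "(\<integral>\<omega>. (X ?g \<omega> - X h \<omega> - t * X k \<omega>)\<^sup>2 \<partial>M)
    = (\<integral>\<omega>. X ?g \<omega> * X ?g \<omega> + X h \<omega> * X h \<omega> + t * t * (X k \<omega> * X k \<omega>)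
        - 2 * (X ?g \<omega> * X h \<omega>) - 2 * t * (X ?g \<omega> * X k \<omega>) + 2 * t * (X h \<omega> * X k \<omega>) \<partial>M)"
    by (rule Bochner_Integration.integral_cong) (auto simp: power2_eq_square algebra_simps)
  also have "\<dots> = ?g \<bullet> ?g + h \<bullet> h + t * t * (k \<bullet> k) - 2 * (?g \<bullet> h) - 2 * t * (?g \<bullet> k) + 2 * t * (h \<bullet> k)"
    by (simp add: X_XX_integrable X_inner)
  also have "\<dots> = 0" by (simp add: inner_add_left inner_add_right inner_commute algebra_simps)
  finally have "(\<integral>\<omega>. (X ?g \<omega> - X h \<omega> - t * X k \<omega>)\<^sup>2 \<partial>M) = 0" .
  moreover have "integrable M (\<lambda>\<omega>. (X ?g \<omega> - X h \<omega> - t * X k \<omega>)\<^sup>2)"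
    using square_integrable_diff[OF square_integrable_diff square_integrable_cmult, OF
      has_moments_square_integrable[OF X_moments] has_moments_square_integrable[OF X_moments]
      has_moments_square_integrable[OF X_moments], of ?g h t k] by (simp add: square_integrable_def)
  ultimately have "AE \<omega> in M. (X ?g \<omega> - X h \<omega> - t * X k \<omega>)\<^sup>2 = 0"
    by (simp add: integral_nonneg_eq_0_iff_AE)
  then show ?thesis by eventually_elim auto
qed

lemma field_measurable[measurable]: "(\<lambda>\<omega> h. X h \<omega>) \<in> measurable M field_space"
  by (rule measurable_PiM_single') auto

text \<open>Totality of the trigonometric functions: orthogonality to exp (i X h) for all
  \<open>h\<close> implies orthogonality to every functional of the field with an integrable
  product.\<close>

lemma integral_zero_field:
  assumes Z: "integrable M Z"
    and 0: "\<And>h. (\<integral>\<omega>. complex_of_real (Z \<omega>) * iexp (X h \<omega>) \<partial>M) = 0"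
    and K: "K \<in> borel_measurable field_space" "integrable M (\<lambda>\<omega>. K (\<lambda>h. X h \<omega>) * Z \<omega>)"
  shows "(\<integral>\<omega>. K (\<lambda>h. X h \<omega>) * Z \<omega> \<partial>M) = 0"
proof (rule integral_zero_fun[where S=field_space and Y="\<lambda>\<omega> h. X h \<omega>" and K=K, OF Z field_measurable _ K(1)])
  show "integrable M (\<lambda>\<omega>. K (\<lambda>h. X h \<omega>) * Z \<omega>)" by (rule K(2))
next
  fix B assume B: "B \<in> sets (field_space :: ('h \<Rightarrow> real) measure)"
  have iZ: "integrable M (\<lambda>\<omega>. complex_of_real (Z \<omega>))" using Z by simp
  have "(\<integral>\<omega>. indicator B (\<lambda>h. X h \<omega>) *\<^sub>R complex_of_real (Z \<omega>) \<partial>M) = 0"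
    by (rule linear_family_char_zero[OF iZ X_measurable X_linear 0 B])
  moreover have "(\<integral>\<omega>. indicator B (\<lambda>h. X h \<omega>) *\<^sub>R complex_of_real (Z \<omega>) \<partial>M)
      = complex_of_real (\<integral>\<omega>. indicator B (\<lambda>h. X h \<omega>) * Z \<omega> \<partial>M)"
    by (simp add: scaleR_conv_of_real flip: of_real_mult integral_complex_of_real)
  ultimately show "(\<integral>\<omega>. indicator B (\<lambda>h. X h \<omega>) * Z \<omega> \<partial>M) = 0" by (simp only: of_real_eq_0_iff)
qed

text \<open>The residual of the regression of the field on \<open>X h\<close>, for a unit vector
  \<open>h\<close>. It is defined pointwise, so that the field is recovered from it everywhere and
  not only almost surely.\<close>

definition orth :: "'h \<Rightarrow> 'a \<Rightarrow> 'h \<Rightarrow> real" where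
  "orth h \<omega> \<psi> = X \<psi> \<omega> - X h \<omega> * (\<psi> \<bullet> h)"

lemma orth_measurable[measurable]: "orth h \<in> measurable M field_space"
  unfolding orth_def by (rule measurable_PiM_single') auto

text \<open>For a unit vector the squared norm of
  \<open>s *\<^sub>R h + \<psi> - (\<psi> \<bullet> h) *\<^sub>R h\<close> splits, so the joint
  characteristic function factorises. Independence follows by using uniqueness twice, once in the
  residual field and once in \<open>X h\<close>.\<close>

lemma distr_orth:
  assumes h: "norm h = 1"
  shows "std_normal_distribution \<Otimes>\<^sub>M distr M field_space (orth h)
    = distr M (borel \<Otimes>\<^sub>M field_space) (\<lambda>\<omega>. (X h \<omega>, orth h \<omega>))"
proof -
  interpret N: real_distribution std_normal_distribution by (rule real_dist_normal_dist)
  interpret Y: prob_space "distr M field_space (orth h)" by (rule prob_space_distr) measurable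
  have hh: "h \<bullet> h = 1" using h by (simp add: dot_square_norm)
  have orthX: "AE \<omega> in M. X (s *\<^sub>R h + \<psi> - (\<psi> \<bullet> h) *\<^sub>R h) \<omega> = s * X h \<omega> + orth h \<omega> \<psi>" for s \<psi>
    using X_linear[of \<psi> "s - \<psi> \<bullet> h" h] by eventually_elim (simp add: orth_def algebra_simps)
  have nrm: "(norm (s *\<^sub>R h + \<psi> - (\<psi> \<bullet> h) *\<^sub>R h))\<^sup>2 = s\<^sup>2 + (norm (\<psi> - (\<psi> \<bullet> h) *\<^sub>R h))\<^sup>2" for s \<psi>
    unfolding power2_norm_eq_inner
    by (simp add: inner_add_left inner_add_right inner_diff_left inner_diff_right hh inner_commute[of h \<psi>] power2_eq_square algebra_simps)
  have joint: "(\<integral>\<omega>. iexp (s * X h \<omega> + orth h \<omega> \<psi>) \<partial>M)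
      = complex_of_real (exp (- s\<^sup>2 / 2)) * complex_of_real (exp (- (norm (\<psi> - (\<psi> \<bullet> h) *\<^sub>R h))\<^sup>2 / 2))" for s \<psi>
  proof -
    have "(\<integral>\<omega>. iexp (s * X h \<omega> + orth h \<omega> \<psi>) \<partial>M) = (\<integral>\<omega>. iexp (1 * X (s *\<^sub>R h + \<psi> - (\<psi> \<bullet> h) *\<^sub>R h) \<omega>) \<partial>M)"
    proof (rule integral_cong_AE)
      show "AE \<omega> in M. iexp (s * X h \<omega> + orth h \<omega> \<psi>) = iexp (1 * X (s *\<^sub>R h + \<psi> - (\<psi> \<bullet> h) *\<^sub>R h) \<omega>)"
        using orthX[of s \<psi>] by eventually_elim simp
    qed (auto simp: orth_def)
    also have "\<dots> = complex_of_real (exp (- s\<^sup>2 / 2)) * complex_of_real (exp (- (norm (\<psi> - (\<psi> \<bullet> h) *\<^sub>R h))\<^sup>2 / 2))"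
      unfolding X_iexp nrm by (simp add: exp_add[symmetric] add_divide_distrib flip: of_real_mult)
    finally show ?thesis .
  qed
  have om: "(\<lambda>\<omega>. orth h \<omega> \<psi>) \<in> borel_measurable M" for \<psi> unfolding orth_def by measurable
  have ind: "measure M {\<omega>\<in>space M. X h \<omega> \<in> A \<and> orth h \<omega> \<in> B}
      = measure M {\<omega>\<in>space M. X h \<omega> \<in> A} * measure M {\<omega>\<in>space M. orth h \<omega> \<in> B}"
    if A[measurable]: "A \<in> sets borel" and B[measurable]: "B \<in> sets field_space" for A B
  proof -
    let ?p = "measure M {\<omega>\<in>space M. orth h \<omega> \<in> B}"
    have ip: "(\<integral>\<omega>. indicator B (orth h \<omega>) \<partial>M) = ?p"
    proof -
      have "(\<integral>\<omega>. indicat_real B (orth h \<omega>) \<partial>M) = (\<integral>\<omega>. indicat_real {\<omega>\<in>space M. orth h \<omega> \<in> B} \<omega> \<partial>M)"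
        by (rule Bochner_Integration.integral_cong) (auto simp: indicator_def)
      then show ?thesis by simp
    qed
    have ib: "integrable M (\<lambda>\<omega>. indicator B (orth h \<omega>) :: real)"
      by (rule integrable_const_bound[of _ 1]) (auto simp: indicator_def)
    \<comment> \<open>With the indicator centred, independence means that \<open>Z\<close>
      integrates to 0 over every event in terms of \<open>X h\<close>, which can be tested on the
      exponentials of \<open>X h\<close>.\<close>
    define Z where "Z \<omega> = indicator B (orth h \<omega>) - ?p" for \<omega>
    have iZ: "integrable M Z" unfolding Z_def using ib by simp
    have "(\<integral>\<omega>. complex_of_real (Z \<omega>) * iexp (s * X h \<omega>) \<partial>M) = 0" for s
    proof -
      let ?c = "complex_of_real (exp (- s\<^sup>2 / 2))"
      have ie: "integrable M (\<lambda>\<omega>. iexp (s * X h \<omega>))"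
        using iexp_integrable[of "\<lambda>_. 1" "\<lambda>\<omega>. s * X h \<omega>"] by simp
      have iW: "integrable M (\<lambda>\<omega>. iexp (s * X h \<omega>) - ?c)" using ie by simp
      have ibe: "integrable M (\<lambda>\<omega>. indicator B (orth h \<omega>) *\<^sub>R (iexp (s * X h \<omega>)))"
        by (rule Bochner_Integration.integrable_bound[OF ie]) (auto simp: indicator_def)
      \<comment> \<open>The weight is the centred exponential of \<open>X h\<close>; by the joint
        characteristic function it is orthogonal to all exponentials of the residual field, which is
        linear in \<open>\<psi>\<close>.\<close>
      have "(\<integral>\<omega>. indicator B (\<lambda>\<psi>. orth h \<omega> \<psi>) *\<^sub>R (iexp (s * X h \<omega>) - ?c) \<partial>M) = 0"
      proof (rule linear_family_char_zero[OF iW om _ _ B])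
        show "AE \<omega> in M. orth h \<omega> (\<psi> + t *\<^sub>R k) = orth h \<omega> \<psi> + t * orth h \<omega> k" for \<psi> t k
          using X_linear[of \<psi> t k] by eventually_elim (simp add: orth_def algebra_simps inner_add_left)
        fix \<psi>
        have i1: "integrable M (\<lambda>\<omega>. iexp (s * X h \<omega> + orth h \<omega> \<psi>))" "integrable M (\<lambda>\<omega>. iexp (orth h \<omega> \<psi>))"
          using iexp_integrable[of "\<lambda>_. 1" "\<lambda>\<omega>. s * X h \<omega> + orth h \<omega> \<psi>"]
            iexp_integrable[of "\<lambda>_. 1" "\<lambda>\<omega>. orth h \<omega> \<psi>"] om by auto
        have "(\<integral>\<omega>. (iexp (s * X h \<omega>) - ?c) * iexp (orth h \<omega> \<psi>) \<partial>M)
          = (\<integral>\<omega>. iexp (s * X h \<omega> + orth h \<omega> \<psi>) - ?c * iexp (orth h \<omega> \<psi>) \<partial>M)"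
          by (simp add: exp_add algebra_simps)
        also have "\<dots> = (\<integral>\<omega>. iexp (s * X h \<omega> + orth h \<omega> \<psi>) \<partial>M) - ?c * (\<integral>\<omega>. iexp (orth h \<omega> \<psi>) \<partial>M)"
          using i1 by simp
        also have "\<dots> = 0" using joint[of s \<psi>] joint[of 0 \<psi>] by simp
        finally show "(\<integral>\<omega>. (iexp (s * X h \<omega>) - ?c) * iexp (orth h \<omega> \<psi>) \<partial>M) = 0" .
      qed
      then have "(\<integral>\<omega>. indicator B (orth h \<omega>) *\<^sub>R (iexp (s * X h \<omega>)) - indicator B (orth h \<omega>) *\<^sub>R ?c \<partial>M) = 0"
        by (simp add: scaleR_diff_right)
      then have e1: "(\<integral>\<omega>. indicator B (orth h \<omega>) *\<^sub>R (iexp (s * X h \<omega>)) \<partial>M) = ?p *\<^sub>R ?c"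
        using ibe ib ip by simp
      have "(\<integral>\<omega>. complex_of_real (Z \<omega>) * iexp (s * X h \<omega>) \<partial>M)
        = (\<integral>\<omega>. indicator B (orth h \<omega>) *\<^sub>R (iexp (s * X h \<omega>)) - ?p *\<^sub>R iexp (s * X h \<omega>) \<partial>M)"
        by (rule Bochner_Integration.integral_cong) (auto simp: Z_def scaleR_conv_of_real algebra_simps indicator_def)
      also have "\<dots> = ?p *\<^sub>R ?c - ?p *\<^sub>R (\<integral>\<omega>. iexp (s * X h \<omega>) \<partial>M)"
        using ibe ie e1 by simp
      also have "\<dots> = 0" using X_iexp[of s h] h by simp
      finally show ?thesis .
    qed
    from char_zero_imp_zero_real[OF iZ X_measurable this A]
    have "0 = (\<integral>\<omega>. indicator A (X h \<omega>) * Z \<omega> \<partial>M)" by simp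
    also have "\<dots> = (\<integral>\<omega>. indicator {\<omega>\<in>space M. X h \<omega> \<in> A \<and> orth h \<omega> \<in> B} \<omega> - ?p * indicator {\<omega>\<in>space M. X h \<omega> \<in> A} \<omega> \<partial>M)"
      by (rule Bochner_Integration.integral_cong) (auto simp: Z_def indicator_def)
    also have "\<dots> = measure M {\<omega>\<in>space M. X h \<omega> \<in> A \<and> orth h \<omega> \<in> B} - ?p * measure M {\<omega>\<in>space M. X h \<omega> \<in> A}"
    proof -
      have "integrable M (indicat_real C)" if "C \<in> sets M" for C
        using that by (intro integrable_real_indicator) (auto simp: less_top[symmetric])
      from this[of "{\<omega>\<in>space M. X h \<omega> \<in> A \<and> orth h \<omega> \<in> B}"] this[of "{\<omega>\<in>space M. X h \<omega> \<in> A}"]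
      show ?thesis by simp
    qed
    finally show ?thesis by (simp add: mult.commute)
  qed
  have Xh: "distr M borel (X h) = std_normal_distribution"
    using centered_gaussian_distr[OF gaussian, of h] h
      distr_id2[of borel std_normal_distribution] by (simp add: X_square)
  show ?thesis
  proof (rule pair_measure_eqI)
    show "sigma_finite_measure (density lborel (\<lambda>x. ennreal (std_normal_density x)))" ..
    show "sigma_finite_measure (distr M field_space (orth h))" ..
    show "sets (std_normal_distribution \<Otimes>\<^sub>M distr M field_space (orth h)) =
       sets (distr M (borel \<Otimes>\<^sub>M field_space) (\<lambda>\<omega>. (X h \<omega>, orth h \<omega>)))"
      by (simp cong: sets_pair_measure_cong)
    fix A B assume "A \<in> sets std_normal_distribution" "B \<in> sets (distr M field_space (orth h))"
    then have A[measurable]: "A \<in> sets borel" and B[measurable]: "B \<in> sets field_space" by auto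
    have m1: "emeasure std_normal_distribution A = ennreal (measure M {\<omega>\<in>space M. X h \<omega> \<in> A})"
      unfolding Xh[symmetric] by (subst emeasure_distr) (auto simp: emeasure_eq_measure vimage_def Int_def conj_commute)
    have m2: "emeasure (distr M field_space (orth h)) B = ennreal (measure M {\<omega>\<in>space M. orth h \<omega> \<in> B})"
      by (subst emeasure_distr) (auto simp: emeasure_eq_measure vimage_def Int_def conj_commute)
    have m3: "emeasure (distr M (borel \<Otimes>\<^sub>M field_space) (\<lambda>\<omega>. (X h \<omega>, orth h \<omega>))) (A \<times> B)
      = ennreal (measure M {\<omega>\<in>space M. X h \<omega> \<in> A \<and> orth h \<omega> \<in> B})"
      by (subst emeasure_distr) (auto simp: emeasure_eq_measure vimage_def Int_def conj_commute conj_ac)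
    show "emeasure std_normal_distribution A * emeasure (distr M field_space (orth h)) B
        = emeasure (distr M (borel \<Otimes>\<^sub>M field_space) (\<lambda>\<omega>. (X h \<omega>, orth h \<omega>))) (A \<times> B)"
      unfolding m1 m2 m3 ind[OF A B] by (simp add: ennreal_mult)
  qed
qed

end

section \<open>Gaussian integration by parts\<close>

lemma DERIV_std_normal_density: "DERIV std_normal_density x :> - x * std_normal_density x"
  unfolding std_normal_density_def
  by (auto intro!: derivative_eq_intros simp: field_simps)

lemma isCont_std_normal_density: "isCont std_normal_density x"
  using DERIV_std_normal_density by (rule DERIV_isCont)

text \<open>Integrability replaces any decay condition on \<gamma>. The boundary term
  \<open>w s\<close> on [-s, s] converges as s grows, and \<open>w\<close> is integrable on the
  line, so its limit must be 0.\<close>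

lemma std_normal_integration_by_parts:
  fixes \<gamma> \<gamma>' :: "real \<Rightarrow> real"
  assumes D: "\<And>t. DERIV \<gamma> t :> \<gamma>' t" and C: "\<And>t. isCont \<gamma>' t"
    and int: "integrable std_normal_distribution \<gamma>" "integrable std_normal_distribution (\<lambda>t. t * \<gamma> t)"
      "integrable std_normal_distribution \<gamma>'"
  shows "(\<integral>t. t * \<gamma> t \<partial>std_normal_distribution) = (\<integral>t. \<gamma>' t \<partial>std_normal_distribution)"
proof -
  have C0: "isCont \<gamma> t" for t using D by (rule DERIV_isCont)
  have [measurable]: "\<gamma> \<in> borel_measurable borel" "\<gamma>' \<in> borel_measurable borel"
    using C C0 by (auto intro!: borel_measurable_continuous_onI continuous_at_imp_continuous_on)
  let ?d = std_normal_density
  have i: "integrable lborel (\<lambda>t. ?d t * f t)" "(\<integral>t. ?d t * f t \<partial>lborel) = (\<integral>t. f t \<partial>std_normal_distribution)"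
    if "integrable std_normal_distribution f" "f \<in> borel_measurable borel" for f
    using that by (auto simp: integrable_density integral_density)
  define f where "f t = ?d t * \<gamma>' t - ?d t * (t * \<gamma> t)" for t
  have fi: "integrable lborel f" unfolding f_def using i(1)[OF int(2)] i(1)[OF int(3)] by simp
  have DF: "DERIV (\<lambda>t. ?d t * \<gamma> t) t :> f t" for t
    by (auto intro!: derivative_eq_intros D DERIV_std_normal_density simp: f_def algebra_simps)
  have Cf: "isCont f t" for t
    unfolding f_def by (intro continuous_intros C C0 isCont_std_normal_density)
  define w where "w s = ?d s * \<gamma> s - ?d (- s) * \<gamma> (- s)" for s
  have w: "(\<integral>t. f t * indicator {- s .. s} t \<partial>lborel) = w s" if "s \<ge> 0" for s
    unfolding w_def using that by (intro integral_FTC_Icc_real DF Cf) auto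
  have lim: "((\<lambda>s. \<integral>t. f t * indicator {- s .. s} t \<partial>lborel) \<longlongrightarrow> (\<integral>t. f t \<partial>lborel)) at_top"
  proof (rule integral_dominated_convergence_at_top)
    show "integrable lborel (\<lambda>t. \<bar>f t\<bar>)" using fi by simp
    show "AE x in lborel. ((\<lambda>s. f x * indicator {- s..s} x) \<longlongrightarrow> f x) at_top"
    proof (rule AE_I2)
      fix x
      have "eventually (\<lambda>s. f x * indicator {- s..s} x = f x) at_top"
        using eventually_ge_at_top[of "\<bar>x\<bar>"] by eventually_elim (auto simp: indicator_def)
      then show "((\<lambda>s. f x * indicator {- s..s} x) \<longlongrightarrow> f x) at_top" by (rule tendsto_eventually)
    qed
  qed (use fi in \<open>auto simp: indicator_def\<close>)
  have wlim: "(w \<longlongrightarrow> (\<integral>t. f t \<partial>lborel)) at_top"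
  proof (rule Lim_transform_eventually[OF lim])
    show "\<forall>\<^sub>F s in at_top. (\<integral>t. f t * indicator {- s .. s} t \<partial>lborel) = w s"
      using eventually_ge_at_top[of 0] by eventually_elim (rule w)
  qed
  have wi: "integrable lborel w"
  proof -
    have "integrable lborel (\<lambda>t. ?d t * \<gamma> t)" by (rule i(1)[OF int(1)]) measurable
    moreover from this have "integrable lborel (\<lambda>t. ?d (- t) * \<gamma> (- t))"
      using lborel_integrable_real_affine[of "\<lambda>t. ?d t * \<gamma> t" "-1" 0] by simp
    ultimately show ?thesis unfolding w_def by simp
  qed
  have "(\<integral>t. f t \<partial>lborel) = 0"
  proof (rule ccontr)
    let ?I = "\<integral>t. f t \<partial>lborel"
    assume I: "?I \<noteq> 0"
    then have "eventually (\<lambda>s. dist (w s) ?I < \<bar>?I\<bar> / 2) at_top"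
      using tendstoD[OF wlim, of "\<bar>?I\<bar> / 2"] by simp
    then obtain s0 where s0: "\<And>s. s \<ge> s0 \<Longrightarrow> dist (w s) ?I < \<bar>?I\<bar> / 2"
      unfolding eventually_at_top_linorder by auto
    \<comment> \<open>A nonzero limit would keep \<open>w\<close> away from 0 on a half-line and
      make the indicator of a set of infinite measure integrable.\<close>
    have "integrable lborel (\<lambda>s. \<bar>?I\<bar> / 2 * indicator {s0..} s :: real)"
    proof (rule Bochner_Integration.integrable_bound[OF wi])
      show "AE s in lborel. norm (\<bar>?I\<bar> / 2 * indicator {s0..} s) \<le> norm (w s)"
      proof (rule AE_I2)
        fix s show "norm (\<bar>?I\<bar> / 2 * indicator {s0..} s) \<le> norm (w s)"
          using s0[of s] by (cases "s \<ge> s0") (auto simp: dist_real_def indicator_def abs_if split: if_splits)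
      qed
    qed auto
    then have "integrable lborel (indicat_real {s0..})" using I by (simp only: integrable_mult_left_iff) simp
    then have "emeasure lborel {s0..} < \<infinity>" by (simp add: integrable_indicator_iff)
    moreover have "emeasure lborel {s0..} = \<infinity>"
    proof -
      have "ennreal (real n) \<le> emeasure lborel {s0..}" for n
      proof -
        have "ennreal (real n) = emeasure lborel {s0..s0 + real n}" by simp
        also have "\<dots> \<le> emeasure lborel {s0..}" by (rule emeasure_mono) auto
        finally show ?thesis .
      qed
      then show ?thesis by (metis ennreal_of_nat_eq_real_of_nat ennreal_SUP_of_nat_eq_top SUP_le_iff infinity_ennreal_def top.extremum_unique)
    qed
    ultimately show False by simp
  qed
  also have "(\<integral>t. f t \<partial>lborel) = (\<integral>t. \<gamma>' t \<partial>std_normal_distribution) - (\<integral>t. t * \<gamma> t \<partial>std_normal_distribution)"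
    unfolding f_def using i[OF int(2)] i[OF int(3)] by simp
  finally show ?thesis by simp
qed

definition shift :: "('h::real_inner \<Rightarrow> real) \<Rightarrow> 'h \<Rightarrow> real \<Rightarrow> 'h \<Rightarrow> real" where
  "shift x h t = (\<lambda>\<psi>. x \<psi> + t * (\<psi> \<bullet> h))"

lemma shift_0[simp]: "shift x h 0 = x"
  by (simp add: shift_def)

lemma shift_shift: "shift (shift x h s) h t = shift x h (s + t)"
  by (simp add: shift_def algebra_simps)

lemma shift_apply: "shift x h t \<psi> = x \<psi> + t * (\<psi> \<bullet> h)"
  by (simp add: shift_def)

text \<open>A functional of the field is differentiated along the Cameron--Martin directions
  \<open>\<lambda>\<psi>. \<psi> \<bullet> h\<close>: this keeps the product and chain rules one-dimensional and needs no
  representation in terms of finitely many coordinates.\<close>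

definition path_deriv ::
    "(('h::{real_inner,banach,second_countable_topology} \<Rightarrow> real) \<Rightarrow> real) \<Rightarrow> (('h \<Rightarrow> real) \<Rightarrow> 'h) \<Rightarrow> bool" where
  "path_deriv g D \<longleftrightarrow> g \<in> borel_measurable field_space \<and> D \<in> borel_measurable field_space \<and>
     (\<forall>x h. DERIV (\<lambda>t. g (shift x h t)) 0 :> D x \<bullet> h \<and> isCont (\<lambda>t. D (shift x h t)) 0)"

text \<open>The definition speaks of time 0 only, but for all base points;
  \<open>shift_shift\<close> transports it to every point of the line.\<close>

lemma path_derivD:
  assumes "path_deriv g D"
  shows "g \<in> borel_measurable field_space" "D \<in> borel_measurable field_space"
    "DERIV (\<lambda>t. g (shift x h t)) s :> D (shift x h s) \<bullet> h" "isCont (\<lambda>t. D (shift x h t)) s"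
proof -
  show "g \<in> borel_measurable field_space" "D \<in> borel_measurable field_space"
    using assms by (auto simp: path_deriv_def)
  have "DERIV (\<lambda>t. g (shift x h (s + t))) 0 :> D (shift x h s) \<bullet> h"
    "isCont (\<lambda>t. D (shift x h (s + t))) 0"
    using assms unfolding path_deriv_def shift_shift[symmetric] by auto
  moreover have "DERIV (\<lambda>t. g (shift x h t)) s :> D (shift x h s) \<bullet> h \<longleftrightarrow>
      DERIV (\<lambda>t. g (shift x h (s + t))) 0 :> D (shift x h s) \<bullet> h"
    using DERIV_shift[of "\<lambda>t. g (shift x h t)" "D (shift x h s) \<bullet> h" 0 s] by (simp add: add.commute)
  moreover have "isCont (\<lambda>t. D (shift x h t)) s \<longleftrightarrow> isCont (\<lambda>t. D (shift x h (s + t))) 0"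
    using LIM_offset_zero_iff[of s "\<lambda>t. D (shift x h t)" "D (shift x h s)"] by (simp add: isCont_def)
  ultimately show "DERIV (\<lambda>t. g (shift x h t)) s :> D (shift x h s) \<bullet> h" "isCont (\<lambda>t. D (shift x h t)) s" by auto
qed

lemma path_deriv_const: "path_deriv (\<lambda>_. c) (\<lambda>_. 0)"
  by (simp add: path_deriv_def)

lemma path_deriv_coord: "path_deriv (\<lambda>x. x \<psi>) (\<lambda>_. \<psi>)"
  unfolding path_deriv_def shift_apply
  by (auto intro!: derivative_eq_intros)

lemma path_deriv_add:
  assumes "path_deriv f Df" "path_deriv g Dg"
  shows "path_deriv (\<lambda>x. f x + g x) (\<lambda>x. Df x + Dg x)"
  using assms unfolding path_deriv_def
  by (auto intro!: derivative_eq_intros continuous_intros simp: inner_add_left)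

lemma path_deriv_mult:
  assumes "path_deriv f Df" "path_deriv g Dg"
  shows "path_deriv (\<lambda>x. f x * g x) (\<lambda>x. f x *\<^sub>R Dg x + g x *\<^sub>R Df x)"
proof -
  note f = path_derivD[OF assms(1)] and g = path_derivD[OF assms(2)]
  have [measurable]: "f \<in> borel_measurable field_space" "g \<in> borel_measurable field_space"
    "Df \<in> borel_measurable field_space" "Dg \<in> borel_measurable field_space" using f g by auto
  have "DERIV (\<lambda>t. f (shift x h t) * g (shift x h t)) 0 :> (f x *\<^sub>R Dg x + g x *\<^sub>R Df x) \<bullet> h" for x h
    using DERIV_mult[OF f(3)[of x h 0] g(3)[of x h 0]] by (simp add: inner_add_left algebra_simps)
  moreover have "isCont (\<lambda>t. f (shift x h t) *\<^sub>R Dg (shift x h t) + g (shift x h t) *\<^sub>R Df (shift x h t)) 0" for x h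
    by (intro continuous_intros f(4) g(4) DERIV_isCont[OF f(3)] DERIV_isCont[OF g(3)])
  ultimately show ?thesis unfolding path_deriv_def by auto
qed

lemma path_deriv_comp:
  assumes "path_deriv g D" and F: "\<And>y. DERIV F y :> F' y" "\<And>y. isCont F' y"
  shows "path_deriv (\<lambda>x. F (g x)) (\<lambda>x. F' (g x) *\<^sub>R D x)"
proof -
  note g = path_derivD[OF assms(1)]
  have [measurable]: "g \<in> borel_measurable field_space" "D \<in> borel_measurable field_space" using g by auto
  have [measurable]: "F \<in> borel_measurable borel" "F' \<in> borel_measurable borel"
    using F DERIV_isCont[OF F(1)] by (auto intro!: borel_measurable_continuous_onI continuous_at_imp_continuous_on)
  have "DERIV (\<lambda>t. F (g (shift x h t))) 0 :> (F' (g x) *\<^sub>R D x) \<bullet> h" for x h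
    using DERIV_chain2[OF F(1) g(3)[of x h 0]] by simp
  moreover have "isCont (\<lambda>t. F' (g (shift x h t)) *\<^sub>R D (shift x h t)) 0" for x h
    by (intro continuous_intros g(4) isCont_o2[OF DERIV_isCont[OF g(3)] F(2)])
  ultimately show ?thesis unfolding path_deriv_def by auto
qed

lemma path_deriv_cmult: "path_deriv g D \<Longrightarrow> path_deriv (\<lambda>x. c * g x) (\<lambda>x. c *\<^sub>R D x)"
  using path_deriv_mult[OF path_deriv_const[of c]] by simp

lemma path_deriv_sum:
  "(\<And>i. i \<in> I \<Longrightarrow> path_deriv (g i) (D i)) \<Longrightarrow> path_deriv (\<lambda>x. \<Sum>i\<in>I. g i x) (\<lambda>x. \<Sum>i\<in>I. D i x)"
  by (induction I rule: infinite_finite_induct) (auto simp: path_deriv_const path_deriv_add)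

context isonormal_process
begin

abbreviation "field \<omega> \<equiv> (\<lambda>h. X h \<omega>)"

lemma field_eq_shift_orth: "field \<omega> = shift (orth h \<omega>) h (X h \<omega>)"
  by (auto simp: shift_def orth_def)

text \<open>Given the residual, the field is a point on a line in direction \<open>h\<close>, at the
  independent standard normal time \<open>X h\<close>. Fubini reduces the formula to the
  one-dimensional one on almost every line.\<close>

lemma integration_by_parts_unit:
  assumes h: "norm h = 1" and g: "path_deriv g D"
    and int: "integrable M (\<lambda>\<omega>. g (field \<omega>))" "integrable M (\<lambda>\<omega>. X h \<omega> * g (field \<omega>))"
      "integrable M (\<lambda>\<omega>. D (field \<omega>) \<bullet> h)"
  shows "(\<integral>\<omega>. X h \<omega> * g (field \<omega>) \<partial>M) = (\<integral>\<omega>. D (field \<omega>) \<bullet> h \<partial>M)"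
proof -
  interpret N: real_distribution std_normal_distribution by (rule real_dist_normal_dist)
  interpret Y: prob_space "distr M field_space (orth h)" by (rule prob_space_distr) measurable
  interpret P: pair_prob_space "distr M field_space (orth h)" std_normal_distribution ..
  note gD = path_derivD[OF g]
  note [measurable] = gD(1,2)
  let ?Y = "distr M field_space (orth h)" and ?N = std_normal_distribution
  have shm[measurable]: "(\<lambda>p. shift (fst p) h (snd p)) \<in> measurable (field_space \<Otimes>\<^sub>M borel) field_space"
  proof -
    have "(\<lambda>p. fst p \<psi>) \<in> borel_measurable (field_space \<Otimes>\<^sub>M borel)" for \<psi> :: 'h
      by (rule measurable_compose[OF measurable_fst measurable_component_singleton]) simp
    then show ?thesis unfolding shift_def by (intro measurable_PiM_single') auto
  qed
  have eqd: "?Y \<Otimes>\<^sub>M ?N = distr M (field_space \<Otimes>\<^sub>M borel) (\<lambda>\<omega>. (orth h \<omega>, X h \<omega>))"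
  proof -
    have "?Y \<Otimes>\<^sub>M ?N = distr (?N \<Otimes>\<^sub>M ?Y) (?Y \<Otimes>\<^sub>M ?N) (\<lambda>(x, y). (y, x))" by (rule P.distr_pair_swap)
    also have "\<dots> = distr (?N \<Otimes>\<^sub>M ?Y) (field_space \<Otimes>\<^sub>M borel) (\<lambda>(x, y). (y, x))"
      by (rule distr_cong) (auto cong: sets_pair_measure_cong)
    also have "\<dots> = distr M (field_space \<Otimes>\<^sub>M borel) (\<lambda>\<omega>. (orth h \<omega>, X h \<omega>))"
      unfolding distr_orth[OF h] by (subst distr_distr) (auto simp: o_def)
    finally show ?thesis .
  qed
  have tr: "integrable (?Y \<Otimes>\<^sub>M ?N) f \<longleftrightarrow> integrable M (\<lambda>\<omega>. f (orth h \<omega>, X h \<omega>))"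
      "(\<integral>p. f p \<partial>(?Y \<Otimes>\<^sub>M ?N)) = (\<integral>\<omega>. f (orth h \<omega>, X h \<omega>) \<partial>M)"
    if [measurable]: "f \<in> borel_measurable (field_space \<Otimes>\<^sub>M borel)" for f :: "('h \<Rightarrow> real) \<times> real \<Rightarrow> real"
    unfolding eqd by (auto simp: integrable_distr_eq integral_distr)
  let ?f1 = "\<lambda>p. g (shift (fst p) h (snd p))"
  let ?f2 = "\<lambda>p. snd p * g (shift (fst p) h (snd p))"
  let ?f3 = "\<lambda>p. D (shift (fst p) h (snd p)) \<bullet> h"
  have m: "?f1 \<in> borel_measurable (field_space \<Otimes>\<^sub>M borel)" "?f2 \<in> borel_measurable (field_space \<Otimes>\<^sub>M borel)"
    "?f3 \<in> borel_measurable (field_space \<Otimes>\<^sub>M borel)" by measurable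
  have i: "integrable (?Y \<Otimes>\<^sub>M ?N) ?f1" "integrable (?Y \<Otimes>\<^sub>M ?N) ?f2" "integrable (?Y \<Otimes>\<^sub>M ?N) ?f3"
    using int unfolding tr(1)[OF m(1)] tr(1)[OF m(2)] tr(1)[OF m(3)] by (simp_all add: field_eq_shift_orth[symmetric])
  have "(\<integral>\<omega>. X h \<omega> * g (field \<omega>) \<partial>M) = (\<integral>p. ?f2 p \<partial>(?Y \<Otimes>\<^sub>M ?N))"
    unfolding tr(2)[OF m(2)] by (simp add: field_eq_shift_orth[symmetric])
  also have "\<dots> = (\<integral>y. (\<integral>t. ?f2 (y, t) \<partial>?N) \<partial>?Y)" by (rule P.integral_fst'[OF i(2), symmetric])
  also have "\<dots> = (\<integral>y. (\<integral>t. ?f3 (y, t) \<partial>?N) \<partial>?Y)"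
  proof (rule integral_cong_AE)
    show "AE y in ?Y. (\<integral>t. ?f2 (y, t) \<partial>?N) = (\<integral>t. ?f3 (y, t) \<partial>?N)"
      using P.AE_integrable_fst'[OF i(1)] P.AE_integrable_fst'[OF i(2)] P.AE_integrable_fst'[OF i(3)]
    proof eventually_elim
      case (elim y)
      show ?case unfolding fst_conv snd_conv
        by (rule std_normal_integration_by_parts) (use elim gD(3,4) in \<open>auto intro!: continuous_intros\<close>)
    qed
  qed (use P.integrable_fst'[OF i(2)] P.integrable_fst'[OF i(3)] in \<open>auto\<close>)
  also have "\<dots> = (\<integral>p. ?f3 p \<partial>(?Y \<Otimes>\<^sub>M ?N))" by (rule P.integral_fst'[OF i(3)])
  also have "\<dots> = (\<integral>\<omega>. D (field \<omega>) \<bullet> h \<partial>M)"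
    unfolding tr(2)[OF m(3)] by (simp add: field_eq_shift_orth[symmetric])
  finally show ?thesis .
qed

text \<open>Both sides are homogeneous in \<open>h\<close>, on the left only almost surely; the zero
  vector cannot be normalised and is treated apart.\<close>

lemma integration_by_parts:
  assumes g: "path_deriv g D"
    and int: "integrable M (\<lambda>\<omega>. g (field \<omega>))" "integrable M (\<lambda>\<omega>. X h \<omega> * g (field \<omega>))"
      "integrable M (\<lambda>\<omega>. D (field \<omega>) \<bullet> h)"
  shows "(\<integral>\<omega>. X h \<omega> * g (field \<omega>) \<partial>M) = (\<integral>\<omega>. D (field \<omega>) \<bullet> h \<partial>M)"
proof (cases "h = 0")
  case True
  have [measurable]: "g \<in> borel_measurable field_space" using path_derivD[OF g] by simp
  have "AE \<omega> in M. X 0 \<omega> = 0" using X_linear[of 0 1 0] by simp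
  then have "AE \<omega> in M. X h \<omega> * g (field \<omega>) = 0" unfolding True by eventually_elim simp
  then have "(\<integral>\<omega>. X h \<omega> * g (field \<omega>) \<partial>M) = 0" by (simp add: integral_eq_zero_AE)
  then show ?thesis using True by simp
next
  case False
  have [measurable]: "g \<in> borel_measurable field_space" using path_derivD[OF g] by simp
  let ?e = "h /\<^sub>R norm h"
  have e: "norm ?e = 1" and he: "h = norm h *\<^sub>R ?e" using False by auto
  have "AE \<omega> in M. X 0 \<omega> = 0" using X_linear[of 0 1 0] by simp
  then have ae: "AE \<omega> in M. X h \<omega> = norm h * X ?e \<omega>"
    using X_linear[of 0 "norm h" ?e] by eventually_elim (use False in simp)
  have ae': "AE \<omega> in M. X h \<omega> * g (field \<omega>) = norm h * (X ?e \<omega> * g (field \<omega>))"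
    using ae by eventually_elim simp
  have iff: "integrable M (\<lambda>\<omega>. norm h * (X ?e \<omega> * g (field \<omega>)))"
    by (rule integrable_cong_AE_imp[OF int(2)]) (use ae' in \<open>auto elim!: eventually_mono\<close>)
  have i2: "integrable M (\<lambda>\<omega>. X ?e \<omega> * g (field \<omega>))"
    using iff False by (simp only: integrable_mult_left_iff norm_eq_zero simp_thms)
  have i3: "integrable M (\<lambda>\<omega>. D (field \<omega>) \<bullet> ?e)" using int(3) by simp
  have "(\<integral>\<omega>. X h \<omega> * g (field \<omega>) \<partial>M) = (\<integral>\<omega>. norm h * (X ?e \<omega> * g (field \<omega>)) \<partial>M)"
    by (rule integral_cong_AE) (use ae' in auto)
  also have "\<dots> = norm h * (\<integral>\<omega>. D (field \<omega>) \<bullet> ?e \<partial>M)"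
    using integration_by_parts_unit[OF e g int(1) i2 i3] by simp
  also have "\<dots> = (\<integral>\<omega>. D (field \<omega>) \<bullet> h \<partial>M)" using False int(3) by simp
  finally show ?thesis .
qed

end

section \<open>Hermite polynomials\<close>

text \<open>Differentiating the three-term recurrence gives a combination that the recurrence itself
  reassembles. For q = 0 the truncated \<open>q - 1\<close> is harmless because of the factor
  0.\<close>

lemma DERIV_hermite: "DERIV (hermite q) x :> real q * hermite (q - 1) x"
proof (induction q arbitrary: x rule: induct_nat_012)
  case 0
  show ?case by simp
next
  case 1
  show ?case by (auto intro!: derivative_eq_intros)
next
  case (ge2 n)
  have "DERIV (\<lambda>x. x * hermite (Suc n) x - real (Suc n) * hermite n x) x
      :> x * (real (Suc n) * hermite n x) + 1 * hermite (Suc n) x - real (Suc n) * (real n * hermite (n - 1) x)"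
    using ge2[of x] by (auto intro!: derivative_eq_intros)
  moreover have "x * (real (Suc n) * hermite n x) + 1 * hermite (Suc n) x - real (Suc n) * (real n * hermite (n - 1) x)
      = real (Suc (Suc n)) * hermite (Suc n) x"
    by (cases n) (auto simp: algebra_simps)
  ultimately show ?case by simp
qed

lemma isCont_hermite: "isCont (hermite q) x"
  using DERIV_hermite by (rule DERIV_isCont)

lemma hermite_measurable[measurable]: "hermite q \<in> borel_measurable borel"
  using isCont_hermite by (auto intro!: borel_measurable_continuous_onI continuous_at_imp_continuous_on)

lemma (in prob_space) has_moments_hermite: "has_moments M Y \<Longrightarrow> has_moments M (\<lambda>\<omega>. hermite q (Y \<omega>))"
proof (induction q rule: induct_nat_012)
  case (ge2 n)
  then have "has_moments M (\<lambda>\<omega>. Y \<omega> * hermite (Suc n) (Y \<omega>) + (- real (Suc n)) * hermite n (Y \<omega>))"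
    by (intro has_moments_add has_moments_mult has_moments_const) auto
  then show ?case by (simp add: algebra_simps)
qed (auto simp: has_moments_const)

lemma path_deriv_hermite:
  "path_deriv (\<lambda>x. hermite q (x h)) (\<lambda>x. (real q * hermite (q - 1) (x h)) *\<^sub>R h)"
  by (rule path_deriv_comp[OF path_deriv_coord DERIV_hermite])
     (intro continuous_intros isCont_hermite)

context isonormal_process
begin

text \<open>Since x He_n - He_n' = He_(n+1), integrating \<open>X h\<close> against
  \<open>hermite n (X h) * K\<close> by parts leaves only the term in which \<open>K\<close> is
  differentiated. In other words, the divergence of \<open>hermite n (X h) *\<^sub>R h\<close> is
  \<open>hermite (Suc n) (X h)\<close>.\<close>

lemma hermite_integration_by_parts:
  assumes h: "norm h = 1" and q: "q \<ge> 1" and K: "path_deriv K D"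
    and mom: "has_moments M (\<lambda>\<omega>. K (field \<omega>))" "has_moments M (\<lambda>\<omega>. norm (D (field \<omega>)))"
  shows "(\<integral>\<omega>. hermite q (X h \<omega>) * K (field \<omega>) \<partial>M)
    = (\<integral>\<omega>. (hermite (q - 1) (X h \<omega>) *\<^sub>R h) \<bullet> D (field \<omega>) \<partial>M)"
proof -
  note KD = path_derivD[OF K]
  note [measurable] = KD(1,2)
  obtain n where q: "q = Suc n" using q by (cases q) auto
  have hh: "h \<bullet> h = 1" using h by (simp add: dot_square_norm)
  have mD: "has_moments M (\<lambda>\<omega>. D (field \<omega>) \<bullet> h)"
    by (rule has_moments_mono[OF mom(2)]) (use h Cauchy_Schwarz_ineq2[of _ h] in auto)
  have mh: "has_moments M (\<lambda>\<omega>. hermite k (X h \<omega>))" for k by (rule has_moments_hermite[OF X_moments])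
  let ?g = "\<lambda>x. hermite n (x h) * K x"
  let ?D = "\<lambda>x. hermite n (x h) *\<^sub>R D x + K x *\<^sub>R ((real n * hermite (n - 1) (x h)) *\<^sub>R h)"
  have pd: "path_deriv ?g ?D" by (rule path_deriv_mult[OF path_deriv_hermite K])
  have Dh: "?D (field \<omega>) \<bullet> h = hermite n (X h \<omega>) * (D (field \<omega>) \<bullet> h)
      + real n * (hermite (n - 1) (X h \<omega>) * K (field \<omega>))" for \<omega>
    by (simp add: inner_add_left hh)
  have m1: "has_moments M (\<lambda>\<omega>. hermite n (X h \<omega>) * (D (field \<omega>) \<bullet> h))"
    and m2: "has_moments M (\<lambda>\<omega>. hermite (n - 1) (X h \<omega>) * K (field \<omega>))"
    and m3: "has_moments M (\<lambda>\<omega>. X h \<omega> * (hermite n (X h \<omega>) * K (field \<omega>)))"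
    by (intro has_moments_mult X_moments mh mD mom)+
  note i = has_moments_integrable[OF m1] has_moments_integrable[OF m2] has_moments_integrable[OF m3]
  have "(\<integral>\<omega>. X h \<omega> * ?g (field \<omega>) \<partial>M) = (\<integral>\<omega>. ?D (field \<omega>) \<bullet> h \<partial>M)"
  proof (rule integration_by_parts[OF pd])
    show "integrable M (\<lambda>\<omega>. ?g (field \<omega>))" by (intro has_moments_integrable has_moments_mult mh mom)
    show "integrable M (\<lambda>\<omega>. ?D (field \<omega>) \<bullet> h)" unfolding Dh using i by simp
  qed (use i in simp)
  then have e: "(\<integral>\<omega>. X h \<omega> * (hermite n (X h \<omega>) * K (field \<omega>)) \<partial>M)
      = (\<integral>\<omega>. hermite n (X h \<omega>) * (D (field \<omega>) \<bullet> h) \<partial>M) + real n * (\<integral>\<omega>. hermite (n - 1) (X h \<omega>) * K (field \<omega>) \<partial>M)"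
    unfolding Dh using i by simp
  have "(\<integral>\<omega>. hermite q (X h \<omega>) * K (field \<omega>) \<partial>M)
     = (\<integral>\<omega>. X h \<omega> * (hermite n (X h \<omega>) * K (field \<omega>)) - real n * (hermite (n - 1) (X h \<omega>) * K (field \<omega>)) \<partial>M)"
    unfolding q by (rule Bochner_Integration.integral_cong) (cases n; auto simp: algebra_simps)+
  also have "\<dots> = (\<integral>\<omega>. hermite n (X h \<omega>) * (D (field \<omega>) \<bullet> h) \<partial>M)" using e i by simp
  finally show ?thesis unfolding q by (simp add: inner_commute)
qed

end

section \<open>Smooth functions of finitely many coordinates\<close>

text \<open>The chain rule along a line, with the coordinates released one at a time. Releasing one
  more is a problem in two variables restricted to the diagonal, where continuity of the partial
  derivative in the new variable gives total differentiability.\<close>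

lemma DERIV_coordinates:
  fixes g :: "(nat \<Rightarrow> real) \<Rightarrow> real"
  assumes cont: "\<And>i. i < n \<Longrightarrow> continuous_on UNIV (d i)"
    and D: "\<And>i x. i < n \<Longrightarrow> DERIV (\<lambda>t. g (x(i := t))) (x i) :> d i x"
    and m: "m \<le> n"
  shows "DERIV (\<lambda>t. g (\<lambda>i. y i + (if i < m then t * a i else 0))) 0 :> (\<Sum>i<m. d i y * a i)"
  using m
proof (induction m)
  case 0
  show ?case by simp
next
  case (Suc m)
  \<comment> \<open>The first m coordinates move with s, coordinate m moves with t; the diagonal s =
    t is the line of the next stage.\<close>
  define z where "z s t = (\<lambda>i. y i + (if i < m then s * a i else if i = m then t * a m else 0))" for s t
  define S where "S = (\<Sum>i<m. d i y * a i)"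
  have z0: "z 0 0 = y" by (auto simp: z_def)
  have zs: "z s 0 = (\<lambda>i. y i + (if i < m then s * a i else 0))" for s by (auto simp: z_def)
  have zt: "(z s t)(m := y m + t' * a m) = z s t'" for s t t' by (auto simp: z_def fun_eq_iff)
  have fx: "((\<lambda>s. g (z s 0)) has_derivative (*) S) (at 0 within UNIV)"
    using Suc unfolding zs S_def by (simp add: has_field_derivative_def)
  have fy: "((\<lambda>t. g (z s t)) has_derivative blinfun_apply (blinfun_mult_right (d m (z s t) * a m))) (at t within UNIV)" for s t
  proof -
    have "DERIV (\<lambda>u. g ((z s t)(m := u))) (y m + t * a m) :> d m (z s t)"
      using D[of m "z s t"] Suc(2) by (simp add: z_def)
    moreover have "DERIV (\<lambda>t'. y m + t' * a m) t :> a m" by (auto intro!: derivative_eq_intros)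
    ultimately have "DERIV (\<lambda>t'. g ((z s t)(m := y m + t' * a m))) t :> d m (z s t) * a m"
      by (rule DERIV_chain2)
    then show ?thesis unfolding zt by (simp add: has_field_derivative_def)
  qed
  have cz: "continuous_on UNIV (\<lambda>p. z (fst p) (snd p))"
  proof (rule continuous_on_coordinatewise_then_product)
    fix i show "continuous_on UNIV (\<lambda>p. z (fst p) (snd p) i)"
      unfolding z_def by (cases "i < m"; cases "i = m") (auto intro!: continuous_intros)
  qed
  have "continuous_on UNIV (\<lambda>p. d m (z (fst p) (snd p)))"
    by (rule continuous_on_compose2[OF cont[of m] cz]) (use Suc(2) in auto)
  then have "isCont (\<lambda>p. d m (z (fst p) (snd p))) (0, 0)"
    by (simp add: continuous_on_eq_continuous_at)
  then have "isCont (\<lambda>p. blinfun_mult_right (d m (z (fst p) (snd p)) * a m)) (0, 0)"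
    by (intro bounded_linear.isCont[OF bounded_linear_blinfun_mult_right] continuous_intros)
  then have fyc: "continuous (at (0, 0) within UNIV \<times> UNIV) (\<lambda>(s, t). blinfun_mult_right (d m (z s t) * a m))"
    by (simp add: case_prod_unfold)
  have "((\<lambda>(s, t). g (z s t)) has_derivative (\<lambda>(ts, tt). S * ts + blinfun_mult_right (d m (z 0 0) * a m) tt))
      (at (0, 0) within UNIV \<times> UNIV)"
    by (rule has_derivative_partialsI[OF fx fy fyc]) auto
  then have "((\<lambda>(s, t). g (z s t)) has_derivative (\<lambda>(ts, tt). S * ts + d m y * a m * tt)) (at ((\<lambda>t. (t, t)) 0))"
    by (simp add: z0)
  moreover have "((\<lambda>t::real. (t, t)) has_derivative (\<lambda>t. (t, t))) (at 0)"
    by (auto intro!: derivative_eq_intros)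
  ultimately have "((\<lambda>t. g (z t t)) has_derivative (\<lambda>t. S * t + d m y * a m * t)) (at 0)"
    using diff_chain_at[of "\<lambda>t::real. (t, t)" "\<lambda>t. (t, t)" 0 "\<lambda>(s, t). g (z s t)" "\<lambda>(ts, tt). S * ts + d m y * a m * tt"]
    by (simp add: o_def)
  moreover have "z t t = (\<lambda>i. y i + (if i < Suc m then t * a i else 0))" for t
    by (auto simp: z_def less_Suc_eq fun_eq_iff)
  moreover have "(\<lambda>t. S * t + d m y * a m * t) = (*) (\<Sum>i<Suc m. d i y * a i)"
    by (auto simp: S_def distrib_right)
  ultimately show ?case by (simp add: has_field_derivative_def)
qed

text \<open>The box bounds only the first \<open>n\<close> coordinates and is not compact in the
  sequence space. Setting the others to 0 leaves \<open>g\<close> unchanged and leads into a compact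
  product of intervals.\<close>

lemma bounded_box_support:
  fixes g :: "(nat \<Rightarrow> real) \<Rightarrow> real"
  assumes cont: "continuous_on UNIV g" and dep: "\<And>x y. (\<And>i. i < n \<Longrightarrow> x i = y i) \<Longrightarrow> g x = g y"
    and supp: "\<And>x i. i < n \<Longrightarrow> K < \<bar>x i\<bar> \<Longrightarrow> g x = 0"
  obtains B where "\<And>x. \<bar>g x\<bar> \<le> B"
proof -
  define S where "S = PiE UNIV (\<lambda>i::nat. if i < n then {-K..K} else {0::real})"
  have "compactin (product_topology (\<lambda>_. euclidean) UNIV) S"
    unfolding S_def compactin_PiE by auto
  then have "compact S" unfolding euclidean_product_topology by simp
  then have "compact (g ` S)" using cont by (intro compact_continuous_image) (auto intro: continuous_on_subset)
  then obtain B where B: "\<And>x. x \<in> S \<Longrightarrow> \<bar>g x\<bar> \<le> B"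
    by (fastforce dest!: compact_imp_bounded simp: bounded_iff)
  have "\<bar>g x\<bar> \<le> max B 0" for x
  proof (cases "\<forall>i<n. \<bar>x i\<bar> \<le> K")
    case True
    then have "- K \<le> x i \<and> x i \<le> K" if "i < n" for i using that by (simp add: abs_le_iff minus_le_iff)
    then have "(\<lambda>i. if i < n then x i else 0) \<in> S" by (auto simp: S_def)
    moreover have "g x = g (\<lambda>i. if i < n then x i else 0)" by (rule dep) simp
    ultimately show ?thesis using B by (fastforce simp: max_def)
  next
    case False
    then show ?thesis using supp[of _ x] by force
  qed
  with that show ?thesis .
qed

text \<open>Only orders 0 and 1 of smoothness are used later. A partial derivative inherits both the
  dependence on finitely many coordinates and the vanishing outside the box, hence it is bounded as
  well.\<close>

lemma smooth_compact_supportD: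
  assumes "smooth_compact_support n g"
  shows "continuous_on UNIV g" "i < n \<Longrightarrow> continuous_on UNIV (partial_deriv i g)"
    "i < n \<Longrightarrow> DERIV (\<lambda>t. g (x(i := t))) (x i) :> partial_deriv i g x"
    "(\<And>i. i < n \<Longrightarrow> x i = y i) \<Longrightarrow> g x = g y"
    "\<exists>B. \<forall>x. \<bar>g x\<bar> \<le> B" "i < n \<Longrightarrow> \<exists>B. \<forall>x. \<bar>partial_deriv i g x\<bar> \<le> B"
proof -
  have dep: "\<And>x y. (\<And>i. i < n \<Longrightarrow> x i = y i) \<Longrightarrow> g x = g y"
    and sm: "\<And>is. set is \<subseteq> {..<n} \<Longrightarrow> continuous_on UNIV (foldr partial_deriv is g) \<and>
        (\<forall>i<n. \<forall>x. (\<lambda>t. foldr partial_deriv is g (x(i := t))) differentiable (at (x i)))"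
    using assms unfolding smooth_compact_support_def by blast+
  obtain K where K: "\<And>x i. g x \<noteq> 0 \<Longrightarrow> i < n \<Longrightarrow> \<bar>x i\<bar> \<le> K"
    using assms unfolding smooth_compact_support_def by blast
  show c0: "continuous_on UNIV g" using sm[of "[]"] by simp
  show c1: "continuous_on UNIV (partial_deriv i g)" if "i < n" for i using sm[of "[i]"] that by simp
  show D: "DERIV (\<lambda>t. g (x(i := t))) (x i) :> partial_deriv i g x" if "i < n" for i x
    using sm[of "[]"] that unfolding partial_deriv_def by (simp add: DERIV_deriv_iff_real_differentiable)
  show "g x = g y" if "\<And>i. i < n \<Longrightarrow> x i = y i" using dep that .
  have supp: "\<And>x i. i < n \<Longrightarrow> K < \<bar>x i\<bar> \<Longrightarrow> g x = 0" using K by force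
  show "\<exists>B. \<forall>x. \<bar>g x\<bar> \<le> B"
  proof (rule bounded_box_support[OF c0 dep supp])
    fix B assume "\<And>x. \<bar>g x\<bar> \<le> B"
    then show ?thesis by blast
  qed
  show "\<exists>B. \<forall>x. \<bar>partial_deriv i g x\<bar> \<le> B" if i: "i < n"
  proof -
    have dep': "partial_deriv i g x = partial_deriv i g y" if "\<And>j. j < n \<Longrightarrow> x j = y j" for x y
    proof -
      have "(\<lambda>t. g (x(i := t))) = (\<lambda>t. g (y(i := t)))" by (rule ext, rule dep) (use that in auto)
      then show ?thesis using that[OF i] by (simp add: partial_deriv_def)
    qed
    have supp': "partial_deriv i g x = 0" if j: "j < n" "K < \<bar>x j\<bar>" for x j
    proof -
      have "DERIV (\<lambda>t. g (x(i := t))) (x i) :> 0"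
      proof (cases "j = i")
        case False
        then have "(\<lambda>t. g (x(i := t))) = (\<lambda>t. 0)" using supp[OF j(1)] j(2) by auto
        then show ?thesis by simp
      next
        case True
        \<comment> \<open>In direction i itself, \<open>g\<close> vanishes on a whole neighbourhood
          because the outside of the box is open.\<close>
        show ?thesis
        proof (rule has_field_derivative_transform_within_open[of "\<lambda>_. 0" _ _ "{t. K < \<bar>t\<bar>}"])
          show "open {t. K < \<bar>t\<bar>}" by (intro open_Collect_less continuous_intros)
          show "\<And>t. t \<in> {t. K < \<bar>t\<bar>} \<Longrightarrow> 0 = g (x(i := t))" using supp[OF i] by fastforce
        qed (use j True in auto)
      qed
      then show ?thesis unfolding partial_deriv_def by (rule DERIV_imp_deriv)
    qed
    show ?thesis
    proof (rule bounded_box_support[OF c1[OF i] dep' supp'])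
      fix B assume "\<And>x. \<bar>partial_deriv i g x\<bar> \<le> B"
      then show ?thesis by blast
    qed
  qed
qed

text \<open>The sequence has countably many coordinates, so the Borel sets of the sequence space
  form the product sigma-algebra.\<close>

lemma continuous_imp_measurable_sequence:
  fixes g :: "(nat \<Rightarrow> real) \<Rightarrow> real" and \<phi> :: "nat \<Rightarrow> 'h"
  assumes "continuous_on UNIV g"
  shows "(\<lambda>x. g (\<lambda>i. x (\<phi> i))) \<in> borel_measurable (field_space :: ('h \<Rightarrow> real) measure)"
proof -
  have "(\<lambda>x. (\<lambda>i. x (\<phi> i))) \<in> measurable (field_space :: ('h \<Rightarrow> real) measure) (PiM UNIV (\<lambda>_::nat. borel :: real measure))"
    by (rule measurable_PiM_single') auto
  then have "(\<lambda>x. (\<lambda>i. x (\<phi> i))) \<in> measurable (field_space :: ('h \<Rightarrow> real) measure) (borel :: (nat \<Rightarrow> real) measure)"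
    using measurable_cong_sets[OF refl sets_PiM_equal_borel] by blast
  then show ?thesis by (rule measurable_compose) (rule borel_measurable_continuous_onI[OF assms])
qed

lemma path_deriv_smooth:
  fixes \<phi> :: "nat \<Rightarrow> 'h::{real_inner,banach,second_countable_topology}"
  assumes "smooth_compact_support n g"
  shows "path_deriv (\<lambda>x. g (\<lambda>i. x (\<phi> i))) (\<lambda>x. \<Sum>i<n. partial_deriv i g (\<lambda>j. x (\<phi> j)) *\<^sub>R \<phi> i)"
  unfolding path_deriv_def
proof (intro conjI allI)
  note g = smooth_compact_supportD[OF assms]
  show "(\<lambda>x. g (\<lambda>i. x (\<phi> i))) \<in> borel_measurable field_space"
    by (rule continuous_imp_measurable_sequence[OF g(1)])
  show "(\<lambda>x. \<Sum>i<n. partial_deriv i g (\<lambda>j. x (\<phi> j)) *\<^sub>R \<phi> i) \<in> borel_measurable field_space"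
    by (intro borel_measurable_sum borel_measurable_scaleR borel_measurable_const
        continuous_imp_measurable_sequence g(2)) auto
  fix x :: "'h \<Rightarrow> real" and h :: 'h
  let ?y = "\<lambda>i. x (\<phi> i)" and ?a = "\<lambda>i. \<phi> i \<bullet> h"
  have "DERIV (\<lambda>t. g (\<lambda>i. ?y i + (if i < n then t * ?a i else 0))) 0 :> (\<Sum>i<n. partial_deriv i g ?y * ?a i)"
    by (rule DERIV_coordinates[of n], rule g(2), assumption, rule g(3), assumption, rule order_refl)
  moreover have "g (\<lambda>i. ?y i + (if i < n then t * ?a i else 0)) = g (\<lambda>i. shift x h t (\<phi> i))" for t
    by (rule g(4)) (simp add: shift_apply)
  ultimately show "DERIV (\<lambda>t. g (\<lambda>i. shift x h t (\<phi> i))) 0 :> (\<Sum>i<n. partial_deriv i g (\<lambda>j. x (\<phi> j)) *\<^sub>R \<phi> i) \<bullet> h"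
    by (simp add: inner_sum_left)
  have "continuous_on UNIV (\<lambda>t. \<Sum>i<n. partial_deriv i g (\<lambda>j. shift x h t (\<phi> j)) *\<^sub>R \<phi> i)"
  proof (intro continuous_on_sum continuous_on_scaleR continuous_on_const)
    fix i assume i: "i \<in> {..<n}"
    have "continuous_on UNIV (\<lambda>t j. shift x h t (\<phi> j))"
      unfolding shift_apply by (intro continuous_intros)
    then show "continuous_on UNIV (\<lambda>t. partial_deriv i g (\<lambda>j. shift x h t (\<phi> j)))"
      using continuous_on_compose2[OF g(2)[of i]] i by fastforce
  qed
  then show "isCont (\<lambda>t. \<Sum>i<n. partial_deriv i g (\<lambda>j. shift x h t (\<phi> j)) *\<^sub>R \<phi> i) 0"
    by (simp add: continuous_on_eq_continuous_at)
qed

section \<open>A smooth bump function\<close>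

text \<open>The classical flat function exp (-1/x), with a polynomial in 1/x in front so that the
  family is closed under differentiation.\<close>

definition flat :: "real poly \<Rightarrow> real \<Rightarrow> real" where
  "flat p x = (if x \<le> 0 then 0 else poly p (1 / x) * exp (- (1 / x)))"

lemma poly_times_exp_tendsto_0: "((\<lambda>u. poly p u * exp (- u :: real)) \<longlongrightarrow> 0) at_top"
proof -
  have "((\<lambda>u. u ^ k * poly p u * exp (- u :: real)) \<longlongrightarrow> 0) at_top" for k
  proof (induction p arbitrary: k rule: pCons_induct)
    case 0
    show ?case by simp
  next
    case (pCons a p)
    have "((\<lambda>u. a * (u ^ k / exp u) + u ^ Suc k * poly p u * exp (- u)) \<longlongrightarrow> a * 0 + 0) at_top"
      by (intro tendsto_add tendsto_mult tendsto_const tendsto_power_div_exp_0 pCons.IH)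
    then show ?case by (simp add: algebra_simps exp_minus divide_inverse)
  qed
  from this[of 0] show ?thesis by simp
qed

text \<open>With u = 1/x one has u' = -u^2, so p(u) exp(-u) is taken to u^2 (p - p')(u) exp(-u), the
  polynomial in the statement. At 0 the right difference quotient is u p(u) exp(-u), which tends to
  0.\<close>

lemma DERIV_flat: "DERIV (flat p) x :> flat ([:0, 0, 1:] * (p - pderiv p)) x"
proof -
  consider "x < 0" | "x > 0" | "x = 0" by linarith
  then show ?thesis
  proof cases
    case 1
    have "DERIV (flat p) x :> 0"
      by (rule has_field_derivative_transform_within_open[of "\<lambda>_. 0" _ _ "{..<0}"]) (use 1 in \<open>auto simp: flat_def\<close>)
    then show ?thesis using 1 by (simp add: flat_def)
  next
    case 2
    have "DERIV (\<lambda>x. poly p (1 / x) * exp (- (1 / x))) x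
        :> poly (pderiv p) (1 / x) * (- (1 / x\<^sup>2)) * exp (- (1 / x)) + poly p (1 / x) * (exp (- (1 / x)) * (1 / x\<^sup>2))"
    proof -
      have i: "DERIV (\<lambda>x. 1 / x) x :> - (1 / x\<^sup>2)"
        using 2 by (auto intro!: derivative_eq_intros simp: power2_eq_square)
      have a: "DERIV (\<lambda>x. poly p (1 / x)) x :> poly (pderiv p) (1 / x) * (- (1 / x\<^sup>2))"
        by (rule DERIV_chain2[OF poly_DERIV i])
      have b: "DERIV (\<lambda>x. exp (- (1 / x))) x :> exp (- (1 / x)) * (1 / x\<^sup>2)"
        using DERIV_chain2[OF DERIV_exp DERIV_minus[OF i]] by simp
      show ?thesis using DERIV_mult[OF a b] by (simp add: algebra_simps)
    qed
    then have "DERIV (flat p) x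
        :> poly (pderiv p) (1 / x) * (- (1 / x\<^sup>2)) * exp (- (1 / x)) + poly p (1 / x) * (exp (- (1 / x)) * (1 / x\<^sup>2))"
      by (rule has_field_derivative_transform_within_open[of _ _ _ "{0<..}"]) (use 2 in \<open>auto simp: flat_def\<close>)
    then show ?thesis using 2 by (simp add: flat_def power2_eq_square field_simps)
  next
    case 3
    have "((\<lambda>u. poly ([:0, 1:] * p) u * exp (- u)) \<longlongrightarrow> 0) at_top" by (rule poly_times_exp_tendsto_0)
    then have "((\<lambda>h. poly ([:0, 1:] * p) (inverse h) * exp (- inverse h)) \<longlongrightarrow> 0) (at_right (0::real))"
      by (rule filterlim_compose[OF _ filterlim_inverse_at_top_right])
    then have r: "((\<lambda>h. flat p h / h) \<longlongrightarrow> 0) (at_right 0)"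
      by (rule Lim_transform_eventually)
         (auto simp: eventually_at_filter flat_def field_simps intro!: always_eventually)
    have l: "((\<lambda>h. flat p h / h) \<longlongrightarrow> 0) (at_left 0)"
      by (rule tendsto_eventually) (auto simp: eventually_at_filter flat_def intro!: always_eventually)
    have "((\<lambda>h. flat p h / h) \<longlongrightarrow> 0) (at 0)" using l r by (rule filterlim_split_at)
    then show ?thesis using 3 by (simp add: DERIV_def flat_def)
  qed
qed

text \<open>A class generated by rules: one derivative that stays in the class already yields
  derivatives of all orders. The flat functions enter with affine arguments so that they can vanish
  on either side of a point.\<close>

inductive_set smooth_functions :: "(real \<Rightarrow> real) set" where
  flat: "(\<lambda>x. flat p (a * x + b)) \<in> smooth_functions"
| const: "(\<lambda>_. c) \<in> smooth_functions"
| ident: "(\<lambda>x. x) \<in> smooth_functions"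
| add: "u \<in> smooth_functions \<Longrightarrow> v \<in> smooth_functions \<Longrightarrow> (\<lambda>x. u x + v x) \<in> smooth_functions"
| mult: "u \<in> smooth_functions \<Longrightarrow> v \<in> smooth_functions \<Longrightarrow> (\<lambda>x. u x * v x) \<in> smooth_functions"

lemma smooth_functions_deriv:
  "u \<in> smooth_functions \<Longrightarrow> \<exists>v\<in>smooth_functions. \<forall>x. DERIV u x :> v x"
proof (induction rule: smooth_functions.induct)
  case (flat p a b)
  let ?q = "[:0, 0, 1:] * (p - pderiv p)"
  have "DERIV (\<lambda>x. flat p (a * x + b)) x :> flat ?q (a * x + b) * a" for x
    by (rule DERIV_chain2[OF DERIV_flat]) (auto intro!: derivative_eq_intros)
  then show ?case
    by (intro bexI[of _ "\<lambda>x. flat ?q (a * x + b) * a"] smooth_functions.intros allI)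
next
  case (const c)
  then show ?case by (intro bexI[of _ "\<lambda>_. 0"]) (auto intro: smooth_functions.intros)
next
  case ident
  then show ?case by (intro bexI[of _ "\<lambda>_. 1"]) (auto intro: smooth_functions.intros)
next
  case (add u v)
  then obtain u' v' where "u' \<in> smooth_functions" "v' \<in> smooth_functions"
    "\<And>x. DERIV u x :> u' x" "\<And>x. DERIV v x :> v' x" by blast
  then show ?case
    by (intro bexI[of _ "\<lambda>x. u' x + v' x"]) (auto intro: smooth_functions.intros DERIV_add)
next
  case (mult u v)
  then obtain u' v' where "u' \<in> smooth_functions" "v' \<in> smooth_functions"
    "\<And>x. DERIV u x :> u' x" "\<And>x. DERIV v x :> v' x" by blast
  with mult show ?case
    by (intro bexI[of _ "\<lambda>x. u' x * v x + v' x * u x"]) (auto intro: smooth_functions.intros DERIV_mult)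
qed

lemma smooth_functions_continuous: "u \<in> smooth_functions \<Longrightarrow> continuous_on UNIV u"
  using smooth_functions_deriv DERIV_isCont by (metis continuous_at_imp_continuous_on)

lemma smooth_functions_scale:
  "u \<in> smooth_functions \<Longrightarrow> (\<lambda>x. u (c * x)) \<in> smooth_functions"
proof (induction rule: smooth_functions.induct)
  case (flat p a b)
  show ?case using smooth_functions.flat[of p "a * c" b] by (simp add: mult.assoc)
qed (auto intro: smooth_functions.intros)

lemma smooth_functions_hermite: "hermite q \<in> smooth_functions"
proof (induction q rule: induct_nat_012)
  case (ge2 n)
  have "(\<lambda>x. x * hermite (Suc n) x + (- real (Suc n)) * hermite n x) \<in> smooth_functions"
    using ge2 by (intro smooth_functions.intros)
  moreover have "(\<lambda>x. x * hermite (Suc n) x + (- real (Suc n)) * hermite n x) = hermite (Suc (Suc n))"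
    by (auto simp: fun_eq_iff algebra_simps)
  ultimately show ?case by (simp only:)
next
  case 0
  have "hermite 0 = (\<lambda>_. 1)" by auto
  then show ?case by (simp add: smooth_functions.const)
next
  case 1
  have "hermite (Suc 0) = (\<lambda>x. x)" by auto
  then show ?case by (simp add: smooth_functions.ident)
qed

lemma bump_exists:
  obtains \<beta> \<beta>' B where "\<beta> \<in> smooth_functions" "\<And>x. DERIV \<beta> x :> \<beta>' x" "\<beta> 0 = 1"
    "\<And>x. \<bar>x\<bar> \<ge> 1 \<Longrightarrow> \<beta> x = 0" "\<And>x. \<bar>\<beta> x\<bar> \<le> B" "\<And>x. \<bar>\<beta>' x\<bar> \<le> B"
proof -
  \<comment> \<open>Each flat factor equals exp (-1) at 0, hence the normalisation by exp 2; one
    factor vanishes for x \<le> -1, the other for x \<ge> 1.\<close>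
  define \<beta> where "\<beta> = (\<lambda>x. exp 2 * (flat 1 (1 * x + 1) * flat 1 ((-1) * x + 1)))"
  have sm: "\<beta> \<in> smooth_functions" unfolding \<beta>_def by (intro smooth_functions.intros)
  obtain \<beta>' where \<beta>': "\<beta>' \<in> smooth_functions" "\<And>x. DERIV \<beta> x :> \<beta>' x"
    using smooth_functions_deriv[OF sm] by blast
  have 0: "\<beta> 0 = 1" by (simp add: \<beta>_def flat_def exp_add[symmetric])
  have supp: "\<beta> x = 0" if "\<bar>x\<bar> \<ge> 1" for x using that by (auto simp: \<beta>_def flat_def)
  have supp': "\<beta>' x = 0" if "\<bar>x\<bar> > 1" for x
  proof -
    have "DERIV \<beta> x :> 0"
    proof (rule has_field_derivative_transform_within_open[of "\<lambda>_. 0" _ _ "{t. 1 < \<bar>t\<bar>}"])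
      show "open {t::real. 1 < \<bar>t\<bar>}" by (intro open_Collect_less continuous_intros)
    qed (use that supp in auto)
    with \<beta>'(2) show ?thesis by (rule DERIV_unique)
  qed
  have bd: "\<exists>B. \<forall>x. \<bar>v x\<bar> \<le> B" if "v \<in> smooth_functions" "\<And>x. \<bar>x\<bar> > 1 \<Longrightarrow> v x = 0" for v
  proof -
    have "compact (v ` {-1..1})"
      using smooth_functions_continuous[OF that(1)] by (intro compact_continuous_image) (auto intro: continuous_on_subset)
    then obtain B where B: "\<And>x. x \<in> {-1..1} \<Longrightarrow> \<bar>v x\<bar> \<le> B"
      by (fastforce dest!: compact_imp_bounded simp: bounded_iff)
    have "\<bar>v x\<bar> \<le> max B 0" for x
      using B[of x] that(2)[of x] by (cases "\<bar>x\<bar> \<le> 1") (auto simp: abs_le_iff max_def)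
    then show ?thesis by blast
  qed
  obtain B1 where B1: "\<And>x. \<bar>\<beta> x\<bar> \<le> B1" using bd[OF sm] supp by force
  obtain B2 where B2: "\<And>x. \<bar>\<beta>' x\<bar> \<le> B2" using bd[OF \<beta>'(1)] supp' by force
  show ?thesis
    by (rule that[OF sm \<beta>'(2) 0 supp, of "max B1 B2"]) (use B1 B2 in \<open>auto simp: le_max_iff_disj\<close>)
qed

section \<open>Cylinder functions and their truncation to compact support\<close>

inductive_set cylinder_functions :: "nat \<Rightarrow> ((nat \<Rightarrow> real) \<Rightarrow> real) set" for n where
  coord: "u \<in> smooth_functions \<Longrightarrow> i < n \<Longrightarrow> (\<lambda>x. u (x i)) \<in> cylinder_functions n"
| const: "(\<lambda>_. c) \<in> cylinder_functions n"
| add: "f \<in> cylinder_functions n \<Longrightarrow> g \<in> cylinder_functions n \<Longrightarrow> (\<lambda>x. f x + g x) \<in> cylinder_functions n"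
| mult: "f \<in> cylinder_functions n \<Longrightarrow> g \<in> cylinder_functions n \<Longrightarrow> (\<lambda>x. f x * g x) \<in> cylinder_functions n"

lemma cylinder_functions_dep:
  "g \<in> cylinder_functions n \<Longrightarrow> (\<And>i. i < n \<Longrightarrow> x i = y i) \<Longrightarrow> g x = g y"
  by (induction rule: cylinder_functions.induct) auto

lemma cylinder_functions_continuous: "g \<in> cylinder_functions n \<Longrightarrow> continuous_on UNIV g"
proof (induction rule: cylinder_functions.induct)
  case (coord u i)
  show ?case
    by (rule continuous_on_compose2[OF smooth_functions_continuous[OF coord(1)]]) auto
qed (auto intro!: continuous_intros)

lemma cylinder_functions_deriv:
  assumes "g \<in> cylinder_functions n" "i < n"
  shows "partial_deriv i g \<in> cylinder_functions n"
    "DERIV (\<lambda>t. g (x(i := t))) (x i) :> partial_deriv i g x"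
proof -
  have "\<exists>d\<in>cylinder_functions n. \<forall>x. DERIV (\<lambda>t. g (x(i := t))) (x i) :> d x"
    using assms(1)
  proof (induction rule: cylinder_functions.induct)
    case (coord u j)
    obtain u' where u': "u' \<in> smooth_functions" "\<And>x. DERIV u x :> u' x"
      using smooth_functions_deriv[OF coord(1)] by blast
    show ?case
    proof (cases "j = i")
      case True
      then show ?thesis using u' assms(2)
        by (intro bexI[of _ "\<lambda>x. u' (x i)"]) (auto intro: cylinder_functions.intros)
    next
      case False
      then show ?thesis by (intro bexI[of _ "\<lambda>_. 0"]) (auto intro: cylinder_functions.intros)
    qed
  next
    case (const c)
    then show ?case by (intro bexI[of _ "\<lambda>_. 0"]) (auto intro: cylinder_functions.intros)
  next
    case (add f g)
    then obtain f' g' where d: "f' \<in> cylinder_functions n" "g' \<in> cylinder_functions n"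
      "\<And>x. DERIV (\<lambda>t. f (x(i := t))) (x i) :> f' x" "\<And>x. DERIV (\<lambda>t. g (x(i := t))) (x i) :> g' x" by blast
    have "DERIV (\<lambda>t. f (x(i := t)) + g (x(i := t))) (x i) :> f' x + g' x" for x
      by (rule DERIV_add[OF d(3,4)])
    then have "\<forall>x. DERIV (\<lambda>t. f (x(i := t)) + g (x(i := t))) (x i) :> f' x + g' x" by blast
    then show ?case
      by (rule bexI[where x="\<lambda>x. f' x + g' x"]) (intro cylinder_functions.intros d)
  next
    case (mult f g)
    then obtain f' g' where d: "f' \<in> cylinder_functions n" "g' \<in> cylinder_functions n"
      "\<And>x. DERIV (\<lambda>t. f (x(i := t))) (x i) :> f' x" "\<And>x. DERIV (\<lambda>t. g (x(i := t))) (x i) :> g' x" by blast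
    have "DERIV (\<lambda>t. f (x(i := t)) * g (x(i := t))) (x i) :> f' x * g x + g' x * f x" for x
      using DERIV_mult[OF d(3)[of x] d(4)[of x]] by (simp del: fun_upd_apply)
    then have "\<forall>x. DERIV (\<lambda>t. f (x(i := t)) * g (x(i := t))) (x i) :> f' x * g x + g' x * f x" by blast
    then show ?case
      by (rule bexI[where x="\<lambda>x. f' x * g x + g' x * f x"]) (intro cylinder_functions.intros d mult)
  qed
  then obtain d where d: "d \<in> cylinder_functions n" "\<And>x. DERIV (\<lambda>t. g (x(i := t))) (x i) :> d x" by blast
  have "partial_deriv i g = d"
    unfolding partial_deriv_def using DERIV_imp_deriv[OF d(2)] by auto
  with d show "partial_deriv i g \<in> cylinder_functions n"
    "DERIV (\<lambda>t. g (x(i := t))) (x i) :> partial_deriv i g x" by auto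
qed

text \<open>All iterated partial derivatives remain in the class, where continuity and
  differentiability are known; only the support has to be assumed.\<close>

lemma cylinder_functions_smooth:
  assumes g: "g \<in> cylinder_functions n" and K: "\<And>x i. i < n \<Longrightarrow> K < \<bar>x i\<bar> \<Longrightarrow> g x = 0"
  shows "smooth_compact_support n g"
  unfolding smooth_compact_support_def
proof (intro conjI allI impI)
  fix x y :: "nat \<Rightarrow> real" assume "\<forall>i<n. x i = y i"
  then show "g x = g y" using cylinder_functions_dep[OF g] by blast
next
  have it: "foldr partial_deriv is g \<in> cylinder_functions n" if "set is \<subseteq> {..<n}" for "is"
    using that by (induction "is") (auto simp: g cylinder_functions_deriv)
  fix "is" assume "is": "set is \<subseteq> {..<n}"
  show "continuous_on UNIV (foldr partial_deriv is g)"
    by (rule cylinder_functions_continuous[OF it[OF "is"]])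
  show "(\<lambda>t. foldr partial_deriv is g (x(i := t))) differentiable at (x i)" if "i < n" for i x
    using cylinder_functions_deriv(2)[OF it[OF "is"] that] real_differentiable_def by blast
next
  show "\<exists>K. \<forall>x. g x \<noteq> 0 \<longrightarrow> (\<forall>i<n. \<bar>x i\<bar> \<le> K)"
    by (rule exI[of _ K]) (use K in force)
qed

lemma cylinder_functions_sum:
  "(\<And>i. i \<in> I \<Longrightarrow> f i \<in> cylinder_functions n) \<Longrightarrow> (\<lambda>x. \<Sum>i\<in>I. f i x) \<in> cylinder_functions n"
  by (induction I rule: infinite_finite_induct) (auto intro: cylinder_functions.intros)

lemma cylinder_functions_prod:
  "(\<And>i. i \<in> I \<Longrightarrow> f i \<in> cylinder_functions n) \<Longrightarrow> (\<lambda>x. \<Prod>i\<in>I. f i x) \<in> cylinder_functions n"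
  by (induction I rule: infinite_finite_induct) (auto intro: cylinder_functions.intros)

lemma L2_tendsto_dominated:
  fixes f :: "nat \<Rightarrow> 'a \<Rightarrow> 'e::{banach,second_countable_topology}"
  assumes [measurable]: "\<And>k. f k \<in> borel_measurable M" "g \<in> borel_measurable M"
    and W: "square_integrable M (W :: 'a \<Rightarrow> real)"
    and lim: "AE x in M. (\<lambda>k. f k x) \<longlonglongrightarrow> g x"
    and bd: "\<And>k x. norm (f k x) \<le> W x" "\<And>x. norm (g x) \<le> W x"
  shows "L2_tendsto M f g"
  unfolding L2_tendsto_def
proof (intro conjI allI)
  have W0: "0 \<le> W x" for x using norm_ge_zero bd(2) order_trans by blast
  show "square_integrable M (f k)" for k
    by (rule square_integrable_bound[OF W]) (use bd W0 in auto)
  show "square_integrable M g"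
    by (rule square_integrable_bound[OF W]) (use bd W0 in auto)
  have [measurable]: "W \<in> borel_measurable M" using W by auto
  have "(\<lambda>k. \<integral>x. (norm (f k x - g x))\<^sup>2 \<partial>M) \<longlonglongrightarrow> (\<integral>x. 0 \<partial>M)"
  proof (rule integral_dominated_convergence)
    show "integrable M (\<lambda>x. 4 * (W x)\<^sup>2)" using W by (simp add: square_integrable_def)
    show "AE x in M. (\<lambda>k. (norm (f k x - g x))\<^sup>2) \<longlonglongrightarrow> 0"
      using lim
    proof eventually_elim
      case (elim x)
      then have "(\<lambda>k. norm (f k x - g x)) \<longlonglongrightarrow> 0"
        using tendsto_norm_zero[of "\<lambda>k. f k x - g x"] LIM_zero by blast
      from tendsto_power[OF this, of 2] show ?case by simp
    qed
    show "AE x in M. norm ((norm (f k x - g x))\<^sup>2) \<le> 4 * (W x)\<^sup>2" for k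
    proof (rule AE_I2)
      fix x
      have "norm (f k x - g x) \<le> 2 * W x"
        using norm_triangle_ineq4[of "f k x" "g x"] bd(1)[of k x] bd(2)[of x] by linarith
      then have "(norm (f k x - g x))\<^sup>2 \<le> (2 * W x)\<^sup>2" by (rule power_mono) simp
      then show "norm ((norm (f k x - g x))\<^sup>2) \<le> 4 * (W x)\<^sup>2" by (simp add: power_mult_distrib)
    qed
  qed auto
  then show "(\<lambda>k. \<integral>x. (norm (f k x - g x))\<^sup>2 \<partial>M) \<longlonglongrightarrow> 0" by simp
qed

lemma is_malliavin_derivI:
  "(\<And>k. smooth_functional_deriv X (F' k) (U' k)) \<Longrightarrow> L2_tendsto M F' F \<Longrightarrow> L2_tendsto M U' U \<Longrightarrow>
    is_malliavin_deriv M X F U"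
  unfolding is_malliavin_deriv_def by blast

text \<open>Malliavin derivatives are defined through compactly supported functions, while
  polynomials are needed. A product of cutoffs varying on scale k + 1 is inserted: differentiating
  it costs a factor \<open>c k\<close>, which tends to 0, and all terms are dominated by
  \<open>p\<close> and its partial derivatives.\<close>

lemma (in isonormal_process) malliavin_deriv_cylinder:
  assumes n: "n \<ge> 1" and p: "p \<in> cylinder_functions n"
    and sq: "square_integrable M (\<lambda>\<omega>. p (\<lambda>i. X (\<phi> i) \<omega>))"
      "\<And>i. i < n \<Longrightarrow> square_integrable M (\<lambda>\<omega>. partial_deriv i p (\<lambda>i. X (\<phi> i) \<omega>))"
  shows "is_malliavin_deriv M X (\<lambda>\<omega>. p (\<lambda>i. X (\<phi> i) \<omega>))
    (\<lambda>\<omega>. \<Sum>i<n. partial_deriv i p (\<lambda>j. X (\<phi> j) \<omega>) *\<^sub>R \<phi> i)"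
proof -
  obtain \<beta> \<beta>' B where b: "\<beta> \<in> smooth_functions" "\<And>x. DERIV \<beta> x :> \<beta>' x" "\<beta> 0 = 1"
    "\<And>x. \<bar>x\<bar> \<ge> 1 \<Longrightarrow> \<beta> x = 0" "\<And>x. \<bar>\<beta> x\<bar> \<le> B" "\<And>x. \<bar>\<beta>' x\<bar> \<le> B"
    by (rule bump_exists, rule that)
  have B1: "B \<ge> 1" using b(3) b(5)[of 0] by simp
  define c where "c k = inverse (real (Suc k))" for k
  have c0: "c \<longlonglongrightarrow> 0" unfolding c_def by (rule LIMSEQ_inverse_real_of_nat)
  have cb: "0 < c k" "c k \<le> 1" for k by (auto simp: c_def inverse_le_1_iff)
  define T where "T k x = (\<Prod>i<n. \<beta> (c k * x i))" for k and x :: "nat \<Rightarrow> real"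
  \<comment> \<open>The cutoff without the factor of coordinate i. It does not depend on that
    coordinate, so differentiation in \<open>x i\<close> touches a single factor.\<close>
  define R where "R k i x = (\<Prod>j\<in>{..<n} - {i}. \<beta> (c k * x j))" for k i and x :: "nat \<Rightarrow> real"
  define g where "g k = (\<lambda>x. p x * T k x)" for k
  have Tc: "T k \<in> cylinder_functions n" for k
    unfolding T_def
    by (intro cylinder_functions_prod cylinder_functions.coord[of "\<lambda>x. \<beta> (c k * x)"] smooth_functions_scale b(1)) auto
  have gc: "g k \<in> cylinder_functions n" for k
    unfolding g_def by (intro cylinder_functions.mult p Tc)
  have TR: "T k x = \<beta> (c k * x i) * R k i x" if "i < n" for k x i
    unfolding T_def R_def using that by (subst prod.remove[of _ i]) auto
  have Tb: "\<bar>T k x\<bar> \<le> B ^ n" for k x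
  proof -
    have "\<bar>T k x\<bar> \<le> (\<Prod>i<n. B)" unfolding T_def abs_prod by (rule prod_mono) (use b(5) in auto)
    then show ?thesis by simp
  qed
  have Rb: "\<bar>R k i x\<bar> \<le> B ^ n" for k i x
  proof -
    have "\<bar>R k i x\<bar> \<le> (\<Prod>j\<in>{..<n} - {i}. B)" unfolding R_def abs_prod by (rule prod_mono) (use b(5) in auto)
    also have "\<dots> \<le> B ^ n"
    proof -
      have "card ({..<n} - {i}) \<le> n" using card_mono[of "{..<n}" "{..<n} - {i}"] by auto
      then show ?thesis using B1 by (simp add: power_increasing)
    qed
    finally show ?thesis .
  qed
  have pd: "partial_deriv i (g k) x = p x * (c k * \<beta>' (c k * x i) * R k i x) + T k x * partial_deriv i p x"
    if i: "i < n" for i k x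
  proof -
    have d1: "DERIV (\<lambda>t. \<beta> (c k * t)) (x i) :> c k * \<beta>' (c k * x i)"
    proof -
      have "DERIV (\<lambda>t. c k * t) (x i) :> c k" by (auto intro!: derivative_eq_intros)
      from DERIV_chain2[OF b(2) this] show ?thesis by (simp add: mult.commute)
    qed
    have "T k (x(i := t)) = \<beta> (c k * t) * R k i x" for t
      unfolding TR[OF i] by (simp add: R_def)
    moreover have "DERIV (\<lambda>t. p (x(i := t)) * (\<beta> (c k * t) * R k i x)) (x i) :>
       p (x(i := x i)) * (c k * \<beta>' (c k * x i) * R k i x) + partial_deriv i p x * (\<beta> (c k * x i) * R k i x)"
      using DERIV_mult[OF cylinder_functions_deriv(2)[OF p i, of x] DERIV_cmult_right[OF d1, of "R k i x"]]
      by (simp add: ac_simps del: fun_upd_apply)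
    ultimately have "DERIV (\<lambda>t. g k (x(i := t))) (x i) :>
       p x * (c k * \<beta>' (c k * x i) * R k i x) + T k x * partial_deriv i p x"
      unfolding g_def TR[OF i, of k x] by (simp add: mult.commute del: fun_upd_apply add: fun_upd_triv)
    then show ?thesis unfolding partial_deriv_def by (rule DERIV_imp_deriv)
  qed
  have smooth: "smooth_compact_support n (g k)" for k
  proof (rule cylinder_functions_smooth[OF gc, where K="real (Suc k)"])
    fix x :: "nat \<Rightarrow> real" and i assume i: "i < n" "real (Suc k) < \<bar>x i\<bar>"
    have "1 \<le> \<bar>c k * x i\<bar>" using i(2) unfolding c_def abs_mult by (simp add: field_simps)
    then have "\<beta> (c k * x i) = 0" by (rule b(4))
    then show "g k x = 0" unfolding g_def TR[OF i(1)] by simp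
  qed
  have cl: "(\<lambda>k. \<beta> (c k * y)) \<longlonglongrightarrow> 1" for y
  proof -
    have "(\<lambda>k. c k * y) \<longlonglongrightarrow> 0" using tendsto_mult_right[OF c0, of y] by simp
    from isCont_tendsto_compose[OF DERIV_isCont[OF b(2)] this] show ?thesis by (simp add: b(3))
  qed
  have Tl: "(\<lambda>k. T k x) \<longlonglongrightarrow> 1" for x
    unfolding T_def using tendsto_prod[of "{..<n}" "\<lambda>i k. \<beta> (c k * x i)" "\<lambda>_. 1"] cl by simp
  have Dl: "(\<lambda>k. c k * \<beta>' (c k * y) * R k i x) \<longlonglongrightarrow> 0" for y i x
  proof (rule Lim_null_comparison[OF always_eventually[OF allI]])
    show "(\<lambda>k. c k * (B * B ^ n)) \<longlonglongrightarrow> 0" using tendsto_mult_right[OF c0] by simp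
    show "norm (c k * \<beta>' (c k * y) * R k i x) \<le> c k * (B * B ^ n)" for k
      unfolding real_norm_def abs_mult using cb(1)[of k] b(6) Rb B1
      by (auto simp: mult.assoc intro!: mult_left_mono mult_mono)
  qed
  let ?Y = "\<lambda>\<omega> i. X (\<phi> i) \<omega>"
  have meas: "(\<lambda>\<omega>. f (?Y \<omega>)) \<in> borel_measurable M" if "f \<in> cylinder_functions n" for f
    using measurable_compose[OF field_measurable continuous_imp_measurable_sequence[OF cylinder_functions_continuous[OF that], of \<phi>]]
    by simp
  have Bn: "1 \<le> B ^ n" using B1 by simp
  have F: "L2_tendsto M (\<lambda>k \<omega>. g k (?Y \<omega>)) (\<lambda>\<omega>. p (?Y \<omega>))"
  proof (rule L2_tendsto_dominated)
    show "square_integrable M (\<lambda>\<omega>. B ^ n * \<bar>p (?Y \<omega>)\<bar>)"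
      using square_integrable_norm[OF sq(1)] by (intro square_integrable_cmult) simp
    show "AE \<omega> in M. (\<lambda>k. g k (?Y \<omega>)) \<longlonglongrightarrow> p (?Y \<omega>)"
      unfolding g_def using tendsto_mult_left[OF Tl] by simp
    show "norm (g k (?Y \<omega>)) \<le> B ^ n * \<bar>p (?Y \<omega>)\<bar>" for k \<omega>
      unfolding g_def real_norm_def abs_mult
      using mult_left_mono[OF Tb[of k "?Y \<omega>"], of "\<bar>p (?Y \<omega>)\<bar>"] by (simp add: ac_simps)
    show "norm (p (?Y \<omega>)) \<le> B ^ n * \<bar>p (?Y \<omega>)\<bar>" for \<omega>
      using mult_right_mono[OF Bn, of "\<bar>p (?Y \<omega>)\<bar>"] by simp
  qed (intro meas gc p)+
  have U: "L2_tendsto M (\<lambda>k \<omega>. \<Sum>i<n. partial_deriv i (g k) (?Y \<omega>) *\<^sub>R \<phi> i)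
      (\<lambda>\<omega>. \<Sum>i<n. partial_deriv i p (?Y \<omega>) *\<^sub>R \<phi> i)"
  proof (rule L2_tendsto_dominated)
    let ?W = "\<lambda>\<omega>. \<Sum>i<n. norm (\<phi> i) * (B * B ^ n * \<bar>p (?Y \<omega>)\<bar> + B ^ n * \<bar>partial_deriv i p (?Y \<omega>)\<bar>)"
    have "square_integrable M (\<lambda>\<omega>. \<bar>p (?Y \<omega>)\<bar>)" "\<And>i. i < n \<Longrightarrow> square_integrable M (\<lambda>\<omega>. \<bar>partial_deriv i p (?Y \<omega>)\<bar>)"
      using square_integrable_norm[OF sq(1)] square_integrable_norm[OF sq(2)] by simp_all
    then show "square_integrable M ?W"
      by (intro square_integrable_sum square_integrable_cmult square_integrable_add) auto
    show "(\<lambda>\<omega>. \<Sum>i<n. partial_deriv i (g k) (?Y \<omega>) *\<^sub>R \<phi> i) \<in> borel_measurable M" for k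
      by (intro borel_measurable_sum borel_measurable_scaleR borel_measurable_const meas cylinder_functions_deriv gc) auto
    show "(\<lambda>\<omega>. \<Sum>i<n. partial_deriv i p (?Y \<omega>) *\<^sub>R \<phi> i) \<in> borel_measurable M"
      by (intro borel_measurable_sum borel_measurable_scaleR borel_measurable_const meas cylinder_functions_deriv p) auto
    show "AE \<omega> in M. (\<lambda>k. \<Sum>i<n. partial_deriv i (g k) (?Y \<omega>) *\<^sub>R \<phi> i) \<longlonglongrightarrow> (\<Sum>i<n. partial_deriv i p (?Y \<omega>) *\<^sub>R \<phi> i)"
    proof (intro AE_I2 tendsto_sum tendsto_scaleR tendsto_const)
      fix \<omega> i assume "i \<in> {..<n}"
      then have i: "i < n" by simp
      have "(\<lambda>k. p (?Y \<omega>) * (c k * \<beta>' (c k * ?Y \<omega> i) * R k i (?Y \<omega>)) + T k (?Y \<omega>) * partial_deriv i p (?Y \<omega>))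
          \<longlonglongrightarrow> p (?Y \<omega>) * 0 + 1 * partial_deriv i p (?Y \<omega>)"
        by (rule tendsto_add[OF tendsto_mult[OF tendsto_const Dl] tendsto_mult[OF Tl tendsto_const]])
      then show "(\<lambda>k. partial_deriv i (g k) (?Y \<omega>)) \<longlonglongrightarrow> partial_deriv i p (?Y \<omega>)"
        unfolding pd[OF i] by simp
    qed
    show "norm (\<Sum>i<n. partial_deriv i (g k) (?Y \<omega>) *\<^sub>R \<phi> i) \<le> ?W \<omega>" for k \<omega>
    proof (rule sum_norm_le)
      fix i assume "i \<in> {..<n}"
      then have i: "i < n" by simp
      have "\<bar>c k * \<beta>' (c k * ?Y \<omega> i) * R k i (?Y \<omega>)\<bar> \<le> (1 * B) * B ^ n"
        unfolding abs_mult using cb[of k] b(6) Rb B1 by (intro mult_mono) auto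
      then have "\<bar>p (?Y \<omega>) * (c k * \<beta>' (c k * ?Y \<omega> i) * R k i (?Y \<omega>))\<bar> \<le> B * B ^ n * \<bar>p (?Y \<omega>)\<bar>"
        unfolding abs_mult[of "p (?Y \<omega>)"] using mult_right_mono[of _ "1 * B * B ^ n" "\<bar>p (?Y \<omega>)\<bar>"]
        by (simp add: mult.commute[of "\<bar>p (?Y \<omega>)\<bar>"])
      moreover have "\<bar>T k (?Y \<omega>) * partial_deriv i p (?Y \<omega>)\<bar> \<le> B ^ n * \<bar>partial_deriv i p (?Y \<omega>)\<bar>"
        unfolding abs_mult using Tb by (rule mult_right_mono) simp
      ultimately have "\<bar>partial_deriv i (g k) (?Y \<omega>)\<bar> \<le> B * B ^ n * \<bar>p (?Y \<omega>)\<bar> + B ^ n * \<bar>partial_deriv i p (?Y \<omega>)\<bar>"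
        unfolding pd[OF i] by linarith
      then show "norm (partial_deriv i (g k) (?Y \<omega>) *\<^sub>R \<phi> i)
          \<le> norm (\<phi> i) * (B * B ^ n * \<bar>p (?Y \<omega>)\<bar> + B ^ n * \<bar>partial_deriv i p (?Y \<omega>)\<bar>)"
        unfolding norm_scaleR mult.commute[of "norm (\<phi> i)"] by (rule mult_right_mono) simp
    qed
    show "norm (\<Sum>i<n. partial_deriv i p (?Y \<omega>) *\<^sub>R \<phi> i) \<le> ?W \<omega>" for \<omega>
    proof (rule sum_norm_le)
      fix i
      have "\<bar>partial_deriv i p (?Y \<omega>)\<bar> \<le> B ^ n * \<bar>partial_deriv i p (?Y \<omega>)\<bar>"
        using mult_right_mono[OF Bn, of "\<bar>partial_deriv i p (?Y \<omega>)\<bar>"] by simp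
      moreover have "0 \<le> B * B ^ n * \<bar>p (?Y \<omega>)\<bar>" using B1 by simp
      ultimately have "\<bar>partial_deriv i p (?Y \<omega>)\<bar> \<le> B * B ^ n * \<bar>p (?Y \<omega>)\<bar> + B ^ n * \<bar>partial_deriv i p (?Y \<omega>)\<bar>"
        by linarith
      then show "norm (partial_deriv i p (?Y \<omega>) *\<^sub>R \<phi> i)
          \<le> norm (\<phi> i) * (B * B ^ n * \<bar>p (?Y \<omega>)\<bar> + B ^ n * \<bar>partial_deriv i p (?Y \<omega>)\<bar>)"
        unfolding norm_scaleR mult.commute[of "norm (\<phi> i)"] by (rule mult_right_mono) simp
    qed
  qed
  have "smooth_functional_deriv X (\<lambda>\<omega>. g k (?Y \<omega>)) (\<lambda>\<omega>. \<Sum>i<n. partial_deriv i (g k) (?Y \<omega>) *\<^sub>R \<phi> i)" for k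
    unfolding smooth_functional_deriv_def using n smooth[of k] by blast
  from is_malliavin_derivI[OF this F U] show ?thesis .
qed

section \<open>Finite Hermite sums\<close>

text \<open>Degrees up to \<open>N\<close> occur together because partial sums of a chaos expansion
  mix them.\<close>

definition hermite_sum :: "(nat \<Rightarrow> 'h \<Rightarrow> real) \<Rightarrow> 'h set \<Rightarrow> nat \<Rightarrow> ('h \<Rightarrow> real) \<Rightarrow> real" where
  "hermite_sum c S N x = (\<Sum>h\<in>S. \<Sum>q\<le>N. c q h * hermite q (x h))"

definition hermite_grad :: "(nat \<Rightarrow> 'h::real_vector \<Rightarrow> real) \<Rightarrow> 'h set \<Rightarrow> nat \<Rightarrow> ('h \<Rightarrow> real) \<Rightarrow> 'h" where
  "hermite_grad c S N x = (\<Sum>h\<in>S. (\<Sum>q\<le>N. c q h * (real q * hermite (q - 1) (x h))) *\<^sub>R h)"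

text \<open>The image of a Hermite sum under \<open>- L\<close>, where \<open>L\<close> is the Ornstein--Uhlenbeck generator.\<close>

definition hermite_number :: "(nat \<Rightarrow> 'h \<Rightarrow> real) \<Rightarrow> 'h set \<Rightarrow> nat \<Rightarrow> ('h \<Rightarrow> real) \<Rightarrow> real" where
  "hermite_number c S N x = (\<Sum>h\<in>S. \<Sum>q\<le>N. c q h * (real q * hermite q (x h)))"

lemma path_deriv_hermite_sum: "path_deriv (hermite_sum c S N) (hermite_grad c S N)"
proof -
  have "path_deriv (\<lambda>x. \<Sum>h\<in>S. \<Sum>q\<le>N. c q h * hermite q (x h))
      (\<lambda>x. \<Sum>h\<in>S. \<Sum>q\<le>N. c q h *\<^sub>R ((real q * hermite (q - 1) (x h)) *\<^sub>R h))"
    by (intro path_deriv_sum path_deriv_cmult path_deriv_hermite)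
  then show ?thesis
    unfolding hermite_sum_def[abs_def] hermite_grad_def[abs_def] scaleR_scaleR scaleR_left.sum .
qed

context isonormal_process
begin

lemma hermite_moments: "has_moments M (\<lambda>\<omega>. hermite q (X h \<omega>))"
  by (rule has_moments_hermite[OF X_moments])

lemma hermite_sum_moments:
  "has_moments M (\<lambda>\<omega>. hermite_sum c S N (field \<omega>))"
  "has_moments M (\<lambda>\<omega>. hermite_number c S N (field \<omega>))"
  "has_moments M (\<lambda>\<omega>. norm (hermite_grad c S N (field \<omega>)))"
proof -
  show "has_moments M (\<lambda>\<omega>. hermite_sum c S N (field \<omega>))"
    "has_moments M (\<lambda>\<omega>. hermite_number c S N (field \<omega>))"
    unfolding hermite_sum_def hermite_number_def
    by (intro has_moments_sum has_moments_mult has_moments_const hermite_moments)+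
  let ?W = "\<lambda>\<omega>. \<Sum>h\<in>S. \<bar>\<Sum>q\<le>N. c q h * (real q * hermite (q - 1) (X h \<omega>))\<bar> * norm h"
  have W: "has_moments M ?W"
    by (intro has_moments_sum has_moments_mult has_moments_const hermite_moments has_moments_norm)
  show "has_moments M (\<lambda>\<omega>. norm (hermite_grad c S N (field \<omega>)))"
  proof (rule has_moments_mono[OF W])
    show "(\<lambda>\<omega>. norm (hermite_grad c S N (field \<omega>))) \<in> borel_measurable M"
      unfolding hermite_grad_def by measurable
    have le: "norm (hermite_grad c S N (field \<omega>)) \<le> ?W \<omega>" for \<omega>
      unfolding hermite_grad_def by (rule sum_norm_le) simp
    then show "\<bar>norm (hermite_grad c S N (field \<omega>))\<bar> \<le> \<bar>?W \<omega>\<bar>" for \<omega>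
      using order_trans[OF le abs_ge_self, of \<omega>] by (simp only: abs_norm_cancel)
  qed
qed

lemma hermite_sum_square_integrable:
  "square_integrable M (\<lambda>\<omega>. hermite_sum c S N (field \<omega>))"
  "square_integrable M (\<lambda>\<omega>. hermite_number c S N (field \<omega>))"
  "square_integrable M (\<lambda>\<omega>. hermite_grad c S N (field \<omega>))"
proof -
  show "square_integrable M (\<lambda>\<omega>. hermite_sum c S N (field \<omega>))"
    "square_integrable M (\<lambda>\<omega>. hermite_number c S N (field \<omega>))"
    by (intro has_moments_square_integrable hermite_sum_moments)+
  show "square_integrable M (\<lambda>\<omega>. hermite_grad c S N (field \<omega>))"
  proof (rule square_integrable_bound[OF has_moments_square_integrable[OF hermite_sum_moments(3)]])
    show "(\<lambda>\<omega>. hermite_grad c S N (field \<omega>)) \<in> borel_measurable M"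
      unfolding hermite_grad_def by measurable
  qed auto
qed

text \<open>This is - L = \<delta> D, with \<delta> the adjoint of D, tested against
  \<open>K\<close>: a term of degree q is reproduced with the factor q when the divergence of its
  gradient is taken.\<close>

lemma hermite_sum_integration_by_parts:
  assumes S: "\<And>h. h \<in> S \<Longrightarrow> norm h = 1" and K: "path_deriv K D"
    and mom: "has_moments M (\<lambda>\<omega>. K (field \<omega>))" "has_moments M (\<lambda>\<omega>. norm (D (field \<omega>)))"
  shows "(\<integral>\<omega>. hermite_number c S N (field \<omega>) * K (field \<omega>) \<partial>M)
    = (\<integral>\<omega>. hermite_grad c S N (field \<omega>) \<bullet> D (field \<omega>) \<partial>M)"
proof -
  note [measurable] = path_derivD(1,2)[OF K]
  have mD: "has_moments M (\<lambda>\<omega>. h \<bullet> D (field \<omega>))" if "h \<in> S" for h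
    by (rule has_moments_mono[OF mom(2)]) (use S[OF that] Cauchy_Schwarz_ineq2[of h] in auto)
  have i1: "integrable M (\<lambda>\<omega>. c q h * (real q * (hermite q (X h \<omega>) * K (field \<omega>))))" for q h
    by (intro has_moments_integrable has_moments_mult has_moments_const hermite_moments mom)
  have i2: "integrable M (\<lambda>\<omega>. c q h * (real q * ((hermite (q - 1) (X h \<omega>) *\<^sub>R h) \<bullet> D (field \<omega>))))" if "h \<in> S" for q h
    unfolding inner_scaleR_left
    by (intro has_moments_integrable has_moments_mult has_moments_const hermite_moments mD that)
  have "(\<integral>\<omega>. hermite_number c S N (field \<omega>) * K (field \<omega>) \<partial>M)
    = (\<integral>\<omega>. (\<Sum>h\<in>S. \<Sum>q\<le>N. c q h * (real q * (hermite q (X h \<omega>) * K (field \<omega>)))) \<partial>M)"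
    by (simp add: hermite_number_def sum_distrib_right mult.assoc)
  also have "\<dots> = (\<Sum>h\<in>S. \<Sum>q\<le>N. \<integral>\<omega>. c q h * (real q * (hermite q (X h \<omega>) * K (field \<omega>))) \<partial>M)"
    using i1 by (simp add: Bochner_Integration.integral_sum Bochner_Integration.integrable_sum)
  also have "\<dots> = (\<Sum>h\<in>S. \<Sum>q\<le>N. \<integral>\<omega>. c q h * (real q * ((hermite (q - 1) (X h \<omega>) *\<^sub>R h) \<bullet> D (field \<omega>))) \<partial>M)"
  proof (intro sum.cong refl)
    fix h q assume h: "h \<in> S"
    show "(\<integral>\<omega>. c q h * (real q * (hermite q (X h \<omega>) * K (field \<omega>))) \<partial>M)
      = (\<integral>\<omega>. c q h * (real q * ((hermite (q - 1) (X h \<omega>) *\<^sub>R h) \<bullet> D (field \<omega>))) \<partial>M)"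
    \<comment> \<open>Degree 0 contributes nothing to either side because of the factor q, and the
      formula for one Hermite polynomial starts at degree 1.\<close>
    proof (cases "q = 0")
      case False
      then show ?thesis using hermite_integration_by_parts[OF S[OF h] _ K mom, of q] by simp
    qed simp
  qed
  also have "\<dots> = (\<integral>\<omega>. (\<Sum>h\<in>S. \<Sum>q\<le>N. c q h * (real q * ((hermite (q - 1) (X h \<omega>) *\<^sub>R h) \<bullet> D (field \<omega>)))) \<partial>M)"
    using i2 by (simp add: Bochner_Integration.integral_sum Bochner_Integration.integrable_sum)
  also have "\<dots> = (\<integral>\<omega>. hermite_grad c S N (field \<omega>) \<bullet> D (field \<omega>) \<partial>M)"
    by (simp add: hermite_grad_def inner_sum_left sum_distrib_right mult.assoc)
  finally show ?thesis .
qed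

lemma malliavin_deriv_hermite_sum:
  assumes S: "finite S"
  shows "is_malliavin_deriv M X (\<lambda>\<omega>. hermite_sum c S N (field \<omega>)) (\<lambda>\<omega>. hermite_grad c S N (field \<omega>))"
proof -
  have main: "is_malliavin_deriv M X (\<lambda>\<omega>. hermite_sum c S N (field \<omega>)) (\<lambda>\<omega>. hermite_grad c S N (field \<omega>))"
    if S: "finite S" "S \<noteq> {}" for c S
  proof -
    define n where "n = card S"
    have n: "n \<ge> 1" using S by (simp add: n_def Suc_le_eq card_gt_0_iff)
    obtain \<phi> where \<phi>: "bij_betw \<phi> {..<n} S"
      using ex_bij_betw_nat_finite[OF S(1)] by (auto simp: n_def atLeast0LessThan)
    define p where "p = (\<lambda>x. \<Sum>i<n. \<Sum>q\<le>N. c q (\<phi> i) * hermite q (x i))"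
    have pc: "p \<in> cylinder_functions n"
      unfolding p_def
      by (intro cylinder_functions_sum cylinder_functions.mult cylinder_functions.const
          cylinder_functions.coord smooth_functions_hermite) simp
    have pd: "partial_deriv i p x = (\<Sum>q\<le>N. c q (\<phi> i) * (real q * hermite (q - 1) (x i)))" if i: "i < n" for i x
    proof -
      have "p (x(i := t)) = (\<Sum>q\<le>N. c q (\<phi> i) * hermite q t) + (\<Sum>j\<in>{..<n} - {i}. \<Sum>q\<le>N. c q (\<phi> j) * hermite q (x j))" for t
        unfolding p_def using i by (subst sum.remove[of _ i]) auto
      moreover have "DERIV (\<lambda>t. (\<Sum>q\<le>N. c q (\<phi> i) * hermite q t)
          + (\<Sum>j\<in>{..<n} - {i}. \<Sum>q\<le>N. c q (\<phi> j) * hermite q (x j))) (x i)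
          :> (\<Sum>q\<le>N. c q (\<phi> i) * (real q * hermite (q - 1) (x i))) + 0"
        by (intro DERIV_add DERIV_const DERIV_sum DERIV_cmult DERIV_hermite)
      ultimately have "DERIV (\<lambda>t. p (x(i := t))) (x i) :> (\<Sum>q\<le>N. c q (\<phi> i) * (real q * hermite (q - 1) (x i)))"
        by (simp del: fun_upd_apply)
      then show ?thesis unfolding partial_deriv_def by (rule DERIV_imp_deriv)
    qed
    have e1: "p (\<lambda>i. X (\<phi> i) \<omega>) = hermite_sum c S N (field \<omega>)" for \<omega>
      unfolding p_def hermite_sum_def
      using sum.reindex_bij_betw[OF \<phi>, of "\<lambda>h. \<Sum>q\<le>N. c q h * hermite q (X h \<omega>)"] .
    have e2: "(\<Sum>i<n. partial_deriv i p (\<lambda>j. X (\<phi> j) \<omega>) *\<^sub>R \<phi> i) = hermite_grad c S N (field \<omega>)" for \<omega>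
      unfolding hermite_grad_def
      using sum.reindex_bij_betw[OF \<phi>, of "\<lambda>h. (\<Sum>q\<le>N. c q h * (real q * hermite (q - 1) (X h \<omega>))) *\<^sub>R h"]
      by (simp add: pd)
    have "is_malliavin_deriv M X (\<lambda>\<omega>. p (\<lambda>i. X (\<phi> i) \<omega>))
        (\<lambda>\<omega>. \<Sum>i<n. partial_deriv i p (\<lambda>j. X (\<phi> j) \<omega>) *\<^sub>R \<phi> i)"
    proof (rule malliavin_deriv_cylinder[OF n pc])
      show "square_integrable M (\<lambda>\<omega>. p (\<lambda>i. X (\<phi> i) \<omega>))"
        unfolding e1 by (rule hermite_sum_square_integrable)
      show "square_integrable M (\<lambda>\<omega>. partial_deriv i p (\<lambda>i. X (\<phi> i) \<omega>))" if "i < n" for i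
        unfolding pd[OF that]
        by (intro has_moments_square_integrable has_moments_sum has_moments_mult has_moments_const hermite_moments)
    qed
    then show ?thesis unfolding e1 e2 .
  qed
  show ?thesis
  proof (cases "S = {}")
    case True
    \<comment> \<open>A smooth functional uses at least one coordinate, so the empty sum is
      represented by the vector 0 with vanishing coefficients.\<close>
    have "is_malliavin_deriv M X (\<lambda>\<omega>. hermite_sum (\<lambda>_ _. 0) {0} N (field \<omega>)) (\<lambda>\<omega>. hermite_grad (\<lambda>_ _. 0) {0} N (field \<omega>))"
      by (rule main) auto
    then show ?thesis using True by (simp add: hermite_sum_def hermite_grad_def)
  qed (rule main[OF S])
qed

end

section \<open>Uniqueness of the Malliavin derivative\<close>

context isonormal_process
begin

text \<open>Integration by parts against \<open>cos (X \<psi>)\<close> and \<open>sin (X \<psi>)\<close> determines a derivative from its primitive.\<close>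

definition weak_deriv :: "('a \<Rightarrow> real) \<Rightarrow> ('a \<Rightarrow> 'h) \<Rightarrow> bool" where
  "weak_deriv G U \<longleftrightarrow> square_integrable M G \<and> square_integrable M U \<and>
     (\<forall>T T' \<phi> \<psi>. (\<forall>y. DERIV T y :> T' y) \<and> (\<forall>y. isCont T' y) \<and> (\<forall>y. \<bar>T y\<bar> \<le> 1) \<and> (\<forall>y. \<bar>T' y\<bar> \<le> 1) \<longrightarrow>
       (\<integral>\<omega>. U \<omega> \<bullet> (T (X \<psi> \<omega>) *\<^sub>R \<phi>) \<partial>M)
         = (\<integral>\<omega>. G \<omega> \<bullet> (X \<phi> \<omega> * T (X \<psi> \<omega>) - T' (X \<psi> \<omega>) * (\<psi> \<bullet> \<phi>)) \<partial>M))"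

text \<open>Integration by parts is applied to the product of \<open>g\<close> with
  \<open>T (X \<psi>)\<close>; the product rule produces the term with \<open>T'\<close>.\<close>

lemma weak_deriv_path_deriv:
  assumes g: "path_deriv g D"
    and mom: "has_moments M (\<lambda>\<omega>. g (field \<omega>))" "has_moments M (\<lambda>\<omega>. norm (D (field \<omega>)))"
  shows "weak_deriv (\<lambda>\<omega>. g (field \<omega>)) (\<lambda>\<omega>. D (field \<omega>))"
  unfolding weak_deriv_def
proof (intro conjI allI impI)
  note [measurable] = path_derivD(1,2)[OF g]
  show "square_integrable M (\<lambda>\<omega>. g (field \<omega>))" by (rule has_moments_square_integrable[OF mom(1)])
  show "square_integrable M (\<lambda>\<omega>. D (field \<omega>))"
    by (rule square_integrable_bound[OF has_moments_square_integrable[OF mom(2)]]) auto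
  fix T T' :: "real \<Rightarrow> real" and \<phi> \<psi> :: 'h
  assume T: "(\<forall>y. DERIV T y :> T' y) \<and> (\<forall>y. isCont T' y) \<and> (\<forall>y. \<bar>T y\<bar> \<le> 1) \<and> (\<forall>y. \<bar>T' y\<bar> \<le> 1)"
  have [measurable]: "T \<in> borel_measurable borel" "T' \<in> borel_measurable borel"
    using T DERIV_isCont by (auto intro!: borel_measurable_continuous_onI continuous_at_imp_continuous_on)
  have mT: "has_moments M (\<lambda>\<omega>. T (X \<psi> \<omega>))" "has_moments M (\<lambda>\<omega>. T' (X \<psi> \<omega>))"
    by (rule has_moments_bounded[of _ 1]; use T in simp)+
  have mD: "has_moments M (\<lambda>\<omega>. D (field \<omega>) \<bullet> \<phi>)"
    by (rule has_moments_mono[OF has_moments_mult[OF mom(2) has_moments_const[of "norm \<phi>"]]])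
       (auto simp: Cauchy_Schwarz_ineq2)
  have pT: "path_deriv (\<lambda>x. T (x \<psi>)) (\<lambda>x. T' (x \<psi>) *\<^sub>R \<psi>)"
    by (rule path_deriv_comp[OF path_deriv_coord]) (use T in auto)
  let ?D = "\<lambda>x. g x *\<^sub>R (T' (x \<psi>) *\<^sub>R \<psi>) + T (x \<psi>) *\<^sub>R D x"
  have pd: "path_deriv (\<lambda>x. g x * T (x \<psi>)) ?D" by (rule path_deriv_mult[OF g pT])
  have Dp: "?D (field \<omega>) \<bullet> \<phi> = g (field \<omega>) * (T' (X \<psi> \<omega>) * (\<psi> \<bullet> \<phi>)) + T (X \<psi> \<omega>) * (D (field \<omega>) \<bullet> \<phi>)" for \<omega>
    by (simp add: inner_add_left)
  have i1: "integrable M (\<lambda>\<omega>. g (field \<omega>) * (T' (X \<psi> \<omega>) * (\<psi> \<bullet> \<phi>)))"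
    and i2: "integrable M (\<lambda>\<omega>. T (X \<psi> \<omega>) * (D (field \<omega>) \<bullet> \<phi>))"
    and i3: "integrable M (\<lambda>\<omega>. X \<phi> \<omega> * (g (field \<omega>) * T (X \<psi> \<omega>)))"
    by (intro has_moments_integrable has_moments_mult mom mT mD X_moments has_moments_const)+
  have "(\<integral>\<omega>. X \<phi> \<omega> * (g (field \<omega>) * T (X \<psi> \<omega>)) \<partial>M) = (\<integral>\<omega>. ?D (field \<omega>) \<bullet> \<phi> \<partial>M)"
  proof (rule integration_by_parts[OF pd])
    show "integrable M (\<lambda>\<omega>. g (field \<omega>) * T (X \<psi> \<omega>))"
      by (intro has_moments_integrable has_moments_mult mom mT)
    show "integrable M (\<lambda>\<omega>. ?D (field \<omega>) \<bullet> \<phi>)" unfolding Dp using i1 i2 by simp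
  qed (rule i3)
  then have e: "(\<integral>\<omega>. X \<phi> \<omega> * (g (field \<omega>) * T (X \<psi> \<omega>)) \<partial>M)
     = (\<integral>\<omega>. g (field \<omega>) * (T' (X \<psi> \<omega>) * (\<psi> \<bullet> \<phi>)) \<partial>M) + (\<integral>\<omega>. T (X \<psi> \<omega>) * (D (field \<omega>) \<bullet> \<phi>) \<partial>M)"
    unfolding Dp using i1 i2 by simp
  have "(\<integral>\<omega>. g (field \<omega>) \<bullet> (X \<phi> \<omega> * T (X \<psi> \<omega>) - T' (X \<psi> \<omega>) * (\<psi> \<bullet> \<phi>)) \<partial>M)
    = (\<integral>\<omega>. X \<phi> \<omega> * (g (field \<omega>) * T (X \<psi> \<omega>)) - g (field \<omega>) * (T' (X \<psi> \<omega>) * (\<psi> \<bullet> \<phi>)) \<partial>M)"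
    by (simp add: algebra_simps)
  also have "\<dots> = (\<integral>\<omega>. T (X \<psi> \<omega>) * (D (field \<omega>) \<bullet> \<phi>) \<partial>M)" using e i1 i3 by simp
  finally show "(\<integral>\<omega>. D (field \<omega>) \<bullet> (T (X \<psi> \<omega>) *\<^sub>R \<phi>) \<partial>M)
      = (\<integral>\<omega>. g (field \<omega>) \<bullet> (X \<phi> \<omega> * T (X \<psi> \<omega>) - T' (X \<psi> \<omega>) * (\<psi> \<bullet> \<phi>)) \<partial>M)" by simp
qed

text \<open>Both sides of the defining identity are pairings with a fixed square-integrable
  function, hence continuous in L2.\<close>

lemma weak_deriv_closed:
  assumes G: "L2_tendsto M G' G" and U: "L2_tendsto M U' U" and w: "\<And>k. weak_deriv (G' k) (U' k)"
  shows "weak_deriv G U"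
  unfolding weak_deriv_def
proof (intro conjI allI impI)
  show "square_integrable M G" "square_integrable M U" using L2_tendstoD G U by blast+
  fix T T' :: "real \<Rightarrow> real" and \<phi> \<psi> :: 'h
  assume T: "(\<forall>y. DERIV T y :> T' y) \<and> (\<forall>y. isCont T' y) \<and> (\<forall>y. \<bar>T y\<bar> \<le> 1) \<and> (\<forall>y. \<bar>T' y\<bar> \<le> 1)"
  have [measurable]: "T \<in> borel_measurable borel" "T' \<in> borel_measurable borel"
    using T DERIV_isCont by (auto intro!: borel_measurable_continuous_onI continuous_at_imp_continuous_on)
  have mT: "has_moments M (\<lambda>\<omega>. T (X \<psi> \<omega>))" "has_moments M (\<lambda>\<omega>. T' (X \<psi> \<omega>))"
    by (rule has_moments_bounded[of _ 1]; use T in simp)+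
  have s1: "square_integrable M (\<lambda>\<omega>. T (X \<psi> \<omega>) *\<^sub>R \<phi>)"
    by (rule square_integrable_bound[OF has_moments_square_integrable[OF
          has_moments_mult[OF mT(1) has_moments_const[of "norm \<phi>"]]]]) (auto simp: abs_mult)
  have s2: "square_integrable M (\<lambda>\<omega>. X \<phi> \<omega> * T (X \<psi> \<omega>) - T' (X \<psi> \<omega>) * (\<psi> \<bullet> \<phi>))"
    by (intro square_integrable_diff has_moments_square_integrable has_moments_mult mT X_moments has_moments_const)
  note l = L2_tendsto_inner[OF U L2_tendsto_const[OF s1]] L2_tendsto_inner[OF G L2_tendsto_const[OF s2]]
  have "(\<integral>\<omega>. U' k \<omega> \<bullet> (T (X \<psi> \<omega>) *\<^sub>R \<phi>) \<partial>M)
      = (\<integral>\<omega>. G' k \<omega> \<bullet> (X \<phi> \<omega> * T (X \<psi> \<omega>) - T' (X \<psi> \<omega>) * (\<psi> \<bullet> \<phi>)) \<partial>M)" for k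
    using w[of k] T unfolding weak_deriv_def by blast
  with l(1) have "(\<lambda>k. \<integral>\<omega>. G' k \<omega> \<bullet> (X \<phi> \<omega> * T (X \<psi> \<omega>) - T' (X \<psi> \<omega>) * (\<psi> \<bullet> \<phi>)) \<partial>M)
      \<longlonglongrightarrow> (\<integral>\<omega>. U \<omega> \<bullet> (T (X \<psi> \<omega>) *\<^sub>R \<phi>) \<partial>M)" by (simp only:)
  from LIMSEQ_unique[OF this l(2)]
  show "(\<integral>\<omega>. U \<omega> \<bullet> (T (X \<psi> \<omega>) *\<^sub>R \<phi>) \<partial>M)
      = (\<integral>\<omega>. G \<omega> \<bullet> (X \<phi> \<omega> * T (X \<psi> \<omega>) - T' (X \<psi> \<omega>) * (\<psi> \<bullet> \<phi>)) \<partial>M)" .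
qed

text \<open>The difference of the two derivatives, paired with \<open>\<phi>\<close>, has vanishing
  cosine and sine transforms along every \<open>X h\<close>, so it is orthogonal to all bounded
  functionals of the field.\<close>

lemma weak_deriv_unique:
  assumes U: "weak_deriv G U" and W: "weak_deriv G W"
    and K: "K \<in> borel_measurable field_space" "\<And>x. \<bar>K x\<bar> \<le> B"
  shows "(\<integral>\<omega>. U \<omega> \<bullet> (K (field \<omega>) *\<^sub>R \<phi>) \<partial>M) = (\<integral>\<omega>. W \<omega> \<bullet> (K (field \<omega>) *\<^sub>R \<phi>) \<partial>M)"
proof -
  note [measurable] = K(1)
  have sU: "square_integrable M U" and sW: "square_integrable M W" using U W by (auto simp: weak_deriv_def)
  have sq: "square_integrable M (\<lambda>\<omega>. L (field \<omega>) *\<^sub>R \<phi>)"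
    if "L \<in> borel_measurable field_space" "\<And>x. \<bar>L x\<bar> \<le> C" for L :: "('h \<Rightarrow> real) \<Rightarrow> real" and C
  proof (rule square_integrable_bounded[where B="C * norm \<phi>"])
    show "(\<lambda>\<omega>. L (field \<omega>) *\<^sub>R \<phi>) \<in> borel_measurable M"
      using measurable_compose[OF field_measurable that(1)] by simp
    show "norm (L (field \<omega>) *\<^sub>R \<phi>) \<le> C * norm \<phi>" for \<omega>
      using that(2) by (simp add: mult_right_mono)
  qed
  define Z where "Z \<omega> = (U \<omega> - W \<omega>) \<bullet> \<phi>" for \<omega>
  have sc: "square_integrable M (\<lambda>\<omega>. \<phi>)" by (simp add: square_integrable_def)
  have iZ: "integrable M Z" unfolding Z_def
    by (rule inner_Cauchy_Schwarz(1)[OF square_integrable_diff[OF sU sW] sc])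
  have split: "(\<integral>\<omega>. L (field \<omega>) * Z \<omega> \<partial>M) = (\<integral>\<omega>. U \<omega> \<bullet> (L (field \<omega>) *\<^sub>R \<phi>) \<partial>M) - (\<integral>\<omega>. W \<omega> \<bullet> (L (field \<omega>) *\<^sub>R \<phi>) \<partial>M)"
      "integrable M (\<lambda>\<omega>. L (field \<omega>) * Z \<omega>)"
    if L: "L \<in> borel_measurable field_space" "\<And>x. \<bar>L x\<bar> \<le> C" for L C
  proof -
    note i = inner_Cauchy_Schwarz(1)[OF sU sq[OF L]] inner_Cauchy_Schwarz(1)[OF sW sq[OF L]]
    have e: "L (field \<omega>) * Z \<omega> = U \<omega> \<bullet> (L (field \<omega>) *\<^sub>R \<phi>) - W \<omega> \<bullet> (L (field \<omega>) *\<^sub>R \<phi>)" for \<omega>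
      by (simp add: Z_def inner_diff_left algebra_simps)
    show "integrable M (\<lambda>\<omega>. L (field \<omega>) * Z \<omega>)"
      "(\<integral>\<omega>. L (field \<omega>) * Z \<omega> \<partial>M) = (\<integral>\<omega>. U \<omega> \<bullet> (L (field \<omega>) *\<^sub>R \<phi>) \<partial>M) - (\<integral>\<omega>. W \<omega> \<bullet> (L (field \<omega>) *\<^sub>R \<phi>) \<partial>M)"
      unfolding e using i by simp_all
  qed
  have trig: "(\<integral>\<omega>. T (X h \<omega>) * Z \<omega> \<partial>M) = 0" "integrable M (\<lambda>\<omega>. T (X h \<omega>) * Z \<omega>)"
    if T: "\<forall>y. DERIV T y :> T' y" "\<forall>y. isCont T' y" "\<forall>y. \<bar>T y\<bar> \<le> 1" "\<forall>y. \<bar>T' y\<bar> \<le> 1" for T T' h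
  proof -
    have [measurable]: "T \<in> borel_measurable borel"
      using T(1) DERIV_isCont by (auto intro!: borel_measurable_continuous_onI continuous_at_imp_continuous_on)
    have Tm: "(\<lambda>x. T (x h)) \<in> borel_measurable field_space" by measurable
    have "(\<integral>\<omega>. U \<omega> \<bullet> (T (X h \<omega>) *\<^sub>R \<phi>) \<partial>M) = (\<integral>\<omega>. W \<omega> \<bullet> (T (X h \<omega>) *\<^sub>R \<phi>) \<partial>M)"
      using U W T unfolding weak_deriv_def by auto
    then show "(\<integral>\<omega>. T (X h \<omega>) * Z \<omega> \<partial>M) = 0" "integrable M (\<lambda>\<omega>. T (X h \<omega>) * Z \<omega>)"
      using split[OF Tm, of 1] T(3) by auto
  qed
  have c: "(\<integral>\<omega>. cos (X h \<omega>) * Z \<omega> \<partial>M) = 0" "integrable M (\<lambda>\<omega>. cos (X h \<omega>) * Z \<omega>)" for h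
    by (rule trig[of cos "\<lambda>y. - sin y" h]; auto intro!: derivative_eq_intros)+
  have s: "(\<integral>\<omega>. sin (X h \<omega>) * Z \<omega> \<partial>M) = 0" "integrable M (\<lambda>\<omega>. sin (X h \<omega>) * Z \<omega>)" for h
    by (rule trig[of sin cos h]; auto intro!: derivative_eq_intros)+
  have z: "(\<integral>\<omega>. complex_of_real (Z \<omega>) * iexp (X h \<omega>) \<partial>M) = 0" for h
  proof -
    have "(\<integral>\<omega>. complex_of_real (Z \<omega>) * iexp (X h \<omega>) \<partial>M)
      = (\<integral>\<omega>. complex_of_real (cos (X h \<omega>) * Z \<omega>) + \<i> * complex_of_real (sin (X h \<omega>) * Z \<omega>) \<partial>M)"
      by (rule Bochner_Integration.integral_cong) (auto simp: exp_Euler cos_of_real sin_of_real algebra_simps)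
    also have "\<dots> = complex_of_real (\<integral>\<omega>. cos (X h \<omega>) * Z \<omega> \<partial>M) + \<i> * complex_of_real (\<integral>\<omega>. sin (X h \<omega>) * Z \<omega> \<partial>M)"
      using c(2)[of h] s(2)[of h]
      by (subst Bochner_Integration.integral_add) (simp_all only: integrable_of_real integrable_mult_right integral_mult_right_zero integral_complex_of_real)
    finally show ?thesis using c s by simp
  qed
  have "(\<integral>\<omega>. K (field \<omega>) * Z \<omega> \<partial>M) = 0"
    by (rule integral_zero_field[OF iZ z K(1) split(2)[OF K]])
  then show ?thesis using split(1)[OF K] by simp
qed

text \<open>From here on a smooth functional is used only through bounded functions of the whole
  field. A single bound is possible because the coordinates are finite in number.\<close>

lemma smooth_functional_path_deriv:
  assumes "smooth_functional_deriv X H V"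
  obtains h n K \<phi> B where "H = (\<lambda>\<omega>. h (field \<omega>))" "V = (\<lambda>\<omega>. \<Sum>i<n. K i (field \<omega>) *\<^sub>R \<phi> i)"
    "path_deriv h (\<lambda>x. \<Sum>i<n. K i x *\<^sub>R \<phi> i)" "\<And>x. \<bar>h x\<bar> \<le> B"
    "\<And>i. i < (n::nat) \<Longrightarrow> K i \<in> borel_measurable field_space" "\<And>i x. i < n \<Longrightarrow> \<bar>K i x\<bar> \<le> B"
proof -
  obtain n g \<phi> where g: "smooth_compact_support n g" and H: "H = (\<lambda>\<omega>. g (\<lambda>i. X (\<phi> i) \<omega>))"
    and V: "V = (\<lambda>\<omega>. \<Sum>i<n. partial_deriv i g (\<lambda>j. X (\<phi> j) \<omega>) *\<^sub>R \<phi> i)"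
    using assms unfolding smooth_functional_deriv_def by blast
  note gd = smooth_compact_supportD[OF g]
  obtain B0 where B0: "\<And>x. \<bar>g x\<bar> \<le> B0" using gd(5) by blast
  have "\<forall>i. \<exists>B. i < n \<longrightarrow> (\<forall>x. \<bar>partial_deriv i g x\<bar> \<le> B)" using gd(6) by blast
  then obtain B1 where B1: "\<And>i x. i < n \<Longrightarrow> \<bar>partial_deriv i g x\<bar> \<le> B1 i" by metis
  define B where "B = B0 + (\<Sum>i<n. B1 i)"
  have B1': "0 \<le> B1 i" if "i < n" for i using B1[OF that, of undefined] by linarith
  have B0': "0 \<le> B0" using B0[of undefined] by linarith
  have Bs: "B1 i \<le> (\<Sum>i<n. B1 i)" if "i < n" for i
    using that B1' by (intro member_le_sum) auto
  have Bs': "0 \<le> (\<Sum>i<n. B1 i)" using B1' by (intro sum_nonneg) auto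
  show ?thesis
  proof (rule that[of "\<lambda>x. g (\<lambda>i. x (\<phi> i))"
        "\<lambda>i x. partial_deriv i g (\<lambda>j. x (\<phi> j))" \<phi> n B])
    show "path_deriv (\<lambda>x. g (\<lambda>i. x (\<phi> i))) (\<lambda>x. \<Sum>i<n. partial_deriv i g (\<lambda>j. x (\<phi> j)) *\<^sub>R \<phi> i)"
      by (rule path_deriv_smooth[OF g])
    show "\<bar>g (\<lambda>i. x (\<phi> i))\<bar> \<le> B" for x using B0[of "\<lambda>i. x (\<phi> i)"] Bs' by (simp add: B_def)
    show "(\<lambda>x. partial_deriv i g (\<lambda>j. x (\<phi> j))) \<in> borel_measurable field_space" if "i < n" for i
      by (rule continuous_imp_measurable_sequence[OF gd(2)[OF that]])
    show "\<bar>partial_deriv i g (\<lambda>j. x (\<phi> j))\<bar> \<le> B" if "i < n" for i x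
      using B1[OF that, of "\<lambda>j. x (\<phi> j)"] Bs[OF that] B0' by (simp add: B_def)
  qed (use H V in auto)
qed

lemma has_moments_bounded_sum:
  assumes K: "\<And>i. i < n \<Longrightarrow> K i \<in> borel_measurable field_space" "\<And>i x. i < n \<Longrightarrow> \<bar>K i x\<bar> \<le> B"
  shows "has_moments M (\<lambda>\<omega>. norm (\<Sum>i<n. K i (field \<omega>) *\<^sub>R (\<phi> i :: 'h)))"
proof (rule has_moments_bounded[where B="\<Sum>i<n. B * norm (\<phi> i)"])
  have m: "(\<lambda>\<omega>. K i (field \<omega>)) \<in> borel_measurable M" if "i < n" for i
    using measurable_compose[OF field_measurable K(1)[OF that]] by simp
  have "(\<lambda>\<omega>. \<Sum>i<n. K i (field \<omega>) *\<^sub>R \<phi> i) \<in> borel_measurable M"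
    by (intro borel_measurable_sum borel_measurable_scaleR borel_measurable_const m) auto
  then show "(\<lambda>\<omega>. norm (\<Sum>i<n. K i (field \<omega>) *\<^sub>R \<phi> i)) \<in> borel_measurable M" by simp
  show "\<bar>norm (\<Sum>i<n. K i (field \<omega>) *\<^sub>R \<phi> i)\<bar> \<le> (\<Sum>i<n. B * norm (\<phi> i))" for \<omega>
    unfolding abs_norm_cancel by (rule sum_norm_le) (use K(2) in \<open>simp add: mult_right_mono\<close>)
qed

lemma malliavin_imp_weak_deriv:
  assumes "is_malliavin_deriv M X G U"
  shows "weak_deriv G U"
proof -
  obtain G' U' where s: "\<And>k. smooth_functional_deriv X (G' k) (U' k)"
    and l: "L2_tendsto M G' G" "L2_tendsto M U' U"
    using assms unfolding is_malliavin_deriv_def by blast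
  have "weak_deriv (G' k) (U' k)" for k
  proof (rule smooth_functional_path_deriv[OF s[of k]])
    fix h n K \<phi> B
    assume a: "G' k = (\<lambda>\<omega>. h (field \<omega>))" "U' k = (\<lambda>\<omega>. \<Sum>i<n. K i (field \<omega>) *\<^sub>R \<phi> i)"
      "path_deriv h (\<lambda>x. \<Sum>i<n. K i x *\<^sub>R \<phi> i)" "\<And>x. \<bar>h x\<bar> \<le> B"
      "\<And>i. i < (n::nat) \<Longrightarrow> K i \<in> borel_measurable field_space" "\<And>i x. i < n \<Longrightarrow> \<bar>K i x\<bar> \<le> B"
    show "weak_deriv (G' k) (U' k)" unfolding a(1,2)
    proof (rule weak_deriv_path_deriv[OF a(3)])
      show "has_moments M (\<lambda>\<omega>. h (field \<omega>))"
        using measurable_compose[OF field_measurable path_derivD(1)[OF a(3)]]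
        by (intro has_moments_bounded[of _ B]) (use a(4) in auto)
      show "has_moments M (\<lambda>\<omega>. norm (\<Sum>i<n. K i (field \<omega>) *\<^sub>R \<phi> i))"
        using a(5,6) by (rule has_moments_bounded_sum)
    qed
  qed
  from weak_deriv_closed[OF l this] show ?thesis .
qed

text \<open>A diagonal argument: for each k a smooth functional within 1/(k+1) of
  \<open>G' k\<close> is selected whose gradient is at the same time that close to
  \<open>U' k\<close>.\<close>

lemma malliavin_deriv_closed:
  assumes G: "L2_tendsto M G' G" and U: "L2_tendsto M U' U"
    and d: "\<And>k. is_malliavin_deriv M X (G' k) (U' k)"
  shows "is_malliavin_deriv M X G U"
proof -
  define Q where "Q k H V \<longleftrightarrow> smooth_functional_deriv X H V \<and> square_integrable M H \<and> square_integrable M V \<and>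
      L2norm M (\<lambda>\<omega>. H \<omega> - G' k \<omega>) < inverse (real (Suc k)) \<and> L2norm M (\<lambda>\<omega>. V \<omega> - U' k \<omega>) < inverse (real (Suc k))" for k H V
  have "\<exists>H V. Q k H V" for k
  proof -
    obtain F' V' where s: "\<And>j. smooth_functional_deriv X (F' j) (V' j)"
      and l: "L2_tendsto M F' (G' k)" "L2_tendsto M V' (U' k)"
      using d[of k] unfolding is_malliavin_deriv_def by blast
    have "\<forall>\<^sub>F j in sequentially. L2norm M (\<lambda>\<omega>. F' j \<omega> - G' k \<omega>) < inverse (real (Suc k))"
      "\<forall>\<^sub>F j in sequentially. L2norm M (\<lambda>\<omega>. V' j \<omega> - U' k \<omega>) < inverse (real (Suc k))"
      by (rule order_tendstoD(2)[OF L2_tendstoD(3)[OF l(1)]] order_tendstoD(2)[OF L2_tendstoD(3)[OF l(2)]]; simp)+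
    then have "\<forall>\<^sub>F j in sequentially. L2norm M (\<lambda>\<omega>. F' j \<omega> - G' k \<omega>) < inverse (real (Suc k)) \<and>
        L2norm M (\<lambda>\<omega>. V' j \<omega> - U' k \<omega>) < inverse (real (Suc k))" by (rule eventually_conj)
    then obtain j where "L2norm M (\<lambda>\<omega>. F' j \<omega> - G' k \<omega>) < inverse (real (Suc k))"
        "L2norm M (\<lambda>\<omega>. V' j \<omega> - U' k \<omega>) < inverse (real (Suc k))"
      unfolding eventually_sequentially by blast
    with s[of j] L2_tendstoD(1)[OF l(1), of j] L2_tendstoD(1)[OF l(2), of j] show ?thesis unfolding Q_def by blast
  qed
  then obtain H V where Q: "\<And>k. Q k (H k) (V k)" by metis
  then have HV: "\<And>k. smooth_functional_deriv X (H k) (V k)" "\<And>k. square_integrable M (H k)"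
    "\<And>k. square_integrable M (V k)"
    "\<And>k. L2norm M (\<lambda>\<omega>. H k \<omega> - G' k \<omega>) < inverse (real (Suc k))"
    "\<And>k. L2norm M (\<lambda>\<omega>. V k \<omega> - U' k \<omega>) < inverse (real (Suc k))" unfolding Q_def by blast+
  show ?thesis
  proof (rule is_malliavin_derivI[OF HV(1)])
    show "L2_tendsto M H G"
    proof (rule L2_tendstoI[OF HV(2)])
      show "square_integrable M G" using L2_tendstoD[OF G] by blast
      show "L2norm M (\<lambda>x. H k x - G x) \<le> inverse (real (Suc k)) + L2norm M (\<lambda>x. G' k x - G x)" for k
        using L2norm_triangle_diff[OF HV(2) L2_tendstoD(1)[OF G] L2_tendstoD(2)[OF G], of k k] HV(4)[of k] by linarith
      show "(\<lambda>k. inverse (real (Suc k)) + L2norm M (\<lambda>x. G' k x - G x)) \<longlonglongrightarrow> 0"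
        using tendsto_add[OF LIMSEQ_inverse_real_of_nat L2_tendstoD(3)[OF G]] by simp
    qed
    show "L2_tendsto M V U"
    proof (rule L2_tendstoI[OF HV(3)])
      show "square_integrable M U" using L2_tendstoD[OF U] by blast
      show "L2norm M (\<lambda>x. V k x - U x) \<le> inverse (real (Suc k)) + L2norm M (\<lambda>x. U' k x - U x)" for k
        using L2norm_triangle_diff[OF HV(3) L2_tendstoD(1)[OF U] L2_tendstoD(2)[OF U], of k k] HV(5)[of k] by linarith
      show "(\<lambda>k. inverse (real (Suc k)) + L2norm M (\<lambda>x. U' k x - U x)) \<longlonglongrightarrow> 0"
        using tendsto_add[OF LIMSEQ_inverse_real_of_nat L2_tendstoD(3)[OF U]] by simp
    qed
  qed
qed

section \<open>The chaos expansion\<close>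

text \<open>Integration by parts lowers both degrees by one, up to a constant factor, until one of
  them is 0; what remains is the mean of a Hermite polynomial of positive degree, which
  vanishes.\<close>

lemma hermite_orthogonal:
  assumes "norm h = 1" "norm g = 1" "p \<noteq> q"
  shows "(\<integral>\<omega>. hermite p (X h \<omega>) * hermite q (X g \<omega>) \<partial>M) = 0"
proof -
  have mean: "(\<integral>\<omega>. hermite r (X k \<omega>) \<partial>M) = 0" if "r \<ge> 1" "norm k = 1" for r k
    using hermite_integration_by_parts[OF that(2,1) path_deriv_const[of 1]] by (simp add: has_moments_const)
  show ?thesis using assms(3)
  proof (induction p arbitrary: q)
    case 0
    then show ?case using mean[of q g] assms by simp
  next
    case (Suc p)
    show ?case
    proof (cases q)
      case 0
      then show ?thesis using mean[of "Suc p" h] assms by simp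
    next
      case (Suc q')
      have "has_moments M (\<lambda>\<omega>. norm ((real q * hermite (q - 1) (X g \<omega>)) *\<^sub>R g))"
        unfolding norm_scaleR
        by (intro has_moments_mult has_moments_norm has_moments_const hermite_moments)
      from hermite_integration_by_parts[OF assms(1) _ path_deriv_hermite hermite_moments this, of "Suc p"]
      have "(\<integral>\<omega>. hermite (Suc p) (X h \<omega>) * hermite q (X g \<omega>) \<partial>M)
        = (\<integral>\<omega>. (real q * (h \<bullet> g)) * (hermite p (X h \<omega>) * hermite q' (X g \<omega>)) \<partial>M)"
        using Suc by (simp add: mult_ac)
      also have "\<dots> = 0" using Suc.IH[of q'] Suc.prems Suc by simp
      finally show ?thesis .
    qed
  qed
qed

text \<open>The algebraic span before closure: orthogonality and approximation are checked here and
  passed to the chaos by L2 limits.\<close>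

definition hermite_span :: "nat \<Rightarrow> ('a \<Rightarrow> real) set" where
  "hermite_span q = {\<lambda>\<omega>. \<Sum>h\<in>S. c h * hermite q (X h \<omega>) |S c. finite S \<and> (\<forall>h\<in>S. norm h = 1)}"

lemma hermite_span_square_integrable: "v \<in> hermite_span q \<Longrightarrow> square_integrable M v"
  unfolding hermite_span_def
  by (auto intro!: has_moments_square_integrable has_moments_sum has_moments_mult has_moments_const hermite_moments)

lemma hermite_span_basis: "norm h = 1 \<Longrightarrow> (\<lambda>\<omega>. hermite q (X h \<omega>)) \<in> hermite_span q"
  unfolding hermite_span_def by (intro CollectI exI[of _ "{h}"] exI[of _ "\<lambda>_. 1"]) auto

lemma hermite_span_orthogonal:
  assumes "u \<in> hermite_span p" "v \<in> hermite_span q" "p \<noteq> q"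
  shows "(\<integral>\<omega>. u \<omega> * v \<omega> \<partial>M) = 0"
proof -
  obtain S c T d where u: "u = (\<lambda>\<omega>. \<Sum>h\<in>S. c h * hermite p (X h \<omega>))" "\<forall>h\<in>S. norm h = 1"
    and v: "v = (\<lambda>\<omega>. \<Sum>h\<in>T. d h * hermite q (X h \<omega>))" "\<forall>h\<in>T. norm h = 1"
    using assms unfolding hermite_span_def by blast
  have i: "integrable M (\<lambda>\<omega>. c h * d g * (hermite p (X h \<omega>) * hermite q (X g \<omega>)))" for h g
    by (intro has_moments_integrable has_moments_mult has_moments_const hermite_moments)
  have "(\<integral>\<omega>. u \<omega> * v \<omega> \<partial>M) = (\<integral>\<omega>. (\<Sum>h\<in>S. \<Sum>g\<in>T. c h * d g * (hermite p (X h \<omega>) * hermite q (X g \<omega>))) \<partial>M)"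
    unfolding u v by (simp add: sum_product mult_ac)
  also have "\<dots> = (\<Sum>h\<in>S. \<Sum>g\<in>T. \<integral>\<omega>. c h * d g * (hermite p (X h \<omega>) * hermite q (X g \<omega>)) \<partial>M)"
    using i by (simp add: Bochner_Integration.integral_sum Bochner_Integration.integrable_sum)
  also have "\<dots> = 0" using u(2) v(2) hermite_orthogonal[OF _ _ assms(3)] by simp
  finally show ?thesis .
qed

lemma wiener_chaos_iff:
  assumes "q \<ge> 1"
  shows "G \<in> wiener_chaos M X q \<longleftrightarrow> (\<exists>P. (\<forall>k. P k \<in> hermite_span q) \<and> L2_tendsto M P G)"
proof
  assume "G \<in> wiener_chaos M X q"
  then obtain S c where "\<forall>k. finite (S k) \<and> (\<forall>h\<in>S k. norm h = 1)"
    "L2_tendsto M (\<lambda>k \<omega>. \<Sum>h\<in>S k. c k h * hermite q (X h \<omega>)) G"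
    using assms unfolding wiener_chaos_def by auto
  then show "\<exists>P. (\<forall>k. P k \<in> hermite_span q) \<and> L2_tendsto M P G"
    unfolding hermite_span_def by (intro exI[of _ "\<lambda>k \<omega>. \<Sum>h\<in>S k. c k h * hermite q (X h \<omega>)"]) blast
next
  assume "\<exists>P. (\<forall>k. P k \<in> hermite_span q) \<and> L2_tendsto M P G"
  then obtain P where P: "\<And>k. P k \<in> hermite_span q" "L2_tendsto M P G" by blast
  have "\<exists>S c. P k = (\<lambda>\<omega>. \<Sum>h\<in>S. c h * hermite q (X h \<omega>)) \<and> finite S \<and> (\<forall>h\<in>S. norm h = 1)" for k
    using P(1)[of k] unfolding hermite_span_def by blast
  then obtain S c where Sc: "\<And>k. P k = (\<lambda>\<omega>. \<Sum>h\<in>S k. c k h * hermite q (X h \<omega>))"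
    "\<And>k. finite (S k) \<and> (\<forall>h\<in>S k. norm h = 1)" by metis
  have "P = (\<lambda>k \<omega>. \<Sum>h\<in>S k. c k h * hermite q (X h \<omega>))" using Sc(1) by (rule ext)
  with P(2) Sc(2) show "G \<in> wiener_chaos M X q"
    using assms unfolding wiener_chaos_def by auto
qed

lemma chaos_orthogonal:
  assumes G: "G \<in> wiener_chaos M X p" "p \<ge> 1" and Z: "square_integrable M Z"
    and v: "\<And>v. v \<in> hermite_span p \<Longrightarrow> (\<integral>\<omega>. Z \<omega> * v \<omega> \<partial>M) = 0"
  shows "(\<integral>\<omega>. Z \<omega> * G \<omega> \<partial>M) = 0"
proof -
  obtain P where P: "\<And>k. P k \<in> hermite_span p" "L2_tendsto M P G"
    using G wiener_chaos_iff by blast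
  from L2_tendsto_inner[OF L2_tendsto_const[OF Z] P(2)]
  have "(\<lambda>k. \<integral>\<omega>. Z \<omega> * P k \<omega> \<partial>M) \<longlonglongrightarrow> (\<integral>\<omega>. Z \<omega> * G \<omega> \<partial>M)" by simp
  then show ?thesis using v[OF P(1)] LIMSEQ_unique[OF _ tendsto_const[of 0]] by simp
qed

lemma wiener_chaos_square_integrable:
  "G \<in> wiener_chaos M X q \<Longrightarrow> q \<ge> 1 \<Longrightarrow> square_integrable M G"
  using wiener_chaos_iff L2_tendstoD by blast

lemma chaos_chaos_orthogonal:
  assumes G: "G \<in> wiener_chaos M X p" "p \<ge> 1" and H: "H \<in> wiener_chaos M X q" "q \<ge> 1" and "p \<noteq> q"
  shows "(\<integral>\<omega>. G \<omega> * H \<omega> \<partial>M) = 0"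
proof (rule chaos_orthogonal[OF H wiener_chaos_square_integrable[OF G]])
  fix v assume v: "v \<in> hermite_span q"
  have "(\<integral>\<omega>. v \<omega> * G \<omega> \<partial>M) = 0"
    by (rule chaos_orthogonal[OF G hermite_span_square_integrable[OF v]])
       (rule hermite_span_orthogonal[OF v _ assms(5)[symmetric]])
  then show "(\<integral>\<omega>. G \<omega> * v \<omega> \<partial>M) = 0" by (simp add: mult.commute)
qed

text \<open>The choice in the definition has a candidate because the projection onto the closure of
  \<open>hermite_span q\<close> exists; orthogonality passes from the span to its limits.\<close>

lemma chaos_projection:
  assumes F: "square_integrable M F" and q: "q \<ge> 1"
  shows "chaos_projection M X q F \<in> wiener_chaos M X q"
    "\<And>H. H \<in> wiener_chaos M X q \<Longrightarrow> (\<integral>\<omega>. (F \<omega> - chaos_projection M X q F \<omega>) * H \<omega> \<partial>M) = 0"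
proof -
  have "\<exists>G. G \<in> wiener_chaos M X q \<and> (\<forall>H\<in>wiener_chaos M X q. (\<integral>\<omega>. (F \<omega> - G \<omega>) * H \<omega> \<partial>M) = 0)"
  proof (rule L2_projection[OF F, of "hermite_span q"])
    show "v \<in> hermite_span q \<Longrightarrow> square_integrable M v" for v by (rule hermite_span_square_integrable)
    show "(\<lambda>_. 0) \<in> hermite_span q"
      unfolding hermite_span_def by (intro CollectI exI[of _ "{}"]) auto
    show "(\<lambda>x. k * v x) \<in> hermite_span q" if v: "v \<in> hermite_span q" for v k
    proof -
      obtain S c where S: "v = (\<lambda>\<omega>. \<Sum>h\<in>S. c h * hermite q (X h \<omega>))" "finite S" "\<forall>h\<in>S. norm h = 1"
        using v unfolding hermite_span_def by blast
      then show ?thesis unfolding hermite_span_def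
        by (intro CollectI exI[of _ S] exI[of _ "\<lambda>h. k * c h"]) (auto simp: sum_distrib_left mult.assoc)
    qed
    show "(\<lambda>x. v x + w x) \<in> hermite_span q" if v: "v \<in> hermite_span q" and w: "w \<in> hermite_span q" for v w
    proof -
      obtain S c T d where S: "v = (\<lambda>\<omega>. \<Sum>h\<in>S. c h * hermite q (X h \<omega>))" "finite S" "\<forall>h\<in>S. norm h = 1"
        and T: "w = (\<lambda>\<omega>. \<Sum>h\<in>T. d h * hermite q (X h \<omega>))" "finite T" "\<forall>h\<in>T. norm h = 1"
        using v w unfolding hermite_span_def by blast
      let ?e = "\<lambda>h. (if h \<in> S then c h else 0) + (if h \<in> T then d h else 0)"
      have "v \<omega> + w \<omega> = (\<Sum>h\<in>S \<union> T. ?e h * hermite q (X h \<omega>))" for \<omega>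
      proof -
        have "v \<omega> = (\<Sum>h\<in>S \<union> T. (if h \<in> S then c h else 0) * hermite q (X h \<omega>))"
          unfolding S(1) using S(2) T(2) by (intro sum.mono_neutral_cong_left) auto
        moreover have "w \<omega> = (\<Sum>h\<in>S \<union> T. (if h \<in> T then d h else 0) * hermite q (X h \<omega>))"
          unfolding T(1) using S(2) T(2) by (intro sum.mono_neutral_cong_left) auto
        ultimately show ?thesis by (simp only: sum.distrib distrib_right)
      qed
      then show ?thesis unfolding hermite_span_def using S T
        by (intro CollectI exI[of _ "S \<union> T"] exI[of _ ?e]) auto
    qed
    fix P G assume P: "\<And>k. P k \<in> hermite_span q" "L2_tendsto M P G"
      and o: "\<And>v. v \<in> hermite_span q \<Longrightarrow> (\<integral>x. (F x - G x) * v x \<partial>M) = 0"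
    have "square_integrable M (\<lambda>x. F x - G x)" using F L2_tendstoD(2)[OF P(2)] by (rule square_integrable_diff)
    then have "\<forall>H\<in>wiener_chaos M X q. (\<integral>\<omega>. (F \<omega> - G \<omega>) * H \<omega> \<partial>M) = 0"
      using chaos_orthogonal[OF _ q, of _ "\<lambda>x. F x - G x"] o by blast
    moreover have "G \<in> wiener_chaos M X q" using P wiener_chaos_iff[OF q] by blast
    ultimately show ?thesis by blast
  qed
  from someI_ex[OF this]
  show "chaos_projection M X q F \<in> wiener_chaos M X q"
    "\<And>H. H \<in> wiener_chaos M X q \<Longrightarrow> (\<integral>\<omega>. (F \<omega> - chaos_projection M X q F \<omega>) * H \<omega> \<partial>M) = 0"
    unfolding chaos_projection_def by auto
qed

text \<open>Powers of \<open>X h\<close> are combinations of Hermite polynomials, and the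
  exponential series turns orthogonality to powers into orthogonality to exp (i t X h). The separate
  condition on the mean covers h = 0, also in a Hilbert space without unit vectors.\<close>

lemma hermite_total:
  assumes Z: "square_integrable M Z" and mean: "(\<integral>\<omega>. Z \<omega> \<partial>M) = 0"
    and o: "\<And>q h. norm h = 1 \<Longrightarrow> (\<integral>\<omega>. Z \<omega> * hermite q (X h \<omega>) \<partial>M) = 0"
    and K: "K \<in> borel_measurable field_space" "integrable M (\<lambda>\<omega>. K (field \<omega>) * Z \<omega>)"
  shows "(\<integral>\<omega>. K (field \<omega>) * Z \<omega> \<partial>M) = 0"
proof -
  have iZ: "integrable M Z" by (rule square_integrable_integrable[OF Z])
  have [measurable]: "Z \<in> borel_measurable M" using Z by auto
  have mono: "(\<integral>\<omega>. Z \<omega> * (hermite q (X h \<omega>) * X h \<omega> ^ p) \<partial>M) = 0" if h: "norm h = 1" for h p q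
  proof (induction p arbitrary: q)
    case 0
    then show ?case using o[OF h] by simp
  next
    case (Suc p)
    have i: "integrable M (\<lambda>\<omega>. Z \<omega> * (hermite r (X h \<omega>) * X h \<omega> ^ p))" for r
    proof -
      have "has_moments M (\<lambda>\<omega>. hermite r (X h \<omega>) * X h \<omega> ^ p)"
      proof (rule has_moments_mult[OF hermite_moments])
        show "has_moments M (\<lambda>\<omega>. X h \<omega> ^ p)"
          by (induction p) (auto intro: has_moments_const has_moments_mult X_moments)
      qed
      from integrable_mult_square_integrable[OF Z has_moments_square_integrable[OF this]] show ?thesis .
    qed
    \<comment> \<open>The recurrence solved for x He_q: one power is traded for the neighbouring
      degrees. At q = 0 the term of degree \<open>q - 1\<close> carries the factor 0.\<close>
    have "hermite q x * x ^ Suc p = hermite (Suc q) x * x ^ p + real q * (hermite (q - 1) x * x ^ p)" for x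
      by (cases q) (auto simp: algebra_simps)
    then have "(\<integral>\<omega>. Z \<omega> * (hermite q (X h \<omega>) * X h \<omega> ^ Suc p) \<partial>M)
      = (\<integral>\<omega>. Z \<omega> * (hermite (Suc q) (X h \<omega>) * X h \<omega> ^ p) + real q * (Z \<omega> * (hermite (q - 1) (X h \<omega>) * X h \<omega> ^ p)) \<partial>M)"
      by (intro Bochner_Integration.integral_cong) (auto simp only: distrib_left mult.left_commute)
    also have "\<dots> = 0" using i Suc.IH by simp
    finally show ?case .
  qed
  have power: "(\<integral>\<omega>. Z \<omega> * X h \<omega> ^ p \<partial>M) = 0" if "norm h = 1" for h p
    using mono[OF that, of 0 p] by simp
  have unit: "(\<integral>\<omega>. complex_of_real (Z \<omega>) * iexp (t * X h \<omega>) \<partial>M) = 0" if h: "norm h = 1" for h t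
  proof -
    let ?z = "\<lambda>\<omega>. \<i> * complex_of_real (t * X h \<omega>)"
    let ?s = "\<lambda>n \<omega>. complex_of_real (Z \<omega>) * (\<Sum>p<n. ?z \<omega> ^ p /\<^sub>R fact p)"
    have "(\<lambda>n. \<integral>\<omega>. ?s n \<omega> \<partial>M) \<longlonglongrightarrow> (\<integral>\<omega>. complex_of_real (Z \<omega>) * iexp (t * X h \<omega>) \<partial>M)"
    proof (rule integral_dominated_convergence)
      show "AE \<omega> in M. (\<lambda>n. ?s n \<omega>) \<longlonglongrightarrow> complex_of_real (Z \<omega>) * iexp (t * X h \<omega>)"
        using exp_converges unfolding sums_def by (intro AE_I2 tendsto_mult tendsto_const)
      \<comment> \<open>Since exp |y| \<le> exp y + exp (-y), exponential moments of
        \<open>X h\<close> give a square-integrable bound for all partial sums of the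
        series.\<close>
      have e2: "square_integrable M (\<lambda>\<omega>. exp (s * X h \<omega>))" for s
        using X_exp_integrable[of "2 * s" h] by (simp add: square_integrable_def exp_double[symmetric] mult.assoc)
      have "square_integrable M (\<lambda>\<omega>. exp (t * X h \<omega>) + exp (- t * X h \<omega>))"
        by (rule square_integrable_add[OF e2 e2])
      from integrable_mult_square_integrable[OF square_integrable_norm[OF Z] this]
      show "integrable M (\<lambda>\<omega>. \<bar>Z \<omega>\<bar> * (exp (t * X h \<omega>) + exp (- t * X h \<omega>)))" by simp
      show "AE \<omega> in M. norm (?s n \<omega>) \<le> \<bar>Z \<omega>\<bar> * (exp (t * X h \<omega>) + exp (- t * X h \<omega>))" for n
      proof (rule AE_I2)
        fix \<omega>
        have "norm (\<Sum>p<n. ?z \<omega> ^ p /\<^sub>R fact p) \<le> (\<Sum>p<n. \<bar>t * X h \<omega>\<bar> ^ p /\<^sub>R fact p)"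
          by (rule sum_norm_le) (simp add: norm_mult norm_power norm_inverse abs_mult)
        also have "\<dots> \<le> exp \<bar>t * X h \<omega>\<bar>"
          using sum_le_suminf[of "\<lambda>p. \<bar>t * X h \<omega>\<bar> ^ p /\<^sub>R fact p" "{..<n}"] summable_exp_generic[of "\<bar>t * X h \<omega>\<bar>"]
          by (simp add: exp_def)
        also have "\<dots> \<le> exp (t * X h \<omega>) + exp (- t * X h \<omega>)"
          by (cases "t * X h \<omega> \<ge> 0") (simp_all add: abs_if)
        finally show "norm (?s n \<omega>) \<le> \<bar>Z \<omega>\<bar> * (exp (t * X h \<omega>) + exp (- t * X h \<omega>))"
          unfolding norm_mult norm_of_real by (rule mult_left_mono) simp
      qed
    qed measurable
    moreover have "(\<integral>\<omega>. ?s n \<omega> \<partial>M) = 0" for n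
    proof -
      have ip: "integrable M (\<lambda>\<omega>. Z \<omega> * X h \<omega> ^ p)" for p
      proof -
        have "has_moments M (\<lambda>\<omega>. X h \<omega> ^ p)"
          by (induction p) (auto intro: has_moments_const has_moments_mult X_moments)
        from integrable_mult_square_integrable[OF Z has_moments_square_integrable[OF this]] show ?thesis .
      qed
      have "(\<integral>\<omega>. ?s n \<omega> \<partial>M) = (\<integral>\<omega>. (\<Sum>p<n. ((\<i> * complex_of_real t) ^ p / fact p) * complex_of_real (Z \<omega> * X h \<omega> ^ p)) \<partial>M)"
        by (intro Bochner_Integration.integral_cong)
           (auto simp: sum_distrib_left power_mult_distrib scaleR_conv_of_real divide_inverse mult_ac)
      also have "\<dots> = (\<Sum>p<n. ((\<i> * complex_of_real t) ^ p / fact p) * complex_of_real (\<integral>\<omega>. Z \<omega> * X h \<omega> ^ p \<partial>M))"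
        by (subst Bochner_Integration.integral_sum)
           (simp_all only: integrable_of_real ip integrable_mult_right integral_mult_right_zero integral_complex_of_real)
      also have "\<dots> = 0" using power[OF h] by simp
      finally show ?thesis .
    qed
    ultimately have "(\<lambda>n::nat. 0 :: complex) \<longlonglongrightarrow> (\<integral>\<omega>. complex_of_real (Z \<omega>) * iexp (t * X h \<omega>) \<partial>M)"
      by (simp only:)
    then show ?thesis using LIMSEQ_unique[OF _ tendsto_const] by blast
  qed
  have z: "(\<integral>\<omega>. complex_of_real (Z \<omega>) * iexp (X h \<omega>) \<partial>M) = 0" for h
  proof -
    have X0: "AE \<omega> in M. X 0 \<omega> = 0" using X_linear[of 0 1 0] by simp
    show ?thesis
    proof (cases "h = 0")
      case True
      have "(\<integral>\<omega>. complex_of_real (Z \<omega>) * iexp (X h \<omega>) \<partial>M) = (\<integral>\<omega>. complex_of_real (Z \<omega>) \<partial>M)"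
        unfolding True by (rule integral_cong_AE) (use X0 in \<open>auto elim!: eventually_mono\<close>)
      then show ?thesis using mean by simp
    next
      case False
      let ?e = "h /\<^sub>R norm h"
      have "AE \<omega> in M. X h \<omega> = norm h * X ?e \<omega>"
        using X0 X_linear[of 0 "norm h" ?e] by eventually_elim (use False in simp)
      then have "(\<integral>\<omega>. complex_of_real (Z \<omega>) * iexp (X h \<omega>) \<partial>M) = (\<integral>\<omega>. complex_of_real (Z \<omega>) * iexp (norm h * X ?e \<omega>) \<partial>M)"
        by (intro integral_cong_AE) (auto elim!: eventually_mono)
      then show ?thesis using unit[of ?e "norm h"] False by simp
    qed
  qed
  show ?thesis by (rule integral_zero_field[OF iZ z K])
qed

text \<open>Projections on different chaoses are orthogonal, and Bessel's inequality makes their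
  squared norms summable. The weights allow one proof for the expansion of \<open>F\<close> and for
  that of its pseudo-inverse.\<close>

lemma chaos_series:
  assumes F: "square_integrable M F" and w: "\<And>q. \<bar>w q\<bar> \<le> 1"
  obtains Y where "L2_tendsto M (\<lambda>k \<omega>. \<Sum>q=1..k. w q * chaos_projection M X q F \<omega>) Y"
proof -
  \<comment> \<open>The index is shifted: \<open>J 0\<close> is the projection on the first chaos,
    as order 0 occurs in neither series.\<close>
  define J where "J i = chaos_projection M X (Suc i) F" for i
  have Jc: "J i \<in> wiener_chaos M X (Suc i)" for i
    unfolding J_def by (rule chaos_projection(1)[OF F]) simp
  have sJ: "square_integrable M (J i)" for i
    by (rule wiener_chaos_square_integrable[OF Jc]) simp
  have oJ: "(\<integral>\<omega>. J i \<omega> * J j \<omega> \<partial>M) = 0" if "i \<noteq> j" for i j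
    by (rule chaos_chaos_orthogonal[OF Jc _ Jc]) (use that in auto)
  define e where "e i = (\<integral>\<omega>. (J i \<omega>)\<^sup>2 \<partial>M)" for i
  have e0: "0 \<le> e i" for i by (simp add: e_def)
  have iJ: "integrable M (\<lambda>\<omega>. J i \<omega> * J j \<omega>)" for i j
    by (rule integrable_mult_square_integrable[OF sJ sJ])
  have nsum: "(\<integral>\<omega>. (\<Sum>i\<in>I. v i * J i \<omega>)\<^sup>2 \<partial>M) = (\<Sum>i\<in>I. (v i)\<^sup>2 * e i)" if I: "finite I" for I v
  proof -
    have "(\<integral>\<omega>. (\<Sum>i\<in>I. v i * J i \<omega>)\<^sup>2 \<partial>M) = (\<integral>\<omega>. (\<Sum>i\<in>I. \<Sum>j\<in>I. v i * v j * (J i \<omega> * J j \<omega>)) \<partial>M)"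
      by (simp add: power2_eq_square sum_product mult_ac)
    also have "\<dots> = (\<Sum>i\<in>I. \<Sum>j\<in>I. v i * v j * (\<integral>\<omega>. J i \<omega> * J j \<omega> \<partial>M))"
      using iJ by (simp add: Bochner_Integration.integral_sum Bochner_Integration.integrable_sum)
    also have "\<dots> = (\<Sum>i\<in>I. \<Sum>j\<in>I. if j = i then (v i)\<^sup>2 * e i else 0)"
      using oJ by (intro sum.cong refl) (auto simp: e_def power2_eq_square)
    also have "\<dots> = (\<Sum>i\<in>I. (v i)\<^sup>2 * e i)" using I by simp
    finally show ?thesis .
  qed
  have FJ: "(\<integral>\<omega>. F \<omega> * J i \<omega> \<partial>M) = e i" for i
  proof -
    have "(\<integral>\<omega>. (F \<omega> - J i \<omega>) * J i \<omega> \<partial>M) = 0"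
      using chaos_projection(2)[OF F _ Jc[of i]] by (simp add: J_def)
    moreover have "(\<integral>\<omega>. (F \<omega> - J i \<omega>) * J i \<omega> \<partial>M) = (\<integral>\<omega>. F \<omega> * J i \<omega> \<partial>M) - e i"
      unfolding e_def power2_eq_square left_diff_distrib
      by (rule Bochner_Integration.integral_diff[OF integrable_mult_square_integrable[OF F sJ] iJ])
    ultimately show ?thesis by simp
  qed
  have "(\<Sum>i<k. e i) \<le> (\<integral>\<omega>. (F \<omega>)\<^sup>2 \<partial>M)" for k
  proof -
    have sS: "square_integrable M (\<lambda>\<omega>. \<Sum>i<k. 1 * J i \<omega>)"
      by (intro square_integrable_sum square_integrable_cmult sJ)
    have FS: "(\<integral>\<omega>. F \<omega> * (\<Sum>i<k. 1 * J i \<omega>) \<partial>M) = (\<Sum>i<k. e i)"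
    proof -
      have "(\<integral>\<omega>. F \<omega> * (\<Sum>i<k. 1 * J i \<omega>) \<partial>M) = (\<integral>\<omega>. (\<Sum>i<k. F \<omega> * J i \<omega>) \<partial>M)"
        by (simp add: sum_distrib_left)
      also have "\<dots> = (\<Sum>i<k. \<integral>\<omega>. F \<omega> * J i \<omega> \<partial>M)"
        by (rule Bochner_Integration.integral_sum) (rule integrable_mult_square_integrable[OF F sJ])
      finally show ?thesis by (simp add: FJ)
    qed
    have "0 \<le> (\<integral>\<omega>. (F \<omega> - (\<Sum>i<k. 1 * J i \<omega>))\<^sup>2 \<partial>M)" by simp
    also have "\<dots> = (\<integral>\<omega>. (F \<omega>)\<^sup>2 - 2 * (F \<omega> * (\<Sum>i<k. 1 * J i \<omega>)) + (\<Sum>i<k. 1 * J i \<omega>)\<^sup>2 \<partial>M)"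
      by (rule Bochner_Integration.integral_cong) (auto simp: power2_eq_square algebra_simps)
    also have "\<dots> = (\<integral>\<omega>. (F \<omega>)\<^sup>2 \<partial>M) - 2 * (\<Sum>i<k. e i) + (\<Sum>i<k. e i)"
    proof -
      have "integrable M (\<lambda>\<omega>. (F \<omega>)\<^sup>2)" "integrable M (\<lambda>\<omega>. (\<Sum>i<k. 1 * J i \<omega>)\<^sup>2)"
        using F sS by (auto simp: square_integrable_def)
      then show ?thesis
        using FS nsum[of "{..<k}" "\<lambda>_. 1"] integrable_mult_square_integrable[OF F sS] by simp
    qed
    finally show ?thesis by simp
  qed
  then have "(\<Sum>i\<le>k. e i) \<le> (\<integral>\<omega>. (F \<omega>)\<^sup>2 \<partial>M)" for k unfolding lessThan_Suc_atMost[symmetric] .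
  with e0 have "summable e" by (rule bounded_imp_summable)
  define Y where "Y k \<omega> = (\<Sum>i<k. w (Suc i) * J i \<omega>)" for k \<omega>
  have sY: "square_integrable M (Y k)" for k
    unfolding Y_def by (intro square_integrable_sum square_integrable_cmult sJ)
  have d: "L2norm M (\<lambda>\<omega>. Y k \<omega> - Y j \<omega>) \<le> sqrt (\<Sum>i=j..<k. e i)" if "j \<le> k" for j k
  proof -
    have "Y k \<omega> - Y j \<omega> = (\<Sum>i=j..<k. w (Suc i) * J i \<omega>)" for \<omega>
      unfolding Y_def using sum_diff_nat_ivl[of 0 j k] that by (simp add: atLeast0LessThan)
    then have "L2norm M (\<lambda>\<omega>. Y k \<omega> - Y j \<omega>) = sqrt (\<Sum>i=j..<k. (w (Suc i))\<^sup>2 * e i)"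
      using nsum[of "{j..<k}"] by (simp add: L2norm_def)
    also have "\<dots> \<le> sqrt (\<Sum>i=j..<k. e i)"
    proof (intro real_sqrt_le_mono sum_mono)
      fix i
      have "(w (Suc i))\<^sup>2 \<le> 1" using w[of "Suc i"] by (simp add: abs_square_le_1)
      then show "(w (Suc i))\<^sup>2 * e i \<le> e i" using e0[of i] by (simp add: mult_left_le_one_le)
    qed
    finally show ?thesis .
  qed
  obtain G where G: "L2_tendsto M Y G"
  proof (rule L2_complete[OF sY])
    fix \<epsilon> :: real assume "\<epsilon> > 0"
    then obtain N where N: "\<And>m n. m \<ge> N \<Longrightarrow> norm (sum e {m..<n}) < \<epsilon>\<^sup>2"
      using \<open>summable e\<close> unfolding summable_Cauchy by (meson zero_less_power)
    have lt: "L2norm M (\<lambda>\<omega>. Y k \<omega> - Y j \<omega>) < \<epsilon>" if "N \<le> j" "j \<le> k" for j k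
    proof -
      have "sqrt (\<Sum>i=j..<k. e i) < sqrt (\<epsilon>\<^sup>2)" using N[OF that(1), of k] by (intro real_sqrt_less_mono) simp
      then show ?thesis using d[OF that(2)] \<open>\<epsilon> > 0\<close> by simp
    qed
    have "L2norm M (\<lambda>\<omega>. Y j \<omega> - Y k \<omega>) < \<epsilon>" if "N \<le> j" "N \<le> k" for j k
      using lt[of j k] lt[of k j] that L2norm_minus_commute[of M "Y j" "Y k"] by (cases "j \<le> k") auto
    then show "\<exists>K. \<forall>j\<ge>K. \<forall>k\<ge>K. L2norm M (\<lambda>x. Y j x - Y k x) < \<epsilon>" by blast
  qed
  have "(\<lambda>k \<omega>. \<Sum>q=1..k. w q * chaos_projection M X q F \<omega>) = Y"
    by (intro ext) (simp add: Y_def J_def sum.atLeast1_atMost_eq)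
  with G that show ?thesis by simp
qed

section \<open>The Ornstein-Uhlenbeck pseudo-inverse and its derivative\<close>

lemma OU_pseudo_inverse_tendsto:
  assumes F: "square_integrable M F"
  shows "L2_tendsto M (\<lambda>k \<omega>. - (\<Sum>q=1..k. (1 / real q) * chaos_projection M X q F \<omega>)) (OU_pseudo_inverse M X F)"
proof -
  obtain Y where "L2_tendsto M (\<lambda>k \<omega>. \<Sum>q=1..k. (1 / real q) * chaos_projection M X q F \<omega>) Y"
  proof (rule chaos_series[OF F, of "\<lambda>q. 1 / real q"])
    show "\<bar>1 / real q\<bar> \<le> 1" for q by (cases "q = 0") (auto simp: field_simps)
  qed
  from L2_tendsto_uminus[OF this]
  have "\<exists>G. L2_tendsto M (\<lambda>k \<omega>. - (\<Sum>q=1..k. (1 / real q) * chaos_projection M X q F \<omega>)) G" by blast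
  then show ?thesis unfolding OU_pseudo_inverse_def by (rule someI_ex)
qed

text \<open>\<open>F - Y\<close> is orthogonal to every Hermite variable, because terms of the
  series beyond degree p do not affect the pairing with one of degree p; totality of the Hermite
  variables does the rest. The equality is obtained against functionals of the field, the form in
  which it is used.\<close>

lemma chaos_series_total:
  assumes F: "square_integrable M F" "(\<integral>\<omega>. F \<omega> \<partial>M) = 0"
    and Y: "L2_tendsto M (\<lambda>k \<omega>. \<Sum>q=1..k. chaos_projection M X q F \<omega>) Y"
    and K: "K \<in> borel_measurable field_space" "\<And>x. \<bar>K x\<bar> \<le> B"
  shows "(\<integral>\<omega>. F \<omega> * K (field \<omega>) \<partial>M) = (\<integral>\<omega>. Y \<omega> * K (field \<omega>) \<partial>M)"
proof -
  let ?J = "\<lambda>q. chaos_projection M X q F"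
  have sY: "square_integrable M Y" using L2_tendstoD[OF Y] by blast
  have Jc: "?J q \<in> wiener_chaos M X q" if "q \<ge> 1" for q by (rule chaos_projection(1)[OF F(1) that])
  have sJ: "square_integrable M (?J q)" if "q \<ge> 1" for q by (rule wiener_chaos_square_integrable[OF Jc[OF that] that])
  have sK: "square_integrable M (\<lambda>\<omega>. K (field \<omega>))"
    using measurable_compose[OF field_measurable K(1)] by (rule square_integrable_bounded[of _ B]) (use K(2) in auto)
  have sZ: "square_integrable M (\<lambda>\<omega>. F \<omega> - Y \<omega>)" by (rule square_integrable_diff[OF F(1) sY])
  \<comment> \<open>The pairings with the partial sums are constant from \<open>k0\<close> on, so
    their limit can be read off.\<close>
  have test: "(\<integral>\<omega>. (F \<omega> - Y \<omega>) * v \<omega> \<partial>M) = 0"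
    if v: "square_integrable M v" and ev: "\<And>k. k \<ge> k0 \<Longrightarrow> (\<integral>\<omega>. F \<omega> * v \<omega> \<partial>M) = (\<integral>\<omega>. (\<Sum>q=1..k. ?J q \<omega>) * v \<omega> \<partial>M)" for v k0
  proof -
    have "(\<lambda>k. \<integral>\<omega>. (\<Sum>q=1..k. ?J q \<omega>) * v \<omega> \<partial>M) \<longlonglongrightarrow> (\<integral>\<omega>. Y \<omega> * v \<omega> \<partial>M)"
      using L2_tendsto_inner[OF Y L2_tendsto_const[OF v]] by simp
    moreover have "(\<lambda>k. \<integral>\<omega>. (\<Sum>q=1..k. ?J q \<omega>) * v \<omega> \<partial>M) \<longlonglongrightarrow> (\<integral>\<omega>. F \<omega> * v \<omega> \<partial>M)"
      by (rule tendsto_eventually, rule eventually_sequentiallyI[of k0], rule ev[symmetric])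
    ultimately have "(\<integral>\<omega>. F \<omega> * v \<omega> \<partial>M) = (\<integral>\<omega>. Y \<omega> * v \<omega> \<partial>M)" using LIMSEQ_unique by blast
    then show ?thesis
      using integrable_mult_square_integrable[OF F(1) v] integrable_mult_square_integrable[OF sY v]
      by (simp add: left_diff_distrib)
  qed
  have sumv: "(\<integral>\<omega>. (\<Sum>q=1..k. ?J q \<omega>) * v \<omega> \<partial>M) = (\<Sum>q=1..k. \<integral>\<omega>. ?J q \<omega> * v \<omega> \<partial>M)"
    if "square_integrable M v" for v k
    unfolding sum_distrib_right
    by (rule Bochner_Integration.integral_sum) (use integrable_mult_square_integrable[OF sJ that] in auto)
  have s1: "square_integrable M (\<lambda>_. 1::real)" by (simp add: square_integrable_def)
  have mJ: "(\<integral>\<omega>. ?J q \<omega> * 1 \<partial>M) = 0" if q: "q \<ge> 1" for q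
  proof -
    have "(\<integral>\<omega>. 1 * ?J q \<omega> \<partial>M) = 0"
    proof (rule chaos_orthogonal[OF Jc[OF q] q s1])
      fix v assume "v \<in> hermite_span q"
      then obtain S c where v: "v = (\<lambda>\<omega>. \<Sum>h\<in>S. c h * hermite q (X h \<omega>))" "\<forall>h\<in>S. norm h = 1"
        unfolding hermite_span_def by blast
      have "(\<integral>\<omega>. hermite q (X h \<omega>) \<partial>M) = 0" if "h \<in> S" for h
        using hermite_orthogonal[of h h 0 q] v(2) that q by simp
      then show "(\<integral>\<omega>. 1 * v \<omega> \<partial>M) = 0"
        unfolding v(1) using has_moments_integrable[OF hermite_moments]
        by (simp add: Bochner_Integration.integral_sum)
    qed
    then show ?thesis by simp
  qed
  have mean: "(\<integral>\<omega>. F \<omega> - Y \<omega> \<partial>M) = 0"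
    using test[OF s1, of 0] sumv[OF s1] mJ F(2) by simp
  have o: "(\<integral>\<omega>. (F \<omega> - Y \<omega>) * hermite p (X h \<omega>) \<partial>M) = 0" if h: "norm h = 1" for p h
  proof (cases "p = 0")
    case True
    then show ?thesis using mean by simp
  next
    case False
    then have p: "p \<ge> 1" by simp
    let ?v = "\<lambda>\<omega>. hermite p (X h \<omega>)"
    have sv: "square_integrable M ?v" by (rule has_moments_square_integrable[OF hermite_moments])
    have vc: "?v \<in> wiener_chaos M X p"
      unfolding wiener_chaos_iff[OF p] using hermite_span_basis[OF h, of p] L2_tendsto_const[OF sv]
      by (intro exI[of _ "\<lambda>_. ?v"]) auto
    have Fp: "(\<integral>\<omega>. F \<omega> * ?v \<omega> \<partial>M) = (\<integral>\<omega>. ?J p \<omega> * ?v \<omega> \<partial>M)"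
      using chaos_projection(2)[OF F(1) p vc] integrable_mult_square_integrable[OF F(1) sv]
        integrable_mult_square_integrable[OF sJ[OF p] sv] by (simp add: left_diff_distrib)
    show ?thesis
    proof (rule test[OF sv])
      fix k assume "k \<ge> p"
      have "(\<Sum>q=1..k. \<integral>\<omega>. ?J q \<omega> * ?v \<omega> \<partial>M) = (\<Sum>q=1..k. if q = p then (\<integral>\<omega>. ?J p \<omega> * ?v \<omega> \<partial>M) else 0)"
        by (intro sum.cong refl) (use chaos_chaos_orthogonal[OF Jc _ vc p] in auto)
      also have "\<dots> = (\<integral>\<omega>. ?J p \<omega> * ?v \<omega> \<partial>M)" using \<open>k \<ge> p\<close> p by simp
      finally show "(\<integral>\<omega>. F \<omega> * ?v \<omega> \<partial>M) = (\<integral>\<omega>. (\<Sum>q=1..k. ?J q \<omega>) * ?v \<omega> \<partial>M)"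
        unfolding sumv[OF sv] Fp by simp
    qed
  qed
  have iK: "integrable M (\<lambda>\<omega>. K (field \<omega>) * (F \<omega> - Y \<omega>))"
    by (rule integrable_mult_square_integrable[OF sK sZ])
  have "(\<integral>\<omega>. K (field \<omega>) * (F \<omega> - Y \<omega>) \<partial>M) = 0"
    by (rule hermite_total[OF sZ mean o K(1) iK])
  then show ?thesis
    using integrable_mult_square_integrable[OF F(1) sK] integrable_mult_square_integrable[OF sY sK]
    by (simp add: right_diff_distrib left_diff_distrib mult.commute)
qed

text \<open>The same coefficients must serve two limits: the weight -1/q leads to the
  pseudo-inverse, and the factor q in \<open>hermite_number\<close> turns it into -1, which leads to
  minus the sum of the chaos components.\<close>

lemma hermite_sum_approximation:
  assumes F: "square_integrable M F"
    and Y: "L2_tendsto M (\<lambda>k \<omega>. \<Sum>q=1..k. chaos_projection M X q F \<omega>) Y"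
  obtains c S where "\<And>k. finite (S k)" "\<And>k h. h \<in> S k \<Longrightarrow> norm h = 1"
    "L2_tendsto M (\<lambda>k \<omega>. hermite_sum (c k) (S k) k (field \<omega>)) (OU_pseudo_inverse M X F)"
    "L2_tendsto M (\<lambda>k \<omega>. hermite_number (c k) (S k) k (field \<omega>)) (\<lambda>\<omega>. - Y \<omega>)"
proof -
  let ?J = "\<lambda>q. chaos_projection M X q F"
  have Jc: "?J q \<in> wiener_chaos M X q" if "q \<ge> 1" for q by (rule chaos_projection(1)[OF F(1) that])
  have sJ: "square_integrable M (?J q)" if "q \<ge> 1" for q by (rule wiener_chaos_square_integrable[OF Jc[OF that] that])
  \<comment> \<open>Stage k involves k components; an error below 1/(k+1)^2 for each keeps the total
    below 1/(k+1).\<close>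
  define \<epsilon> where "\<epsilon> k = inverse (real (Suc k)) * inverse (real (Suc k))" for k
  have \<epsilon>: "\<epsilon> k > 0" for k by (simp add: \<epsilon>_def)
  define Q where "Q q k T d \<longleftrightarrow> finite T \<and> (\<forall>h\<in>T. norm h = 1) \<and>
      L2norm M (\<lambda>\<omega>. (\<Sum>h\<in>T. d h * hermite q (X h \<omega>)) - ?J q \<omega>) < \<epsilon> k" for q k T d
  have "\<exists>T d. q \<ge> 1 \<longrightarrow> Q q k T d" for q k
  proof (cases "q \<ge> 1")
    case True
    obtain P where P: "\<And>k. P k \<in> hermite_span q" "L2_tendsto M P (?J q)"
      using Jc[OF True] wiener_chaos_iff[OF True] by blast
    have "\<forall>\<^sub>F j in sequentially. L2norm M (\<lambda>\<omega>. P j \<omega> - ?J q \<omega>) < \<epsilon> k"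
      by (rule order_tendstoD(2)[OF L2_tendstoD(3)[OF P(2)] \<epsilon>])
    then obtain j where j: "L2norm M (\<lambda>\<omega>. P j \<omega> - ?J q \<omega>) < \<epsilon> k" unfolding eventually_sequentially by blast
    obtain T d where "P j = (\<lambda>\<omega>. \<Sum>h\<in>T. d h * hermite q (X h \<omega>))" "finite T" "\<forall>h\<in>T. norm h = 1"
      using P(1)[of j] unfolding hermite_span_def by blast
    with j have "Q q k T d" unfolding Q_def by simp
    then show ?thesis by blast
  qed blast
  then obtain T d where "\<And>q k. q \<ge> 1 \<Longrightarrow> Q q k (T q k) (d q k)" by metis
  then have T: "\<And>q k. q \<ge> 1 \<Longrightarrow> finite (T q k)" "\<And>q k h. q \<ge> 1 \<Longrightarrow> h \<in> T q k \<Longrightarrow> norm h = 1"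
    "\<And>q k. q \<ge> 1 \<Longrightarrow> L2norm M (\<lambda>\<omega>. (\<Sum>h\<in>T q k. d q k h * hermite q (X h \<omega>)) - ?J q \<omega>) < \<epsilon> k"
    unfolding Q_def by blast+
  define A where "A q k \<omega> = (\<Sum>h\<in>T q k. d q k h * hermite q (X h \<omega>))" for q k \<omega>
  have sA: "square_integrable M (A q k)" for q k unfolding A_def
    by (intro has_moments_square_integrable has_moments_sum has_moments_mult has_moments_const hermite_moments)
  define S where "S k = (\<Union>q\<in>{1..k}. T q k)" for k
  \<comment> \<open>The sets of directions vary with the degree; extending the coefficients by 0
    puts all degrees on the common set \<open>S k\<close>.\<close>
  define c where "c k q h = (if q \<ge> 1 \<and> h \<in> T q k then - (1 / real q) * d q k h else 0)" for k q h
  have fS: "finite (S k)" for k unfolding S_def using T(1) by auto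
  have nS: "norm h = 1" if "h \<in> S k" for h k using that T(2) unfolding S_def by auto
  have cs: "(\<Sum>h\<in>S k. \<Sum>q\<le>k. c k q h * r q h) = (\<Sum>q=1..k. - (1 / real q) * (\<Sum>h\<in>T q k. d q k h * r q h))" for k r
  proof -
    have "(\<Sum>h\<in>S k. \<Sum>q\<le>k. c k q h * r q h) = (\<Sum>q\<le>k. \<Sum>h\<in>S k. c k q h * r q h)" by (rule sum.swap)
    also have "\<dots> = (\<Sum>q=1..k. \<Sum>h\<in>S k. c k q h * r q h)"
      by (rule sum.mono_neutral_right) (auto simp: c_def)
    also have "\<dots> = (\<Sum>q=1..k. \<Sum>h\<in>T q k. c k q h * r q h)"
    proof (rule sum.cong[OF refl])
      fix q assume "q \<in> {1..k}"
      then have "T q k \<subseteq> S k" unfolding S_def by auto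
      then show "(\<Sum>h\<in>S k. c k q h * r q h) = (\<Sum>h\<in>T q k. c k q h * r q h)"
        using fS by (intro sum.mono_neutral_right) (auto simp: c_def)
    qed
    also have "\<dots> = (\<Sum>q=1..k. - (1 / real q) * (\<Sum>h\<in>T q k. d q k h * r q h))"
      unfolding sum_distrib_left by (intro sum.cong refl) (auto simp: c_def)
    finally show ?thesis .
  qed
  have hs: "hermite_sum (c k) (S k) k (field \<omega>) = (\<Sum>q=1..k. - (1 / real q) * A q k \<omega>)" for k \<omega>
    unfolding hermite_sum_def A_def by (rule cs)
  have hn: "hermite_number (c k) (S k) k (field \<omega>) = (\<Sum>q=1..k. (- 1) * A q k \<omega>)" for k \<omega>
    unfolding hermite_number_def A_def cs
    by (intro sum.cong refl) (auto simp: sum_distrib_left sum_negf mult.left_commute)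
  have approx: "L2norm M (\<lambda>\<omega>. (\<Sum>q=1..k. w q * A q k \<omega>) - (\<Sum>q=1..k. w q * ?J q \<omega>)) \<le> inverse (real (Suc k))"
    if w: "\<And>q. \<bar>w q\<bar> \<le> 1" for w k
  proof -
    have sd: "square_integrable M (\<lambda>\<omega>. A q k \<omega> - ?J q \<omega>)" if "q \<in> {1..k}" for q
      using that by (intro square_integrable_diff sA sJ) auto
    have "L2norm M (\<lambda>\<omega>. (\<Sum>q=1..k. w q * A q k \<omega>) - (\<Sum>q=1..k. w q * ?J q \<omega>))
      = L2norm M (\<lambda>\<omega>. \<Sum>q=1..k. w q * (A q k \<omega> - ?J q \<omega>))"
      by (simp add: sum_subtractf right_diff_distrib)
    also have "\<dots> \<le> (\<Sum>q=1..k. L2norm M (\<lambda>\<omega>. w q * (A q k \<omega> - ?J q \<omega>)))"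
      by (rule L2norm_sum) (intro square_integrable_cmult sd)
    also have "\<dots> \<le> (\<Sum>q=1..k. \<epsilon> k)"
    proof (rule sum_mono)
      fix q assume q: "q \<in> {1..k}"
      have "\<bar>w q\<bar> * L2norm M (\<lambda>\<omega>. A q k \<omega> - ?J q \<omega>) \<le> 1 * \<epsilon> k"
        using w[of q] T(3)[of q k] q unfolding A_def by (intro mult_mono) (auto intro: less_imp_le)
      then show "L2norm M (\<lambda>\<omega>. w q * (A q k \<omega> - ?J q \<omega>)) \<le> \<epsilon> k" unfolding L2norm_cmult by simp
    qed
    also have "\<dots> \<le> inverse (real (Suc k))"
    proof -
      have "real k * inverse (real (Suc k)) \<le> 1" by (simp add: field_simps)
      from mult_right_mono[OF this, of "inverse (real (Suc k))"]
      show ?thesis by (simp add: \<epsilon>_def mult.assoc)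
    qed
    finally show ?thesis .
  qed
  have lim: "L2_tendsto M (\<lambda>k \<omega>. \<Sum>q=1..k. w q * A q k \<omega>) V"
    if w: "\<And>q. \<bar>w q\<bar> \<le> 1" and V: "L2_tendsto M (\<lambda>k \<omega>. \<Sum>q=1..k. w q * ?J q \<omega>) V" for w V
  proof (rule L2_tendstoI)
    show s: "square_integrable M (\<lambda>\<omega>. \<Sum>q=1..k. w q * A q k \<omega>)" for k
      by (intro square_integrable_sum square_integrable_cmult sA)
    show "square_integrable M V" using L2_tendstoD[OF V] by blast
    show "L2norm M (\<lambda>\<omega>. (\<Sum>q=1..k. w q * A q k \<omega>) - V \<omega>)
      \<le> inverse (real (Suc k)) + L2norm M (\<lambda>\<omega>. (\<Sum>q=1..k. w q * ?J q \<omega>) - V \<omega>)" for k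
      using L2norm_triangle_diff[OF s L2_tendstoD(1)[OF V] L2_tendstoD(2)[OF V], of k k] approx[of w k, OF w] by linarith
    show "(\<lambda>k. inverse (real (Suc k)) + L2norm M (\<lambda>\<omega>. (\<Sum>q=1..k. w q * ?J q \<omega>) - V \<omega>)) \<longlonglongrightarrow> 0"
      using tendsto_add[OF LIMSEQ_inverse_real_of_nat L2_tendstoD(3)[OF V]] by simp
  qed
  show ?thesis
  proof (rule that[OF fS nS])
    show "L2_tendsto M (\<lambda>k \<omega>. hermite_sum (c k) (S k) k (field \<omega>)) (OU_pseudo_inverse M X F)"
      unfolding hs
    proof (rule lim)
      show "\<bar>- (1 / real q)\<bar> \<le> 1" for q by (cases "q = 0") (auto simp: field_simps)
      show "L2_tendsto M (\<lambda>k \<omega>. \<Sum>q=1..k. - (1 / real q) * ?J q \<omega>) (OU_pseudo_inverse M X F)"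
        using OU_pseudo_inverse_tendsto[OF F] by (simp add: sum_negf)
    qed
    show "L2_tendsto M (\<lambda>k \<omega>. hermite_number (c k) (S k) k (field \<omega>)) (\<lambda>\<omega>. - Y \<omega>)"
      unfolding hn
    proof (rule lim)
      show "L2_tendsto M (\<lambda>k \<omega>. \<Sum>q=1..k. - 1 * ?J q \<omega>) (\<lambda>\<omega>. - Y \<omega>)"
        using L2_tendsto_uminus[OF Y] by (simp add: sum_negf)
    qed simp
  qed
qed

text \<open>The energy identity bounds differences of gradients by differences of Hermite sums and
  of their images under L. Both of these converge, so the gradients do, and their limit
  \<open>W\<close> inherits integration by parts against bounded \<open>K\<close>.\<close>

lemma OU_derivative:
  assumes F: "square_integrable M F" "(\<integral>\<omega>. F \<omega> \<partial>M) = 0"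
  obtains W where "is_malliavin_deriv M X (OU_pseudo_inverse M X F) W"
    "\<And>K D B. path_deriv K D \<Longrightarrow> (\<And>x. \<bar>K x\<bar> \<le> B) \<Longrightarrow> has_moments M (\<lambda>\<omega>. norm (D (field \<omega>))) \<Longrightarrow>
      (\<integral>\<omega>. F \<omega> * K (field \<omega>) \<partial>M) = - (\<integral>\<omega>. W \<omega> \<bullet> D (field \<omega>) \<partial>M)"
proof -
  obtain Y where "L2_tendsto M (\<lambda>k \<omega>. \<Sum>q=1..k. 1 * chaos_projection M X q F \<omega>) Y"
    by (rule chaos_series[OF F(1), of "\<lambda>_. 1"]) auto
  then have Y: "L2_tendsto M (\<lambda>k \<omega>. \<Sum>q=1..k. chaos_projection M X q F \<omega>) Y" by simp
  let ?G = "OU_pseudo_inverse M X F"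
  obtain c S where S: "\<And>k. finite (S k)" "\<And>k h. h \<in> S k \<Longrightarrow> norm h = 1"
    and P: "L2_tendsto M (\<lambda>k \<omega>. hermite_sum (c k) (S k) k (field \<omega>)) ?G"
    and N: "L2_tendsto M (\<lambda>k \<omega>. hermite_number (c k) (S k) k (field \<omega>)) (\<lambda>\<omega>. - Y \<omega>)"
    by (rule hermite_sum_approximation[OF F(1) Y]) blast
  define p where "p k \<omega> = hermite_sum (c k) (S k) k (field \<omega>)" for k \<omega>
  define n where "n k \<omega> = hermite_number (c k) (S k) k (field \<omega>)" for k \<omega>
  define d where "d k \<omega> = hermite_grad (c k) (S k) k (field \<omega>)" for k \<omega>
  have sp: "square_integrable M (p k)" and sn: "square_integrable M (n k)" and sd: "square_integrable M (d k)" for k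
    unfolding p_def n_def d_def by (rule hermite_sum_square_integrable)+
  have P': "L2_tendsto M p ?G" and N': "L2_tendsto M n (\<lambda>\<omega>. - Y \<omega>)"
    using P N unfolding p_def n_def by simp_all
  have ibp: "(\<integral>\<omega>. n j \<omega> * K (field \<omega>) \<partial>M) = (\<integral>\<omega>. d j \<omega> \<bullet> D (field \<omega>) \<partial>M)"
    if "path_deriv K D" "has_moments M (\<lambda>\<omega>. K (field \<omega>))" "has_moments M (\<lambda>\<omega>. norm (D (field \<omega>)))" for j K D
    unfolding n_def d_def by (rule hermite_sum_integration_by_parts[OF S(2) that])
  have bil: "(\<integral>\<omega>. d j \<omega> \<bullet> d k \<omega> \<partial>M) = (\<integral>\<omega>. n j \<omega> * p k \<omega> \<partial>M)" for j k
    unfolding d_def[of k] p_def[of k]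
    by (rule ibp[OF path_deriv_hermite_sum hermite_sum_moments(1) hermite_sum_moments(3), symmetric])
  \<comment> \<open>The identity \<open>bil\<close> is bilinear: the squared distance of two
    gradients is the pairing of the two differences, to which Cauchy-Schwarz applies.\<close>
  have grad: "(L2norm M (\<lambda>\<omega>. d j \<omega> - d k \<omega>))\<^sup>2 \<le> L2norm M (\<lambda>\<omega>. n j \<omega> - n k \<omega>) * L2norm M (\<lambda>\<omega>. p j \<omega> - p k \<omega>)" for j k
  proof -
    note ii = inner_Cauchy_Schwarz(1)[OF sd sd] and mi = integrable_mult_square_integrable[OF sn sp]
    have "(L2norm M (\<lambda>\<omega>. d j \<omega> - d k \<omega>))\<^sup>2
        = (\<integral>\<omega>. d j \<omega> \<bullet> d j \<omega> - d j \<omega> \<bullet> d k \<omega> - d k \<omega> \<bullet> d j \<omega> + d k \<omega> \<bullet> d k \<omega> \<partial>M)"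
      unfolding L2norm_square power2_norm_eq_inner by (simp add: inner_diff_left inner_diff_right algebra_simps)
    also have "\<dots> = (\<integral>\<omega>. n j \<omega> * p j \<omega> \<partial>M) - (\<integral>\<omega>. n j \<omega> * p k \<omega> \<partial>M) - (\<integral>\<omega>. n k \<omega> * p j \<omega> \<partial>M) + (\<integral>\<omega>. n k \<omega> * p k \<omega> \<partial>M)"
      using ii by (simp add: bil)
    also have "\<dots> = (\<integral>\<omega>. (n j \<omega> - n k \<omega>) \<bullet> (p j \<omega> - p k \<omega>) \<partial>M)"
      using mi by (simp add: left_diff_distrib right_diff_distrib)
    also have "\<dots> \<le> L2norm M (\<lambda>\<omega>. n j \<omega> - n k \<omega>) * L2norm M (\<lambda>\<omega>. p j \<omega> - p k \<omega>)"
      using inner_Cauchy_Schwarz(2)[OF square_integrable_diff[OF sn sn] square_integrable_diff[OF sp sp], of j k j k] by simp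
    finally show ?thesis .
  qed
  obtain W where W: "L2_tendsto M d W"
  proof (rule L2_complete[OF sd])
    fix \<epsilon> :: real assume \<epsilon>: "\<epsilon> > 0"
    have "\<forall>\<^sub>F k in sequentially. L2norm M (\<lambda>\<omega>. p k \<omega> - ?G \<omega>) < \<epsilon> / 2"
      "\<forall>\<^sub>F k in sequentially. L2norm M (\<lambda>\<omega>. n k \<omega> - - Y \<omega>) < \<epsilon> / 2"
      by (rule order_tendstoD(2)[OF L2_tendstoD(3)[OF P']] order_tendstoD(2)[OF L2_tendstoD(3)[OF N']]; use \<epsilon> in simp)+
    then have "\<forall>\<^sub>F k in sequentially. L2norm M (\<lambda>\<omega>. p k \<omega> - ?G \<omega>) < \<epsilon> / 2 \<and> L2norm M (\<lambda>\<omega>. n k \<omega> - - Y \<omega>) < \<epsilon> / 2"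
      by (rule eventually_conj)
    then obtain K where K: "\<And>k. k \<ge> K \<Longrightarrow> L2norm M (\<lambda>\<omega>. p k \<omega> - ?G \<omega>) < \<epsilon> / 2"
      "\<And>k. k \<ge> K \<Longrightarrow> L2norm M (\<lambda>\<omega>. n k \<omega> - - Y \<omega>) < \<epsilon> / 2"
      unfolding eventually_sequentially by blast
    have "L2norm M (\<lambda>\<omega>. d j \<omega> - d k \<omega>) < \<epsilon>" if "j \<ge> K" "k \<ge> K" for j k
    proof -
      have "L2norm M (\<lambda>\<omega>. p j \<omega> - p k \<omega>) < \<epsilon>"
        using L2norm_triangle_diff[OF sp L2_tendstoD(2)[OF P'] sp, of j k] K(1)[OF that(1)] K(1)[OF that(2)]
          L2norm_minus_commute[of M "p k" ?G] by linarith
      moreover have "L2norm M (\<lambda>\<omega>. n j \<omega> - n k \<omega>) < \<epsilon>"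
        using L2norm_triangle_diff[OF sn L2_tendstoD(2)[OF N'] sn, of j k] K(2)[OF that(1)] K(2)[OF that(2)]
          L2norm_minus_commute[of M "n k" "\<lambda>\<omega>. - Y \<omega>"] by linarith
      ultimately have "L2norm M (\<lambda>\<omega>. n j \<omega> - n k \<omega>) * L2norm M (\<lambda>\<omega>. p j \<omega> - p k \<omega>) < \<epsilon> * \<epsilon>"
        by (intro mult_strict_mono') auto
      then have "(L2norm M (\<lambda>\<omega>. d j \<omega> - d k \<omega>))\<^sup>2 < \<epsilon>\<^sup>2" using grad[of j k] by (simp add: power2_eq_square)
      then show ?thesis using \<epsilon> by (simp add: power_less_imp_less_base)
    qed
    then show "\<exists>K. \<forall>j\<ge>K. \<forall>k\<ge>K. L2norm M (\<lambda>x. d j x - d k x) < \<epsilon>" by blast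
  qed
  show ?thesis
  proof (rule that)
    show "is_malliavin_deriv M X ?G W"
      by (rule malliavin_deriv_closed[OF P' W]) (unfold p_def d_def, rule malliavin_deriv_hermite_sum[OF S(1)])
    fix K :: "('h \<Rightarrow> real) \<Rightarrow> real" and D B
    assume K: "path_deriv K D" "\<And>x. \<bar>K x\<bar> \<le> B" and mD: "has_moments M (\<lambda>\<omega>. norm (D (field \<omega>)))"
    note [measurable] = path_derivD(1,2)[OF K(1)]
    have mK: "has_moments M (\<lambda>\<omega>. K (field \<omega>))" by (rule has_moments_bounded[of _ B]) (use K(2) in auto)
    have sK: "square_integrable M (\<lambda>\<omega>. K (field \<omega>))" by (rule has_moments_square_integrable[OF mK])
    have sD: "square_integrable M (\<lambda>\<omega>. D (field \<omega>))"
      by (rule square_integrable_bound[OF has_moments_square_integrable[OF mD]]) auto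
    have "(\<lambda>k. \<integral>\<omega>. n k \<omega> * K (field \<omega>) \<partial>M) \<longlonglongrightarrow> (\<integral>\<omega>. - Y \<omega> * K (field \<omega>) \<partial>M)"
      using L2_tendsto_inner[OF N' L2_tendsto_const[OF sK]] by simp
    moreover have "(\<lambda>k. \<integral>\<omega>. d k \<omega> \<bullet> D (field \<omega>) \<partial>M) \<longlonglongrightarrow> (\<integral>\<omega>. W \<omega> \<bullet> D (field \<omega>) \<partial>M)"
      by (rule L2_tendsto_inner[OF W L2_tendsto_const[OF sD]])
    ultimately have "(\<integral>\<omega>. - Y \<omega> * K (field \<omega>) \<partial>M) = (\<integral>\<omega>. W \<omega> \<bullet> D (field \<omega>) \<partial>M)"
      unfolding ibp[OF K(1) mK mD] by (rule LIMSEQ_unique)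
    then show "(\<integral>\<omega>. F \<omega> * K (field \<omega>) \<partial>M) = - (\<integral>\<omega>. W \<omega> \<bullet> D (field \<omega>) \<partial>M)"
      using chaos_series_total[OF F Y path_derivD(1)[OF K(1)] K(2)] by simp
  qed
qed

lemma malliavin_deriv_OU:
  assumes "square_integrable M F" "(\<integral>\<omega>. F \<omega> \<partial>M) = 0"
  shows "is_malliavin_deriv M X (OU_pseudo_inverse M X F) (malliavin_deriv M X (OU_pseudo_inverse M X F))"
proof -
  obtain W where "is_malliavin_deriv M X (OU_pseudo_inverse M X F) W" by (rule OU_derivative[OF assms])
  then show ?thesis
    unfolding malliavin_deriv_def by (rule someI[of "is_malliavin_deriv M X (OU_pseudo_inverse M X F)"])
qed

section \<open>The Malliavin-Stein identity\<close>

lemma malliavin_deriv_D12: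
  assumes "F \<in> D12 M X" shows "is_malliavin_deriv M X F (malliavin_deriv M X F)"
  using assms someI_ex[of "is_malliavin_deriv M X F"] unfolding D12_def malliavin_deriv_def by simp

lemma is_malliavin_deriv_square_integrable:
  assumes "is_malliavin_deriv M X F U"
  shows "square_integrable M F" "square_integrable M U"
  using malliavin_imp_weak_deriv[OF assms] by (auto simp: weak_deriv_def)

lemma stein_factor_integrable:
  assumes "F \<in> D12 M X" "(\<integral>\<omega>. F \<omega> \<partial>M) = 0"
  shows "integrable M (stein_factor M X F)"
proof -
  note F = malliavin_deriv_D12[OF assms(1)]
  note U = malliavin_deriv_OU[OF is_malliavin_deriv_square_integrable(1)[OF F] assms(2)]
  have "integrable M (\<lambda>\<omega>. malliavin_deriv M X F \<omega> \<bullet> (- malliavin_deriv M X (OU_pseudo_inverse M X F) \<omega>))"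
    by (intro inner_Cauchy_Schwarz(1) square_integrable_uminus is_malliavin_deriv_square_integrable(2)[OF F]
        is_malliavin_deriv_square_integrable(2)[OF U])
  then show ?thesis unfolding stein_factor_def[abs_def] by simp
qed

text \<open>The formula is first proved with \<open>f\<close> evaluated at smooth approximations
  \<open>H k\<close> of \<open>F\<close>, where the gradient of \<open>f (H k)\<close> is a finite
  sum of bounded functionals times fixed vectors. At that stage the constructed gradient
  \<open>W\<close> can be exchanged for the chosen derivative of the pseudo-inverse; then k tends to
  infinity.\<close>

lemma malliavin_stein_identity:
  fixes f f' :: "real \<Rightarrow> real"
  assumes F: "F \<in> D12 M X" "(\<integral>\<omega>. F \<omega> \<partial>M) = 0"
    and f: "\<And>y. DERIV f y :> f' y" "\<And>y. isCont f' y" "\<And>y. \<bar>f' y\<bar> \<le> C"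
  shows "(\<integral>\<omega>. F \<omega> * f (F \<omega>) \<partial>M) = (\<integral>\<omega>. f' (F \<omega>) * (1 - stein_factor M X F \<omega>) \<partial>M)"
proof -
  let ?DF = "malliavin_deriv M X F" and ?U = "malliavin_deriv M X (OU_pseudo_inverse M X F)"
  note dF = malliavin_deriv_D12[OF F(1)]
  note sF = is_malliavin_deriv_square_integrable[OF dF]
  note dU = malliavin_deriv_OU[OF sF(1) F(2)]
  note sU = is_malliavin_deriv_square_integrable(2)[OF dU]
  have [measurable]: "f \<in> borel_measurable borel" "f' \<in> borel_measurable borel"
    using f DERIV_isCont[OF f(1)] by (auto intro!: borel_measurable_continuous_onI continuous_at_imp_continuous_on)
  have [measurable]: "F \<in> borel_measurable M" "?DF \<in> borel_measurable M" "?U \<in> borel_measurable M"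
    using sF sU by auto
  have C0: "0 \<le> C" using f(3)[of 0] by linarith
  have lip: "\<bar>f a - f b\<bar> \<le> C * \<bar>a - b\<bar>" for a b
    using field_differentiable_bound[of UNIV f f' C a b] f by simp
  obtain W where W: "is_malliavin_deriv M X (OU_pseudo_inverse M X F) W"
    "\<And>K D B. path_deriv K D \<Longrightarrow> (\<And>x. \<bar>K x\<bar> \<le> B) \<Longrightarrow> has_moments M (\<lambda>\<omega>. norm (D (field \<omega>))) \<Longrightarrow>
      (\<integral>\<omega>. F \<omega> * K (field \<omega>) \<partial>M) = - (\<integral>\<omega>. W \<omega> \<bullet> D (field \<omega>) \<partial>M)"
    by (rule OU_derivative[OF sF(1) F(2)]) blast
  note sW = is_malliavin_deriv_square_integrable(2)[OF W(1)]
  note wU = malliavin_imp_weak_deriv[OF dU] and wW = malliavin_imp_weak_deriv[OF W(1)]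
  obtain H V where HV: "\<And>k. smooth_functional_deriv X (H k) (V k)"
    and H: "L2_tendsto M H F" and V: "L2_tendsto M V ?DF"
    using dF unfolding is_malliavin_deriv_def by blast
  have smooth: "(\<integral>\<omega>. F \<omega> * f (H k \<omega>) \<partial>M) = - (\<integral>\<omega>. ?U \<omega> \<bullet> (f' (H k \<omega>) *\<^sub>R V k \<omega>) \<partial>M)" for k
  proof (rule smooth_functional_path_deriv[OF HV[of k]])
    fix h n K \<phi> B
    assume a: "H k = (\<lambda>\<omega>. h (field \<omega>))" "V k = (\<lambda>\<omega>. \<Sum>i<n. K i (field \<omega>) *\<^sub>R \<phi> i)"
      "path_deriv h (\<lambda>x. \<Sum>i<n. K i x *\<^sub>R \<phi> i)" "\<And>x. \<bar>h x\<bar> \<le> B"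
      "\<And>i. i < (n::nat) \<Longrightarrow> K i \<in> borel_measurable field_space" "\<And>i x. i < n \<Longrightarrow> \<bar>K i x\<bar> \<le> B"
    note [measurable] = path_derivD(1)[OF a(3)]
    let ?L = "\<lambda>i x. f' (h x) * K i x"
    have L: "?L i \<in> borel_measurable field_space" "\<bar>?L i x\<bar> \<le> C * B" if "i < n" for i x
    proof -
      note [measurable] = a(5)[OF that]
      show "?L i \<in> borel_measurable field_space" by measurable
      show "\<bar>?L i x\<bar> \<le> C * B" unfolding abs_mult using f(3) a(6)[OF that] C0 by (intro mult_mono) auto
    qed
    have eL: "f' (h x) *\<^sub>R (\<Sum>i<n. K i x *\<^sub>R \<phi> i) = (\<Sum>i<n. ?L i x *\<^sub>R \<phi> i)" for x
      by (simp add: scaleR_sum_right)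
    have pd: "path_deriv (\<lambda>x. f (h x)) (\<lambda>x. \<Sum>i<n. ?L i x *\<^sub>R \<phi> i)"
      using path_deriv_comp[OF a(3) f(1,2)] unfolding eL .
    have fb: "\<bar>f (h x)\<bar> \<le> \<bar>f 0\<bar> + C * B" for x
      using lip[of "h x" 0] mult_left_mono[OF a(4)[of x] C0] by simp
    have "has_moments M (\<lambda>\<omega>. norm (\<Sum>i<n. ?L i (field \<omega>) *\<^sub>R \<phi> i))"
      using L by (rule has_moments_bounded_sum)
    from W(2)[OF pd fb this]
    have "(\<integral>\<omega>. F \<omega> * f (H k \<omega>) \<partial>M) = - (\<integral>\<omega>. W \<omega> \<bullet> (\<Sum>i<n. ?L i (field \<omega>) *\<^sub>R \<phi> i) \<partial>M)"
      unfolding a(1) .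
    \<comment> \<open>Both \<open>W\<close> and \<open>?U\<close> are weak derivatives of the
      pseudo-inverse, and every summand has the form to which \<open>weak_deriv_unique\<close>
      applies.\<close>
    also have "(\<integral>\<omega>. W \<omega> \<bullet> (\<Sum>i<n. ?L i (field \<omega>) *\<^sub>R \<phi> i) \<partial>M) = (\<integral>\<omega>. ?U \<omega> \<bullet> (\<Sum>i<n. ?L i (field \<omega>) *\<^sub>R \<phi> i) \<partial>M)"
    proof -
      have sL: "square_integrable M (\<lambda>\<omega>. ?L i (field \<omega>) *\<^sub>R \<phi> i)" if "i \<in> {..<n}" for i
      proof (rule square_integrable_bounded[where B="C * B * norm (\<phi> i)"])
        show "(\<lambda>\<omega>. ?L i (field \<omega>) *\<^sub>R \<phi> i) \<in> borel_measurable M"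
          using measurable_compose[OF field_measurable L(1), of i] that by simp
        show "norm (?L i (field \<omega>) *\<^sub>R \<phi> i) \<le> C * B * norm (\<phi> i)" for \<omega>
          unfolding norm_scaleR real_norm_def using L(2) that by (intro mult_right_mono) auto
      qed
      have "(\<integral>\<omega>. Z \<omega> \<bullet> (\<Sum>i<n. ?L i (field \<omega>) *\<^sub>R \<phi> i) \<partial>M) = (\<Sum>i<n. \<integral>\<omega>. Z \<omega> \<bullet> (?L i (field \<omega>) *\<^sub>R \<phi> i) \<partial>M)"
        if "square_integrable M Z" for Z
        unfolding inner_sum_right
        by (rule Bochner_Integration.integral_sum) (rule inner_Cauchy_Schwarz(1)[OF that sL])
      from this[OF sW] this[OF sU] show ?thesis
        using weak_deriv_unique[OF wW wU L] by simp
    qed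
    finally show "(\<integral>\<omega>. F \<omega> * f (H k \<omega>) \<partial>M) = - (\<integral>\<omega>. ?U \<omega> \<bullet> (f' (H k \<omega>) *\<^sub>R V k \<omega>) \<partial>M)"
      unfolding a(1,2) eL .
  qed
  \<comment> \<open>\<open>f\<close> is Lipschitz, so \<open>f (H k)\<close> converges in L2
    directly; \<open>f'\<close> is merely continuous, and almost sure convergence along a
    subsequence is used for it.\<close>
  obtain r where r: "strict_mono r" "AE \<omega> in M. (\<lambda>k. H (r k) \<omega>) \<longlonglongrightarrow> F \<omega>"
    by (rule L2_tendsto_AE_subseq[OF H])
  note Hr = L2_tendsto_subseq[OF H r(1)] and Vr = L2_tendsto_subseq[OF V r(1)]
  note sHr = L2_tendstoD[OF Hr] and sVr = L2_tendstoD[OF Vr]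
  have [measurable]: "H (r k) \<in> borel_measurable M" "V (r k) \<in> borel_measurable M" for k
    using sHr(1) sVr(1) by auto
  have sf: "square_integrable M (\<lambda>\<omega>. f (Z \<omega>))" if Z: "square_integrable M Z" for Z
  proof (rule square_integrable_bound)
    have [measurable]: "Z \<in> borel_measurable M" using Z by auto
    show "(\<lambda>\<omega>. f (Z \<omega>)) \<in> borel_measurable M" by measurable
    show "square_integrable M (\<lambda>\<omega>. \<bar>f 0\<bar> + C * \<bar>Z \<omega>\<bar>)"
      using square_integrable_norm[OF Z] by (intro square_integrable_add square_integrable_cmult) (auto simp: square_integrable_def)
    show "AE \<omega> in M. norm (f (Z \<omega>)) \<le> norm (\<bar>f 0\<bar> + C * \<bar>Z \<omega>\<bar>)"
      using lip[of "Z \<omega>" 0 for \<omega>] C0 by (intro AE_I2) (smt (verit) abs_ge_zero mult_nonneg_nonneg real_norm_def)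
  qed
  have fl: "L2_tendsto M (\<lambda>k \<omega>. f (H (r k) \<omega>)) (\<lambda>\<omega>. f (F \<omega>))"
  proof (rule L2_tendstoI[OF sf[OF sHr(1)] sf[OF sF(1)]])
    show "L2norm M (\<lambda>\<omega>. f (H (r k) \<omega>) - f (F \<omega>)) \<le> C * L2norm M (\<lambda>\<omega>. H (r k) \<omega> - F \<omega>)" for k
    proof -
      have sd: "square_integrable M (\<lambda>\<omega>. C * (H (r k) \<omega> - F \<omega>))"
        by (intro square_integrable_cmult square_integrable_diff sHr sF)
      have "(\<integral>\<omega>. (norm (f (H (r k) \<omega>) - f (F \<omega>)))\<^sup>2 \<partial>M) \<le> (\<integral>\<omega>. (norm (C * (H (r k) \<omega> - F \<omega>)))\<^sup>2 \<partial>M)"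
      proof (rule integral_mono)
        show "(norm (f (H (r k) \<omega>) - f (F \<omega>)))\<^sup>2 \<le> (norm (C * (H (r k) \<omega> - F \<omega>)))\<^sup>2" for \<omega>
          using lip[of "H (r k) \<omega>" "F \<omega>"] C0 by (intro power_mono) (auto simp: abs_mult)
      qed (use sd square_integrable_diff[OF sf[OF sHr(1)] sf[OF sF(1)], of k] in \<open>auto simp: square_integrable_def\<close>)
      then have "L2norm M (\<lambda>\<omega>. f (H (r k) \<omega>) - f (F \<omega>)) \<le> L2norm M (\<lambda>\<omega>. C * (H (r k) \<omega> - F \<omega>))"
        unfolding L2norm_def by (rule real_sqrt_le_mono)
      then show ?thesis unfolding L2norm_cmult using C0 by simp
    qed
    show "(\<lambda>k. C * L2norm M (\<lambda>\<omega>. H (r k) \<omega> - F \<omega>)) \<longlonglongrightarrow> 0"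
      using tendsto_mult_left[OF sHr(3), of C] by simp
  qed
  have sfV: "square_integrable M (\<lambda>\<omega>. f' (Z \<omega>) *\<^sub>R Q \<omega>)"
    if "square_integrable M Q" and [measurable]: "Z \<in> borel_measurable M" for Z and Q :: "'a \<Rightarrow> 'h"
  proof (rule square_integrable_bound[OF square_integrable_scaleR[OF that(1), of C]])
    have [measurable]: "Q \<in> borel_measurable M" using that by auto
    show "(\<lambda>\<omega>. f' (Z \<omega>) *\<^sub>R Q \<omega>) \<in> borel_measurable M" by measurable
    show "AE \<omega> in M. norm (f' (Z \<omega>) *\<^sub>R Q \<omega>) \<le> norm (C *\<^sub>R Q \<omega>)"
      using f(3) C0 by (intro AE_I2) (simp add: mult_right_mono)
  qed
  have Vl: "L2_tendsto M (\<lambda>k \<omega>. f' (H (r k) \<omega>) *\<^sub>R V (r k) \<omega>) (\<lambda>\<omega>. f' (F \<omega>) *\<^sub>R ?DF \<omega>)"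
  proof (rule L2_tendstoI)
    \<comment> \<open>The error of the product is split: replacing \<open>V\<close> costs at most
      \<open>C\<close> times its L2 error, and with the gradient \<open>?DF\<close> fixed, dominated
      convergence handles \<open>f'\<close>.\<close>
    have l2: "L2_tendsto M (\<lambda>k \<omega>. f' (H (r k) \<omega>) *\<^sub>R ?DF \<omega>) (\<lambda>\<omega>. f' (F \<omega>) *\<^sub>R ?DF \<omega>)"
    proof (rule L2_tendsto_dominated)
      show "square_integrable M (\<lambda>\<omega>. C * norm (?DF \<omega>))"
        by (intro square_integrable_cmult square_integrable_norm sF)
      show "AE \<omega> in M. (\<lambda>k. f' (H (r k) \<omega>) *\<^sub>R ?DF \<omega>) \<longlonglongrightarrow> f' (F \<omega>) *\<^sub>R ?DF \<omega>"
        using r(2) by eventually_elim (intro tendsto_scaleR tendsto_const isCont_tendsto_compose[OF f(2)])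
    qed (use f(3) in \<open>auto intro!: mult_right_mono\<close>)
    show s1: "square_integrable M (\<lambda>\<omega>. f' (H (r k) \<omega>) *\<^sub>R V (r k) \<omega>)" for k
      by (rule sfV[OF sVr(1)]) measurable
    show s2: "square_integrable M (\<lambda>\<omega>. f' (F \<omega>) *\<^sub>R ?DF \<omega>)"
      by (rule sfV[OF sF(2)]) measurable
    show "L2norm M (\<lambda>\<omega>. f' (H (r k) \<omega>) *\<^sub>R V (r k) \<omega> - f' (F \<omega>) *\<^sub>R ?DF \<omega>)
       \<le> C * L2norm M (\<lambda>\<omega>. V (r k) \<omega> - ?DF \<omega>) + L2norm M (\<lambda>\<omega>. f' (H (r k) \<omega>) *\<^sub>R ?DF \<omega> - f' (F \<omega>) *\<^sub>R ?DF \<omega>)" for k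
    proof -
      have sd: "square_integrable M (\<lambda>\<omega>. V (r k) \<omega> - ?DF \<omega>)" by (intro square_integrable_diff sVr sF)
      have "(\<integral>\<omega>. (norm (f' (H (r k) \<omega>) *\<^sub>R V (r k) \<omega> - f' (H (r k) \<omega>) *\<^sub>R ?DF \<omega>))\<^sup>2 \<partial>M)
          \<le> (\<integral>\<omega>. (norm (C *\<^sub>R (V (r k) \<omega> - ?DF \<omega>)))\<^sup>2 \<partial>M)"
      proof (rule integral_mono)
        show "integrable M (\<lambda>\<omega>. (norm (f' (H (r k) \<omega>) *\<^sub>R V (r k) \<omega> - f' (H (r k) \<omega>) *\<^sub>R ?DF \<omega>))\<^sup>2)"
          using square_integrable_diff[OF s1 L2_tendstoD(1)[OF l2], of k k] by (simp add: square_integrable_def)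
        show "integrable M (\<lambda>\<omega>. (norm (C *\<^sub>R (V (r k) \<omega> - ?DF \<omega>)))\<^sup>2)"
          using square_integrable_scaleR[OF sd, of C] by (simp add: square_integrable_def)
        show "(norm (f' (H (r k) \<omega>) *\<^sub>R V (r k) \<omega> - f' (H (r k) \<omega>) *\<^sub>R ?DF \<omega>))\<^sup>2 \<le> (norm (C *\<^sub>R (V (r k) \<omega> - ?DF \<omega>)))\<^sup>2" for \<omega>
          unfolding scaleR_diff_right[symmetric] norm_scaleR
          using f(3)[of "H (r k) \<omega>"] C0 by (intro power_mono mult_right_mono) auto
      qed
      then have "L2norm M (\<lambda>\<omega>. f' (H (r k) \<omega>) *\<^sub>R V (r k) \<omega> - f' (H (r k) \<omega>) *\<^sub>R ?DF \<omega>)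
          \<le> L2norm M (\<lambda>\<omega>. C *\<^sub>R (V (r k) \<omega> - ?DF \<omega>))"
        unfolding L2norm_def by (rule real_sqrt_le_mono)
      then have "L2norm M (\<lambda>\<omega>. f' (H (r k) \<omega>) *\<^sub>R V (r k) \<omega> - f' (H (r k) \<omega>) *\<^sub>R ?DF \<omega>) \<le> C * L2norm M (\<lambda>\<omega>. V (r k) \<omega> - ?DF \<omega>)"
        unfolding L2norm_scaleR using C0 by simp
      then show ?thesis
        using L2norm_triangle_diff[OF s1 L2_tendstoD(1)[OF l2] s2, of k k] by linarith
    qed
    show "(\<lambda>k. C * L2norm M (\<lambda>\<omega>. V (r k) \<omega> - ?DF \<omega>) + L2norm M (\<lambda>\<omega>. f' (H (r k) \<omega>) *\<^sub>R ?DF \<omega> - f' (F \<omega>) *\<^sub>R ?DF \<omega>)) \<longlonglongrightarrow> 0"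
      using tendsto_add[OF tendsto_mult_left[OF sVr(3), of C] L2_tendstoD(3)[OF l2]] by simp
  qed
  have "(\<lambda>k. \<integral>\<omega>. F \<omega> * f (H (r k) \<omega>) \<partial>M) \<longlonglongrightarrow> (\<integral>\<omega>. F \<omega> * f (F \<omega>) \<partial>M)"
    using L2_tendsto_inner[OF L2_tendsto_const[OF sF(1)] fl] by simp
  moreover have "(\<lambda>k. - (\<integral>\<omega>. ?U \<omega> \<bullet> (f' (H (r k) \<omega>) *\<^sub>R V (r k) \<omega>) \<partial>M)) \<longlonglongrightarrow> - (\<integral>\<omega>. ?U \<omega> \<bullet> (f' (F \<omega>) *\<^sub>R ?DF \<omega>) \<partial>M)"
    by (rule tendsto_minus[OF L2_tendsto_inner[OF L2_tendsto_const[OF sU] Vl]])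
  ultimately have "(\<integral>\<omega>. F \<omega> * f (F \<omega>) \<partial>M) = - (\<integral>\<omega>. ?U \<omega> \<bullet> (f' (F \<omega>) *\<^sub>R ?DF \<omega>) \<partial>M)"
    unfolding smooth by (rule LIMSEQ_unique)
  also have "\<dots> = (\<integral>\<omega>. - (?U \<omega> \<bullet> (f' (F \<omega>) *\<^sub>R ?DF \<omega>)) \<partial>M)" by simp
  also have "\<dots> = (\<integral>\<omega>. f' (F \<omega>) * (1 - stein_factor M X F \<omega>) \<partial>M)"
    by (rule Bochner_Integration.integral_cong) (auto simp: stein_factor_def inner_commute)
  finally show ?thesis .
qed

end

section \<open>Stein's equation\<close>

abbreviation "\<Phi> \<equiv> cdf std_normal_distribution"

section \<open>The standard normal distribution function and its tails\<close>

lemma std_normal_cdf_bounds: "0 \<le> \<Phi> x" "\<Phi> x \<le> 1"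
proof -
  interpret N: real_distribution std_normal_distribution by (rule real_dist_normal_dist)
  show "0 \<le> \<Phi> x" "\<Phi> x \<le> 1" using N.cdf_nonneg N.cdf_bounded_prob by auto
qed

lemma std_normal_cdf_mono: "x \<le> y \<Longrightarrow> \<Phi> x \<le> \<Phi> y"
proof -
  interpret N: real_distribution std_normal_distribution by (rule real_dist_normal_dist)
  show "x \<le> y \<Longrightarrow> \<Phi> x \<le> \<Phi> y" by (rule N.cdf_nondecreasing)
qed

lemma std_normal_cdf_lim: "(\<Phi> \<longlongrightarrow> 0) at_bot" "(\<Phi> \<longlongrightarrow> 1) at_top"
proof -
  interpret N: real_distribution std_normal_distribution by (rule real_dist_normal_dist)
  show "(\<Phi> \<longlongrightarrow> 0) at_bot" "(\<Phi> \<longlongrightarrow> 1) at_top" by (rule N.cdf_lim_at_bot N.cdf_lim_at_top_prob)+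
qed

lemma std_normal_density_continuous: "continuous_on S std_normal_density"
  using isCont_std_normal_density by (auto intro!: continuous_at_imp_continuous_on)

lemma DERIV_std_normal_cdf: "DERIV \<Phi> x :> std_normal_density x"
proof -
  interpret N: real_distribution std_normal_distribution by (rule real_dist_normal_dist)
  let ?d = std_normal_density
  \<comment> \<open>A base point below x turns the distribution function near x into an indefinite
    integral over a compact interval.\<close>
  have eq: "\<Phi> y = \<Phi> (x - 1) + integral {x - 1..y} ?d" if "y \<in> {x - 1<..<x + 1}" for y
  proof -
    have y: "x - 1 < y" using that by simp
    have m: "measure std_normal_distribution {x - 1<..y} = (\<integral>t. indicator {x - 1<..y} t * ?d t \<partial>lborel)"
    proof -
      have "measure std_normal_distribution {x - 1<..y} = (\<integral>t. indicator {x - 1<..y} t \<partial>std_normal_distribution)"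
        by simp
      also have "\<dots> = (\<integral>t. indicator {x - 1<..y} t * ?d t \<partial>lborel)"
        by (subst integral_density) (auto simp: mult.commute)
      finally show ?thesis .
    qed
    have "\<Phi> y - \<Phi> (x - 1) = measure std_normal_distribution {x - 1<..y}"
      using N.cdf_diff_eq[OF y] .
    also have "\<dots> = (\<integral>t. indicator {x - 1<..y} t * ?d t \<partial>lborel)" by (rule m)
    also have "\<dots> = (\<integral>t. indicator {x - 1..y} t * ?d t \<partial>lborel)"
    proof (rule integral_cong_AE)
      show "AE t in lborel. indicator {x - 1<..y} t * ?d t = indicator {x - 1..y} t * ?d t"
        using AE_lborel_singleton[of "x - 1"] by eventually_elim (auto simp: indicator_def)
    qed auto
    also have "\<dots> = (LINT t:{x - 1..y}|lborel. ?d t)" by (simp add: set_lebesgue_integral_def)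
    also have "\<dots> = integral {x - 1..y} ?d"
      by (rule set_borel_integral_eq_integral) (intro borel_integrable_atLeastAtMost' std_normal_density_continuous)
    finally show ?thesis by simp
  qed
  have "((\<lambda>y. integral {x - 1..y} ?d) has_real_derivative ?d x) (at x within {x - 1..x + 1})"
    by (rule integral_has_real_derivative) (auto intro: std_normal_density_continuous)
  then have "((\<lambda>y. integral {x - 1..y} ?d) has_real_derivative ?d x) (at x)"
    by (subst (asm) at_within_interior) auto
  then have "((\<lambda>y. \<Phi> (x - 1) + integral {x - 1..y} ?d) has_real_derivative ?d x) (at x)"
    using DERIV_add[OF DERIV_const, of "\<lambda>y. integral {x - 1..y} ?d" "?d x" x UNIV "\<Phi> (x - 1)"] by simp
  then show ?thesis
    by (rule has_field_derivative_transform_within_open[of _ _ _ "{x - 1<..<x + 1}"]) (auto simp: eq)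
qed

lemma std_normal_density_pos: "0 < std_normal_density x"
  by (rule normal_density_pos) simp

text \<open>With t = x^2 / 2 the inequalities exp t \<ge> t and exp t \<ge> t^2 / 2 give the
  constants 2 and 8.\<close>

lemma std_normal_density_le: "x\<^sup>2 * std_normal_density x \<le> 8 * inverse (x\<^sup>2)" "std_normal_density x \<le> 2 * inverse (x\<^sup>2)"
  if "x \<noteq> 0"
proof -
  have t: "0 \<le> x\<^sup>2 / 2" by simp
  have s: "1 / sqrt (2 * pi) \<le> 1" using pi_ge_two by (simp add: real_le_rsqrt)
  have d: "std_normal_density x \<le> inverse (exp (x\<^sup>2 / 2))"
    unfolding std_normal_density_def using mult_right_mono[OF s, of "exp (- x\<^sup>2 / 2)"] by (simp add: exp_minus)
  have x: "0 < x\<^sup>2" using that by simp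
  have "x\<^sup>2 / 2 \<le> exp (x\<^sup>2 / 2)" using exp_ge_add_one_self[of "x\<^sup>2 / 2"] by linarith
  then have "inverse (exp (x\<^sup>2 / 2)) \<le> inverse (x\<^sup>2 / 2)" using x by (intro le_imp_inverse_le) auto
  from order_trans[OF d this] show "std_normal_density x \<le> 2 * inverse (x\<^sup>2)" by (simp add: inverse_eq_divide)
  have "(x\<^sup>2 / 2)\<^sup>2 / 2 \<le> exp (x\<^sup>2 / 2)" using exp_lower_Taylor_quadratic[OF t] t by linarith
  then have "inverse (exp (x\<^sup>2 / 2)) \<le> inverse ((x\<^sup>2 / 2)\<^sup>2 / 2)" using x by (intro le_imp_inverse_le) auto
  then have "x\<^sup>2 * std_normal_density x \<le> x\<^sup>2 * inverse ((x\<^sup>2 / 2)\<^sup>2 / 2)" using d by (intro mult_left_mono) auto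
  also have "\<dots> = 8 * inverse (x\<^sup>2)" using x by (simp add: field_simps power2_eq_square)
  finally show "x\<^sup>2 * std_normal_density x \<le> 8 * inverse (x\<^sup>2)" .
qed

lemma inverse_square_tendsto: "((\<lambda>x::real. c * inverse (x\<^sup>2)) \<longlongrightarrow> 0) at_top" "((\<lambda>x::real. c * inverse (x\<^sup>2)) \<longlongrightarrow> 0) at_bot"
proof -
  have "((\<lambda>x::real. c * (inverse x)\<^sup>2) \<longlongrightarrow> c * 0\<^sup>2) at_top"
    by (intro tendsto_mult tendsto_const tendsto_power tendsto_mono[OF at_top_le_at_infinity tendsto_inverse_0])
  then show "((\<lambda>x::real. c * inverse (x\<^sup>2)) \<longlongrightarrow> 0) at_top" by (simp add: power_inverse)
  have "((\<lambda>x::real. c * (inverse x)\<^sup>2) \<longlongrightarrow> c * 0\<^sup>2) at_bot"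
    by (intro tendsto_mult tendsto_const tendsto_power tendsto_mono[OF at_bot_le_at_infinity tendsto_inverse_0])
  then show "((\<lambda>x::real. c * inverse (x\<^sup>2)) \<longlongrightarrow> 0) at_bot" by (simp add: power_inverse)
qed

lemma std_normal_density_tendsto:
  "(std_normal_density \<longlongrightarrow> 0) at_top" "(std_normal_density \<longlongrightarrow> 0) at_bot"
  "((\<lambda>x. x\<^sup>2 * std_normal_density x) \<longlongrightarrow> 0) at_top" "((\<lambda>x. x\<^sup>2 * std_normal_density x) \<longlongrightarrow> 0) at_bot"
proof -
  have "eventually (\<lambda>x::real. x \<noteq> 0) at_top" "eventually (\<lambda>x::real. x \<noteq> 0) at_bot"
    using eventually_gt_at_top[of 0] eventually_le_at_bot[of "- 1"] by (auto elim!: eventually_mono)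
  note n = eventually_mono[OF this(1) std_normal_density_le(2)] eventually_mono[OF this(2) std_normal_density_le(2)]
    eventually_mono[OF this(1) std_normal_density_le(1)] eventually_mono[OF this(2) std_normal_density_le(1)]
  have nn: "eventually (\<lambda>x. 0 \<le> std_normal_density x) F" "eventually (\<lambda>x. 0 \<le> x\<^sup>2 * std_normal_density x) F" for F
    by simp_all
  show "(std_normal_density \<longlongrightarrow> 0) at_top"
    by (rule tendsto_sandwich[OF nn(1) n(1) tendsto_const inverse_square_tendsto(1)])
  show "(std_normal_density \<longlongrightarrow> 0) at_bot"
    by (rule tendsto_sandwich[OF nn(1) n(2) tendsto_const inverse_square_tendsto(2)])
  show "((\<lambda>x. x\<^sup>2 * std_normal_density x) \<longlongrightarrow> 0) at_top"
    by (rule tendsto_sandwich[OF nn(2) n(3) tendsto_const inverse_square_tendsto(1)])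
  show "((\<lambda>x. x\<^sup>2 * std_normal_density x) \<longlongrightarrow> 0) at_bot"
    by (rule tendsto_sandwich[OF nn(2) n(4) tendsto_const inverse_square_tendsto(2)])
qed

text \<open>With x fixed in the coefficient, \<open>std_normal_density y + x * \<Phi> y\<close>
  increases up to y = x and tends to 0 at minus infinity; this works for either sign of x.\<close>

lemma mills_ratio_lower: "- x * \<Phi> x \<le> std_normal_density x"
proof -
  let ?g = "\<lambda>y. std_normal_density y + x * \<Phi> y"
  have "DERIV ?g y :> (x - y) * std_normal_density y" for y
    using DERIV_add[OF DERIV_std_normal_density[of y] DERIV_cmult[OF DERIV_std_normal_cdf[of y], of x]]
    by (simp add: algebra_simps)
  then have mono: "?g y \<le> ?g x" if "y \<le> x" for y
    using that by (intro DERIV_nonneg_imp_nondecreasing[of y x ?g]) (auto intro!: exI[of _ "(x - _) * std_normal_density _"])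
  have "(?g \<longlongrightarrow> 0 + x * 0) at_bot"
    by (intro tendsto_add tendsto_mult tendsto_const std_normal_density_tendsto std_normal_cdf_lim)
  then have "0 + x * 0 \<le> ?g x"
    by (rule tendsto_upperbound) (use mono in \<open>auto simp: eventually_at_bot_linorder\<close>)
  then show ?thesis by simp
qed

lemma mills_ratio_upper: "x * (1 - \<Phi> x) \<le> std_normal_density x"
proof -
  let ?g = "\<lambda>y. std_normal_density y - x * (1 - \<Phi> y)"
  have "DERIV (\<lambda>y. - ?g y) y :> (y - x) * std_normal_density y" for y
    by (auto intro!: derivative_eq_intros DERIV_std_normal_density DERIV_std_normal_cdf simp: algebra_simps)
  then have "- ?g x \<le> - ?g y" if "x \<le> y" for y
    using that by (intro DERIV_nonneg_imp_nondecreasing[of x y "\<lambda>y. - ?g y"]) (auto intro!: exI[of _ "(_ - x) * std_normal_density _"])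
  then have mono: "?g y \<le> ?g x" if "x \<le> y" for y using that by force
  have "(?g \<longlongrightarrow> 0 - x * (1 - 1)) at_top"
    by (intro tendsto_diff tendsto_mult tendsto_const std_normal_density_tendsto std_normal_cdf_lim)
  then have "0 - x * (1 - 1) \<le> ?g x"
    by (rule tendsto_upperbound) (use mono in \<open>auto simp: eventually_at_top_linorder intro!: exI[of _ x]\<close>)
  then show ?thesis by simp
qed

text \<open>The two branches together are \<Phi>(min x z) (1 - \<Phi>(max x z)) divided by the
  density at x, the standard solution of Stein's equation for a half-line. Each branch is
  differentiable on the whole line, so they can be treated separately and glued at
  \<open>z\<close>.\<close>

definition stein_left :: "real \<Rightarrow> real \<Rightarrow> real" where
  "stein_left z x = (1 - \<Phi> z) * \<Phi> x / std_normal_density x"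

definition stein_right :: "real \<Rightarrow> real \<Rightarrow> real" where
  "stein_right z x = \<Phi> z * (1 - \<Phi> x) / std_normal_density x"

definition stein_sol :: "real \<Rightarrow> real \<Rightarrow> real" where
  "stein_sol z x = (if x \<le> z then stein_left z x else stein_right z x)"

text \<open>Stein's equation solved for the derivative. This makes the equation hold at every point
  and assigns the left derivative to the kink.\<close>

definition stein_deriv :: "real \<Rightarrow> real \<Rightarrow> real" where
  "stein_deriv z x = x * stein_sol z x + (if x \<le> z then 1 else 0) - \<Phi> z"

text \<open>\<open>stein_sol z\<close> has a kink at \<open>z\<close>. Adding \<open>(1 - exp (- k (x - z))) / k\<close> to the right of \<open>z\<close>
  removes it and changes the derivative there only by \<open>exp (- k (x - z))\<close>.\<close>

definition stein_sol_approx :: "real \<Rightarrow> real \<Rightarrow> real \<Rightarrow> real" where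
  "stein_sol_approx z k x =
     (if x \<le> z then stein_left z x else stein_right z x + (1 - exp (- k * (x - z))) / k)"

definition stein_deriv_approx :: "real \<Rightarrow> real \<Rightarrow> real \<Rightarrow> real" where
  "stein_deriv_approx z k x = x * stein_sol z x + exp (- k * max 0 (x - z)) - \<Phi> z"

lemma quotient_deriv_eq: "d \<noteq> 0 \<Longrightarrow> ((a * d) * d - b * (- x * d)) / (d * d) = x * (b / d) + a"
  for a b d x :: real
  by (simp add: field_simps)

lemma DERIV_stein_left: "DERIV (stein_left z) x :> x * stein_left z x + 1 - \<Phi> z"
proof -
  have "DERIV (\<lambda>x. (1 - \<Phi> z) * \<Phi> x / std_normal_density x) x :>
      (((1 - \<Phi> z) * std_normal_density x) * std_normal_density x - ((1 - \<Phi> z) * \<Phi> x) * (- x * std_normal_density x)) / (std_normal_density x * std_normal_density x)"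
    by (rule DERIV_divide[OF DERIV_cmult[OF DERIV_std_normal_cdf] DERIV_std_normal_density])
       (use std_normal_density_pos[of x] in simp)
  then show ?thesis unfolding stein_left_def[abs_def]
    using quotient_deriv_eq[of "std_normal_density x" "1 - \<Phi> z" "(1 - \<Phi> z) * \<Phi> x" x] std_normal_density_pos[of x]
    by (simp add: add_diff_eq)
qed

lemma DERIV_stein_right: "DERIV (stein_right z) x :> x * stein_right z x - \<Phi> z"
proof -
  have "DERIV (\<lambda>x. \<Phi> z * (1 - \<Phi> x)) x :> \<Phi> z * (0 - std_normal_density x)"
    by (rule DERIV_cmult[OF DERIV_diff[OF DERIV_const DERIV_std_normal_cdf]])
  then have "DERIV (\<lambda>x. \<Phi> z * (1 - \<Phi> x) / std_normal_density x) x :>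
      ((\<Phi> z * (0 - std_normal_density x)) * std_normal_density x - (\<Phi> z * (1 - \<Phi> x)) * (- x * std_normal_density x)) / (std_normal_density x * std_normal_density x)"
    by (rule DERIV_divide[OF _ DERIV_std_normal_density])
       (use std_normal_density_pos[of x] in simp)
  then show ?thesis unfolding stein_right_def[abs_def]
    using quotient_deriv_eq[of "std_normal_density x" "- \<Phi> z" "\<Phi> z * (1 - \<Phi> x)" x] std_normal_density_pos[of x]
    by simp
qed

lemma stein_left_eq_right: "stein_left z z = stein_right z z"
  by (simp add: stein_left_def stein_right_def)

text \<open>Nonnegativity is one Mills inequality; for the upper bound \<open>1 - \<Phi> z\<close>
  is first enlarged to \<open>1 - \<Phi> x\<close>, and the other Mills inequality applies. The sign
  is recorded for the smoothing below.\<close>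

lemma stein_deriv_left: "x \<le> z \<Longrightarrow> 0 \<le> stein_deriv z x \<and> stein_deriv z x \<le> 1"
proof -
  assume xz: "x \<le> z"
  let ?d = "std_normal_density x"
  have d: "0 < ?d" by (rule std_normal_density_pos)
  have a: "- x * \<Phi> x / ?d \<le> 1" "x * (1 - \<Phi> x) / ?d \<le> 1"
    unfolding pos_divide_le_eq[OF d] mult_1 by (rule mills_ratio_lower mills_ratio_upper)+
  have e: "stein_deriv z x = (1 - \<Phi> z) * (1 + x * \<Phi> x / ?d)"
    using xz by (simp add: stein_deriv_def stein_sol_def stein_left_def algebra_simps)
  have b: "0 \<le> 1 + x * \<Phi> x / ?d" using a(1) by simp
  have "(1 - \<Phi> z) * (1 + x * \<Phi> x / ?d) \<le> (1 - \<Phi> x) * (1 + x * \<Phi> x / ?d)"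
    using std_normal_cdf_mono[OF xz] b by (intro mult_right_mono) auto
  also have "\<dots> = (1 - \<Phi> x) + \<Phi> x * (x * (1 - \<Phi> x) / ?d)" by (simp add: algebra_simps)
  also have "\<dots> \<le> (1 - \<Phi> x) + \<Phi> x * 1"
    using a(2) std_normal_cdf_bounds[of x] by (intro add_left_mono mult_left_mono) auto
  finally show ?thesis unfolding e using b std_normal_cdf_bounds[of z] by simp
qed

lemma stein_deriv_right: "z < x \<Longrightarrow> - 1 \<le> stein_deriv z x \<and> stein_deriv z x \<le> 0"
proof -
  assume xz: "z < x"
  let ?d = "std_normal_density x"
  have d: "0 < ?d" by (rule std_normal_density_pos)
  have a: "- x * \<Phi> x / ?d \<le> 1" "x * (1 - \<Phi> x) / ?d \<le> 1"
    unfolding pos_divide_le_eq[OF d] mult_1 by (rule mills_ratio_lower mills_ratio_upper)+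
  have e: "- stein_deriv z x = \<Phi> z * (1 - x * (1 - \<Phi> x) / ?d)"
    using xz by (simp add: stein_deriv_def stein_sol_def stein_right_def algebra_simps)
  have b: "0 \<le> 1 - x * (1 - \<Phi> x) / ?d" using a(2) by simp
  have "\<Phi> z * (1 - x * (1 - \<Phi> x) / ?d) \<le> \<Phi> x * (1 - x * (1 - \<Phi> x) / ?d)"
    using std_normal_cdf_mono[of z x] xz b by (intro mult_right_mono) auto
  also have "\<dots> = \<Phi> x + (1 - \<Phi> x) * (- x * \<Phi> x / ?d)" by (simp add: algebra_simps)
  also have "\<dots> \<le> \<Phi> x + (1 - \<Phi> x) * 1"
    using a(1) std_normal_cdf_bounds[of x] by (intro add_left_mono mult_left_mono) auto
  finally have "- stein_deriv z x \<le> 1" unfolding e by simp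
  moreover have "0 \<le> - stein_deriv z x" unfolding e using b std_normal_cdf_bounds[of z] by simp
  ultimately show ?thesis by linarith
qed

lemma stein_deriv_bound: "\<bar>stein_deriv z x\<bar> \<le> 1"
  using stein_deriv_left[of x z] stein_deriv_right[of z x] by (cases "x \<le> z") auto

text \<open>To the right of \<open>z\<close> the derivative lies in [-1, 0] and the correction in
  [0, 1], so the sum stays in [-1, 1]; absolute values alone would give only 2.\<close>

lemma stein_deriv_approx_bound:
  assumes "k \<ge> 0" shows "\<bar>stein_deriv_approx z k x\<bar> \<le> 1"
proof (cases "x \<le> z")
  case True
  then have "stein_deriv_approx z k x = stein_deriv z x" by (simp add: stein_deriv_approx_def stein_deriv_def)
  then show ?thesis using stein_deriv_bound by simp
next
  case False
  then have "stein_deriv_approx z k x = stein_deriv z x + exp (- k * max 0 (x - z))"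
    by (simp add: stein_deriv_approx_def stein_deriv_def)
  moreover have "0 \<le> k * max 0 (x - z)" using assms by simp
  then have "exp (- k * max 0 (x - z)) \<le> 1" "0 \<le> exp (- k * max 0 (x - z))" by simp_all
  moreover have "- 1 \<le> stein_deriv z x" "stein_deriv z x \<le> 0" using stein_deriv_right[of z x] False by auto
  ultimately show ?thesis unfolding abs_le_iff by linarith
qed

text \<open>The bound is a bounded continuous function of x, so its mean can be followed through
  convergence in distribution.\<close>

lemma stein_deriv_approx_diff:
  assumes "k \<ge> 0" shows "\<bar>stein_deriv z x - stein_deriv_approx z k x\<bar> \<le> exp (- k * \<bar>x - z\<bar>)"
  using assms by (cases "x \<le> z") (auto simp: stein_deriv_approx_def stein_deriv_def)

lemma DERIV_glue:
  fixes f1 f2 :: "real \<Rightarrow> real"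
  assumes "DERIV f1 z :> D" "DERIV f2 z :> D" "f1 z = f2 z"
  shows "DERIV (\<lambda>x. if x \<le> z then f1 x else f2 x) z :> D"
  unfolding has_field_derivative_iff
proof (rule filterlim_split_at)
  have a: "((\<lambda>y. (f1 y - f1 z) / (y - z)) \<longlongrightarrow> D) (at z)" "((\<lambda>y. (f2 y - f2 z) / (y - z)) \<longlongrightarrow> D) (at z)"
    using assms by (simp_all add: has_field_derivative_iff)
  show "((\<lambda>y. ((if y \<le> z then f1 y else f2 y) - (if z \<le> z then f1 z else f2 z)) / (y - z)) \<longlongrightarrow> D) (at_left z)"
    by (rule Lim_transform_eventually[OF filterlim_mono[OF a(1) order_refl at_le]])
       (auto simp: eventually_at_filter)
  show "((\<lambda>y. ((if y \<le> z then f1 y else f2 y) - (if z \<le> z then f1 z else f2 z)) / (y - z)) \<longlongrightarrow> D) (at_right z)"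
    by (rule Lim_transform_eventually[OF filterlim_mono[OF a(2) order_refl at_le]])
       (use assms(3) in \<open>auto simp: eventually_at_filter\<close>)
qed

text \<open>The derivative of the exact solution jumps by -1 at \<open>z\<close>, and the correction
  has slope 1 there, so the one-sided derivatives agree.\<close>

lemma DERIV_stein_sol_approx:
  assumes k: "k > 0"
  shows "DERIV (stein_sol_approx z k) x :> stein_deriv_approx z k x"
proof -
  let ?r = "\<lambda>x. stein_right z x + (1 - exp (- k * (x - z))) / k"
  have Dr: "DERIV ?r x :> x * stein_right z x + exp (- k * (x - z)) - \<Phi> z" for x
  proof -
    have "DERIV (\<lambda>x. (1 - exp (- k * (x - z))) / k) x :> exp (- k * (x - z))"
      using k by (auto intro!: derivative_eq_intros)
    from DERIV_add[OF DERIV_stein_right this] show ?thesis by (simp add: add_diff_eq diff_add_eq)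
  qed
  consider "x < z" | "x = z" | "x > z" by linarith
  then show ?thesis
  proof cases
    case 1
    have "DERIV (stein_sol_approx z k) x :> x * stein_left z x + 1 - \<Phi> z"
      by (rule has_field_derivative_transform_within_open[OF DERIV_stein_left, of "{..<z}"])
         (use 1 in \<open>auto simp: stein_sol_approx_def\<close>)
    then show ?thesis using 1 by (simp add: stein_deriv_approx_def stein_sol_def)
  next
    case 2
    have "DERIV (\<lambda>x. if x \<le> z then stein_left z x else ?r x) z :> z * stein_left z z + 1 - \<Phi> z"
      by (rule DERIV_glue[OF DERIV_stein_left]) (use Dr[of z] in \<open>simp_all add: stein_left_eq_right\<close>)
    then show ?thesis unfolding 2 stein_sol_approx_def[abs_def] stein_deriv_approx_def
      by (simp add: stein_sol_def)
  next
    case 3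
    have "DERIV (stein_sol_approx z k) x :> x * stein_right z x + exp (- k * (x - z)) - \<Phi> z"
      by (rule has_field_derivative_transform_within_open[OF Dr, of "{z<..}"])
         (use 3 in \<open>auto simp: stein_sol_approx_def\<close>)
    then show ?thesis using 3 by (simp add: stein_deriv_approx_def stein_sol_def)
  qed
qed

lemma isCont_stein_sol: "isCont (stein_sol z) x"
proof -
  \<comment> \<open>Freezing each branch at \<open>z\<close> beyond its own side removes the case
    distinction.\<close>
  have e: "stein_sol z = (\<lambda>x. stein_left z (min x z) + stein_right z (max x z) - stein_left z z)"
    by (auto simp: stein_sol_def fun_eq_iff stein_left_eq_right min_def max_def)
  have c: "isCont (stein_left z) y" "isCont (stein_right z) y" for y
    using DERIV_stein_left DERIV_stein_right by (blast intro: DERIV_isCont)+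
  have "isCont (\<lambda>x. stein_left z (min x z)) x" "isCont (\<lambda>x. stein_right z (max x z)) x"
    by (rule isCont_o2[OF _ c(1)] isCont_o2[OF _ c(2)], intro continuous_intros)+
  then show ?thesis unfolding e by (intro isCont_diff isCont_add continuous_const)
qed

lemma isCont_stein_deriv_approx: "isCont (stein_deriv_approx z k) x"
  unfolding stein_deriv_approx_def[abs_def] by (intro continuous_intros isCont_stein_sol)

lemma stein_measurable[measurable]:
  "stein_sol z \<in> borel_measurable borel" "stein_deriv z \<in> borel_measurable borel"
  "stein_deriv_approx z k \<in> borel_measurable borel"
proof -
  show [measurable]: "stein_sol z \<in> borel_measurable borel" "stein_deriv_approx z k \<in> borel_measurable borel"
    using isCont_stein_sol isCont_stein_deriv_approx
    by (auto intro!: borel_measurable_continuous_onI continuous_at_imp_continuous_on)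
  show "stein_deriv z \<in> borel_measurable borel" unfolding stein_deriv_def[abs_def] by measurable
qed

lemma exp_neg_mult_tendsto:
  fixes a :: real assumes "a > 0"
  shows "(\<lambda>k. exp (- real (Suc k) * a)) \<longlonglongrightarrow> 0"
proof -
  have "(\<lambda>k. exp (- a) ^ Suc k) \<longlonglongrightarrow> 0"
    using assms by (intro LIMSEQ_Suc LIMSEQ_power_zero) auto
  then show ?thesis unfolding exp_of_nat_mult[symmetric] by (simp add: algebra_simps)
qed

lemma stein_deriv_approx_tendsto: "(\<lambda>k. stein_deriv_approx z (real (Suc k)) x) \<longlonglongrightarrow> stein_deriv z x"
proof (cases "x \<le> z")
  case True
  then show ?thesis by (simp add: stein_deriv_approx_def stein_deriv_def)
next
  case False
  then have "(\<lambda>k. x * stein_sol z x + exp (- real (Suc k) * max 0 (x - z)) - \<Phi> z) \<longlonglongrightarrow> x * stein_sol z x + 0 - \<Phi> z"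
    by (intro tendsto_diff tendsto_add tendsto_const exp_neg_mult_tendsto) auto
  then show ?thesis using False unfolding stein_deriv_approx_def stein_deriv_def by simp
qed

lemma stein_sol_approx_tendsto: "(\<lambda>k. stein_sol_approx z (real (Suc k)) x) \<longlonglongrightarrow> stein_sol z x"
proof (cases "x \<le> z")
  case True
  then show ?thesis by (simp add: stein_sol_approx_def stein_sol_def)
next
  case False
  have "(\<lambda>k. stein_right z x + (1 - exp (- real (Suc k) * (x - z))) * inverse (real (Suc k))) \<longlonglongrightarrow> stein_right z x + (1 - 0) * 0"
    by (intro tendsto_add tendsto_mult tendsto_diff tendsto_const exp_neg_mult_tendsto LIMSEQ_inverse_real_of_nat)
       (use False in simp)
  then show ?thesis using False unfolding stein_sol_approx_def stein_sol_def by (simp add: divide_inverse)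
qed

text \<open>The smoothed solutions are 1-Lipschitz and have the same value at \<open>z\<close> for
  all k, which gives a bound independent of k.\<close>

lemma stein_sol_approx_bound:
  assumes "k > 0"
  shows "\<bar>stein_sol_approx z k x\<bar> \<le> \<bar>stein_left z z\<bar> + \<bar>z\<bar> + \<bar>x\<bar>"
proof -
  have "\<bar>stein_sol_approx z k x - stein_sol_approx z k z\<bar> \<le> 1 * \<bar>x - z\<bar>"
    using field_differentiable_bound[of UNIV "stein_sol_approx z k" "stein_deriv_approx z k" 1 x z]
      DERIV_stein_sol_approx[OF assms] stein_deriv_approx_bound[of k] assms by simp
  moreover have "stein_sol_approx z k z = stein_left z z" by (simp add: stein_sol_approx_def)
  moreover have "\<bar>x - z\<bar> \<le> \<bar>x\<bar> + \<bar>z\<bar>" by (rule abs_triangle_ineq4)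
  moreover have "\<bar>stein_sol_approx z k x\<bar> \<le> \<bar>stein_sol_approx z k x - stein_sol_approx z k z\<bar> + \<bar>stein_sol_approx z k z\<bar>"
    by (rule abs_triangle_ineq2[THEN diff_le_eq[THEN iffD1]])
  ultimately show ?thesis by simp
qed

text \<open>An explicit antiderivative exists on each side of \<open>z\<close>. Its values at
  infinity vanish, and at \<open>z\<close> the cubic terms of the two sides cancel, leaving the
  stated value.\<close>

lemma std_normal_stein_deriv_moment:
  "(\<integral>x. stein_deriv z x * x \<partial>std_normal_distribution) = (z\<^sup>2 - 1) * std_normal_density z / 3"
proof -
  let ?d = std_normal_density
  \<comment> \<open>Partial integration of x^2 \<Phi>(x) with x^3 / 3 leaves x^3 / 3 times the
    density, whose antiderivative is -(x^2 + 2) / 3 times the density; the term linear in x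
    contributes -1 times the density, and (x^2 + 2) / 3 - 1 = (x^2 - 1) / 3.\<close>
  define R1 where "R1 x = (x^3 * ((1 - \<Phi> z) * \<Phi> x) + (x\<^sup>2 - 1) * ?d x * (1 - \<Phi> z)) / 3" for x
  define R2 where "R2 x = (x^3 * (\<Phi> z * (1 - \<Phi> x)) - (x\<^sup>2 - 1) * ?d x * \<Phi> z) / 3" for x
  define u where "u x = ?d x * (stein_deriv z x * x)" for x
  have um[measurable]: "u \<in> borel_measurable borel" unfolding u_def by measurable
  have d0: "?d x \<noteq> 0" for x using std_normal_density_pos[of x] by simp
  have D1: "DERIV R1 x :> ?d x * ((x * stein_left z x + 1 - \<Phi> z) * x)" for x
  proof -
    have "DERIV (\<lambda>x. x^3 * ((1 - \<Phi> z) * \<Phi> x) + (x\<^sup>2 - 1) * ?d x * (1 - \<Phi> z)) x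
        :> x^3 * ((1 - \<Phi> z) * ?d x) + 3 * x\<^sup>2 * ((1 - \<Phi> z) * \<Phi> x)
        + ((x\<^sup>2 - 1) * (- x * ?d x) + 2 * x * ?d x) * (1 - \<Phi> z)"
      by (auto intro!: derivative_eq_intros DERIV_std_normal_density DERIV_std_normal_cdf simp: algebra_simps)
    from DERIV_cdivide[OF this, of 3]
    have "DERIV R1 x :> (x^3 * ((1 - \<Phi> z) * ?d x) + 3 * x\<^sup>2 * ((1 - \<Phi> z) * \<Phi> x)
        + ((x\<^sup>2 - 1) * (- x * ?d x) + 2 * x * ?d x) * (1 - \<Phi> z)) / 3"
      unfolding R1_def .
    note D = this
    have "?d x * stein_left z x = (1 - \<Phi> z) * \<Phi> x" using d0[of x] by (simp add: stein_left_def)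
    moreover have "?d x * ((x * stein_left z x + 1 - \<Phi> z) * x) = x\<^sup>2 * (?d x * stein_left z x) + ?d x * (1 - \<Phi> z) * x"
      by (simp add: algebra_simps power2_eq_square)
    ultimately have "?d x * ((x * stein_left z x + 1 - \<Phi> z) * x) = x\<^sup>2 * ((1 - \<Phi> z) * \<Phi> x) + ?d x * (1 - \<Phi> z) * x"
      by (simp only:)
    note eq = this
    show ?thesis unfolding eq by (rule DERIV_cong[OF D]) (simp add: field_simps power2_eq_square power3_eq_cube)
  qed
  have D2: "DERIV R2 x :> ?d x * ((x * stein_right z x - \<Phi> z) * x)" for x
  proof -
    have "DERIV (\<lambda>x. x^3 * (\<Phi> z * (1 - \<Phi> x)) - (x\<^sup>2 - 1) * ?d x * \<Phi> z) x
        :> x^3 * (\<Phi> z * (- ?d x)) + 3 * x\<^sup>2 * (\<Phi> z * (1 - \<Phi> x))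
        - ((x\<^sup>2 - 1) * (- x * ?d x) + 2 * x * ?d x) * \<Phi> z"
      by (auto intro!: derivative_eq_intros DERIV_std_normal_density DERIV_std_normal_cdf simp: algebra_simps)
    from DERIV_cdivide[OF this, of 3]
    have "DERIV R2 x :> (x^3 * (\<Phi> z * (- ?d x)) + 3 * x\<^sup>2 * (\<Phi> z * (1 - \<Phi> x))
        - ((x\<^sup>2 - 1) * (- x * ?d x) + 2 * x * ?d x) * \<Phi> z) / 3"
      unfolding R2_def .
    note D = this
    have "?d x * stein_right z x = \<Phi> z * (1 - \<Phi> x)" using d0[of x] by (simp add: stein_right_def)
    moreover have "?d x * ((x * stein_right z x - \<Phi> z) * x) = x\<^sup>2 * (?d x * stein_right z x) - ?d x * \<Phi> z * x"
      by (simp add: algebra_simps power2_eq_square)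
    ultimately have "?d x * ((x * stein_right z x - \<Phi> z) * x) = x\<^sup>2 * (\<Phi> z * (1 - \<Phi> x)) - ?d x * \<Phi> z * x"
      by (simp only:)
    note eq = this
    show ?thesis unfolding eq by (rule DERIV_cong[OF D]) (simp add: field_simps power2_eq_square power3_eq_cube)
  qed
  have C1: "isCont (\<lambda>x. ?d x * ((x * stein_left z x + 1 - \<Phi> z) * x)) x" for x
    by (intro continuous_intros isCont_std_normal_density DERIV_isCont[OF DERIV_stein_left])
  have C2: "isCont (\<lambda>x. ?d x * ((x * stein_right z x - \<Phi> z) * x)) x" for x
    by (intro continuous_intros isCont_std_normal_density DERIV_isCont[OF DERIV_stein_right])
  \<comment> \<open>The fundamental theorem is applied on both sides of \<open>z\<close>; the two
    intervals overlap in the null set consisting of \<open>z\<close>.\<close>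
  have fin: "(\<integral>x. u x * indicator {- s..s} x \<partial>lborel) = R1 z - R1 (- s) + (R2 s - R2 z)" if s: "s \<ge> \<bar>z\<bar>" for s
  proof -
    have i1: "has_bochner_integral lborel (\<lambda>x. ?d x * ((x * stein_left z x + 1 - \<Phi> z) * x) * indicator {- s..z} x) (R1 z - R1 (- s))"
      using s by (intro has_bochner_integral_FTC_Icc_real D1 C1) auto
    have i2: "has_bochner_integral lborel (\<lambda>x. ?d x * ((x * stein_right z x - \<Phi> z) * x) * indicator {z..s} x) (R2 s - R2 z)"
      using s by (intro has_bochner_integral_FTC_Icc_real D2 C2) auto
    have "(\<integral>x. u x * indicator {- s..s} x \<partial>lborel)
      = (\<integral>x. ?d x * ((x * stein_left z x + 1 - \<Phi> z) * x) * indicator {- s..z} x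
            + ?d x * ((x * stein_right z x - \<Phi> z) * x) * indicator {z..s} x \<partial>lborel)"
    proof (rule integral_cong_AE)
      show "AE x in lborel. u x * indicator {- s..s} x = ?d x * ((x * stein_left z x + 1 - \<Phi> z) * x) * indicator {- s..z} x
            + ?d x * ((x * stein_right z x - \<Phi> z) * x) * indicator {z..s} x"
        using AE_lborel_singleton[of z]
        by eventually_elim (use s in \<open>auto simp: u_def stein_deriv_def stein_sol_def indicator_def\<close>)
    qed (use i1 i2 in \<open>auto simp: has_bochner_integral_iff\<close>)
    also have "\<dots> = R1 z - R1 (- s) + (R2 s - R2 z)"
      by (rule has_bochner_integral_integral_eq[OF has_bochner_integral_add[OF i1 i2]])
    finally show ?thesis .
  qed
  have ui: "integrable lborel u"
  proof (rule Bochner_Integration.integrable_bound[OF integrable_std_normal_moment_abs[of 1]])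
    show "AE x in lborel. norm (u x) \<le> norm (?d x * \<bar>x\<bar> ^ 1)"
      unfolding u_def using stein_deriv_bound[of z]
      by (intro AE_I2) (auto simp: abs_mult intro!: mult_left_mono mult_left_le_one_le)
  qed measurable
  have lim: "((\<lambda>s. \<integral>x. u x * indicator {- s..s} x \<partial>lborel) \<longlongrightarrow> (\<integral>x. u x \<partial>lborel)) at_top"
  proof (rule integral_dominated_convergence_at_top)
    show "integrable lborel (\<lambda>t. \<bar>u t\<bar>)" using ui by simp
    show "AE x in lborel. ((\<lambda>s. u x * indicator {- s..s} x) \<longlongrightarrow> u x) at_top"
    proof (rule AE_I2)
      fix x
      have "eventually (\<lambda>s. u x * indicator {- s..s} x = u x) at_top"
        using eventually_ge_at_top[of "\<bar>x\<bar>"] by eventually_elim (auto simp: indicator_def)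
      then show "((\<lambda>s. u x * indicator {- s..s} x) \<longlongrightarrow> u x) at_top" by (rule tendsto_eventually)
    qed
  qed (auto simp: indicator_def)
  \<comment> \<open>By the lower Mills inequality, x^3 \<Phi>(x) is at most x^2 times the density in
    absolute value for x \<le> 0.\<close>
  have L1: "(R1 \<longlongrightarrow> 0) at_bot"
  proof -
    have "((\<lambda>x. x^3 * \<Phi> x) \<longlongrightarrow> 0) at_bot"
    proof (rule Lim_null_comparison[OF _ std_normal_density_tendsto(4)])
      show "\<forall>\<^sub>F x in at_bot. norm (x^3 * \<Phi> x) \<le> x\<^sup>2 * ?d x"
        using eventually_le_at_bot[of 0]
      proof eventually_elim
        case (elim x)
        have "x^3 * \<Phi> x = - (x\<^sup>2 * (- x * \<Phi> x))" by (simp add: power3_eq_cube power2_eq_square)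
        moreover have "0 \<le> x\<^sup>2 * (- x * \<Phi> x)"
          by (intro mult_nonneg_nonneg) (use elim std_normal_cdf_bounds[of x] in auto)
        ultimately have "norm (x^3 * \<Phi> x) = x\<^sup>2 * (- x * \<Phi> x)"
          by (simp only: real_norm_def abs_minus_cancel abs_of_nonneg)
        also have "\<dots> \<le> x\<^sup>2 * ?d x" using mills_ratio_lower[of x] by (intro mult_left_mono) auto
        finally show ?case .
      qed
    qed
    then have "((\<lambda>x. ((1 - \<Phi> z) * (x^3 * \<Phi> x) + (x\<^sup>2 * ?d x - ?d x) * (1 - \<Phi> z)) / 3) \<longlongrightarrow> ((1 - \<Phi> z) * 0 + (0 - 0) * (1 - \<Phi> z)) / 3) at_bot"
      by (intro tendsto_divide tendsto_add tendsto_mult tendsto_diff tendsto_const std_normal_density_tendsto) auto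
    then show ?thesis unfolding R1_def[abs_def] by (simp add: algebra_simps)
  qed
  have L2: "(R2 \<longlongrightarrow> 0) at_top"
  proof -
    have "((\<lambda>x. x^3 * (1 - \<Phi> x)) \<longlongrightarrow> 0) at_top"
    proof (rule Lim_null_comparison[OF _ std_normal_density_tendsto(3)])
      show "\<forall>\<^sub>F x in at_top. norm (x^3 * (1 - \<Phi> x)) \<le> x\<^sup>2 * ?d x"
        using eventually_ge_at_top[of 0]
      proof eventually_elim
        case (elim x)
        have "norm (x^3 * (1 - \<Phi> x)) = x\<^sup>2 * (x * (1 - \<Phi> x))"
          using elim std_normal_cdf_bounds[of x] by (simp add: abs_mult power3_eq_cube power2_eq_square)
        also have "\<dots> \<le> x\<^sup>2 * ?d x" using mills_ratio_upper[of x] by (intro mult_left_mono) auto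
        finally show ?case .
      qed
    qed
    then have "((\<lambda>x. (\<Phi> z * (x^3 * (1 - \<Phi> x)) - (x\<^sup>2 * ?d x - ?d x) * \<Phi> z) / 3) \<longlongrightarrow> (\<Phi> z * 0 - (0 - 0) * \<Phi> z) / 3) at_top"
      by (intro tendsto_divide tendsto_add tendsto_mult tendsto_diff tendsto_const std_normal_density_tendsto) auto
    then show ?thesis unfolding R2_def[abs_def] by (simp add: algebra_simps)
  qed
  have "((\<lambda>s. R1 z - R1 (- s) + (R2 s - R2 z)) \<longlongrightarrow> R1 z - 0 + (0 - R2 z)) at_top"
    by (intro tendsto_add tendsto_diff tendsto_const L2 filterlim_compose[OF L1 filterlim_uminus_at_bot_at_top])
  moreover have "((\<lambda>s. R1 z - R1 (- s) + (R2 s - R2 z)) \<longlongrightarrow> (\<integral>x. u x \<partial>lborel)) at_top"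
    by (rule Lim_transform_eventually[OF lim])
       (use eventually_ge_at_top[of "\<bar>z\<bar>"] in eventually_elim, rule fin)
  ultimately have "(\<integral>x. u x \<partial>lborel) = R1 z - 0 + (0 - R2 z)"
    using tendsto_unique[OF trivial_limit_at_top_linorder] by blast
  also have "\<dots> = (z\<^sup>2 - 1) * ?d z / 3" by (simp add: R1_def R2_def field_simps)
  finally show ?thesis unfolding u_def by (subst integral_density) auto
qed

lemma std_normal_cdf_third_deriv: "(deriv ^^ 3) \<Phi> z = (z\<^sup>2 - 1) * std_normal_density z"
proof -
  have 1: "deriv \<Phi> = std_normal_density"
    using DERIV_imp_deriv[OF DERIV_std_normal_cdf] by auto
  have 2: "deriv std_normal_density = (\<lambda>x. - x * std_normal_density x)"
    using DERIV_imp_deriv[OF DERIV_std_normal_density] by auto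
  have "DERIV (\<lambda>x. - x * std_normal_density x) z :> (z\<^sup>2 - 1) * std_normal_density z"
    by (auto intro!: derivative_eq_intros DERIV_std_normal_density simp: power2_eq_square algebra_simps)
  then have "deriv (\<lambda>x. - x * std_normal_density x) z = (z\<^sup>2 - 1) * std_normal_density z"
    by (rule DERIV_imp_deriv)
  then show ?thesis by (simp add: numeral_3_eq_3 1 2)
qed

section \<open>Stein's identity for the distribution function\<close>

context isonormal_process
begin

text \<open>The smoothed solutions meet the hypotheses of the Malliavin-Stein identity. As the
  smoothing disappears, one side is dominated by a quadratic expression in |F| and the other by |1 -
  S|.\<close>

lemma kolmogorov_stein_identity:
  assumes F: "F \<in> D12 M X" "(\<integral>\<omega>. F \<omega> \<partial>M) = 0"
  shows "measure M {\<omega> \<in> space M. F \<omega> \<le> z} - \<Phi> z = (\<integral>\<omega>. stein_deriv z (F \<omega>) * stein_factor M X F \<omega> \<partial>M)"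
proof -
  let ?S = "stein_factor M X F"
  note sF = is_malliavin_deriv_square_integrable(1)[OF malliavin_deriv_D12[OF F(1)]]
  have iF: "integrable M F" by (rule square_integrable_integrable[OF sF])
  have iS: "integrable M ?S" by (rule stein_factor_integrable[OF F])
  have [measurable]: "F \<in> borel_measurable M" "?S \<in> borel_measurable M" using iF iS by auto
  let ?f = "\<lambda>k. stein_sol_approx z (real (Suc k))" and ?g = "\<lambda>k. stein_deriv_approx z (real (Suc k))"
  have fm[measurable]: "?f k \<in> borel_measurable borel" for k
    using DERIV_isCont[OF DERIV_stein_sol_approx[of "real (Suc k)" z]]
    by (auto intro!: borel_measurable_continuous_onI continuous_at_imp_continuous_on)
  have id: "(\<integral>\<omega>. F \<omega> * ?f k (F \<omega>) \<partial>M) = (\<integral>\<omega>. ?g k (F \<omega>) * (1 - ?S \<omega>) \<partial>M)" for k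
    by (rule malliavin_stein_identity[OF F DERIV_stein_sol_approx isCont_stein_deriv_approx stein_deriv_approx_bound]) auto
  let ?c = "\<bar>stein_left z z\<bar> + \<bar>z\<bar>"
  have dom: "integrable M (\<lambda>\<omega>. \<bar>F \<omega>\<bar> * (?c + \<bar>F \<omega>\<bar>))"
    unfolding distrib_left using iF sF by (auto simp: square_integrable_def power2_eq_square[symmetric])
  have bd: "norm (F \<omega> * ?f k (F \<omega>)) \<le> \<bar>F \<omega>\<bar> * (?c + \<bar>F \<omega>\<bar>)" for k \<omega>
    unfolding real_norm_def abs_mult by (intro mult_left_mono stein_sol_approx_bound) auto
  have lim1: "(\<lambda>k. \<integral>\<omega>. F \<omega> * ?f k (F \<omega>) \<partial>M) \<longlonglongrightarrow> (\<integral>\<omega>. F \<omega> * stein_sol z (F \<omega>) \<partial>M)"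
  proof (rule integral_dominated_convergence[OF _ _ dom])
    show "AE \<omega> in M. (\<lambda>k. F \<omega> * ?f k (F \<omega>)) \<longlonglongrightarrow> F \<omega> * stein_sol z (F \<omega>)"
      by (intro AE_I2 tendsto_mult tendsto_const stein_sol_approx_tendsto)
    show "AE \<omega> in M. norm (F \<omega> * ?f k (F \<omega>)) \<le> \<bar>F \<omega>\<bar> * (?c + \<bar>F \<omega>\<bar>)" for k
      by (intro AE_I2 bd)
  qed measurable
  have lim2: "(\<lambda>k. \<integral>\<omega>. ?g k (F \<omega>) * (1 - ?S \<omega>) \<partial>M) \<longlonglongrightarrow> (\<integral>\<omega>. stein_deriv z (F \<omega>) * (1 - ?S \<omega>) \<partial>M)"
  proof (rule integral_dominated_convergence)
    show "integrable M (\<lambda>\<omega>. \<bar>1 - ?S \<omega>\<bar>)" using iS by simp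
    show "AE \<omega> in M. (\<lambda>k. ?g k (F \<omega>) * (1 - ?S \<omega>)) \<longlonglongrightarrow> stein_deriv z (F \<omega>) * (1 - ?S \<omega>)"
      by (intro AE_I2 tendsto_mult tendsto_const stein_deriv_approx_tendsto)
    show "AE \<omega> in M. norm (?g k (F \<omega>) * (1 - ?S \<omega>)) \<le> \<bar>1 - ?S \<omega>\<bar>" for k
      using stein_deriv_approx_bound[of "real (Suc k)" z] by (intro AE_I2) (simp add: abs_mult mult_left_le_one_le)
  qed measurable
  have eq: "(\<integral>\<omega>. F \<omega> * stein_sol z (F \<omega>) \<partial>M) = (\<integral>\<omega>. stein_deriv z (F \<omega>) * (1 - ?S \<omega>) \<partial>M)"
    using LIMSEQ_unique[OF lim1[unfolded id] lim2] .
  have ig: "integrable M (\<lambda>\<omega>. stein_deriv z (F \<omega>))"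
    by (rule integrable_const_bound[of _ 1]) (use stein_deriv_bound in auto)
  have igS: "integrable M (\<lambda>\<omega>. stein_deriv z (F \<omega>) * ?S \<omega>)"
    by (rule Bochner_Integration.integrable_bound[OF iS])
       (use stein_deriv_bound in \<open>auto simp: abs_mult mult_left_le_one_le\<close>)
  have ifs: "integrable M (\<lambda>\<omega>. F \<omega> * stein_sol z (F \<omega>))"
  proof (rule Bochner_Integration.integrable_bound[OF dom])
    show "AE \<omega> in M. norm (F \<omega> * stein_sol z (F \<omega>)) \<le> norm (\<bar>F \<omega>\<bar> * (?c + \<bar>F \<omega>\<bar>))"
    proof (rule AE_I2)
      fix \<omega>
      have "(\<lambda>k. norm (F \<omega> * ?f k (F \<omega>))) \<longlonglongrightarrow> norm (F \<omega> * stein_sol z (F \<omega>))"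
        by (intro tendsto_norm tendsto_mult tendsto_const stein_sol_approx_tendsto)
      then have "norm (F \<omega> * stein_sol z (F \<omega>)) \<le> \<bar>F \<omega>\<bar> * (?c + \<bar>F \<omega>\<bar>)"
        by (rule LIMSEQ_le_const2) (use bd in blast)
      then show "norm (F \<omega> * stein_sol z (F \<omega>)) \<le> norm (\<bar>F \<omega>\<bar> * (?c + \<bar>F \<omega>\<bar>))" by simp
    qed
  qed measurable
  have ii: "integrable M (indicat_real {\<omega> \<in> space M. F \<omega> \<le> z})"
    by (rule integrable_real_indicator) (auto simp: less_top[symmetric])
  \<comment> \<open>Stein's equation under the integral; the value of \<open>stein_deriv\<close> at
    the kink matches the closed half-line in the event.\<close>
  have "(\<integral>\<omega>. stein_deriv z (F \<omega>) - F \<omega> * stein_sol z (F \<omega>) \<partial>M) = (\<integral>\<omega>. indicat_real {\<omega> \<in> space M. F \<omega> \<le> z} \<omega> - \<Phi> z \<partial>M)"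
    by (rule Bochner_Integration.integral_cong) (auto simp: stein_deriv_def)
  also have "\<dots> = measure M {\<omega> \<in> space M. F \<omega> \<le> z} - \<Phi> z"
    using ii by (simp add: prob_space)
  finally show ?thesis
    using eq ig igS ifs by (simp add: right_diff_distrib)
qed

lemma kolmogorov_bound:
  assumes F: "F \<in> D12 M X" "(\<integral>\<omega>. F \<omega> \<partial>M) = 0" and S: "integrable M (\<lambda>\<omega>. (stein_factor M X F \<omega>)\<^sup>2)"
  shows "\<bar>measure M {\<omega> \<in> space M. F \<omega> \<le> z} - \<Phi> z\<bar> \<le> sqrt (\<integral>\<omega>. (stein_factor M X F \<omega>)\<^sup>2 \<partial>M)"
proof -
  let ?S = "stein_factor M X F"
  have iS: "integrable M ?S" by (rule stein_factor_integrable[OF F])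
  then have sS: "square_integrable M ?S" using S by (simp add: square_integrable_def)
  note sF = is_malliavin_deriv_square_integrable(1)[OF malliavin_deriv_D12[OF F(1)]]
  have [measurable]: "F \<in> borel_measurable M" "?S \<in> borel_measurable M" using sF sS by auto
  have b: "\<bar>stein_deriv z (F \<omega>) * ?S \<omega>\<bar> \<le> \<bar>?S \<omega>\<bar>" for \<omega>
    using stein_deriv_bound by (simp add: abs_mult mult_left_le_one_le)
  have "\<bar>\<integral>\<omega>. stein_deriv z (F \<omega>) * ?S \<omega> \<partial>M\<bar> \<le> (\<integral>\<omega>. \<bar>?S \<omega>\<bar> \<partial>M)"
    by (rule order_trans[OF integral_abs_bound integral_mono'])
       (use iS b in \<open>auto\<close>)
  also have "\<dots> \<le> L2norm M ?S" using square_integrable_integrable(2)[OF sS] by simp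
  finally show ?thesis unfolding kolmogorov_stein_identity[OF F] by (simp add: L2norm_def)
qed

end

section \<open>Gaussian regression and convergence in distribution\<close>

lemma (in prob_space) standard_gaussian_distr:
  assumes "centered_gaussian M Y" "(\<integral>\<omega>. (Y \<omega>)\<^sup>2 \<partial>M) = 1"
  shows "distr M borel Y = std_normal_distribution"
  using centered_gaussian_distr[OF assms(1)] assms(2) distr_id2[of borel std_normal_distribution] by simp

text \<open>Since \<open>N1\<close> has unit variance, \<open>N2 - \<rho> N1\<close> is uncorrelated
  with it, hence independent of it by joint normality; it is also centred, so its product with a
  bounded function of \<open>N1\<close> has mean 0. The degenerate case of a vanishing residual is
  included.\<close>

lemma (in prob_space) gaussian_regression:
  fixes N :: "'a \<Rightarrow> real \<times> real" and g :: "real \<Rightarrow> real"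
  assumes N: "centered_gaussian_vector M N"
    and var: "(\<integral>\<omega>. (fst (N \<omega>))\<^sup>2 \<partial>M) = 1" and cov: "(\<integral>\<omega>. fst (N \<omega>) * snd (N \<omega>) \<partial>M) = \<rho>"
    and g[measurable]: "g \<in> borel_measurable borel" "\<And>x. \<bar>g x\<bar> \<le> B"
  shows "(\<integral>\<omega>. g (fst (N \<omega>)) * snd (N \<omega>) \<partial>M) = \<rho> * (\<integral>\<omega>. g (fst (N \<omega>)) * fst (N \<omega>) \<partial>M)"
proof -
  define Y where "Y \<omega> = fst (N \<omega>)" for \<omega>
  define D where "D \<omega> = snd (N \<omega>) - \<rho> * fst (N \<omega>)" for \<omega>
  have lin: "centered_gaussian M (\<lambda>\<omega>. a * D \<omega> + b * Y \<omega>)" for a b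
  proof -
    have "centered_gaussian M (\<lambda>\<omega>. (b - a * \<rho>, a) \<bullet> N \<omega>)"
      using N unfolding centered_gaussian_vector_def by blast
    moreover have "(b - a * \<rho>, a) \<bullet> N \<omega> = a * D \<omega> + b * Y \<omega>" for \<omega>
      by (simp add: inner_prod_def D_def Y_def algebra_simps)
    ultimately show ?thesis by simp
  qed
  have gD: "centered_gaussian M D" and gY: "centered_gaussian M Y" using lin[of 1 0] lin[of 0 1] by simp_all
  have mD: "has_moments M D" and mY: "has_moments M Y"
    using centered_gaussian_moments(1) gD gY by blast+
  have [measurable]: "D \<in> borel_measurable M" "Y \<in> borel_measurable M" using mD mY by auto
  note iD = has_moments_integrable[OF mD] and iY = has_moments_integrable[OF mY]
  have m2: "has_moments M (\<lambda>\<omega>. snd (N \<omega>))"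
    using has_moments_add[OF mD has_moments_mult[OF has_moments_const[of \<rho>] mY]] by (simp add: D_def Y_def)
  have i: "integrable M (\<lambda>\<omega>. D \<omega> * D \<omega>)" "integrable M (\<lambda>\<omega>. D \<omega> * Y \<omega>)" "integrable M (\<lambda>\<omega>. Y \<omega> * Y \<omega>)"
    "integrable M (\<lambda>\<omega>. Y \<omega> * snd (N \<omega>))"
    by (intro has_moments_integrable has_moments_mult mD mY m2)+
  have DY: "(\<integral>\<omega>. D \<omega> * Y \<omega> \<partial>M) = 0"
  proof -
    have "(\<integral>\<omega>. D \<omega> * Y \<omega> \<partial>M) = (\<integral>\<omega>. Y \<omega> * snd (N \<omega>) - \<rho> * (Y \<omega> * Y \<omega>) \<partial>M)"
      by (simp add: D_def Y_def algebra_simps)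
    also have "\<dots> = (\<integral>\<omega>. Y \<omega> * snd (N \<omega>) \<partial>M) - \<rho> * (\<integral>\<omega>. Y \<omega> * Y \<omega> \<partial>M)" using i by simp
    also have "\<dots> = 0" using var cov by (simp add: Y_def power2_eq_square)
    finally show ?thesis .
  qed
  define v where "v = (\<integral>\<omega>. D \<omega> * D \<omega> \<partial>M)"
  have sq: "(\<integral>\<omega>. (a * D \<omega> + b * Y \<omega>)\<^sup>2 \<partial>M) = a\<^sup>2 * v + b\<^sup>2" for a b
  proof -
    have "(\<integral>\<omega>. (a * D \<omega> + b * Y \<omega>)\<^sup>2 \<partial>M)
      = (\<integral>\<omega>. a\<^sup>2 * (D \<omega> * D \<omega>) + 2 * a * b * (D \<omega> * Y \<omega>) + b\<^sup>2 * (Y \<omega> * Y \<omega>) \<partial>M)"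
      by (rule Bochner_Integration.integral_cong) (auto simp: power2_eq_square algebra_simps)
    also have "\<dots> = a\<^sup>2 * v + b\<^sup>2" using i DY var by (simp add: v_def Y_def power2_eq_square)
    finally show ?thesis .
  qed
  have cf: "(\<integral>\<omega>. iexp (a * D \<omega> + b * Y \<omega>) \<partial>M) = complex_of_real (exp (- a\<^sup>2 * v / 2)) * complex_of_real (exp (- b\<^sup>2 / 2))" for a b
    using centered_gaussian_iexp[OF lin, of 1 a b] unfolding sq
    by (simp add: exp_add[symmetric] add_divide_distrib diff_divide_distrib flip: of_real_mult)
  have ie: "integrable M (\<lambda>\<omega>. iexp (a * D \<omega> + b * Y \<omega>))" for a b
    using iexp_integrable[of "\<lambda>_. 1" "\<lambda>\<omega>. a * D \<omega> + b * Y \<omega>"] by simp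
  \<comment> \<open>Uniqueness of characteristic functions is used twice, first in \<open>Y\<close>
    and then in \<open>D\<close>; the passage from indicators of \<open>D\<close> to
    \<open>D\<close> itself is \<open>integral_zero_fun\<close>.\<close>
  have zero: "(\<integral>\<omega>. indicator A (Y \<omega>) * D \<omega> \<partial>M) = 0" if A[measurable]: "A \<in> sets borel" for A
  proof -
    let ?p = "\<integral>\<omega>. indicat_real A (Y \<omega>) \<partial>M"
    have ia: "integrable M (\<lambda>\<omega>. indicat_real A (Y \<omega>))"
      by (rule integrable_const_bound[of _ 1]) (auto simp: indicator_def)
    define Z where "Z \<omega> = indicat_real A (Y \<omega>) - ?p" for \<omega>
    have iZ: "integrable M Z" unfolding Z_def using ia by simp
    have [measurable]: "Z \<in> borel_measurable M" using iZ by auto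
    have "(\<integral>\<omega>. complex_of_real (Z \<omega>) * iexp (s * D \<omega>) \<partial>M) = 0" for s
    proof -
      let ?c = "complex_of_real (exp (- s\<^sup>2 * v / 2))"
      have ies: "integrable M (\<lambda>\<omega>. iexp (s * D \<omega>))" using ie[of s 0] by simp
      have iW: "integrable M (\<lambda>\<omega>. iexp (s * D \<omega>) - ?c)" using ies by simp
      have ias: "integrable M (\<lambda>\<omega>. indicat_real A (Y \<omega>) *\<^sub>R iexp (s * D \<omega>))"
        by (rule Bochner_Integration.integrable_bound[OF ies]) (auto simp: indicator_def)
      have "(\<integral>\<omega>. (iexp (s * D \<omega>) - ?c) * iexp (t * Y \<omega>) \<partial>M) = 0" for t
      proof -
        have "(\<integral>\<omega>. (iexp (s * D \<omega>) - ?c) * iexp (t * Y \<omega>) \<partial>M)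
          = (\<integral>\<omega>. iexp (s * D \<omega> + t * Y \<omega>) - ?c * iexp (0 * D \<omega> + t * Y \<omega>) \<partial>M)"
          by (simp add: exp_add algebra_simps)
        also have "\<dots> = (\<integral>\<omega>. iexp (s * D \<omega> + t * Y \<omega>) \<partial>M) - ?c * (\<integral>\<omega>. iexp (0 * D \<omega> + t * Y \<omega>) \<partial>M)"
          using ie[of s t] ie[of 0 t] by (simp only: Bochner_Integration.integral_diff integrable_mult_right integral_mult_right_zero)
        also have "\<dots> = 0" unfolding cf by simp
        finally show ?thesis .
      qed
      from char_zero_imp_zero[OF iW _ this A]
      have "(\<integral>\<omega>. indicat_real A (Y \<omega>) *\<^sub>R (iexp (s * D \<omega>) - ?c) \<partial>M) = 0" by simp
      then have "(\<integral>\<omega>. indicat_real A (Y \<omega>) *\<^sub>R iexp (s * D \<omega>) - indicat_real A (Y \<omega>) *\<^sub>R ?c \<partial>M) = 0"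
        by (simp only: scaleR_diff_right)
      then have e1: "(\<integral>\<omega>. indicat_real A (Y \<omega>) *\<^sub>R iexp (s * D \<omega>) \<partial>M) = ?p *\<^sub>R ?c"
        using ias ia by simp
      have "(\<integral>\<omega>. complex_of_real (Z \<omega>) * iexp (s * D \<omega>) \<partial>M)
        = (\<integral>\<omega>. indicat_real A (Y \<omega>) *\<^sub>R iexp (s * D \<omega>) - ?p *\<^sub>R iexp (s * D \<omega>) \<partial>M)"
        by (rule Bochner_Integration.integral_cong) (simp_all add: Z_def scaleR_conv_of_real left_diff_distrib)
      also have "\<dots> = ?p *\<^sub>R ?c - ?p *\<^sub>R (\<integral>\<omega>. iexp (s * D \<omega>) \<partial>M)"
        using ias ies e1 by simp
      also have "\<dots> = 0" using cf[of s 0] by simp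
      finally show ?thesis .
    qed
    then have z: "(\<integral>\<omega>. indicator C (D \<omega>) * Z \<omega> \<partial>M) = 0" if "C \<in> sets borel" for C
      using char_zero_imp_zero_real[OF iZ _ _ that] by simp
    have iDZ: "integrable M (\<lambda>\<omega>. D \<omega> * Z \<omega>)"
    proof (rule Bochner_Integration.integrable_bound)
      show "integrable M (\<lambda>\<omega>. (1 + \<bar>?p\<bar>) * D \<omega>)" using iD by simp
      show "AE \<omega> in M. norm (D \<omega> * Z \<omega>) \<le> norm ((1 + \<bar>?p\<bar>) * D \<omega>)"
      proof (rule AE_I2)
        fix \<omega>
        have "\<bar>indicat_real A (Y \<omega>)\<bar> \<le> 1" by (simp add: indicator_def)
        then have "\<bar>Z \<omega>\<bar> \<le> \<bar>1 + \<bar>?p\<bar>\<bar>"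
          unfolding Z_def using abs_triangle_ineq4[of "indicat_real A (Y \<omega>)" ?p] by linarith
        from mult_right_mono[OF this, of "\<bar>D \<omega>\<bar>"] show "norm (D \<omega> * Z \<omega>) \<le> norm ((1 + \<bar>?p\<bar>) * D \<omega>)"
          by (simp only: real_norm_def abs_mult abs_ge_zero mult.commute)
      qed
    qed measurable
    have "(\<integral>\<omega>. D \<omega> * Z \<omega> \<partial>M) = 0"
      by (rule integral_zero_fun[where K="\<lambda>x. x" and Y=D and S=borel, OF iZ _ z _ iDZ]) auto
    moreover have "(\<integral>\<omega>. D \<omega> \<partial>M) = 0"
    proof -
      interpret N: real_distribution std_normal_distribution by (rule real_dist_normal_dist)
      have "(\<integral>\<omega>. D \<omega> \<partial>M) = (\<integral>x. x \<partial>distr M borel D)" by (subst integral_distr) auto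
      also have "\<dots> = sqrt (\<integral>\<omega>. (D \<omega>)\<^sup>2 \<partial>M) * (\<integral>x. x ^ 1 \<partial>std_normal_distribution)"
        unfolding centered_gaussian_distr[OF gD] by (subst integral_distr) auto
      also have "\<dots> = 0" by (subst integral_std_normal_distribution_moment_odd) auto
      finally show ?thesis .
    qed
    moreover have "integrable M (\<lambda>\<omega>. indicat_real A (Y \<omega>) * D \<omega>)"
      by (rule Bochner_Integration.integrable_bound[OF iD]) (auto simp: indicator_def)
    moreover have "D \<omega> * Z \<omega> = indicat_real A (Y \<omega>) * D \<omega> - ?p * D \<omega>" for \<omega> by (simp add: Z_def algebra_simps)
    ultimately show ?thesis using iD by simp
  qed
  have B: "\<bar>g x * y\<bar> \<le> \<bar>B * y\<bar>" for x y
    unfolding abs_mult using g(2)[of x] by (intro mult_right_mono) auto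
  have ig: "integrable M (\<lambda>\<omega>. g (Y \<omega>) * D \<omega>)" "integrable M (\<lambda>\<omega>. g (Y \<omega>) * Y \<omega>)"
    by (rule Bochner_Integration.integrable_bound[OF integrable_mult_right[OF iD, of B]]
        Bochner_Integration.integrable_bound[OF integrable_mult_right[OF iY, of B]]; use B in simp)+
  have "(\<integral>\<omega>. g (Y \<omega>) * D \<omega> \<partial>M) = 0"
    by (rule integral_zero_fun[OF iD _ zero g(1) ig(1)]) auto
  moreover have "g (fst (N \<omega>)) * snd (N \<omega>) = g (Y \<omega>) * D \<omega> + \<rho> * (g (Y \<omega>) * Y \<omega>)" for \<omega>
    by (simp add: D_def Y_def algebra_simps)
  ultimately show ?thesis using ig by (simp add: Y_def)
qed

section \<open>Truncation and passage to the limit\<close>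

definition clamp_real :: "real \<Rightarrow> real \<Rightarrow> real" where
  "clamp_real K y = max (- K) (min K y)"

text \<open>Beyond \<open>K\<close> one has |y| \<le> y^2 / K, so a second moment controls the error
  of clamping.\<close>

lemma clamp_real_diff:
  assumes "K > 0" shows "\<bar>y - clamp_real K y\<bar> \<le> y\<^sup>2 / K"
proof (cases "\<bar>y\<bar> \<le> K")
  case True
  then have "clamp_real K y = y" by (auto simp: clamp_real_def)
  then show ?thesis using assms by simp
next
  case False
  have "\<bar>y - clamp_real K y\<bar> \<le> \<bar>y\<bar>" using assms by (auto simp: clamp_real_def max_def min_def abs_if)
  also have "\<bar>y\<bar> * K \<le> \<bar>y\<bar> * \<bar>y\<bar>" using False by (intro mult_left_mono) auto
  then have "\<bar>y\<bar> \<le> y\<^sup>2 / K" using assms by (simp add: pos_le_divide_eq power2_eq_square)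
  finally show ?thesis .
qed

text \<open>Two replacements make the integrand bounded and continuous. Smoothing is paid for by
  Cauchy-Schwarz and the unit second moment of \<open>S\<close>, clamping by 1 / K. Under the root
  stands again the mean of a bounded continuous function of \<open>F\<close>, which can be compared
  with the limit law.\<close>

lemma (in prob_space) stein_truncation:
  fixes F S :: "'a \<Rightarrow> real"
  assumes F[measurable]: "F \<in> borel_measurable M" and S: "square_integrable M S" "(\<integral>\<omega>. (S \<omega>)\<^sup>2 \<partial>M) = 1"
    and K: "K > 0" and k: "k \<ge> 0"
  shows "\<bar>(\<integral>\<omega>. stein_deriv z (F \<omega>) * S \<omega> \<partial>M) - (\<integral>\<omega>. stein_deriv_approx z k (F \<omega>) * clamp_real K (S \<omega>) \<partial>M)\<bar>
    \<le> sqrt (\<integral>\<omega>. exp (- k * \<bar>F \<omega> - z\<bar>) \<partial>M) + 1 / K"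
proof -
  have [measurable]: "S \<in> borel_measurable M" using S by auto
  have [measurable]: "clamp_real K \<in> borel_measurable borel" unfolding clamp_real_def[abs_def] by measurable
  let ?g = "\<lambda>\<omega>. stein_deriv z (F \<omega>)" and ?h = "\<lambda>\<omega>. stein_deriv_approx z k (F \<omega>)"
  have iS: "integrable M S" by (rule square_integrable_integrable[OF S(1)])
  have hb: "\<bar>?h \<omega>\<bar> \<le> 1" for \<omega> by (rule stein_deriv_approx_bound[OF k])
  have sgh: "square_integrable M (\<lambda>\<omega>. ?g \<omega> - ?h \<omega>)"
  proof (rule square_integrable_bounded[of _ 2])
    show "norm (?g \<omega> - ?h \<omega>) \<le> 2" for \<omega>
      using abs_triangle_ineq4[of "?g \<omega>" "?h \<omega>"] stein_deriv_bound[of z "F \<omega>"] hb[of \<omega>]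
      unfolding real_norm_def by linarith
  qed measurable
  have sq: "integrable M (\<lambda>\<omega>. (S \<omega>)\<^sup>2)" using S by (simp add: square_integrable_def)
  have ic: "integrable M (\<lambda>\<omega>. S \<omega> - clamp_real K (S \<omega>))"
    by (rule Bochner_Integration.integrable_bound[OF integrable_divide_zero[OF sq, of K]])
       (use clamp_real_diff[OF K] K in auto)
  have i1: "integrable M (\<lambda>\<omega>. (?g \<omega> - ?h \<omega>) * S \<omega>)" by (rule integrable_mult_square_integrable[OF sgh S(1)])
  have i2: "integrable M (\<lambda>\<omega>. ?h \<omega> * (S \<omega> - clamp_real K (S \<omega>)))"
    by (rule Bochner_Integration.integrable_bound[OF ic]) (use hb in \<open>auto simp: abs_mult mult_left_le_one_le\<close>)
  have i3: "integrable M (\<lambda>\<omega>. ?g \<omega> * S \<omega>)" "integrable M (\<lambda>\<omega>. ?h \<omega> * S \<omega>)"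
    by (rule Bochner_Integration.integrable_bound[OF iS]; use hb stein_deriv_bound in \<open>auto simp: abs_mult mult_left_le_one_le\<close>)+
  have i4: "integrable M (\<lambda>\<omega>. ?h \<omega> * clamp_real K (S \<omega>))"
    using Bochner_Integration.integrable_diff[OF i3(2) i2] by (simp add: algebra_simps)
  have "(\<integral>\<omega>. ?g \<omega> * S \<omega> \<partial>M) - (\<integral>\<omega>. ?h \<omega> * clamp_real K (S \<omega>) \<partial>M) = (\<integral>\<omega>. ?g \<omega> * S \<omega> - ?h \<omega> * clamp_real K (S \<omega>) \<partial>M)"
    using i3 i4 by simp
  also have "\<dots> = (\<integral>\<omega>. (?g \<omega> - ?h \<omega>) * S \<omega> + ?h \<omega> * (S \<omega> - clamp_real K (S \<omega>)) \<partial>M)"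
    by (rule Bochner_Integration.integral_cong) (auto simp: algebra_simps)
  also have "\<dots> = (\<integral>\<omega>. (?g \<omega> - ?h \<omega>) * S \<omega> \<partial>M) + (\<integral>\<omega>. ?h \<omega> * (S \<omega> - clamp_real K (S \<omega>)) \<partial>M)"
    using i1 i2 by simp
  finally have e: "(\<integral>\<omega>. ?g \<omega> * S \<omega> \<partial>M) - (\<integral>\<omega>. ?h \<omega> * clamp_real K (S \<omega>) \<partial>M)
    = (\<integral>\<omega>. (?g \<omega> - ?h \<omega>) * S \<omega> \<partial>M) + (\<integral>\<omega>. ?h \<omega> * (S \<omega> - clamp_real K (S \<omega>)) \<partial>M)" .
  have "\<bar>\<integral>\<omega>. (?g \<omega> - ?h \<omega>) \<bullet> S \<omega> \<partial>M\<bar> \<le> L2norm M (\<lambda>\<omega>. ?g \<omega> - ?h \<omega>) * L2norm M S"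
    by (rule inner_Cauchy_Schwarz(2)[OF sgh S(1)])
  also have "\<dots> = sqrt (\<integral>\<omega>. (?g \<omega> - ?h \<omega>)\<^sup>2 \<partial>M)" using S(2) by (simp add: L2norm_def)
  also have "\<dots> \<le> sqrt (\<integral>\<omega>. exp (- k * \<bar>F \<omega> - z\<bar>) \<partial>M)"
  proof (rule real_sqrt_le_mono, rule integral_mono)
    show "integrable M (\<lambda>\<omega>. (?g \<omega> - ?h \<omega>)\<^sup>2)" using sgh by (simp add: square_integrable_def)
    have le1: "exp (- k * \<bar>x\<bar>) \<le> 1" for x :: real using k by simp
    show "integrable M (\<lambda>\<omega>. exp (- k * \<bar>F \<omega> - z\<bar>))"
      by (rule integrable_const_bound[of _ 1]) (use le1 in auto)
    fix \<omega>
    \<comment> \<open>One factor keeps the exponential bound, the other is bounded by 1.\<close>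
    have "(?g \<omega> - ?h \<omega>)\<^sup>2 = \<bar>?g \<omega> - ?h \<omega>\<bar> * \<bar>?g \<omega> - ?h \<omega>\<bar>" by (simp add: power2_eq_square)
    also have "\<dots> \<le> exp (- k * \<bar>F \<omega> - z\<bar>) * 1"
      using stein_deriv_approx_diff[OF k, of z "F \<omega>"] order_trans[OF stein_deriv_approx_diff[OF k, of z "F \<omega>"] le1]
      by (intro mult_mono) simp_all
    finally show "(?g \<omega> - ?h \<omega>)\<^sup>2 \<le> exp (- k * \<bar>F \<omega> - z\<bar>)" by simp
  qed
  finally have b1: "\<bar>\<integral>\<omega>. (?g \<omega> - ?h \<omega>) * S \<omega> \<partial>M\<bar> \<le> sqrt (\<integral>\<omega>. exp (- k * \<bar>F \<omega> - z\<bar>) \<partial>M)" by simp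
  have "\<bar>\<integral>\<omega>. ?h \<omega> * (S \<omega> - clamp_real K (S \<omega>)) \<partial>M\<bar> \<le> (\<integral>\<omega>. \<bar>?h \<omega> * (S \<omega> - clamp_real K (S \<omega>))\<bar> \<partial>M)"
    by (rule integral_abs_bound)
  also have "\<dots> \<le> (\<integral>\<omega>. (S \<omega>)\<^sup>2 / K \<partial>M)"
  proof (rule integral_mono)
    show "integrable M (\<lambda>\<omega>. \<bar>?h \<omega> * (S \<omega> - clamp_real K (S \<omega>))\<bar>)" using i2 by simp
    show "integrable M (\<lambda>\<omega>. (S \<omega>)\<^sup>2 / K)" using sq by simp
    show "\<bar>?h \<omega> * (S \<omega> - clamp_real K (S \<omega>))\<bar> \<le> (S \<omega>)\<^sup>2 / K" for \<omega>
      using order_trans[OF _ clamp_real_diff[OF K]] hb by (simp add: abs_mult mult_left_le_one_le)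
  qed
  also have "\<dots> = 1 / K" using S(2) by simp
  finally show ?thesis using b1 unfolding e by linarith
qed

text \<open>The same truncation estimate is used for the sequence and for the limit. The index
  \<open>n0\<close> is there because the normalised factor has unit second moment only once
  \<open>\<phi> n\<close> is known to be positive.\<close>

lemma stein_deriv_convergence:
  fixes F S :: "nat \<Rightarrow> 'a \<Rightarrow> real" and N :: "'b \<Rightarrow> real \<times> real"
  assumes M: "prob_space M" and M': "prob_space M'"
    and F: "\<And>n. n \<ge> n0 \<Longrightarrow> F n \<in> borel_measurable M"
    and S: "\<And>n. n \<ge> n0 \<Longrightarrow> square_integrable M (S n)" "\<And>n. n \<ge> n0 \<Longrightarrow> (\<integral>\<omega>. (S n \<omega>)\<^sup>2 \<partial>M) = 1"
    and N: "square_integrable M' (\<lambda>\<omega>. snd (N \<omega>))" "(\<integral>\<omega>. (snd (N \<omega>))\<^sup>2 \<partial>M') = 1"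
      "(\<lambda>\<omega>. fst (N \<omega>)) \<in> borel_measurable M'" "distr M' borel (\<lambda>\<omega>. fst (N \<omega>)) = std_normal_distribution"
    and conv: "conv_in_distribution M (\<lambda>n \<omega>. (F n \<omega>, S n \<omega>)) M' N"
  shows "(\<lambda>n. \<integral>\<omega>. stein_deriv z (F n \<omega>) * S n \<omega> \<partial>M) \<longlonglongrightarrow> (\<integral>\<omega>. stein_deriv z (fst (N \<omega>)) * snd (N \<omega>) \<partial>M')"
proof (rule LIMSEQ_I)
  interpret M: prob_space M by fact
  interpret M': prob_space M' by fact
  note [measurable] = N(3)
  fix e :: real assume e: "e > 0"
  \<comment> \<open>Five errors of size e/16 will occur: smoothing and clamping for the sequence and
    for the limit, and one from the convergence of the truncated means.\<close>
  define K where "K = 16 / e"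
  have K: "K > 0" "1 / K = e / 16" using e by (simp_all add: K_def)
  \<comment> \<open>The law of \<open>N1\<close> has no atom at \<open>z\<close>, so the smoothing
    error of the limit law tends to 0; \<open>k\<close> is chosen from that law and then kept fixed
    while n grows.\<close>
  have b0: "(\<lambda>k. \<integral>\<omega>. exp (- real (Suc k) * \<bar>fst (N \<omega>) - z\<bar>) \<partial>M') \<longlonglongrightarrow> (\<integral>\<omega>. 0 \<partial>M')"
  proof (rule integral_dominated_convergence)
    have "AE x in std_normal_distribution. x \<noteq> z"
      by (subst AE_density) (use AE_lborel_singleton[of z] in \<open>auto elim!: eventually_mono\<close>)
    then have "AE x in distr M' borel (\<lambda>\<omega>. fst (N \<omega>)). x \<noteq> z" unfolding N(4) .
    then have "AE \<omega> in M'. fst (N \<omega>) \<noteq> z" by (subst (asm) AE_distr_iff) auto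
    then show "AE \<omega> in M'. (\<lambda>k. exp (- real (Suc k) * \<bar>fst (N \<omega>) - z\<bar>)) \<longlonglongrightarrow> 0"
      by eventually_elim (intro exp_neg_mult_tendsto, simp)
    show "integrable M' (\<lambda>_. 1 :: real)" by simp
    show "AE \<omega> in M'. norm (exp (- real (Suc k) * \<bar>fst (N \<omega>) - z\<bar>)) \<le> 1" for k
      by (intro AE_I2) (simp add: mult_nonpos_nonneg del: of_nat_Suc)
  qed auto
  have "\<forall>\<^sub>F k in sequentially. (\<integral>\<omega>. exp (- real (Suc k) * \<bar>fst (N \<omega>) - z\<bar>) \<partial>M') < (e / 16)\<^sup>2"
    using order_tendstoD(2)[OF b0, of "(e / 16)\<^sup>2"] e by simp
  then obtain j where j: "(\<integral>\<omega>. exp (- real (Suc j) * \<bar>fst (N \<omega>) - z\<bar>) \<partial>M') < (e / 16)\<^sup>2"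
    unfolding eventually_sequentially by blast
  define k where "k = real (Suc j)"
  have k: "k \<ge> 0" by (simp add: k_def)
  have j': "(\<integral>\<omega>. exp (- k * \<bar>fst (N \<omega>) - z\<bar>) \<partial>M') < (e / 16)\<^sup>2" using j by (simp only: k_def)
  let ?b = "\<lambda>p::real \<times> real. exp (- k * \<bar>fst p - z\<bar>)"
  let ?h = "\<lambda>p::real \<times> real. stein_deriv_approx z k (fst p) * clamp_real K (snd p)"
  have "continuous_on UNIV ?b" by (intro continuous_intros)
  moreover have "bounded (range ?b)" unfolding bounded_iff using k by (intro exI[of _ 1]) auto
  ultimately have lb: "(\<lambda>n. \<integral>\<omega>. ?b (F n \<omega>, S n \<omega>) \<partial>M) \<longlonglongrightarrow> (\<integral>\<omega>. ?b (N \<omega>) \<partial>M')"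
    using conv unfolding conv_in_distribution_def by blast
  have cd: "continuous_on UNIV (stein_deriv_approx z k)"
    using isCont_stein_deriv_approx by (auto intro!: continuous_at_imp_continuous_on)
  have "continuous_on UNIV ?h"
    unfolding clamp_real_def by (intro continuous_intros continuous_on_compose2[OF cd]) auto
  moreover have "bounded (range ?h)"
  proof -
    have "\<bar>clamp_real K y\<bar> \<le> K" for y using K(1) by (auto simp: clamp_real_def)
    then have "\<bar>?h p\<bar> \<le> 1 * K" for p
      unfolding abs_mult using stein_deriv_approx_bound[OF k] by (intro mult_mono) auto
    then show ?thesis unfolding bounded_iff by (intro exI[of _ "1 * K"]) auto
  qed
  ultimately have lh: "(\<lambda>n. \<integral>\<omega>. ?h (F n \<omega>, S n \<omega>) \<partial>M) \<longlonglongrightarrow> (\<integral>\<omega>. ?h (N \<omega>) \<partial>M')"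
    using conv unfolding conv_in_distribution_def by blast
  have "\<forall>\<^sub>F n in sequentially. (\<integral>\<omega>. ?b (F n \<omega>, S n \<omega>) \<partial>M) < (e / 16)\<^sup>2"
    using order_tendstoD(2)[OF lb j'] .
  moreover have "\<forall>\<^sub>F n in sequentially. dist (\<integral>\<omega>. ?h (F n \<omega>, S n \<omega>) \<partial>M) (\<integral>\<omega>. ?h (N \<omega>) \<partial>M') < e / 16"
    using tendstoD[OF lh, of "e / 16"] e by simp
  ultimately have "\<forall>\<^sub>F n in sequentially. norm ((\<integral>\<omega>. stein_deriv z (F n \<omega>) * S n \<omega> \<partial>M)
      - (\<integral>\<omega>. stein_deriv z (fst (N \<omega>)) * snd (N \<omega>) \<partial>M')) < e"
    using eventually_ge_at_top[of n0]
  proof eventually_elim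
    case (elim n)
    have root: "sqrt x \<le> e / 16" if "x < (e / 16)\<^sup>2" for x
      using e that by (intro real_le_lsqrt) auto
    have "\<bar>(\<integral>\<omega>. stein_deriv z (F n \<omega>) * S n \<omega> \<partial>M) - (\<integral>\<omega>. ?h (F n \<omega>, S n \<omega>) \<partial>M)\<bar> \<le> e / 16 + e / 16"
      using M.stein_truncation[OF F[OF elim(3)] S(1)[OF elim(3)] S(2)[OF elim(3)] K(1) k, of z] root[of "\<integral>\<omega>. ?b (F n \<omega>, S n \<omega>) \<partial>M"] elim(1)
      unfolding K(2) by simp
    moreover have "\<bar>(\<integral>\<omega>. stein_deriv z (fst (N \<omega>)) * snd (N \<omega>) \<partial>M') - (\<integral>\<omega>. ?h (N \<omega>) \<partial>M')\<bar> \<le> e / 16 + e / 16"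
      using M'.stein_truncation[OF N(3) N(1) N(2) K(1) k, of z] root[OF j']
      unfolding K(2) by simp
    moreover have "\<bar>(\<integral>\<omega>. ?h (F n \<omega>, S n \<omega>) \<partial>M) - (\<integral>\<omega>. ?h (N \<omega>) \<partial>M')\<bar> < e / 16"
      using elim(2) by (simp only: dist_real_def)
    ultimately show ?case using e unfolding real_norm_def by linarith
  qed
  then show "\<exists>no. \<forall>n\<ge>no. norm ((\<integral>\<omega>. stein_deriv z (F n \<omega>) * S n \<omega> \<partial>M)
      - (\<integral>\<omega>. stein_deriv z (fst (N \<omega>)) * snd (N \<omega>) \<partial>M')) < e"
    unfolding eventually_sequentially .
qed

theorem theorem3p1:
  fixes M :: "'a measure"
    and X :: "'h::{real_inner,banach,second_countable_topology} \<Rightarrow> 'a \<Rightarrow> real"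
    and F :: "nat \<Rightarrow> 'a \<Rightarrow> real"
    and \<phi> :: "nat \<Rightarrow> real"
    and M' :: "'b measure"
    and N :: "'b \<Rightarrow> real \<times> real"
    and \<rho> :: real
    and m :: nat
  assumes X: "isonormal M X"
    and F_meas: "\<And>n. n \<ge> 1 \<Longrightarrow> F n \<in> borel_measurable (generated_sigma M X)"
    and F_sq: "\<And>n. n \<ge> 1 \<Longrightarrow> integrable M (\<lambda>\<omega>. (F n \<omega>)\<^sup>2)"
    and F_centered: "\<And>n. n \<ge> 1 \<Longrightarrow> (\<integral>\<omega>. F n \<omega> \<partial>M) = 0"
    and F_var: "(\<lambda>n. \<integral>\<omega>. (F n \<omega>)\<^sup>2 \<partial>M) \<longlonglongrightarrow> 1"
    and F_D12: "\<And>n. n \<ge> 1 \<Longrightarrow> F n \<in> D12 M X"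
    and F_ac: "\<And>n. n \<ge> 1 \<Longrightarrow> absolutely_continuous lborel (distr M borel (F n))"
    and phi: "\<And>n. \<phi> n = sqrt (\<integral>\<omega>. (stein_factor M X (F n) \<omega>)\<^sup>2 \<partial>M)"
    and phi_finite: "\<And>n. n \<ge> 1 \<Longrightarrow> integrable M (\<lambda>\<omega>. (stein_factor M X (F n) \<omega>)\<^sup>2)"
    and phi_lim: "\<phi> \<longlonglongrightarrow> 0"
    and m: "m \<ge> 1"
    and phi_pos: "\<And>n. n \<ge> m \<Longrightarrow> \<phi> n > 0"
    and M': "prob_space M'"
    and N_gauss: "centered_gaussian_vector M' N"
    and N1_var: "(\<integral>\<omega>. (fst (N \<omega>))\<^sup>2 \<partial>M') = 1"
    and N2_var: "(\<integral>\<omega>. (snd (N \<omega>))\<^sup>2 \<partial>M') = 1"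
    and N_cov: "(\<integral>\<omega>. fst (N \<omega>) * snd (N \<omega>) \<partial>M') = \<rho>"
    and conv: "conv_in_distribution M (\<lambda>n \<omega>. (F n \<omega>, stein_factor M X (F n) \<omega> / \<phi> n)) M' N"
  shows "(\<forall>n\<ge>1. kolmogorov_dist (distr M borel (F n)) std_normal_distribution \<le> \<phi> n) \<and>
    (\<forall>z. (\<lambda>n. inverse (\<phi> n) *
              (measure M {\<omega> \<in> space M. F n \<omega> \<le> z} - cdf std_normal_distribution z))
            \<longlonglongrightarrow> \<rho> / 3 * (z\<^sup>2 - 1) * (exp (- z\<^sup>2 / 2) / sqrt (2 * pi)) \<and>
         \<rho> / 3 * (z\<^sup>2 - 1) * (exp (- z\<^sup>2 / 2) / sqrt (2 * pi)) =
           \<rho> / 3 * (deriv ^^ 3) (cdf std_normal_distribution) z) \<and>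
    (\<rho> \<noteq> 0 \<longrightarrow>
      (\<exists>c n0. 0 < c \<and> c < 1 \<and> n0 \<ge> 1 \<and>
        (\<forall>n\<ge>n0.
           c < kolmogorov_dist (distr M borel (F n)) std_normal_distribution / \<phi> n \<and>
           kolmogorov_dist (distr M borel (F n)) std_normal_distribution / \<phi> n \<le> 1)))"
proof -
  interpret isonormal_process M X by unfold_locales (rule X)
  interpret M': prob_space M' by (rule M')
  let ?S = "\<lambda>n. stein_factor M X (F n)"
  let ?K = "\<lambda>n. kolmogorov_dist (distr M borel (F n)) std_normal_distribution"
  have Fm[measurable]: "F n \<in> borel_measurable M" if "n \<ge> 1" for n
    using is_malliavin_deriv_square_integrable(1)[OF malliavin_deriv_D12[OF F_D12[OF that]]] by auto
  have cdf: "cdf (distr M borel (F n)) z = measure M {\<omega> \<in> space M. F n \<omega> \<le> z}" if "n \<ge> 1" for n z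
    using Fm[OF that] by (simp add: cdf_def measure_distr vimage_def Int_def conj_commute)
  have bound: "\<bar>cdf (distr M borel (F n)) z - \<Phi> z\<bar> \<le> \<phi> n" if "n \<ge> 1" for n z
    unfolding cdf[OF that] phi by (rule kolmogorov_bound[OF F_D12[OF that] F_centered[OF that] phi_finite[OF that]])
  have upper: "?K n \<le> \<phi> n" if "n \<ge> 1" for n
    unfolding kolmogorov_dist_def by (rule cSUP_least) (use bound[OF that] in auto)
  \<comment> \<open>The uniform bound makes the set bounded above, so that its supremum is really an
    upper bound.\<close>
  have lower: "\<bar>cdf (distr M borel (F n)) z - \<Phi> z\<bar> \<le> ?K n" if "n \<ge> 1" for n z
    unfolding kolmogorov_dist_def by (rule cSUP_upper) (use bound[OF that] in \<open>auto intro!: bdd_aboveI2\<close>)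
  have dens: "exp (- z\<^sup>2 / 2) / sqrt (2 * pi) = std_normal_density z" for z
    by (simp add: std_normal_density_def)
  have gauss: "centered_gaussian M' (\<lambda>\<omega>. fst (N \<omega>))" "centered_gaussian M' (\<lambda>\<omega>. snd (N \<omega>))"
  proof -
    have "centered_gaussian M' (\<lambda>\<omega>. (1, 0) \<bullet> N \<omega>)" "centered_gaussian M' (\<lambda>\<omega>. (0, 1) \<bullet> N \<omega>)"
      using N_gauss unfolding centered_gaussian_vector_def by blast+
    then show "centered_gaussian M' (\<lambda>\<omega>. fst (N \<omega>))" "centered_gaussian M' (\<lambda>\<omega>. snd (N \<omega>))"
      by (simp_all add: inner_prod_def)
  qed
  have N1m[measurable]: "(\<lambda>\<omega>. fst (N \<omega>)) \<in> borel_measurable M'" using gauss(1) by (simp add: centered_gaussian_def)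
  note N1_distr = M'.standard_gaussian_distr[OF gauss(1) N1_var]
  have limit: "(\<integral>\<omega>. stein_deriv z (fst (N \<omega>)) * snd (N \<omega>) \<partial>M') = \<rho> / 3 * (z\<^sup>2 - 1) * std_normal_density z" for z
  proof -
    have "(\<integral>\<omega>. stein_deriv z (fst (N \<omega>)) * snd (N \<omega>) \<partial>M') = \<rho> * (\<integral>\<omega>. stein_deriv z (fst (N \<omega>)) * fst (N \<omega>) \<partial>M')"
      by (rule M'.gaussian_regression[OF N_gauss N1_var N_cov _ stein_deriv_bound]) measurable
    also have "(\<integral>\<omega>. stein_deriv z (fst (N \<omega>)) * fst (N \<omega>) \<partial>M') = (\<integral>x. stein_deriv z x * x \<partial>std_normal_distribution)"
      unfolding N1_distr[symmetric] by (subst integral_distr) auto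
    finally show ?thesis unfolding std_normal_stein_deriv_moment by simp
  qed
  have conv_z: "(\<lambda>n. inverse (\<phi> n) * (measure M {\<omega> \<in> space M. F n \<omega> \<le> z} - \<Phi> z))
      \<longlonglongrightarrow> \<rho> / 3 * (z\<^sup>2 - 1) * std_normal_density z" for z
  proof -
    \<comment> \<open>Division by \<open>\<phi> n\<close> is what gives the second coordinate unit
      second moment, for n \<ge> m.\<close>
    have "(\<lambda>n. \<integral>\<omega>. stein_deriv z (F n \<omega>) * (?S n \<omega> / \<phi> n) \<partial>M) \<longlonglongrightarrow> (\<integral>\<omega>. stein_deriv z (fst (N \<omega>)) * snd (N \<omega>) \<partial>M')"
    proof (rule stein_deriv_convergence[OF prob_space_axioms M' _ _ _ _ N2_var N1m N1_distr conv])
      fix n assume "m \<le> n"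
      then have n: "1 \<le> n" "\<phi> n > 0" using m phi_pos by auto
      show "F n \<in> borel_measurable M" by (rule Fm[OF n(1)])
      have Sm[measurable]: "?S n \<in> borel_measurable M"
        using stein_factor_integrable[OF F_D12[OF n(1)] F_centered[OF n(1)]] by auto
      show "square_integrable M (\<lambda>\<omega>. ?S n \<omega> / \<phi> n)"
        using phi_finite[OF n(1)] by (simp add: square_integrable_def power_divide)
      have e: "(\<phi> n)\<^sup>2 = (\<integral>\<omega>. (?S n \<omega>)\<^sup>2 \<partial>M)" unfolding phi by simp
      have "(\<integral>\<omega>. (?S n \<omega> / \<phi> n)\<^sup>2 \<partial>M) = (\<integral>\<omega>. (?S n \<omega>)\<^sup>2 \<partial>M) / (\<phi> n)\<^sup>2" by (simp add: power_divide)
      then show "(\<integral>\<omega>. (?S n \<omega> / \<phi> n)\<^sup>2 \<partial>M) = 1" unfolding e[symmetric] using n(2) by simp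
    qed (rule has_moments_square_integrable[OF M'.centered_gaussian_moments(1)[OF gauss(2)]])
    moreover have "\<forall>\<^sub>F n in sequentially. (\<integral>\<omega>. stein_deriv z (F n \<omega>) * (?S n \<omega> / \<phi> n) \<partial>M)
        = inverse (\<phi> n) * (measure M {\<omega> \<in> space M. F n \<omega> \<le> z} - \<Phi> z)"
      using eventually_ge_at_top[of 1]
    proof eventually_elim
      case (elim n)
      show ?case unfolding kolmogorov_stein_identity[OF F_D12[OF elim] F_centered[OF elim]]
        by (simp add: divide_inverse mult_ac)
    qed
    ultimately show ?thesis unfolding limit by (rule Lim_transform_eventually)
  qed
  have "\<exists>c n0. 0 < c \<and> c < 1 \<and> n0 \<ge> 1 \<and> (\<forall>n\<ge>n0. c < ?K n / \<phi> n \<and> ?K n / \<phi> n \<le> 1)" if "\<rho> \<noteq> 0"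
  proof -
    \<comment> \<open>The limit is nonzero wherever z^2 differs from 1; at z = 0 its absolute value
      is \<open>L\<close>.\<close>
    define L where "L = \<bar>\<rho> / 3 * (0\<^sup>2 - 1) * std_normal_density 0\<bar>"
    have L: "L > 0" using that std_normal_density_pos[of 0] by (simp add: L_def)
    \<comment> \<open>\<open>L / 2\<close> stays strictly below the limit, and 1/2 keeps
      \<open>c\<close> below 1.\<close>
    define c where "c = min (L / 2) (1 / 2)"
    have c: "0 < c" "c < 1" "c < L" using L by (auto simp: c_def min_def)
    have "(\<lambda>n. \<bar>inverse (\<phi> n) * (measure M {\<omega> \<in> space M. F n \<omega> \<le> 0} - \<Phi> 0)\<bar>) \<longlonglongrightarrow> L"
      unfolding L_def by (rule tendsto_rabs[OF conv_z])
    from order_tendstoD(1)[OF this c(3)] obtain n1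
      where n1: "\<And>n. n \<ge> n1 \<Longrightarrow> c < \<bar>inverse (\<phi> n) * (measure M {\<omega> \<in> space M. F n \<omega> \<le> 0} - \<Phi> 0)\<bar>"
      unfolding eventually_sequentially by blast
    have "c < ?K n / \<phi> n \<and> ?K n / \<phi> n \<le> 1" if "n \<ge> max n1 m" for n
    proof -
      have n: "n \<ge> 1" "\<phi> n > 0" "n \<ge> n1" using that m phi_pos by auto
      have "c < \<bar>cdf (distr M borel (F n)) 0 - \<Phi> 0\<bar> / \<phi> n"
        using n1[OF n(3)] n(2) unfolding cdf[OF n(1)] by (simp add: abs_mult divide_inverse mult.commute)
      also have "\<dots> \<le> ?K n / \<phi> n" using lower[OF n(1)] n(2) by (intro divide_right_mono) auto
      finally show ?thesis using upper[OF n(1)] n(2) by simp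
    qed
    then show ?thesis using c m by (intro exI[of _ c] exI[of _ "max n1 m"]) auto
  qed
  then show ?thesis
    unfolding dens std_normal_cdf_third_deriv using upper conv_z by auto
qed

end
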